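(* For $\alpha \in \mathbb{T}$, let $H^{\alpha}$ be the operator acting on finitely supported functions $f$ on $\mathbb{Z}$ by $$H^{\alpha} f(n) = \sum_{m \in \mathbb{Z},\, m \neq 0} \frac{e^{2\pi i \alpha m^2} f(n-m)}{m}, \qquad n \in \mathbb{Z}.$$ There exists $r$ with $1 < r < 2$ such that $$\sup_{\alpha \in \mathbb{T}} \| H^{\alpha} : (r,r) \| < \infty,$$ where $\| \cdot : (r,r)\|$ denotes the sparse norm. That is, there exist $1<r<2$ and a finite constant $C$ such that for all $\alpha \in \mathbb{T}$ and all finitely supported functions $f,g$ on $\mathbb{Z}$, $$|\langle H^{\alpha} f, g\rangle| \leq C \sup_{\mathcal{S}} \Lambda_{\mathcal{S},r}(f,g),$$ where the supremum is over all sparse collections $\mathcal{S}$ of intervals.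
   Context: $\mathbb{T} = \mathbb{R}/\mathbb{Z}$, functions are complex valued, and $\langle f,g\rangle = \sum_{n\in\mathbb{Z}} f(n)\overline{g(n)}$. An interval is a (nonempty, finite) set $I = \mathbb{Z}\cap[a,b]$ with $a,b\in\mathbb{R}$; its length $|I|$ is its cardinality. For $1\le r<\infty$, the $L^r$-average of $f$ on $I$ is $$\langle f\rangle_{I,r} = \Big[\frac{1}{|I|}\sum_{x\in I}|f(x)|^r\Big]^{1/r}.$$ A collection $\mathcal{S}$ of intervals is called $\rho$-sparse if for each $S\in\mathcal{S}$ there is a subset $E_S\subset S$ such that (a) $|E_S|>\rho|S|$ and (b) $\big\|\sum_{S\in\mathcal{S}}\mathbf{1}_{E_S}\big\|_\infty\le\rho^{-1}$. The value $\rho\in(0,1)$ is fixed once and for all and "sparse" means $\rho$-sparse; constants may depend on $\rho$. For a sparse collection $\mathcal{S}$, the sparse form is $$\Lambda_{\mathcal{S},r}(f,g)=\sum_{S\in\mathcal{S}}\langle f\rangle_{S,r}\,\langle g\rangle_{S,r}\,|S|.$$ For an operator $T$ acting on finitely supported functions on $\mathbb{Z}$, the sparse norm $\|T:(r,r)\|$ is the infimum of the constants $C>0$ such that for all finitely supported $f,g$ on $\mathbb{Z}$ one has $|\langle Tf,g\rangle|\le C\sup_{\mathcal{S}}\Lambda_{\mathcal{S},r}(f,g)$, the supremum being over all sparse collections $\mathcal{S}$ (and $\|T:(r,r)\|=\infty$ if there is no such $C$). *)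

theory Defs
  imports "HOL-Analysis.Analysis"
begin

definition finitely_supported :: "(int \<Rightarrow> complex) \<Rightarrow> bool" where
  "finitely_supported f \<longleftrightarrow> finite {n. f n \<noteq> 0}"

definition pairing :: "(int \<Rightarrow> complex) \<Rightarrow> (int \<Rightarrow> complex) \<Rightarrow> complex" where
  "pairing f g = (\<Sum>\<^sub>\<infinity>n. f n * cnj (g n))"

definition discrete_interval :: "int set \<Rightarrow> bool" where
  "discrete_interval I \<longleftrightarrow>
     I \<noteq> {} \<and> (\<exists>a b :: real. I = {n. a \<le> real_of_int n \<and> real_of_int n \<le> b})"

definition avg :: "int set \<Rightarrow> real \<Rightarrow> (int \<Rightarrow> complex) \<Rightarrow> real" where
  "avg I r f = ((1 / real (card I)) * (\<Sum>x\<in>I. norm (f x) powr r)) powr (1 / r)"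

text \<open>The collection may be infinite. The overlap count is therefore taken in the extended
  nonnegative reals, where every sum exists and divergence means the value \<open>\<infinity>\<close>.\<close>

definition sparse :: "real \<Rightarrow> int set set \<Rightarrow> bool" where
  "sparse \<rho> \<S> \<longleftrightarrow>
     (\<forall>S\<in>\<S>. discrete_interval S) \<and>
     (\<exists>E :: int set \<Rightarrow> int set.
        (\<forall>S\<in>\<S>. E S \<subseteq> S \<and> real (card (E S)) > \<rho> * real (card S)) \<and>
        (SUP x. \<Sum>\<^sub>\<infinity>S\<in>\<S>. (indicator (E S) x :: ennreal)) \<le> ennreal (1 / \<rho>))"

definition sparse_form ::
  "int set set \<Rightarrow> real \<Rightarrow> (int \<Rightarrow> complex) \<Rightarrow> (int \<Rightarrow> complex) \<Rightarrow> ennreal" where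
  "sparse_form \<S> r f g =
     (\<Sum>\<^sub>\<infinity>S\<in>\<S>. ennreal (avg S r f * avg S r g * real (card S)))"

definition sparse_bound ::
  "real \<Rightarrow> real \<Rightarrow> ((int \<Rightarrow> complex) \<Rightarrow> (int \<Rightarrow> complex)) \<Rightarrow> real \<Rightarrow> bool" where
  "sparse_bound \<rho> r T C \<longleftrightarrow>
     (\<forall>f g. finitely_supported f \<longrightarrow> finitely_supported g \<longrightarrow>
        ennreal (norm (pairing (T f) g)) \<le>
          ennreal C * (SUP \<S>\<in>{\<S>. sparse \<rho> \<S>}. sparse_form \<S> r f g))"

text \<open>The infimum of the empty set is \<open>\<infinity>\<close> in \<^typ>\<open>ennreal\<close>.\<close>

definition sparse_norm ::
  "real \<Rightarrow> real \<Rightarrow> ((int \<Rightarrow> complex) \<Rightarrow> (int \<Rightarrow> complex)) \<Rightarrow> ennreal" where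
  "sparse_norm \<rho> r T = Inf {ennreal C | C :: real. C > 0 \<and> sparse_bound \<rho> r T C}"

text \<open>The phase \<open>\<alpha>\<close> is a real representative of a point of \<open>\<real>/\<int>\<close>; the lemma
  \<open>quad_hilbert_periodic\<close> shows that the operator depends only on the class of \<open>\<alpha>\<close>.\<close>

definition quad_hilbert :: "real \<Rightarrow> (int \<Rightarrow> complex) \<Rightarrow> int \<Rightarrow> complex" where
  "quad_hilbert \<alpha> f n =
     (\<Sum>\<^sub>\<infinity>m\<in>{m :: int. m \<noteq> 0}.
        exp (2 * of_real pi * \<i> * of_real \<alpha> * of_int m ^ 2) * f (n - m) / of_int m)"

lemma quad_hilbert_periodic: "quad_hilbert (\<alpha> + of_int k) = quad_hilbert \<alpha>"
proof -
  have "exp (2 * of_real pi * \<i> * of_real (\<alpha> + of_int k) * of_int m ^ 2) =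
        exp (2 * of_real pi * \<i> * of_real \<alpha> * of_int m ^ 2)" for m :: int
    unfolding exp_eq by (intro exI[of _ "k * m ^ 2"]) (simp add: algebra_simps)
  then show ?thesis
    unfolding quad_hilbert_def fun_eq_iff by simp
qed

lemma sparse_bound_mono:
  assumes "sparse_bound \<rho> r T C" "C \<le> D"
  shows "sparse_bound \<rho> r T D"
  unfolding sparse_bound_def
proof (intro allI impI)
  fix f g assume "finitely_supported f" "finitely_supported g"
  then have "ennreal (norm (pairing (T f) g)) \<le>
      ennreal C * (SUP \<S>\<in>{\<S>. sparse \<rho> \<S>}. sparse_form \<S> r f g)"
    using assms(1) unfolding sparse_bound_def by blast
  also have "\<dots> \<le> ennreal D * (SUP \<S>\<in>{\<S>. sparse \<rho> \<S>}. sparse_form \<S> r f g)"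
    using assms(2) by (intro mult_right_mono ennreal_leI) auto
  finally show "ennreal (norm (pairing (T f) g)) \<le>
      ennreal D * (SUP \<S>\<in>{\<S>. sparse \<rho> \<S>}. sparse_form \<S> r f g)" .
qed

lemma SUP_sparse_norm_finite_iff:
  "(SUP i. sparse_norm \<rho> r (T i)) < \<infinity> \<longleftrightarrow> (\<exists>C>0. \<forall>i. sparse_bound \<rho> r (T i) C)"
proof
  assume fin: "(SUP i. sparse_norm \<rho> r (T i)) < \<infinity>"
  define s where "s = enn2real (SUP i. sparse_norm \<rho> r (T i))"
  have s: "ennreal s = (SUP i. sparse_norm \<rho> r (T i))" "s \<ge> 0"
    using fin by (auto simp: s_def)
  have "sparse_bound \<rho> r (T i) (s + 1)" for i
  proof -
    have "sparse_norm \<rho> r (T i) \<le> ennreal s"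
      unfolding s by (rule SUP_upper) simp
    also have "\<dots> < ennreal (s + 1)"
      using s(2) by (simp add: ennreal_less_iff)
    finally obtain C where "C > 0" "sparse_bound \<rho> r (T i) C" "ennreal C < ennreal (s + 1)"
      unfolding sparse_norm_def Inf_less_iff by auto
    then show ?thesis
      by (metis sparse_bound_mono ennreal_less_iff less_imp_le)
  qed
  then show "\<exists>C>0. \<forall>i. sparse_bound \<rho> r (T i) C"
    using s(2) by (intro exI[of _ "s + 1"]) auto
next
  assume "\<exists>C>0. \<forall>i. sparse_bound \<rho> r (T i) C"
  then obtain C where C: "C > 0" "\<And>i. sparse_bound \<rho> r (T i) C" by blast
  have "sparse_norm \<rho> r (T i) \<le> ennreal C" for i
    unfolding sparse_norm_def using C by (intro Inf_lower) auto
  then have "(SUP i. sparse_norm \<rho> r (T i)) \<le> ennreal C"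
    by (intro SUP_least)
  also have "\<dots> < \<infinity>" by simp
  finally show "(SUP i. sparse_norm \<rho> r (T i)) < \<infinity>" .
qed

end

theory Submission
  imports Defs
begin

text \<open>
  The exponent is \<open>r = 3/2\<close>. For finitely supported \<open>f\<close> and \<open>g\<close> let \<open>M x\<close> be the supremum of
  \<open>avg I (3/2) f * avg I (3/2) g\<close> over the integer intervals \<open>I\<close> containing \<open>x\<close> (this is
  \<open>maxprod\<close>). A stopping-time selection in three dyadic grids (\<open>sum_maxprod_le_sparse\<close>) bounds
  \<open>\<Sum>x. M x\<close> by a constant times the supremum of the sparse forms. So no sparse family ever has
  to be constructed for the operator: it is enough to bound the form of \<open>H\<^sup>\<alpha>\<close> by \<open>C * Z\<close>,
  uniformly in \<open>\<alpha>\<close>, for each \<open>Z\<close> that dominates all finite sums of \<open>M\<close>. Such bounds can be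
  added, hence the kernel \<open>e(\<alpha> m\<^sup>2) / m\<close>, where \<open>e(x) = exp(2 \<pi> i x)\<close>, may be cut into the
  shells \<open>N \<le> \<bar>m\<bar> < 2 N\<close> with \<open>N = 2 ^ j\<close>, and the question is how to sum over \<open>j\<close>.

  A single scale is controlled by its \<open>\<ell>\<^sup>2\<close> norm: a kernel of range \<open>N\<close> and size \<open>1/N\<close> with
  operator norm \<open>\<nu>\<close> on \<open>\<ell>\<^sup>2\<close> has form at most \<open>C * sqrt \<nu> * Z\<close> (\<open>single_scale_bound\<close>, an
  interpolation between \<open>\<ell>\<^sup>1\<close> and \<open>\<ell>\<^sup>2\<close>). By Weyl differencing \<open>\<nu>\<close> is governed by rational
  approximations of \<open>\<theta> = 2 \<alpha>\<close>. If no reduced fraction \<open>a/q\<close> with \<open>q ^ 4 \<le> N\<close> satisfies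
  \<open>\<bar>\<theta> - a/q\<bar> \<le> 1/(4 N q)\<close>, then \<open>\<nu>\<close> is \<open>O(N powr (-1/8))\<close>, which is summable over \<open>j\<close>.
  Otherwise put \<open>\<mu> = N\<^sup>2 \<bar>\<theta> - a/q\<bar>\<close>. If \<open>\<mu> > 1\<close>, then \<open>\<nu>\<close> is
  \<open>O(q powr (-1/2) * \<mu> powr (-1/4))\<close>. If \<open>\<mu> \<le> 1\<close>, then \<open>\<alpha>\<close> may be replaced by \<open>a/(2 q)\<close> with
  an error of operator norm \<open>O(min \<mu> (q powr (-1/2)))\<close>. These bounds are also summable: at the
  scales in question two different fractions never have denominators in the same dyadic block
  (\<open>major_same_block\<close>), so that a scale is determined by the dyadic sizes of \<open>q\<close> and \<open>\<mu>\<close> and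
  the sum is dominated by a product of two geometric series.

  What remains are the scales with \<open>\<mu> \<le> 1\<close>, and there the shells of the rational phase
  \<open>a/(2 q)\<close> must be summed without any gain from scale to scale. For a given fraction these
  scales form an interval. The phase \<open>e(a m\<^sup>2 / (2 q))\<close> has period \<open>2 q\<close> in \<open>m\<close>. Writing
  \<open>n = 2 q s + t\<close>, and up to an error that is summable in \<open>j\<close>, the sum of the shells becomes a
  truncated Hilbert transform in \<open>s\<close>, tensored with a Gauss matrix in \<open>t\<close>
  (\<open>rational_scales_bound\<close>). The Gauss matrix has norm \<open>O(sqrt q)\<close>, the kernel contributes
  \<open>1/(2 q)\<close>, and passing from functions on the integers to functions of \<open>s\<close> with values in
  \<open>\<ell>\<^sup>2\<close> costs \<open>q powr (1/3)\<close>. The total is \<open>O(q powr (-1/6))\<close>, again summable because each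
  dyadic block of denominators contributes at most one fraction.

  The last ingredient is the bound \<open>C * Z\<close> for truncated Hilbert transforms of functions with
  values in a real inner product space (\<open>truncated_hilbert_maxprod\<close>). It is proved by a
  Calderon-Zygmund induction on scales: on a dyadic interval the form differs from the sum of
  the forms on the stopping intervals inside it by at most a constant times the product of the
  averages and the length (\<open>local_estimate\<close>), and the stopping intervals cover at most half of
  the interval, so the errors add up to a multiple of the sum of \<open>M\<close>.
\<close>

section \<open>Averages and the maximal product\<close>

lemma avg_nonneg: "avg I r f \<ge> 0"
  by (simp add: avg_def)

lemma avg_powr_eq:
  assumes "finite I" "I \<noteq> {}" "r > 0"
  shows "real (card I) * avg I r f powr r = (\<Sum>x\<in>I. norm (f x) powr r)"
proof -
  have c: "card I > 0" using assms by (simp add: card_gt_0_iff)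
  have "0 \<le> (\<Sum>x\<in>I. norm (f x) powr r)" by (intro sum_nonneg) auto
  then show ?thesis using c assms by (simp add: avg_def powr_powr)
qed

text \<open>Enlarging an interval by a factor \<open>c\<close> loses \<open>c powr (1/r)\<close>, and \<open>c powr (1/r) \<le> c\<close>.\<close>

lemma avg_le_superset:
  assumes "finite J" "I \<subseteq> J" "I \<noteq> {}" "real (card J) \<le> c * real (card I)" "c \<ge> 1" "r \<ge> 1"
  shows "avg I r f \<le> c * avg J r f"
proof -
  have ci: "card I > 0" using assms finite_subset by (metis card_gt_0_iff)
  have cj: "card J > 0" using assms by (metis card_gt_0_iff subset_empty)
  have s: "(\<Sum>x\<in>I. norm (f x) powr r) \<le> (\<Sum>x\<in>J. norm (f x) powr r)"
    using assms by (intro sum_mono2) auto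
  have s0: "0 \<le> (\<Sum>x\<in>J. norm (f x) powr r)" by (intro sum_nonneg) auto
  have "1 / real (card I) * (\<Sum>x\<in>I. norm (f x) powr r) \<le> c / real (card J) * (\<Sum>x\<in>J. norm (f x) powr r)"
    by (intro mult_mono s s0 sum_nonneg) (use ci cj assms in \<open>auto simp: field_simps\<close>)
  then have "avg I r f \<le> (c / real (card J) * (\<Sum>x\<in>J. norm (f x) powr r)) powr (1 / r)"
    unfolding avg_def by (intro powr_mono2) (use assms in \<open>auto intro!: divide_nonneg_nonneg sum_nonneg\<close>)
  also have "\<dots> = c powr (1/r) * avg J r f"
    unfolding avg_def using assms s0 by (subst powr_mult [symmetric]) (auto intro!: divide_nonneg_nonneg)
  also have "\<dots> \<le> c powr 1 * avg J r f"
    by (intro mult_right_mono powr_mono avg_nonneg) (use assms in auto)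
  finally show ?thesis using assms by simp
qed

lemma avg_mono:
  assumes "\<And>x. x \<in> I \<Longrightarrow> norm (f x) \<le> norm (g x)" "r > 0"
  shows "avg I r f \<le> avg I r g"
  unfolding avg_def using assms
  by (intro powr_mono2 mult_left_mono sum_mono) (auto intro!: divide_nonneg_nonneg sum_nonneg)

lemma avg_scale:
  assumes "c \<ge> 0" "r > 0"
  shows "avg I r (\<lambda>x. of_real c * f x) = c * avg I r f"
proof -
  have "(\<Sum>x\<in>I. norm (of_real c * f x) powr r) = c powr r * (\<Sum>x\<in>I. norm (f x) powr r)"
    using assms by (simp add: norm_mult powr_mult sum_distrib_left)
  then have "avg I r (\<lambda>x. of_real c * f x) = (c powr r * (1 / real (card I) * (\<Sum>x\<in>I. norm (f x) powr r))) powr (1/r)"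
    unfolding avg_def by (simp add: mult_ac)
  also have "\<dots> = c * avg I r f"
    unfolding avg_def using assms by (subst powr_mult) (auto intro!: divide_nonneg_nonneg sum_nonneg simp: powr_powr)
  finally show ?thesis .
qed

lemma avg_le_bound:
  assumes "\<And>x. x \<in> I \<Longrightarrow> norm (f x) \<le> B" "finite I" "I \<noteq> {}" "r > 0"
  shows "avg I r f \<le> B"
proof -
  have B: "B \<ge> 0" using assms by (metis ex_in_conv norm_ge_zero order_trans)
  have ci: "card I > 0" using assms by (metis card_gt_0_iff)
  have "(\<Sum>x\<in>I. norm (f x) powr r) \<le> real (card I) * B powr r"
    using assms by (intro sum_bounded_above powr_mono2) auto
  then have "avg I r f \<le> (B powr r) powr (1/r)"
    unfolding avg_def using assms ci
    by (intro powr_mono2) (auto intro!: divide_nonneg_nonneg sum_nonneg simp: field_simps)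
  then show ?thesis using B assms by (simp add: powr_powr)
qed

text \<open>The supremum is taken over the product of the two averages on the same interval, which may
  be smaller than the product of the two maximal functions. This joint supremum is the
  quantity that sparse forms dominate.\<close>

definition maxprod :: "(int \<Rightarrow> complex) \<Rightarrow> (int \<Rightarrow> complex) \<Rightarrow> int \<Rightarrow> real" where
  "maxprod f g x = (SUP (a, b) \<in> {(a, b). a \<le> x \<and> x \<le> b}. avg {a..b} (3/2) f * avg {a..b} (3/2) g)"

lemma finitely_supported_bounded:
  assumes "finitely_supported f"
  obtains B where "\<And>x. norm (f x) \<le> B"
proof -
  have "finite (insert 0 ((\<lambda>x. norm (f x)) ` {n. f n \<noteq> 0}))" using assms by (auto simp: finitely_supported_def)
  then have "\<exists>B. \<forall>y \<in> insert 0 ((\<lambda>x. norm (f x)) ` {n. f n \<noteq> 0}). y \<le> B"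
    by (meson Max_ge)
  then obtain B where B: "\<forall>y \<in> insert 0 ((\<lambda>x. norm (f x)) ` {n. f n \<noteq> 0}). y \<le> B" ..
  have "norm (f x) \<le> B" for x using B by (cases "f x = 0") auto
  then show ?thesis using that by blast
qed

text \<open>A finitely supported function is bounded, and an average does not exceed a pointwise bound.
  Without this the supremum would be an arbitrary real number.\<close>

lemma maxprod_bdd:
  assumes "finitely_supported f" "finitely_supported g"
  shows "bdd_above ((\<lambda>(a, b). avg {a..b} (3/2) f * avg {a..b} (3/2) g) ` {(a, b). a \<le> x \<and> x \<le> b})"
proof -
  obtain B where B: "\<And>x. norm (f x) \<le> B" using finitely_supported_bounded assms by blast
  obtain C where C: "\<And>x. norm (g x) \<le> C" using finitely_supported_bounded assms by blast
  have "B \<ge> 0" using B norm_ge_zero order_trans by blast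
  show ?thesis
  proof (rule bdd_aboveI2, clarify)
    fix a b assume "a \<le> x" "x \<le> b"
    then show "avg {a..b} (3/2) f * avg {a..b} (3/2) g \<le> B * C"
      by (intro mult_mono avg_le_bound B C avg_nonneg \<open>B \<ge> 0\<close>) auto
  qed
qed

lemma maxprod_upper:
  assumes "finitely_supported f" "finitely_supported g" "a \<le> x" "x \<le> b"
  shows "avg {a..b} (3/2) f * avg {a..b} (3/2) g \<le> maxprod f g x"
  unfolding maxprod_def
  using cSUP_upper[OF _ maxprod_bdd[OF assms(1,2)], of "(a,b)" x] assms by simp

lemma maxprod_nonneg:
  assumes "finitely_supported f" "finitely_supported g"
  shows "maxprod f g x \<ge> 0"
  using maxprod_upper[OF assms, of x x x] avg_nonneg by (metis mult_nonneg_nonneg order_refl order_trans)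

lemma maxprod_less_obtain:
  assumes "finitely_supported f" "finitely_supported g" "c < maxprod f g x"
  obtains a b where "a \<le> x" "x \<le> b" "c < avg {a..b} (3/2) f * avg {a..b} (3/2) g"
proof -
  have "{(a, b). a \<le> x \<and> x \<le> b} \<noteq> {}" by auto
  from less_cSUP_iff[OF this maxprod_bdd[OF assms(1,2)]] assms(3) show ?thesis
    unfolding maxprod_def using that by auto
qed

section \<open>Domination of the maximal product by sparse forms\<close>

text \<open>In a laminar family the maximal members are disjoint and have the same union, so the
  hypothesis can be summed over them without overlap. This is the weak type inequality of the
  maximal function of a grid.\<close>

lemma laminar_weak_type:
  fixes w :: "'a \<Rightarrow> real"
  assumes "finite C" "\<And>S. S \<in> C \<Longrightarrow> finite S"
    and lam: "\<And>S T. S \<in> C \<Longrightarrow> T \<in> C \<Longrightarrow> S \<inter> T = {} \<or> S \<subseteq> T \<or> T \<subseteq> S"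
    and c: "\<And>S. S \<in> C \<Longrightarrow> c * real (card S) \<le> sum w S"
  shows "c * real (card (\<Union>C)) \<le> sum w (\<Union>C)"
proof -
  define M where "M = {S\<in>C. \<forall>T\<in>C. S \<subseteq> T \<longrightarrow> S = T}"
  have MC: "M \<subseteq> C" and fM: "finite M" using assms by (auto simp: M_def)
  have un: "\<Union>M = \<Union>C"
  proof
    show "\<Union>M \<subseteq> \<Union>C" using MC by auto
    show "\<Union>C \<subseteq> \<Union>M"
    proof
      fix x assume "x \<in> \<Union>C"
      then obtain S where S: "S \<in> C" "x \<in> S" by auto
      obtain T where "T \<in> C" "S \<subseteq> T" "\<forall>b\<in>C. T \<subseteq> b \<longrightarrow> T = b"
        using finite_has_maximal2[OF assms(1) S(1)] by auto
      then show "x \<in> \<Union>M" using S by (auto simp: M_def)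
    qed
  qed
  have dj: "S \<inter> T = {}" if "S \<in> M" "T \<in> M" "S \<noteq> T" for S T
    using lam[of S T] that by (auto simp: M_def)
  have "c * real (card (\<Union>M)) = (\<Sum>S\<in>M. c * real (card S))"
    using dj assms MC fM by (subst card_Union_disjoint) (auto simp: pairwise_def disjnt_def sum_distrib_left)
  also have "\<dots> \<le> (\<Sum>S\<in>M. sum w S)" using c MC by (intro sum_mono) auto
  also have "\<dots> = sum w (\<Union>M)"
    using dj assms MC fM by (subst sum.Union_disjoint) auto
  finally show ?thesis by (simp add: un)
qed

text \<open>One of three shifted dyadic grids (the one-third trick): for fixed \<open>\<omega>\<close> the admissible left
  endpoints at level \<open>k\<close> are the multiples of \<open>2 ^ k\<close> with residue \<open>\<omega>\<close> modulo 3, hence they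
  are \<open>3 * 2 ^ k\<close> apart and the intervals of one level tile the integers.\<close>

definition grid :: "int \<Rightarrow> int set set" where
  "grid \<omega> = {{L..<L + 3 * 2 ^ k} | L k. 2 ^ k dvd L \<and> L mod 3 = \<omega>}"

text \<open>Both left endpoints are multiples of the smaller power of two with the same residue modulo
  3, so they differ by \<open>z\<close> times the shorter length for an integer \<open>z\<close>, and the three cases
  for \<open>z\<close> are: to the left of the longer interval, to its right, inside.\<close>

lemma grid_nested:
  fixes L L' :: int
  assumes "k \<le> k'" "2 ^ k dvd L" "2 ^ k' dvd L'" "L mod 3 = L' mod 3"
  shows "{L..<L + 3 * 2 ^ k} \<inter> {L'..<L' + 3 * 2 ^ k'} = {} \<or> {L..<L + 3 * 2 ^ k} \<subseteq> {L'..<L' + 3 * 2 ^ k'}"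
proof -
  have "(2::int) ^ k dvd L'" using assms(1,3) by (meson dvd_trans le_imp_power_dvd)
  then have "2 ^ k dvd L' - L" using assms by simp
  moreover have "3 dvd L' - L" using assms(4) by presburger
  moreover have "coprime (3::int) (2 ^ k)" by simp
  ultimately have "3 * 2 ^ k dvd L' - L" by (simp add: divides_mult)
  then obtain z where z: "L' - L = 3 * 2 ^ k * z" by auto
  define d :: int where "d = 3 * 2 ^ k"
  define e :: int where "e = 2 ^ (k' - k)"
  have "(2::int) ^ k' = 2 ^ k * e" using assms(1) by (simp add: e_def flip: power_add)
  then have L'e: "L' + 3 * 2 ^ k' = L + d * (z + e)" using z by (simp add: d_def algebra_simps)
  have L': "L' = L + d * z" using z by (simp add: d_def)
  have d0: "d > 0" by (simp add: d_def)
  consider "z \<ge> 1" | "z + e \<le> 0" | "z \<le> 0" "z + e \<ge> 1" by linarith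
  then show ?thesis
  proof cases
    case 1
    then have "d * z \<ge> d" using d0 by simp
    then show ?thesis using L' by (auto simp flip: d_def)
  next
    case 2
    then have "d * (z + e) \<le> 0" using d0 by (simp add: mult_nonneg_nonpos)
    then show ?thesis using L'e by auto
  next
    case 3
    then have "d * (z + e) \<ge> d" "d * z \<le> 0" using d0 by (auto simp: mult_nonneg_nonpos)
    then show ?thesis using L'e L' by (auto simp flip: d_def)
  qed
qed

lemma grid_laminar:
  assumes "S \<in> grid \<omega>" "T \<in> grid \<omega>"
  shows "S \<inter> T = {} \<or> S \<subseteq> T \<or> T \<subseteq> S"
proof -
  obtain L k where S: "S = {L..<L + 3 * 2 ^ k}" "2 ^ k dvd L" "L mod 3 = \<omega>" using assms(1) by (auto simp: grid_def)
  obtain L' k' where T: "T = {L'..<L' + 3 * 2 ^ k'}" "2 ^ k' dvd L'" "L' mod 3 = \<omega>" using assms(2) by (auto simp: grid_def)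
  show ?thesis
    using grid_nested[of k k' L L'] grid_nested[of k' k L' L] S T by (metis Int_commute nle_le)
qed

lemma grid_interval:
  assumes "S \<in> grid \<omega>"
  shows "finite S" "S \<noteq> {}" "discrete_interval S"
proof -
  obtain L k where S: "S = {L..<L + 3 * 2 ^ k}" using assms(1) by (auto simp: grid_def)
  have p: "(0::int) < 3 * 2 ^ k" by simp
  show "finite S" "S \<noteq> {}" using S p by auto
  have "S = {n. real_of_int L \<le> real_of_int n \<and> real_of_int n \<le> real_of_int (L + 3 * 2 ^ k - 1)}"
    unfolding S of_int_le_iff by auto
  then show "discrete_interval S" using \<open>S \<noteq> {}\<close> unfolding discrete_interval_def by blast
qed

text \<open>Take \<open>2 ^ k\<close> comparable to the length and start at the multiple \<open>L\<close> of \<open>2 ^ k\<close> just below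
  \<open>a\<close>. The interval of length \<open>3 * 2 ^ k\<close> reaches beyond \<open>b\<close>, and it lies in the grid given by
  \<open>L mod 3\<close>.\<close>

lemma grid_cover:
  fixes a b :: int
  assumes "a \<le> b"
  obtains \<omega> S where "\<omega> \<in> {0,1,2}" "S \<in> grid \<omega>" "{a..b} \<subseteq> S" "real (card S) \<le> 6 * real (card {a..b})"
proof -
  define l where "l = b - a + 1"
  have l1: "l \<ge> 1" using assms by (simp add: l_def)
  have ex: "\<exists>k::nat. l \<le> 2 ^ k"
  proof
    have "l = int (nat l)" using l1 by simp
    also have "\<dots> \<le> int (2 ^ nat l)" using less_exp[of "nat l"] by linarith
    finally show "l \<le> 2 ^ nat l" by simp
  qed
  define k where "k = (LEAST k::nat. l \<le> 2 ^ k)"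
  have k: "l \<le> 2 ^ k" unfolding k_def by (rule LeastI_ex[OF ex])
  have k2: "2 ^ k \<le> 2 * l"
  proof (cases k)
    case 0 then show ?thesis using l1 by simp
  next
    case (Suc m)
    then have "\<not> l \<le> 2 ^ m" unfolding k_def using not_less_Least by (metis lessI)
    then show ?thesis using Suc by simp
  qed
  define L where "L = 2 ^ k * (a div 2 ^ k)"
  have La: "L \<le> a" "a < L + 2 ^ k"
  proof -
    have "0 \<le> a mod 2 ^ k" "a mod 2 ^ k < 2 ^ k" by simp_all
    moreover have "2 ^ k * (a div 2 ^ k) + a mod 2 ^ k = a" by simp
    ultimately show "L \<le> a" "a < L + 2 ^ k" unfolding L_def by linarith+
  qed
  have sub: "{a..b} \<subseteq> {L..<L + 3 * 2 ^ k}" using La k by (auto simp: l_def)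
  have "real (card {L..<L + 3 * 2 ^ k}) = real_of_int (3 * 2 ^ k)" by simp
  also have "\<dots> \<le> real_of_int (6 * l)" using k2 by (simp only: of_int_le_iff)
  also have "\<dots> = 6 * real (card {a..b})" using assms by (simp add: l_def)
  finally have "real (card {L..<L + 3 * 2 ^ k}) \<le> 6 * real (card {a..b})" .
  moreover have "{L..<L + 3 * 2 ^ k} \<in> grid (L mod 3)" 
    unfolding grid_def mem_Collect_eq by (rule exI[of _ L], rule exI[of _ k]) (simp add: L_def)
  moreover have "L mod 3 \<in> {0,1,2}" by auto
  ultimately show ?thesis by (intro that[OF _ _ sub])
qed

text \<open>Intervals on which the average of \<open>f\<close> jumps by a factor \<open>B\<close> can cover only the fraction
  \<open>B powr (-r)\<close> of \<open>S\<close>.\<close>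

lemma avg_ratio_union_small:
  assumes "finite C" "C \<subseteq> grid \<omega>" "\<And>T. T \<in> C \<Longrightarrow> T \<subseteq> S" "finite S" "S \<noteq> {}" "avg S r f > 0"
    and "\<And>T. T \<in> C \<Longrightarrow> avg T r f \<ge> B * avg S r f" "B > 0" "r > 0"
  shows "B powr r * real (card (\<Union>C)) \<le> real (card S)"
proof -
  let ?w = "\<lambda>x. norm (f x) powr r"
  have "(B * avg S r f) powr r * real (card (\<Union>C)) \<le> sum ?w (\<Union>C)"
  proof (rule laminar_weak_type)
    fix T assume T: "T \<in> C"
    have ft: "finite T" "T \<noteq> {}" using T assms grid_interval by blast+
    have "(B * avg S r f) powr r * real (card T) \<le> avg T r f powr r * real (card T)"
      using assms T by (intro mult_right_mono powr_mono2) auto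
    also have "\<dots> = sum ?w T" using avg_powr_eq[OF ft \<open>r > 0\<close>, of f] by (simp add: mult_ac)
    finally show "(B * avg S r f) powr r * real (card T) \<le> sum ?w T" .
    show "finite T" by fact
  next
    fix T T' assume "T \<in> C" "T' \<in> C"
    then show "T \<inter> T' = {} \<or> T \<subseteq> T' \<or> T' \<subseteq> T" using grid_laminar assms by blast
  qed fact
  also have "\<dots> \<le> sum ?w S" using assms by (intro sum_mono2) auto
  also have "\<dots> = real (card S) * avg S r f powr r" using avg_powr_eq[of S r f] assms by simp
  finally have "avg S r f powr r * (B powr r * real (card (\<Union>C))) \<le> avg S r f powr r * real (card S)"
    using assms by (simp add: powr_mult mult_ac)
  then show ?thesis using assms by simp
qed

text \<open>Disjoint sets \<open>E S\<close> have overlap at most 1, which is below \<open>1/\<rho>\<close>.\<close>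

lemma sparse_of_disjoint_parts:
  assumes "0 < \<rho>" "\<rho> < 1" "finite \<S>" "\<And>S. S \<in> \<S> \<Longrightarrow> discrete_interval S"
    and "\<And>S. S \<in> \<S> \<Longrightarrow> E S \<subseteq> S \<and> real (card (E S)) > \<rho> * real (card S)"
    and dj: "\<And>S T. S \<in> \<S> \<Longrightarrow> T \<in> \<S> \<Longrightarrow> S \<noteq> T \<Longrightarrow> E S \<inter> E T = {}"
  shows "sparse \<rho> \<S>"
  unfolding sparse_def
proof (intro conjI exI[of _ E])
  have "(\<Sum>\<^sub>\<infinity>S\<in>\<S>. (indicator (E S) x :: ennreal)) \<le> 1" for x
  proof -
    have "(\<Sum>\<^sub>\<infinity>S\<in>\<S>. (indicator (E S) x :: ennreal)) = (\<Sum>S\<in>\<S>. indicator (E S) x)"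
      using assms by simp
    also have "\<dots> \<le> 1"
    proof (cases "\<exists>S\<in>\<S>. x \<in> E S")
      case True
      then obtain S where S: "S \<in> \<S>" "x \<in> E S" by auto
      then have "(\<Sum>T\<in>\<S>. (indicator (E T) x :: ennreal)) = (\<Sum>T\<in>\<S>. if T = S then 1 else 0)"
        using dj by (intro sum.cong) (auto simp: indicator_def)
      also have "\<dots> = 1" using S assms by simp
      finally show ?thesis by simp
    qed (simp add: indicator_def)
    finally show ?thesis .
  qed
  moreover have "(1::ennreal) \<le> ennreal (1 / \<rho>)"
    using assms by (subst ennreal_1[symmetric], intro ennreal_leI) (simp add: field_simps)
  ultimately show "(SUP x. \<Sum>\<^sub>\<infinity>S\<in>\<S>. (indicator (E S) x :: ennreal)) \<le> ennreal (1 / \<rho>)"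
    by (intro SUP_least) (meson order_trans)
qed (use assms in auto)

text \<open>Let the level of \<open>S\<close> be the integer part of \<open>log (B * B) (P S)\<close>. Keep those intervals all of
  whose strictly larger companions have a smaller level. Every interval lies in a kept one of
  at least its level, which gives the inequality. If \<open>T\<close> is kept and strictly inside a kept
  \<open>S\<close>, then \<open>T\<close> has a larger level, and by the parity assumption larger by at least 2. Hence
  \<open>P T \<ge> B * B * P S\<close>, one of the two averages grows by the factor \<open>B\<close>, and such \<open>T\<close> cover
  only a small part of \<open>S\<close>. The parity assumption is what makes this work: levels that differ
  by 1 do not exclude nearly equal products.\<close>

lemma grid_family_dominated:
  fixes f g :: "int \<Rightarrow> complex" and D :: "int \<Rightarrow> int set" and r :: real
  defines "P \<equiv> \<lambda>S. avg S r f * avg S r g"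
  assumes \<rho>: "0 < \<rho>" "\<rho> < 1" and r: "r > 0" and B: "B > 1" "2 / B powr r < 1 - \<rho>"
    and X: "finite X" "\<And>x. x \<in> X \<Longrightarrow> D x \<in> grid \<omega> \<and> x \<in> D x \<and> P (D x) > 0"
    and par: "\<And>x. x \<in> X \<Longrightarrow> \<lfloor>log (B * B) (P (D x))\<rfloor> mod 2 = \<pi>"
  shows "\<exists>\<S>. sparse \<rho> \<S> \<and> finite \<S> \<and> (\<Sum>x\<in>X. P (D x)) \<le> B * B * (\<Sum>S\<in>\<S>. P S * real (card S))"
proof -
  define A where "A = B * B"
  have A: "A > 1" using B by (simp add: A_def less_1_mult)
  define lev where "lev S = \<lfloor>log A (P S)\<rfloor>" for S
  define F where "F = D ` X"
  have fF: "finite F" using X by (simp add: F_def)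
  define \<S> where "\<S> = {S\<in>F. \<forall>T\<in>F. S \<subset> T \<longrightarrow> lev T < lev S}"
  have SF: "\<S> \<subseteq> F" by (auto simp: \<S>_def)
  then have fS: "finite \<S>" using fF finite_subset by blast
  have FG: "F \<subseteq> grid \<omega>" and PF: "\<And>S. S \<in> F \<Longrightarrow> P S > 0" and parF: "\<And>S. S \<in> F \<Longrightarrow> lev S mod 2 = \<pi>"
    using X par by (auto simp: F_def lev_def A_def)
  have fin: "finite S" "S \<noteq> {}" if "S \<in> F" for S using that FG grid_interval by blast+
  have lev: "A powr lev S \<le> P S" "P S < A powr (lev S + 1)" if "S \<in> F" for S
  proof -
    have e: "P S = A powr (log A (P S))" using A PF[OF that] by simp
    have "A powr lev S \<le> A powr (log A (P S))" using A by (intro powr_mono) (auto simp: lev_def)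
    then show "A powr lev S \<le> P S" using e by simp
    have "A powr (log A (P S)) < A powr (lev S + 1)" unfolding lev_def
      using A by (subst powr_less_cancel_iff) auto
    then show "P S < A powr (lev S + 1)" using e by simp
  qed
  \<comment> \<open>a maximal element among the intervals that contain \<open>T\<close> and have at least its level\<close>
  have parent: "\<exists>S\<in>\<S>. T \<subseteq> S \<and> lev T \<le> lev S" if T: "T \<in> F" for T
  proof -
    let ?G = "{S\<in>F. T \<subseteq> S \<and> lev T \<le> lev S}"
    obtain S where S: "S \<in> ?G" "\<forall>b\<in>?G. S \<subseteq> b \<longrightarrow> S = b"
      using finite_has_maximal2[of ?G T] fF T by auto
    have "S \<in> \<S>"
    proof -
      { fix U assume U: "U \<in> F" "S \<subset> U" "\<not> lev U < lev S"
        then have "U \<in> ?G" using S(1) by auto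
        then have False using S(2) U by auto }
      then show ?thesis using S(1) by (auto simp: \<S>_def)
    qed
    then show ?thesis using S(1) by auto
  qed
  then obtain \<pi>' where \<pi>': "\<And>T. T \<in> F \<Longrightarrow> \<pi>' T \<in> \<S> \<and> T \<subseteq> \<pi>' T \<and> lev T \<le> lev (\<pi>' T)" by metis
  have "(\<Sum>x\<in>X. P (D x)) \<le> (\<Sum>x\<in>X. A * P (\<pi>' (D x)))"
  proof (rule sum_mono)
    fix x assume x: "x \<in> X"
    then have DF: "D x \<in> F" by (simp add: F_def)
    have pF: "\<pi>' (D x) \<in> F" using \<pi>'[OF DF] SF by auto
    have "P (D x) \<le> A powr (lev (D x) + 1)" using lev(2)[OF DF] by simp
    also have "\<dots> \<le> A powr (lev (\<pi>' (D x)) + 1)" using \<pi>'[OF DF] A by (intro powr_mono) auto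
    also have "\<dots> = A * A powr (lev (\<pi>' (D x)))" using A by (simp add: powr_add)
    also have "\<dots> \<le> A * P (\<pi>' (D x))" using lev(1)[OF pF] A by simp
    finally show "P (D x) \<le> A * P (\<pi>' (D x))" .
  qed
  also have "\<dots> = (\<Sum>S\<in>\<S>. \<Sum>x\<in>{x\<in>X. \<pi>' (D x) = S}. A * P (\<pi>' (D x)))"
    by (rule sum.group[symmetric]) (use X fS \<pi>' in \<open>auto simp: F_def\<close>)
  also have "\<dots> = (\<Sum>S\<in>\<S>. real (card {x\<in>X. \<pi>' (D x) = S}) * (A * P S))" by simp
  also have "\<dots> \<le> (\<Sum>S\<in>\<S>. real (card S) * (A * P S))"
  proof (intro sum_mono mult_right_mono)
    fix S assume S: "S \<in> \<S>"
    then have SF': "S \<in> F" using SF by auto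
    have "{x\<in>X. \<pi>' (D x) = S} \<subseteq> S"
    proof safe
      fix x assume "x \<in> X" "S = \<pi>' (D x)"
      then have "x \<in> D x" "D x \<subseteq> \<pi>' (D x)" using X \<pi>'[of "D x"] by (auto simp: F_def)
      then show "x \<in> \<pi>' (D x)" by auto
    qed
    then show "real (card {x\<in>X. \<pi>' (D x) = S}) \<le> real (card S)" using fin[OF SF'] by (simp add: card_mono)
    show "0 \<le> A * P S" using A PF[OF SF'] by simp
  qed
  also have "\<dots> = B * B * (\<Sum>S\<in>\<S>. P S * real (card S))"
    by (simp add: A_def sum_distrib_left mult_ac)
  finally have main: "(\<Sum>x\<in>X. P (D x)) \<le> B * B * (\<Sum>S\<in>\<S>. P S * real (card S))" .
  \<comment> \<open>the part of \<open>S\<close> outside the kept intervals strictly inside \<open>S\<close>\<close>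
  define E where "E S = S - \<Union>{T\<in>\<S>. T \<subset> S}" for S
  have "sparse \<rho> \<S>"
  proof (rule sparse_of_disjoint_parts[where E = E])
    fix S assume S: "S \<in> \<S>"
    then have SF': "S \<in> F" using SF by auto
    then show "discrete_interval S" using FG grid_interval by blast
    let ?C = "{T\<in>\<S>. T \<subset> S}"
    let ?Cf = "{T\<in>?C. avg T r f \<ge> B * avg S r f}"
    let ?Cg = "{T\<in>?C. avg T r g \<ge> B * avg S r g}"
    have pos: "avg S r f > 0" "avg S r g > 0"
      using PF[OF SF'] avg_nonneg[of S r f] avg_nonneg[of S r g] unfolding P_def
      by (auto simp: zero_less_mult_iff)
    have Cun: "?C = ?Cf \<union> ?Cg"
    proof -
      { fix T assume T: "T \<in> \<S>" "T \<subset> S" "avg T r f < B * avg S r f" "avg T r g < B * avg S r g"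
        have TF: "T \<in> F" using T SF by auto
        have "lev S < lev T" using T S TF SF' by (auto simp: \<S>_def)
        moreover have "lev S mod 2 = lev T mod 2" using parF TF SF' by simp
        ultimately have "lev S + 2 \<le> lev T" by presburger
        have "A * P S \<le> A * A powr (lev S + 1)" using lev(2)[OF SF'] A by simp
        also have "\<dots> = A powr (lev S + 2)" using A by (simp add: powr_add powr_numeral power2_eq_square)
        also have "\<dots> \<le> A powr lev T" using A \<open>lev S + 2 \<le> lev T\<close> by (intro powr_mono) auto
        also have "\<dots> \<le> P T" by (rule lev(1)[OF TF])
        also have "P T < (B * avg S r f) * (B * avg S r g)" unfolding P_def
          by (intro mult_strict_mono' T avg_nonneg)
        also have "\<dots> = A * P S" by (simp add: A_def P_def)
        finally have False by simp }
      then show ?thesis by force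
    qed
    have sm: "B powr r * real (card (\<Union>?Cf)) \<le> real (card S)" "B powr r * real (card (\<Union>?Cg)) \<le> real (card S)"
      using SF FG fS fin[OF SF'] pos r B by (intro avg_ratio_union_small[where \<omega> = \<omega>]; auto)+
    have B0: "B powr r > 0" using B by simp
    have "real (card (\<Union>?C)) \<le> real (card (\<Union>?Cf)) + real (card (\<Union>?Cg))"
    proof -
      have "\<Union>?C = \<Union>?Cf \<union> \<Union>?Cg" by (subst Cun) (rule Union_Un_distrib)
      then show ?thesis using card_Un_le[of "\<Union>?Cf" "\<Union>?Cg"] by simp
    qed
    also have "\<dots> \<le> 2 / B powr r * real (card S)" using sm B0 by (simp add: field_simps)
    also have "\<dots> < (1 - \<rho>) * real (card S)"
      using B fin[OF SF'] by (intro mult_strict_right_mono) (auto simp: card_gt_0_iff)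
    finally have small: "real (card (\<Union>?C)) < (1 - \<rho>) * real (card S)" .
    have "card S \<le> card (E S) + card (\<Union>?C)"
    proof -
      have "S = E S \<union> \<Union>?C" by (auto simp: E_def)
      then show ?thesis using card_Un_le by metis
    qed
    then show "E S \<subseteq> S \<and> real (card (E S)) > \<rho> * real (card S)"
      using small by (auto simp: E_def algebra_simps)
  next
    fix S T assume ST: "S \<in> \<S>" "T \<in> \<S>" "S \<noteq> T"
    then have "S \<inter> T = {} \<or> S \<subset> T \<or> T \<subset> S" using grid_laminar SF FG by blast
    then show "E S \<inter> E T = {}" using ST by (auto simp: E_def)
  qed (use \<rho> fS in auto)
  then show ?thesis using main fS by blast
qed

text \<open>Each \<open>x\<close> is given a grid interval on which the product of averages is comparable to
  \<open>maxprod f g x\<close>: the factor 72 is 2 for almost attaining the supremum times \<open>6 * 6\<close> for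
  passing to a grid interval. There are six classes of points, by grid and by parity of the
  level, and each is dominated by one sparse form.\<close>

lemma sum_maxprod_le_sparse:
  assumes \<rho>: "0 < \<rho>" "\<rho> < 1"
  obtains C where "C > 0" "\<And>f g X. finitely_supported f \<Longrightarrow> finitely_supported g \<Longrightarrow> finite X \<Longrightarrow>
    ennreal (\<Sum>x\<in>X. maxprod f g x) \<le> ennreal C * (SUP \<S>\<in>{\<S>. sparse \<rho> \<S>}. sparse_form \<S> (3/2) f g)"
proof -
  \<comment> \<open>large enough that \<open>2 / B powr (3/2) < 1 - \<rho>\<close>\<close>
  define B where "B = max 2 (4 / (1 - \<rho>))"
  have B: "B > 1" "B \<ge> 4 / (1 - \<rho>)" by (auto simp: B_def)
  have "B powr 1 \<le> B powr (3/2)" using B by (intro powr_mono) auto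
  then have "B \<le> B powr (3/2)" using B by simp
  then have "4 / (1 - \<rho>) \<le> B powr (3/2)" using B by simp
  then have "4 \<le> B powr (3/2) * (1 - \<rho>)" using \<rho> by (simp add: field_simps)
  then have B2: "2 / B powr (3/2) < 1 - \<rho>" using B by (simp add: divide_less_eq mult.commute)
  show ?thesis
  proof (rule that[of "72 * (6 * (B * B))"])
    show "0 < 72 * (6 * (B * B))" using B by simp
    fix f g :: "int \<Rightarrow> complex" and X :: "int set"
    assume fg: "finitely_supported f" "finitely_supported g" and X: "finite X"
    define Sp where "Sp = (SUP \<S>\<in>{\<S>. sparse \<rho> \<S>}. sparse_form \<S> (3/2) f g)"
    define P where "P S = avg S (3/2) f * avg S (3/2) g" for S
    define X' where "X' = {x\<in>X. maxprod f g x > 0}"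
    have "\<exists>\<omega> S. \<omega> \<in> {0,1,2} \<and> S \<in> grid \<omega> \<and> x \<in> S \<and> maxprod f g x \<le> 72 * P S" if x: "x \<in> X'" for x
    proof -
      have "maxprod f g x / 2 < maxprod f g x" using x by (simp add: X'_def)
      then obtain a b where ab: "a \<le> x" "x \<le> b" "maxprod f g x / 2 < avg {a..b} (3/2) f * avg {a..b} (3/2) g"
        using maxprod_less_obtain[OF fg] by blast
      obtain \<omega> S where S: "\<omega> \<in> {0,1,2}" "S \<in> grid \<omega>" "{a..b} \<subseteq> S" "real (card S) \<le> 6 * real (card {a..b})"
        using grid_cover[of a b] ab by auto
      have fS: "finite S" using S grid_interval by blast
      have "avg {a..b} (3/2) f * avg {a..b} (3/2) g \<le> (6 * avg S (3/2) f) * (6 * avg S (3/2) g)"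
        using ab S fS by (intro mult_mono avg_le_superset mult_nonneg_nonneg avg_nonneg) auto
      then have "maxprod f g x \<le> 72 * P S" using ab by (simp add: P_def)
      moreover have "x \<in> S" using S ab by auto
      ultimately show ?thesis using S by blast
    qed
    then obtain om D where D: "\<And>x. x \<in> X' \<Longrightarrow> om x \<in> {0,1,2} \<and> D x \<in> grid (om x) \<and> x \<in> D x \<and> maxprod f g x \<le> 72 * P (D x)"
      by metis
    define par where "par x = \<lfloor>log (B * B) (P (D x))\<rfloor> mod 2" for x
    define Y where "Y \<omega> p = {x\<in>X'. om x = \<omega> \<and> par x = p}" for \<omega> p
    have fX': "finite X'" using X by (simp add: X'_def)
    have fY: "finite (Y \<omega> p)" for \<omega> p using fX' by (simp add: Y_def)
    have Ppos: "P (D x) > 0" if "x \<in> X'" for x using D[OF that] that by (auto simp: X'_def)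
    have each: "ennreal (\<Sum>x\<in>Y \<omega> p. P (D x)) \<le> ennreal (B * B) * Sp" for \<omega> p
    proof -
      have "\<exists>\<S>. sparse \<rho> \<S> \<and> finite \<S> \<and> (\<Sum>x\<in>Y \<omega> p. P (D x)) \<le> B * B * (\<Sum>S\<in>\<S>. P S * real (card S))"
        unfolding P_def
        by (rule grid_family_dominated[where \<pi> = p and \<omega> = \<omega>])
           (use \<rho> B B2 fY D Ppos in \<open>auto simp: Y_def par_def P_def\<close>)
      then obtain \<S> where S: "sparse \<rho> \<S>" "finite \<S>" "(\<Sum>x\<in>Y \<omega> p. P (D x)) \<le> B * B * (\<Sum>S\<in>\<S>. P S * real (card S))"
        by blast
      have "ennreal (\<Sum>x\<in>Y \<omega> p. P (D x)) \<le> ennreal (B * B * (\<Sum>S\<in>\<S>. P S * real (card S)))"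
        using S by (intro ennreal_leI)
      also have "\<dots> = ennreal (B * B) * ennreal (\<Sum>S\<in>\<S>. P S * real (card S))"
        using B by (intro ennreal_mult sum_nonneg mult_nonneg_nonneg) (auto simp: P_def avg_nonneg)
      also have "ennreal (\<Sum>S\<in>\<S>. P S * real (card S)) = sparse_form \<S> (3/2) f g"
        unfolding sparse_form_def using S by (subst sum_ennreal[symmetric]) (auto simp: P_def avg_nonneg)
      also have "\<dots> \<le> Sp" unfolding Sp_def using S by (intro SUP_upper) auto
      finally show ?thesis by (simp add: mult_left_mono)
    qed
    have "(\<Sum>x\<in>X. maxprod f g x) = (\<Sum>x\<in>X'. maxprod f g x)"
      unfolding X'_def using X maxprod_nonneg[OF fg]
      by (intro sum.mono_neutral_right) (auto simp: less_le)
    also have "\<dots> \<le> (\<Sum>x\<in>X'. 72 * P (D x))" using D by (intro sum_mono) auto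
    also have "\<dots> = 72 * (\<Sum>x\<in>X'. P (D x))" by (simp add: sum_distrib_left)
    also have "(\<Sum>x\<in>X'. P (D x)) = (\<Sum>(\<omega>,p)\<in>{0,1,2}\<times>{0,1}. \<Sum>x\<in>{x\<in>X'. (om x, par x) = (\<omega>,p)}. P (D x))"
      unfolding case_prod_unfold prod.collapse
      by (rule sum.group[symmetric]) (use fX' D in \<open>auto simp: par_def\<close>)
    also have "\<dots> = (\<Sum>(\<omega>,p)\<in>{0,1,2}\<times>{0,1}. \<Sum>x\<in>Y \<omega> p. P (D x))" by (simp add: Y_def)
    finally have "ennreal (\<Sum>x\<in>X. maxprod f g x) \<le> ennreal (72 * (\<Sum>(\<omega>,p)\<in>{0,1,2}\<times>{0,1}. \<Sum>x\<in>Y \<omega> p. P (D x)))"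
      by (intro ennreal_leI)
    also have "\<dots> = ennreal 72 * (\<Sum>(\<omega>,p)\<in>{0,1,2}\<times>{0,1}. ennreal (\<Sum>x\<in>Y \<omega> p. P (D x)))"
    proof -
      have nn: "0 \<le> (\<Sum>x\<in>Y \<omega> p. P (D x))" for \<omega> p
        by (intro sum_nonneg) (simp add: P_def avg_nonneg)
      have "ennreal (72 * (\<Sum>(\<omega>,p)\<in>{0,1,2}\<times>{0,1}. \<Sum>x\<in>Y \<omega> p. P (D x)))
          = ennreal 72 * ennreal (\<Sum>(\<omega>,p)\<in>{0,1,2}\<times>{0,1}. \<Sum>x\<in>Y \<omega> p. P (D x))"
        by (intro ennreal_mult sum_nonneg) (auto simp: nn simp del: sum.cartesian_product)
      also have "ennreal (\<Sum>(\<omega>,p)\<in>{0,1,2}\<times>{0,1}. \<Sum>x\<in>Y \<omega> p. P (D x))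
          = (\<Sum>(\<omega>,p)\<in>{0,1,2}\<times>{0,1}. ennreal (\<Sum>x\<in>Y \<omega> p. P (D x)))"
        unfolding case_prod_unfold by (rule sum_ennreal[symmetric]) (rule nn)
      finally show ?thesis .
    qed
    also have "\<dots> \<le> ennreal 72 * (\<Sum>(\<omega>,p)\<in>{0::int,1,2}\<times>{0::int,1}. ennreal (B * B) * Sp)"
      using each by (intro mult_left_mono sum_mono) auto
    also have "\<dots> = ennreal 72 * (6 * (ennreal (B * B) * Sp))"
      by (simp add: split_def)
    also have "\<dots> = ennreal (72 * (6 * (B * B))) * Sp"
      using B by (simp add: ennreal_mult mult.assoc)
    finally show "ennreal (\<Sum>x\<in>X. maxprod f g x) \<le> ennreal (72 * (6 * (B * B))) * Sp" .
  qed
qed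

section \<open>Forms on one scale\<close>

text \<open>The first argument of the kernel belongs to \<open>f\<close> and the second to \<open>g\<close>, so that a convolution
  with \<open>c\<close> has the kernel \<open>\<lambda>n' n. c (n - n')\<close>.\<close>

definition bform :: "int set \<Rightarrow> (int \<Rightarrow> int \<Rightarrow> complex) \<Rightarrow> (int \<Rightarrow> complex) \<Rightarrow> (int \<Rightarrow> complex) \<Rightarrow> complex" where
  "bform A \<kappa> f g = (\<Sum>n'\<in>A. \<Sum>n\<in>A. \<kappa> n' n * f n' * cnj (g n))"

text \<open>\<open>\<nu>\<close> bounds the norm on \<open>\<ell>\<^sup>2\<close> of the operator with kernel \<open>\<kappa>\<close>, stated by duality and for all
  finite sections at once.\<close>

definition op_le :: "(int \<Rightarrow> int \<Rightarrow> complex) \<Rightarrow> real \<Rightarrow> bool" where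
  "op_le \<kappa> \<nu> \<longleftrightarrow> (\<forall>A f g. finite A \<longrightarrow>
     norm (bform A \<kappa> f g) \<le> \<nu> * sqrt (\<Sum>n\<in>A. (norm (f n))\<^sup>2) * sqrt (\<Sum>n\<in>A. (norm (g n))\<^sup>2))"

lemma op_leD:
  assumes "op_le \<kappa> \<nu>" "finite A"
  shows "norm (bform A \<kappa> f g) \<le> \<nu> * sqrt (\<Sum>n\<in>A. (norm (f n))\<^sup>2) * sqrt (\<Sum>n\<in>A. (norm (g n))\<^sup>2)"
  using assms by (auto simp: op_le_def)

lemma bform_add_kernel: "bform A (\<lambda>n' n. \<kappa> n' n + \<kappa>' n' n) f g = bform A \<kappa> f g + bform A \<kappa>' f g"
  by (simp add: bform_def distrib_right sum.distrib)

lemma bform_scale_kernel: "bform A (\<lambda>n' n. c * \<kappa> n' n) f g = c * bform A \<kappa> f g"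
  by (simp add: bform_def sum_distrib_left mult.assoc)

lemma bform_diff_kernel: "bform A (\<lambda>n' n. \<kappa> n' n - \<kappa>' n' n) f g = bform A \<kappa> f g - bform A \<kappa>' f g"
  by (simp add: bform_def left_diff_distrib sum_subtractf)

lemma bform_sum_kernel: "bform A (\<lambda>n' n. \<Sum>i\<in>I. \<kappa> i n' n) f g = (\<Sum>i\<in>I. bform A (\<kappa> i) f g)"
proof -
  have "bform A (\<lambda>n' n. \<Sum>i\<in>I. \<kappa> i n' n) f g = (\<Sum>n'\<in>A. \<Sum>i\<in>I. \<Sum>n\<in>A. \<kappa> i n' n * f n' * cnj (g n))"
    unfolding bform_def by (intro sum.cong refl, subst sum.swap) (simp add: sum_distrib_right)
  also have "\<dots> = (\<Sum>i\<in>I. bform A (\<kappa> i) f g)" unfolding bform_def by (rule sum.swap)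
  finally show ?thesis .
qed

lemma bform_add_left: "bform A \<kappa> (\<lambda>x. f x + f' x) g = bform A \<kappa> f g + bform A \<kappa> f' g"
  by (simp add: bform_def distrib_left distrib_right sum.distrib)

lemma bform_add_right: "bform A \<kappa> f (\<lambda>x. g x + g' x) = bform A \<kappa> f g + bform A \<kappa> f g'"
  by (simp add: bform_def distrib_left sum.distrib)

lemma bform_cong:
  assumes "\<And>n' n. n' \<in> A \<Longrightarrow> n \<in> A \<Longrightarrow> \<kappa> n' n = \<kappa>' n' n" "\<And>n. n \<in> A \<Longrightarrow> f n = f' n" "\<And>n. n \<in> A \<Longrightarrow> g n = g' n"
  shows "bform A \<kappa> f g = bform A \<kappa>' f' g'"
  using assms by (auto simp: bform_def intro!: sum.cong)

lemma op_le_mono: "op_le \<kappa> \<nu> \<Longrightarrow> \<nu> \<le> \<nu>' \<Longrightarrow> op_le \<kappa> \<nu>'"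
  unfolding op_le_def
  by (meson mult_right_mono order_trans real_sqrt_ge_zero sum_nonneg zero_le_power2)

lemma op_le_add:
  assumes "op_le \<kappa> \<nu>" "op_le \<kappa>' \<nu>'"
  shows "op_le (\<lambda>n' n. \<kappa> n' n + \<kappa>' n' n) (\<nu> + \<nu>')"
  unfolding op_le_def
proof (intro allI impI)
  fix A :: "int set" and f g :: "int \<Rightarrow> complex" assume A: "finite A"
  show "norm (bform A (\<lambda>n' n. \<kappa> n' n + \<kappa>' n' n) f g) \<le>
      (\<nu> + \<nu>') * sqrt (\<Sum>n\<in>A. (norm (f n))\<^sup>2) * sqrt (\<Sum>n\<in>A. (norm (g n))\<^sup>2)"
    using norm_triangle_ineq[of "bform A \<kappa> f g" "bform A \<kappa>' f g"]
      op_leD[OF assms(1) A, of f g] op_leD[OF assms(2) A, of f g]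
    by (simp add: bform_add_kernel distrib_right)
qed

lemma op_le_scale:
  assumes "op_le \<kappa> \<nu>"
  shows "op_le (\<lambda>n' n. c * \<kappa> n' n) (norm c * \<nu>)"
  unfolding op_le_def
  using op_leD[OF assms] by (auto simp: bform_scale_kernel norm_mult mult.assoc intro!: mult_left_mono)

lemma op_le_diff:
  assumes "op_le \<kappa> \<nu>" "op_le \<kappa>' \<nu>'"
  shows "op_le (\<lambda>n' n. \<kappa> n' n - \<kappa>' n' n) (\<nu> + \<nu>')"
  using op_le_add[OF assms(1) op_le_scale[OF assms(2), of "-1"]] by simp

lemma op_le_0: "op_le (\<lambda>n' n. 0) 0"
  by (simp add: op_le_def bform_def)

lemma op_le_sum:
  assumes "finite I" "\<And>i. i \<in> I \<Longrightarrow> op_le (\<kappa> i) (\<nu> i)"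
  shows "op_le (\<lambda>n' n. \<Sum>i\<in>I. \<kappa> i n' n) (\<Sum>i\<in>I. \<nu> i)"
  using assms by (induction rule: finite_induct) (auto simp: op_le_0 intro: op_le_add)

lemma op_le_reflect:
  assumes "op_le (\<lambda>n' n. c (n - n')) \<nu>"
  shows "op_le (\<lambda>n' n. c (n' - n)) \<nu>"
  unfolding op_le_def
proof (intro allI impI)
  fix A :: "int set" and f g :: "int \<Rightarrow> complex" assume A: "finite A"
  have i: "inj_on uminus A" for A :: "int set" by (auto simp: inj_on_def)
  have "bform (uminus ` A) (\<lambda>n' n. c (n - n')) (\<lambda>x. f (-x)) (\<lambda>x. g (-x)) = bform A (\<lambda>n' n. c (n' - n)) f g"
    unfolding bform_def by (simp add: sum.reindex[OF i] algebra_simps)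
  moreover have "(\<Sum>n\<in>uminus ` A. (norm (h (-n)))\<^sup>2) = (\<Sum>n\<in>A. (norm (h n))\<^sup>2)" for h :: "int \<Rightarrow> complex"
    by (simp add: sum.reindex[OF i])
  ultimately show "norm (bform A (\<lambda>n' n. c (n' - n)) f g) \<le>
      \<nu> * sqrt (\<Sum>n\<in>A. (norm (f n))\<^sup>2) * sqrt (\<Sum>n\<in>A. (norm (g n))\<^sup>2)"
    using op_leD[OF assms, of "uminus ` A" "\<lambda>x. f (-x)" "\<lambda>x. g (-x)"] A by simp
qed

text \<open>Schur's test: split \<open>K\<close> as \<open>sqrt K * sqrt K\<close> and apply the Cauchy-Schwarz inequality on
  \<open>A \<times> B\<close>.\<close>

lemma schur_test_real:
  fixes K :: "'a \<Rightarrow> 'b \<Rightarrow> real" and a :: "'a \<Rightarrow> real" and b :: "'b \<Rightarrow> real"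
  assumes "finite A" "finite B" "\<And>x y. K x y \<ge> 0" "M \<ge> 0"
    and "\<And>x. x \<in> A \<Longrightarrow> (\<Sum>y\<in>B. K x y) \<le> M" "\<And>y. y \<in> B \<Longrightarrow> (\<Sum>x\<in>A. K x y) \<le> M"
  shows "(\<Sum>x\<in>A. \<Sum>y\<in>B. K x y * \<bar>a x\<bar> * \<bar>b y\<bar>) \<le> M * sqrt (\<Sum>x\<in>A. (a x)\<^sup>2) * sqrt (\<Sum>y\<in>B. (b y)\<^sup>2)"
proof -
  let ?u = "\<lambda>(x,y). sqrt (K x y) * a x" and ?v = "\<lambda>(x,y). sqrt (K x y) * b y"
  have "(\<Sum>x\<in>A. \<Sum>y\<in>B. K x y * \<bar>a x\<bar> * \<bar>b y\<bar>) = (\<Sum>p\<in>A\<times>B. \<bar>?u p\<bar> * \<bar>?v p\<bar>)"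
    unfolding sum.cartesian_product
  proof (intro sum.cong refl, clarify)
    fix x y
    have "K x y * \<bar>a x\<bar> * \<bar>b y\<bar> = (sqrt (K x y) * sqrt (K x y)) * \<bar>a x\<bar> * \<bar>b y\<bar>" using assms(3) by simp
    then show "K x y * \<bar>a x\<bar> * \<bar>b y\<bar> = \<bar>sqrt (K x y) * a x\<bar> * \<bar>sqrt (K x y) * b y\<bar>"
      using assms(3) by (simp only: abs_mult abs_of_nonneg real_sqrt_ge_zero) (simp add: mult_ac)
  qed
  also have "\<dots> \<le> L2_set ?u (A\<times>B) * L2_set ?v (A\<times>B)" by (rule L2_set_mult_ineq)
  also have "\<dots> \<le> sqrt (M * (\<Sum>x\<in>A. (a x)\<^sup>2)) * sqrt (M * (\<Sum>y\<in>B. (b y)\<^sup>2))"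
  proof (intro mult_mono)
    have "(\<Sum>p\<in>A\<times>B. (?u p)\<^sup>2) = (\<Sum>x\<in>A. (a x)\<^sup>2 * (\<Sum>y\<in>B. K x y))"
    proof -
      have "(\<Sum>p\<in>A\<times>B. (?u p)\<^sup>2) = (\<Sum>x\<in>A. \<Sum>y\<in>B. (?u (x,y))\<^sup>2)"
        unfolding sum.cartesian_product by (intro sum.cong refl) (simp add: split_def)
      then show ?thesis using assms(3) by (simp add: power_mult_distrib sum_distrib_right mult.commute)
    qed
    also have "\<dots> \<le> (\<Sum>x\<in>A. (a x)\<^sup>2 * M)" using assms by (intro sum_mono mult_left_mono) auto
    finally show "L2_set ?u (A\<times>B) \<le> sqrt (M * (\<Sum>x\<in>A. (a x)\<^sup>2))"
      unfolding L2_set_def by (simp add: sum_distrib_left mult_ac)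
    have "(\<Sum>p\<in>A\<times>B. (?v p)\<^sup>2) = (\<Sum>x\<in>A. \<Sum>y\<in>B. (b y)\<^sup>2 * K x y)"
    proof -
      have "(\<Sum>p\<in>A\<times>B. (?v p)\<^sup>2) = (\<Sum>x\<in>A. \<Sum>y\<in>B. (?v (x,y))\<^sup>2)"
        unfolding sum.cartesian_product by (intro sum.cong refl) (simp add: split_def)
      then show ?thesis using assms(3) by (simp add: power_mult_distrib mult_ac)
    qed
    also have "\<dots> = (\<Sum>y\<in>B. (b y)\<^sup>2 * (\<Sum>x\<in>A. K x y))"
      by (subst sum.swap) (simp add: sum_distrib_left)
    also have "\<dots> \<le> (\<Sum>y\<in>B. (b y)\<^sup>2 * M)" using assms by (intro sum_mono mult_left_mono) auto
    finally show "L2_set ?v (A\<times>B) \<le> sqrt (M * (\<Sum>y\<in>B. (b y)\<^sup>2))"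
      unfolding L2_set_def by (simp add: sum_distrib_left mult_ac)
  qed (auto simp: L2_set_nonneg intro!: mult_nonneg_nonneg sum_nonneg assms)
  also have "\<dots> = M * sqrt (\<Sum>x\<in>A. (a x)\<^sup>2) * sqrt (\<Sum>y\<in>B. (b y)\<^sup>2)"
    using assms(4) by (simp add: real_sqrt_mult mult_ac)
  finally show ?thesis .
qed

lemma norm_bform_le: "norm (bform A \<kappa> f g) \<le> (\<Sum>n'\<in>A. \<Sum>n\<in>A. norm (\<kappa> n' n) * norm (f n') * norm (g n))"
  unfolding bform_def by (rule order_trans[OF norm_sum] sum_mono)+ (simp add: norm_mult)

lemma op_le_schur:
  assumes "\<And>n' A. finite A \<Longrightarrow> (\<Sum>n\<in>A. norm (\<kappa> n' n)) \<le> M" "\<And>n A. finite A \<Longrightarrow> (\<Sum>n'\<in>A. norm (\<kappa> n' n)) \<le> M"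
  shows "op_le \<kappa> M"
  unfolding op_le_def
proof (intro allI impI)
  fix A :: "int set" and f g :: "int \<Rightarrow> complex" assume A: "finite A"
  have "M \<ge> 0" using assms(1)[of "{}"] by simp
  then show "norm (bform A \<kappa> f g) \<le> M * sqrt (\<Sum>n\<in>A. (norm (f n))\<^sup>2) * sqrt (\<Sum>n\<in>A. (norm (g n))\<^sup>2)"
    using schur_test_real[OF A A, of "\<lambda>n' n. norm (\<kappa> n' n)" M "\<lambda>n. norm (f n)" "\<lambda>n. norm (g n)"] assms A
      norm_bform_le[of A \<kappa> f g] by fastforce
qed

text \<open>The \<open>T\<^sup>* T\<close> method. The square of the norm of \<open>T f\<close> is the form of \<open>f\<close> with kernel
  \<open>\<Sum>m. c (m + h) * cnj (c m)\<close>, where \<open>h = n'' - n'\<close>, and Schur's test bounds it by the sum of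
  these autocorrelations over \<open>h\<close>.\<close>

lemma op_le_convolution:
  fixes c :: "int \<Rightarrow> complex"
  assumes W: "finite W" "\<And>m. m \<notin> W \<Longrightarrow> c m = 0" and "\<nu> \<ge> 0"
    and S: "\<And>H. finite H \<Longrightarrow> (\<Sum>h\<in>H. norm (\<Sum>m\<in>W. c (m + h) * cnj (c m))) \<le> \<nu>\<^sup>2"
  shows "op_le (\<lambda>n' n. c (n - n')) \<nu>"
  unfolding op_le_def
proof (intro allI impI)
  fix A :: "int set" and f g :: "int \<Rightarrow> complex" assume A: "finite A"
  define S where "S h = (\<Sum>m\<in>W. c (m + h) * cnj (c m))" for h
  define u where "u n = (\<Sum>n'\<in>A. c (n - n') * f n')" for n
  \<comment> \<open>\<open>V\<close> contains the support of \<open>u\<close>, so that the autocorrelations are complete sums\<close>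
  define V where "V = A \<union> (\<lambda>(n',m). n' + m) ` (A \<times> W)"
  have fV: "finite V" using A W by (simp add: V_def)
  have inner: "(\<Sum>n\<in>V. c (n - n') * cnj (c (n - n''))) = S (n'' - n')" if "n'' \<in> A" for n' n''
  proof -
    have "S (n'' - n') = (\<Sum>n\<in>(\<lambda>m. m + n'') ` W. c (n - n') * cnj (c (n - n'')))"
      by (subst sum.reindex) (auto simp: S_def algebra_simps)
    also have "\<dots> = (\<Sum>n\<in>V. c (n - n') * cnj (c (n - n'')))"
    proof (rule sum.mono_neutral_left[OF fV])
      show "(\<lambda>m. m + n'') ` W \<subseteq> V"
      proof clarify
        fix m assume "m \<in> W"
        then have "(n'', m) \<in> A \<times> W" using that by simp
        then have "(\<lambda>(n',m). n' + m) (n'', m) \<in> V" unfolding V_def by blast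
        then show "m + n'' \<in> V" by (simp add: add.commute)
      qed
      show "\<forall>i\<in>V - (\<lambda>m. m + n'') ` W. c (i - n') * cnj (c (i - n'')) = 0"
      proof
        fix i assume "i \<in> V - (\<lambda>m. m + n'') ` W"
        then have "i - n'' \<notin> W" by (auto simp: image_iff)
        then show "c (i - n') * cnj (c (i - n'')) = 0" using W by simp
      qed
    qed
    finally show ?thesis by simp
  qed
  have "complex_of_real (\<Sum>n\<in>V. (norm (u n))\<^sup>2) = (\<Sum>n\<in>V. u n * cnj (u n))"
    by (simp add: complex_norm_square del: of_real_power flip: of_real_power)
  also have "\<dots> = (\<Sum>n\<in>V. \<Sum>n'\<in>A. \<Sum>n''\<in>A. f n' * cnj (f n'') * (c (n - n') * cnj (c (n - n''))))"
    unfolding u_def cnj_sum sum_product by (simp add: mult_ac)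
  also have "\<dots> = (\<Sum>n'\<in>A. \<Sum>n''\<in>A. \<Sum>n\<in>V. f n' * cnj (f n'') * (c (n - n') * cnj (c (n - n''))))"
  proof -
    have "(\<Sum>n\<in>V. \<Sum>n'\<in>A. h n n') = (\<Sum>n'\<in>A. \<Sum>n\<in>V. h n n')" for h :: "int \<Rightarrow> int \<Rightarrow> complex" by (rule sum.swap)
    then show ?thesis by simp
  qed
  also have "\<dots> = (\<Sum>n'\<in>A. \<Sum>n''\<in>A. f n' * cnj (f n'') * S (n'' - n'))"
    by (intro sum.cong refl) (simp add: inner flip: sum_distrib_left)
  finally have "norm (complex_of_real (\<Sum>n\<in>V. (norm (u n))\<^sup>2)) = norm (\<Sum>n'\<in>A. \<Sum>n''\<in>A. f n' * cnj (f n'') * S (n'' - n'))"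
    by (rule arg_cong)
  then have "(\<Sum>n\<in>V. (norm (u n))\<^sup>2) = norm (\<Sum>n'\<in>A. \<Sum>n''\<in>A. f n' * cnj (f n'') * S (n'' - n'))"
    by (simp only: norm_of_real abs_of_nonneg[OF sum_nonneg[OF zero_le_power2]])
  also have "\<dots> \<le> (\<Sum>n'\<in>A. \<Sum>n''\<in>A. norm (S (n'' - n')) * \<bar>norm (f n')\<bar> * \<bar>norm (f n'')\<bar>)"
    by (rule order_trans[OF norm_sum] sum_mono)+ (simp add: norm_mult)
  also have "\<dots> \<le> \<nu>\<^sup>2 * sqrt (\<Sum>x\<in>A. (norm (f x))\<^sup>2) * sqrt (\<Sum>x\<in>A. (norm (f x))\<^sup>2)"
  proof (rule schur_test_real[OF A A])
    fix x
    have "(\<Sum>y\<in>A. norm (S (y - x))) = (\<Sum>h\<in>(\<lambda>y. y - x) ` A. norm (S h))"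
      by (subst sum.reindex) (auto simp: inj_on_def)
    then show "(\<Sum>y\<in>A. norm (S (y - x))) \<le> \<nu>\<^sup>2" using assms(4) A by (simp add: S_def)
    have "(\<Sum>y\<in>A. norm (S (x - y))) = (\<Sum>h\<in>(\<lambda>y. x - y) ` A. norm (S h))"
      by (subst sum.reindex) (auto simp: inj_on_def)
    then show "(\<Sum>y\<in>A. norm (S (x - y))) \<le> \<nu>\<^sup>2" using assms(4) A by (simp add: S_def)
  qed auto
  also have "\<dots> = \<nu>\<^sup>2 * (\<Sum>x\<in>A. (norm (f x))\<^sup>2)" by (simp add: mult.assoc sum_nonneg)
  finally have u2: "(\<Sum>n\<in>V. (norm (u n))\<^sup>2) \<le> \<nu>\<^sup>2 * (\<Sum>x\<in>A. (norm (f x))\<^sup>2)" .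
  have "bform A (\<lambda>n' n. c (n - n')) f g = (\<Sum>n\<in>A. u n * cnj (g n))"
    unfolding bform_def u_def by (subst sum.swap) (simp add: sum_distrib_right)
  then have "norm (bform A (\<lambda>n' n. c (n - n')) f g) \<le> (\<Sum>n\<in>A. \<bar>norm (u n)\<bar> * \<bar>norm (g n)\<bar>)"
    using norm_sum[of "\<lambda>n. u n * cnj (g n)" A] by (simp add: norm_mult)
  also have "\<dots> \<le> sqrt (\<Sum>n\<in>A. (norm (u n))\<^sup>2) * sqrt (\<Sum>n\<in>A. (norm (g n))\<^sup>2)"
    using L2_set_mult_ineq[of "\<lambda>n. norm (u n)" "\<lambda>n. norm (g n)" A] by (simp add: L2_set_def)
  also have "\<dots> \<le> sqrt (\<nu>\<^sup>2 * (\<Sum>x\<in>A. (norm (f x))\<^sup>2)) * sqrt (\<Sum>n\<in>A. (norm (g n))\<^sup>2)"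
  proof (intro mult_right_mono real_sqrt_le_mono)
    have "(\<Sum>n\<in>A. (norm (u n))\<^sup>2) \<le> (\<Sum>n\<in>V. (norm (u n))\<^sup>2)"
      using fV by (intro sum_mono2) (auto simp: V_def)
    then show "(\<Sum>n\<in>A. (norm (u n))\<^sup>2) \<le> \<nu>\<^sup>2 * (\<Sum>x\<in>A. (norm (f x))\<^sup>2)" using u2 by simp
  qed (simp add: sum_nonneg)
  finally show "norm (bform A (\<lambda>n' n. c (n - n')) f g) \<le>
      \<nu> * sqrt (\<Sum>n\<in>A. (norm (f n))\<^sup>2) * sqrt (\<Sum>n\<in>A. (norm (g n))\<^sup>2)"
    using \<open>\<nu> \<ge> 0\<close> by (simp add: real_sqrt_mult)
qed

lemma powr_three_halves:
  fixes t :: real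
  assumes "t \<ge> 0"
  shows "t powr (3/2) = t * sqrt t"
proof (cases "t = 0")
  case False
  have "t powr (3/2) = t powr (1 + 1/2)" by simp
  also have "\<dots> = t powr 1 * t powr (1/2)" by (rule powr_add)
  finally show ?thesis using assms False by (simp add: powr_half_sqrt)
qed simp

lemma avg_three_halves:
  assumes "finite R" "R \<noteq> {}"
  shows "(\<Sum>x\<in>R. norm (f x) * sqrt (norm (f x))) = real (card R) * (avg R (3/2) f * sqrt (avg R (3/2) f))"
  using avg_powr_eq[OF assms, of "3/2" f] by (simp add: powr_three_halves avg_nonneg)

text \<open>Above the level \<open>T * a\<close> one has \<open>\<bar>f\<bar> \<le> \<bar>f\<bar> powr (3/2) / sqrt (T * a)\<close>.\<close>

lemma sum_high_part_le:
  fixes f :: "int \<Rightarrow> complex"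
  assumes "finite R" "R \<noteq> {}" "T > 0"
  defines "a \<equiv> avg R (3/2) f"
  shows "(\<Sum>x\<in>{x\<in>R. norm (f x) > T * a}. norm (f x)) \<le> a * real (card R) / sqrt T"
proof (cases "a = 0")
  case True
  then have "(\<Sum>x\<in>R. norm (f x) * sqrt (norm (f x))) = 0"
    using avg_three_halves[OF assms(1,2), of f] by (simp add: a_def)
  then have "\<forall>x\<in>R. norm (f x) * sqrt (norm (f x)) = 0" using assms by (subst (asm) sum_nonneg_eq_0_iff) auto
  then have "(\<Sum>x\<in>{x\<in>R. norm (f x) > T * a}. norm (f x)) = 0" by (intro sum.neutral) auto
  then show ?thesis using True by simp
next
  case False
  then have a: "a > 0" using avg_nonneg[of R "3/2" f] by (simp add: a_def)
  have "sqrt (T * a) * (\<Sum>x\<in>{x\<in>R. norm (f x) > T * a}. norm (f x)) =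
      (\<Sum>x\<in>{x\<in>R. norm (f x) > T * a}. norm (f x) * sqrt (T * a))"
    by (simp add: sum_distrib_left mult.commute)
  also have "\<dots> \<le> (\<Sum>x\<in>{x\<in>R. norm (f x) > T * a}. norm (f x) * sqrt (norm (f x)))"
    by (intro sum_mono mult_left_mono) auto
  also have "\<dots> \<le> (\<Sum>x\<in>R. norm (f x) * sqrt (norm (f x)))"
    using assms by (intro sum_mono2) auto
  also have "\<dots> = sqrt a * (real (card R) * a)" using avg_three_halves[OF assms(1,2), of f] by (simp add: a_def)
  finally have "sqrt a * (sqrt T * (\<Sum>x\<in>{x\<in>R. norm (f x) > T * a}. norm (f x))) \<le> sqrt a * (real (card R) * a)"
    by (simp add: real_sqrt_mult mult_ac)
  then show ?thesis using a assms by (simp add: field_simps)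
qed

text \<open>Below the level \<open>T * a\<close> one has \<open>\<bar>f\<bar>\<^sup>2 \<le> sqrt (T * a) * \<bar>f\<bar> powr (3/2)\<close>.\<close>

lemma sum_low_part_le:
  fixes f :: "int \<Rightarrow> complex"
  assumes "finite R" "R \<noteq> {}" "T > 0"
  defines "a \<equiv> avg R (3/2) f"
  shows "(\<Sum>x\<in>{x\<in>R. norm (f x) \<le> T * a}. (norm (f x))\<^sup>2) \<le> sqrt T * a\<^sup>2 * real (card R)"
proof -
  have a: "a \<ge> 0" by (simp add: a_def avg_nonneg)
  have "(\<Sum>x\<in>{x\<in>R. norm (f x) \<le> T * a}. (norm (f x))\<^sup>2) \<le>
    (\<Sum>x\<in>{x\<in>R. norm (f x) \<le> T * a}. norm (f x) * sqrt (norm (f x)) * sqrt (T * a))"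
  proof (rule sum_mono)
    fix x assume "x \<in> {x\<in>R. norm (f x) \<le> T * a}"
    then have "(norm (f x) * sqrt (norm (f x))) * sqrt (norm (f x)) \<le> norm (f x) * sqrt (norm (f x)) * sqrt (T * a)"
      by (intro mult_left_mono) auto
    then show "(norm (f x))\<^sup>2 \<le> norm (f x) * sqrt (norm (f x)) * sqrt (T * a)"
      by (simp add: mult.assoc power2_eq_square)
  qed
  also have "\<dots> \<le> (\<Sum>x\<in>R. norm (f x) * sqrt (norm (f x)) * sqrt (T * a))"
    using assms a by (intro sum_mono2) auto
  also have "\<dots> = (real (card R) * (a * sqrt a)) * sqrt (T * a)"
    using avg_three_halves[OF assms(1,2), of f] by (simp add: a_def flip: sum_distrib_right)
  also have "\<dots> = sqrt T * a\<^sup>2 * real (card R)" using a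
    by (simp add: real_sqrt_mult power2_eq_square)
  finally show ?thesis .
qed

lemma sum_norm_le_avg:
  fixes f :: "int \<Rightarrow> complex"
  assumes "finite R" "R \<noteq> {}"
  shows "(\<Sum>x\<in>R. norm (f x)) \<le> 2 * avg R (3/2) f * real (card R)"
proof -
  let ?a = "avg R (3/2) f"
  have "(\<Sum>x\<in>R. norm (f x)) \<le> (\<Sum>x\<in>R. ?a + (if norm (f x) > 1 * ?a then norm (f x) else 0))"
    by (intro sum_mono) (auto simp: avg_nonneg)
  also have "\<dots> = real (card R) * ?a + (\<Sum>x\<in>{x\<in>R. norm (f x) > 1 * ?a}. norm (f x))"
    using assms by (simp add: sum.distrib sum.inter_filter)
  also have "\<dots> \<le> real (card R) * ?a + ?a * real (card R) / sqrt 1"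
    by (intro add_left_mono sum_high_part_le assms) auto
  finally show ?thesis by (simp add: mult_ac)
qed

text \<open>Cut \<open>f\<close> and \<open>g\<close> at \<open>1/\<nu>\<close> times their averages. The low parts are handled on \<open>\<ell>\<^sup>2\<close> and give
  \<open>\<nu> * sqrt (1/\<nu>) = sqrt \<nu>\<close>. A high part has \<open>\<ell>\<^sup>1\<close> mass smaller by the same factor \<open>sqrt \<nu>\<close>
  and is paired with the pointwise bound of the kernel.\<close>

lemma bform_local_interpolation:
  assumes R: "finite R" "R \<noteq> {}" and b: "\<And>n' n. norm (\<kappa> n' n) \<le> b" and op: "op_le \<kappa> \<nu>" and \<nu>: "\<nu> > 0"
  shows "norm (bform R \<kappa> f g) \<le> sqrt \<nu> * real (card R) * (1 + 4 * b * real (card R)) * (avg R (3/2) f * avg R (3/2) g)"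
proof -
  define a where "a = avg R (3/2) f"
  define a' where "a' = avg R (3/2) g"
  \<comment> \<open>the truncation level that balances the \<open>\<ell>\<^sup>1\<close> and the \<open>\<ell>\<^sup>2\<close> contributions\<close>
  define T where "T = 1 / \<nu>"
  have T: "T > 0" using \<nu> by (simp add: T_def)
  have a: "a \<ge> 0" "a' \<ge> 0" by (simp_all add: a_def a'_def avg_nonneg)
  define fl where "fl x = (if norm (f x) \<le> T * a then f x else 0)" for x
  define fh where "fh x = (if norm (f x) > T * a then f x else 0)" for x
  define gl where "gl x = (if norm (g x) \<le> T * a' then g x else 0)" for x
  define gh where "gh x = (if norm (g x) > T * a' then g x else 0)" for x
  have f: "f = (\<lambda>x. fl x + fh x)" and g: "g = (\<lambda>x. gl x + gh x)"
    by (auto simp: fl_def fh_def gl_def gh_def)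
  have triv: "norm (bform R \<kappa> u v) \<le> b * (\<Sum>x\<in>R. norm (u x)) * (\<Sum>x\<in>R. norm (v x))" for u v
  proof -
    have "norm (bform R \<kappa> u v) \<le> (\<Sum>n'\<in>R. \<Sum>n\<in>R. norm (\<kappa> n' n) * norm (u n') * norm (v n))" by (rule norm_bform_le)
    also have "\<dots> \<le> (\<Sum>n'\<in>R. \<Sum>n\<in>R. b * norm (u n') * norm (v n))"
      by (intro sum_mono mult_right_mono b) auto
    also have "\<dots> = b * (\<Sum>x\<in>R. norm (u x)) * (\<Sum>x\<in>R. norm (v x))"
      unfolding mult.assoc sum_product by (simp only: sum_distrib_left)
    finally show ?thesis .
  qed
  have b0: "b \<ge> 0" using b norm_ge_zero order_trans by blast
  have fh1: "(\<Sum>x\<in>R. norm (fh x)) \<le> a * real (card R) / sqrt T"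
    using sum_high_part_le[OF R T, of f] by (simp add: fh_def a_def if_distrib sum.inter_filter R cong: if_cong)
  have gh1: "(\<Sum>x\<in>R. norm (gh x)) \<le> a' * real (card R) / sqrt T"
    using sum_high_part_le[OF R T, of g] by (simp add: gh_def a'_def if_distrib sum.inter_filter R cong: if_cong)
  have fl2: "(\<Sum>x\<in>R. (norm (fl x))\<^sup>2) \<le> sqrt T * a\<^sup>2 * real (card R)"
    using sum_low_part_le[OF R T, of f] by (simp add: fl_def a_def if_distrib[of "\<lambda>z. (norm z)\<^sup>2"] sum.inter_filter R cong: if_cong)
  have gl2: "(\<Sum>x\<in>R. (norm (gl x))\<^sup>2) \<le> sqrt T * a'\<^sup>2 * real (card R)"
    using sum_low_part_le[OF R T, of g] by (simp add: gl_def a'_def if_distrib[of "\<lambda>z. (norm z)\<^sup>2"] sum.inter_filter R cong: if_cong)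
  have f1: "(\<Sum>x\<in>R. norm (fl x)) \<le> 2 * a * real (card R)"
    by (rule order_trans[OF sum_mono sum_norm_le_avg[OF R, of f, folded a_def]]) (simp add: fl_def)
  have g1: "(\<Sum>x\<in>R. norm (g x)) \<le> 2 * a' * real (card R)"
    by (rule sum_norm_le_avg[OF R, of g, folded a'_def])
  have e1: "norm (bform R \<kappa> fl gl) \<le> sqrt \<nu> * real (card R) * (a * a')"
  proof -
    have "norm (bform R \<kappa> fl gl) \<le> \<nu> * sqrt (\<Sum>n\<in>R. (norm (fl n))\<^sup>2) * sqrt (\<Sum>n\<in>R. (norm (gl n))\<^sup>2)"
      by (rule op_leD[OF op R(1)])
    also have "\<dots> \<le> \<nu> * sqrt (sqrt T * a\<^sup>2 * real (card R)) * sqrt (sqrt T * a'\<^sup>2 * real (card R))"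
      using \<nu> by (intro mult_mono real_sqrt_le_mono fl2 gl2 mult_nonneg_nonneg) (use T in \<open>auto simp: sum_nonneg\<close>)
    also have "sqrt (sqrt T * a\<^sup>2 * real (card R)) = sqrt (sqrt T) * a * sqrt (real (card R))"
      using a by (simp add: real_sqrt_mult)
    also have "sqrt (sqrt T * a'\<^sup>2 * real (card R)) = sqrt (sqrt T) * a' * sqrt (real (card R))"
      using a by (simp add: real_sqrt_mult)
    also have "\<nu> * (sqrt (sqrt T) * a * sqrt (real (card R))) * (sqrt (sqrt T) * a' * sqrt (real (card R))) =
        \<nu> * (sqrt (sqrt T) * sqrt (sqrt T)) * (a * a') * (sqrt (real (card R)) * sqrt (real (card R)))"
      by (simp only: mult_ac)
    also have "\<dots> = \<nu> * sqrt T * (a * a') * real (card R)" using T by (simp del: mult_cancel_left mult_cancel_right)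
    also have "\<nu> * sqrt T = sqrt \<nu>" using \<nu> by (simp add: T_def real_sqrt_divide real_div_sqrt)
    finally show ?thesis by (simp add: mult_ac)
  qed
  have sT: "1 / sqrt T = sqrt \<nu>" using \<nu> by (simp add: T_def real_sqrt_divide)
  have e2: "norm (bform R \<kappa> fh g) \<le> sqrt \<nu> * real (card R) * (2 * b * real (card R)) * (a * a')"
  proof -
    have "norm (bform R \<kappa> fh g) \<le> b * (a * real (card R) / sqrt T) * (2 * a' * real (card R))"
      by (rule order_trans[OF triv]) (intro mult_mono mult_nonneg_nonneg b0 fh1 g1 sum_nonneg divide_nonneg_nonneg; use a T in simp)
    also have "\<dots> = (1 / sqrt T) * real (card R) * (2 * b * real (card R)) * (a * a')" by simp
    finally show ?thesis by (simp only: sT)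
  qed
  have e3: "norm (bform R \<kappa> fl gh) \<le> sqrt \<nu> * real (card R) * (2 * b * real (card R)) * (a * a')"
  proof -
    have "norm (bform R \<kappa> fl gh) \<le> b * (2 * a * real (card R)) * (a' * real (card R) / sqrt T)"
      by (rule order_trans[OF triv]) (intro mult_mono mult_nonneg_nonneg b0 gh1 f1 sum_nonneg divide_nonneg_nonneg; use a T in simp)
    also have "\<dots> = (1 / sqrt T) * real (card R) * (2 * b * real (card R)) * (a * a')" by simp
    finally show ?thesis by (simp only: sT)
  qed
  have "bform R \<kappa> f g = bform R \<kappa> fl gl + bform R \<kappa> fl gh + bform R \<kappa> fh g"
  proof -
    have "bform R \<kappa> f g = bform R \<kappa> fl g + bform R \<kappa> fh g" by (subst f) (rule bform_add_left)
    also have "bform R \<kappa> fl g = bform R \<kappa> fl gl + bform R \<kappa> fl gh" by (subst g) (rule bform_add_right)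
    finally show ?thesis .
  qed
  then have "norm (bform R \<kappa> f g) \<le> norm (bform R \<kappa> fl gl) + norm (bform R \<kappa> fl gh) + norm (bform R \<kappa> fh g)"
    by (metis norm_triangle_ineq norm_triangle_mono order_refl)
  also have "\<dots> \<le> sqrt \<nu> * real (card R) * (1 + 4 * b * real (card R)) * (a * a')"
    using e1 e2 e3 by (simp add: algebra_simps)
  finally show ?thesis by (simp add: a_def a'_def)
qed

text \<open>Consecutive blocks of length \<open>N\<close> are disjoint.\<close>

lemma sum_blocks_le:
  fixes M :: "int \<Rightarrow> real" and N :: int
  assumes "N > 0" "finite U" "\<And>X. finite X \<Longrightarrow> sum M X \<le> Z"
  shows "(\<Sum>u\<in>U. \<Sum>x\<in>{N * u..<N * (u + 1)}. M x) \<le> Z"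
proof -
  have dv: "x div N = u" if "x \<in> {N * u..<N * (u + 1)}" for x u
  proof -
    have "x = N * u + (x - N * u)" "0 \<le> x - N * u" "x - N * u < N" using that by (auto simp: algebra_simps)
    then show ?thesis using assms(1) by (metis div_mult_self4 div_pos_pos_trivial add.commute add.right_neutral less_irrefl mult.commute)
  qed
  have "(\<Sum>u\<in>U. \<Sum>x\<in>{N * u..<N * (u + 1)}. M x) = sum M (\<Union>u\<in>U. {N * u..<N * (u + 1)})"
  proof (rule sum.UNION_disjoint[symmetric])
    show "\<forall>i\<in>U. \<forall>j\<in>U. i \<noteq> j \<longrightarrow> {N * i..<N * (i + 1)} \<inter> {N * j..<N * (j + 1)} = {}"
      using dv by blast
  qed (use assms(2) in auto)
  also have "\<dots> \<le> Z" using assms by (intro assms(3)) auto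
  finally show ?thesis .
qed

text \<open>Cut \<open>f\<close> into blocks of length \<open>N\<close>. The kernel sees only the window of nine blocks around
  each, and the product of the averages over the window is at most \<open>maxprod f g\<close> at every
  point of the block.\<close>

lemma single_scale_bound:
  fixes N :: int
  assumes N: "N > 0" and supp: "\<And>n' n. \<kappa> n' n \<noteq> 0 \<Longrightarrow> \<bar>n - n'\<bar> \<le> 4 * N"
    and b: "\<And>n' n. norm (\<kappa> n' n) \<le> D / of_int N" and op: "op_le \<kappa> \<nu>" and \<nu>: "\<nu> > 0" and A: "finite A"
    and fg: "finitely_supported f" "finitely_supported g"
    and Z: "\<And>X. finite X \<Longrightarrow> (\<Sum>x\<in>X. maxprod f g x) \<le> Z"
  shows "norm (bform A \<kappa> f g) \<le> 9 * (1 + 36 * D) * sqrt \<nu> * Z"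
proof -
  have D0: "D \<ge> 0"
  proof -
    have "0 \<le> D / of_int N" using b norm_ge_zero order_trans by blast
    then show ?thesis using N by (simp add: zero_le_divide_iff)
  qed
  define U where "U = (\<lambda>x. x div N) ` A"
  have fU: "finite U" using A by (simp add: U_def)
  define I where "I u = {N * u..<N * (u + 1)}" for u
  \<comment> \<open>range \<open>4 * N\<close> on either side of a block of length \<open>N\<close>\<close>
  define R where "R u = {N * (u - 4)..<N * (u + 5)}" for u
  define fu where "fu u x = (if x \<in> A \<and> x div N = u then f x else 0)" for u x
  define gA where "gA x = (if x \<in> A then g x else 0)" for x
  have blk: "x \<in> I (x div N)" for x
  proof -
    have "0 \<le> x mod N" "x mod N < N" using N by simp_all
    moreover have "N * (x div N) + x mod N = x" by simp
    ultimately have "N * (x div N) \<le> x" "x < N * (x div N) + N" by linarith+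
    then show ?thesis unfolding I_def by (simp add: distrib_left)
  qed
  have nbhd: "n \<in> R u" if "n' \<in> I u" "\<bar>n - n'\<bar> \<le> 4 * N" for n n' u
  proof -
    have "N * u \<le> n'" "n' < N * u + N" using that by (auto simp: I_def distrib_left)
    then have "N * u - 4 * N \<le> n" "n < N * u + 5 * N" using that by linarith+
    then show ?thesis by (simp add: R_def algebra_simps)
  qed
  have split: "bform A \<kappa> f g = (\<Sum>u\<in>U. bform (R u) \<kappa> (fu u) gA)"
  proof -
    have "bform A \<kappa> f g = (\<Sum>u\<in>U. \<Sum>n'\<in>{x\<in>A. x div N = u}. \<Sum>n\<in>A. \<kappa> n' n * f n' * cnj (g n))"
      unfolding bform_def by (rule sum.group[symmetric]) (use A fU in \<open>auto simp: U_def\<close>)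
    also have "\<dots> = (\<Sum>u\<in>U. bform (R u) \<kappa> (fu u) gA)"
    proof (rule sum.cong[OF refl])
      fix u assume "u \<in> U"
      have "bform (R u) \<kappa> (fu u) gA = (\<Sum>n'\<in>R u. \<Sum>n\<in>R u. \<kappa> n' n * fu u n' * cnj (gA n))" by (simp add: bform_def)
      also have "\<dots> = (\<Sum>n'\<in>{x\<in>A. x div N = u}. \<Sum>n\<in>R u. \<kappa> n' n * fu u n' * cnj (gA n))"
      proof (rule sum.mono_neutral_right)
        show "{x\<in>A. x div N = u} \<subseteq> R u" using nbhd[of _ u] blk N by fastforce
      qed (auto simp: R_def fu_def)
      also have "\<dots> = (\<Sum>n'\<in>{x\<in>A. x div N = u}. \<Sum>n\<in>A. \<kappa> n' n * f n' * cnj (g n))"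
      proof (rule sum.cong[OF refl])
        fix n' assume n': "n' \<in> {x\<in>A. x div N = u}"
        have bl: "n' \<in> I u" using blk[of n'] n' by auto
        have "(\<Sum>n\<in>R u. \<kappa> n' n * fu u n' * cnj (gA n)) = (\<Sum>n\<in>R u \<inter> A. \<kappa> n' n * fu u n' * cnj (gA n))"
          by (rule sum.mono_neutral_right) (auto simp: R_def gA_def)
        also have "\<dots> = (\<Sum>n\<in>R u \<inter> A. \<kappa> n' n * f n' * cnj (g n))"
          using n' by (intro sum.cong) (auto simp: fu_def gA_def)
        also have "\<dots> = (\<Sum>n\<in>A. \<kappa> n' n * f n' * cnj (g n))"
        proof (rule sum.mono_neutral_left[OF A])
          show "\<forall>n\<in>A - R u \<inter> A. \<kappa> n' n * f n' * cnj (g n) = 0"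
            using nbhd[OF bl] supp by fastforce
        qed auto
        finally show "(\<Sum>n\<in>R u. \<kappa> n' n * fu u n' * cnj (gA n)) = (\<Sum>n\<in>A. \<kappa> n' n * f n' * cnj (g n))" .
      qed
      finally show "(\<Sum>n'\<in>{x\<in>A. x div N = u}. \<Sum>n\<in>A. \<kappa> n' n * f n' * cnj (g n)) = bform (R u) \<kappa> (fu u) gA" by simp
    qed
    finally show ?thesis .
  qed
  have each: "norm (bform (R u) \<kappa> (fu u) gA) \<le> 9 * (1 + 36 * D) * sqrt \<nu> * (\<Sum>x\<in>I u. maxprod f g x)" for u
  proof -
    have Rne: "finite (R u)" "R u \<noteq> {}" using N by (auto simp: R_def algebra_simps)
    have cR: "real (card (R u)) = 9 * of_int N" using N by (simp add: R_def algebra_simps)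
    have Re: "R u = {N * (u - 4)..N * (u + 5) - 1}" by (auto simp: R_def)
    have "norm (bform (R u) \<kappa> (fu u) gA) \<le> sqrt \<nu> * real (card (R u)) * (1 + 4 * (D / of_int N) * real (card (R u))) * (avg (R u) (3/2) (fu u) * avg (R u) (3/2) gA)"
      by (rule bform_local_interpolation[OF Rne b op \<nu>])
    also have "\<dots> \<le> sqrt \<nu> * real (card (R u)) * (1 + 4 * (D / of_int N) * real (card (R u))) * (avg (R u) (3/2) f * avg (R u) (3/2) g)"
      using D0 N \<nu> by (intro mult_left_mono mult_mono avg_mono avg_nonneg mult_nonneg_nonneg add_nonneg_nonneg divide_nonneg_nonneg) (auto simp: fu_def gA_def)
    also have "\<dots> = 9 * (1 + 36 * D) * sqrt \<nu> * (of_int N * (avg (R u) (3/2) f * avg (R u) (3/2) g))"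
      using N unfolding cR by (simp add: field_simps)
    also have "\<dots> \<le> 9 * (1 + 36 * D) * sqrt \<nu> * (\<Sum>x\<in>I u. maxprod f g x)"
    proof (rule mult_left_mono)
      have "of_int N * (avg (R u) (3/2) f * avg (R u) (3/2) g) = (\<Sum>x\<in>I u. avg (R u) (3/2) f * avg (R u) (3/2) g)"
        using N by (simp add: I_def algebra_simps)
      also have "\<dots> \<le> (\<Sum>x\<in>I u. maxprod f g x)"
      proof (rule sum_mono)
        fix x assume "x \<in> I u"
        then have "x \<in> R u" using nbhd[of x u x] N by simp
        then show "avg (R u) (3/2) f * avg (R u) (3/2) g \<le> maxprod f g x"
          unfolding Re by (intro maxprod_upper fg) auto
      qed
      finally show "of_int N * (avg (R u) (3/2) f * avg (R u) (3/2) g) \<le> (\<Sum>x\<in>I u. maxprod f g x)" .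
    qed (use D0 \<nu> in auto)
    finally show ?thesis .
  qed
  have "norm (bform A \<kappa> f g) \<le> (\<Sum>u\<in>U. norm (bform (R u) \<kappa> (fu u) gA))"
    unfolding split by (rule norm_sum)
  also have "\<dots> \<le> (\<Sum>u\<in>U. 9 * (1 + 36 * D) * sqrt \<nu> * (\<Sum>x\<in>I u. maxprod f g x))"
    by (intro sum_mono each)
  also have "\<dots> = 9 * (1 + 36 * D) * sqrt \<nu> * (\<Sum>u\<in>U. \<Sum>x\<in>I u. maxprod f g x)"
    by (simp add: sum_distrib_left)
  also have "\<dots> \<le> 9 * (1 + 36 * D) * sqrt \<nu> * Z"
    using D0 \<nu> sum_blocks_le[OF N fU Z] by (intro mult_left_mono) (auto simp: I_def)
  finally show ?thesis .
qed

section \<open>Hilbert's inequality for vector-valued sequences\<close>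

lemma sum_symmetric_int:
  fixes \<phi> :: "int \<Rightarrow> real"
  shows "(\<Sum>j\<in>{-int R..int R}. \<phi> j) = \<phi> 0 + (\<Sum>j\<in>{1..R}. \<phi> (int j) + \<phi> (- int j))"
proof (induction R)
  case (Suc R)
  have "{-int (Suc R)..int (Suc R)} = insert (- int (Suc R)) (insert (int (Suc R)) {-int R..int R})" by auto
  then have "(\<Sum>j\<in>{-int (Suc R)..int (Suc R)}. \<phi> j) = \<phi> (- int (Suc R)) + (\<phi> (int (Suc R)) + (\<Sum>j\<in>{-int R..int R}. \<phi> j))"
    by (simp only:) (subst sum.insert; simp)+
  then show ?case using Suc by simp
qed simp

lemma sum_inverse_squares_nat: "(\<Sum>j\<in>{1..n}. 1 / (real j)\<^sup>2) \<le> 2"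
proof (cases "n \<ge> 1")
  case True
  then have "(\<Sum>j\<in>{1..n}. 1 / (real j)\<^sup>2) \<le> 2 - 1 / real n"
  proof (induction n rule: dec_induct)
    case (step n)
    have "1 / (real (Suc n))\<^sup>2 \<le> 1 / real n - 1 / real (Suc n)"
    proof -
      have "1 / (real (Suc n))\<^sup>2 \<le> 1 / (real n * real (Suc n))"
        using step by (intro divide_left_mono) (auto simp: power2_eq_square)
      also have "\<dots> = 1 / real n - 1 / real (Suc n)" using step by (simp add: field_simps)
      finally show ?thesis .
    qed
    then show ?case using step by simp
  qed simp
  also have "\<dots> \<le> 2" by simp
  finally show ?thesis .
qed simp

lemma int_finite_symmetric_cover:
  assumes "finite (A :: int set)"
  obtains R where "A \<subseteq> {-int R..int R}"
proof -
  obtain k where k: "\<forall>a\<in>abs ` A. a \<le> k"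
    using assms by (metis bdd_above_finite bdd_above.E finite_imageI)
  have "A \<subseteq> {-int (nat k)..int (nat k)}" using k by fastforce
  then show ?thesis using that by blast
qed

lemma sum_inverse_squares_int:
  assumes "finite A"
  shows "(\<Sum>j\<in>A. (1 / real_of_int j)\<^sup>2) \<le> 4"
proof -
  obtain R where R: "A \<subseteq> {-int R..int R}" using int_finite_symmetric_cover[OF assms] by blast
  have "(\<Sum>j\<in>A. (1 / real_of_int j)\<^sup>2) \<le> (\<Sum>j\<in>{-int R..int R}. (1 / real_of_int j)\<^sup>2)"
    using R by (intro sum_mono2) auto
  also have "\<dots> = 2 * (\<Sum>j\<in>{1..R}. 1 / (real j)\<^sup>2)"
    unfolding sum_symmetric_int by (simp add: power_divide sum_distrib_left)
  also have "\<dots> \<le> 2 * 2" using sum_inverse_squares_nat[of R] by (intro mult_left_mono) auto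
  finally show ?thesis by simp
qed

text \<open>The symmetric partial sums vanish for \<open>m = 0\<close>, where \<open>1/0 = 0\<close> removes the singularity.
  Shifting by one changes them only by boundary terms of size \<open>O(1/R)\<close>.\<close>

lemma shifted_harmonic_tendsto_0:
  "(\<lambda>R. \<Sum>n\<in>{-int R..int R}. 1 / real_of_int (n - m)) \<longlonglongrightarrow> 0"
proof -
  define h where "h m R = (\<Sum>n\<in>{-int R..int R}. 1 / real_of_int (n - m))" for m R
  have h0: "h 0 R = 0" for R unfolding h_def sum_symmetric_int by simp
  have neg: "h (- m) R = - h m R" for m R
  proof -
    have "h (- m) R = (\<Sum>n\<in>uminus ` {-int R..int R}. 1 / real_of_int (n + m))" by (simp add: h_def)
    also have "\<dots> = (\<Sum>n\<in>{-int R..int R}. 1 / real_of_int (- n + m))" by (subst sum.reindex) (auto simp: inj_on_def)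
    also have "\<dots> = (\<Sum>n\<in>{-int R..int R}. - (1 / real_of_int (n - m)))"
    proof (rule sum.cong[OF refl])
      fix n
      have "real_of_int (- n + m) = - real_of_int (n - m)" by simp
      then show "1 / real_of_int (- n + m) = - (1 / real_of_int (n - m))" by (simp only: divide_minus_right)
    qed
    finally show ?thesis by (simp add: h_def sum_negf)
  qed
  have step: "h (m + 1) R = h m R - 1 / (real R - real_of_int m) - 1 / (real R + real_of_int m + 1)" for m R
  proof -
    have "h (m + 1) R = (\<Sum>n\<in>{-int R..int R}. 1 / real_of_int ((n - 1) - m))" by (simp add: h_def algebra_simps)
    also have "\<dots> = (\<Sum>n\<in>(\<lambda>n. n - 1) ` {-int R..int R}. 1 / real_of_int (n - m))"
      by (subst sum.reindex) (auto simp: inj_on_def)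
    also have "(\<lambda>n. n - 1) ` {-int R..int R} = {-int R - 1..int R - 1}" by simp
    also have "(\<Sum>n\<in>{-int R - 1..int R - 1}. 1 / real_of_int (n - m)) =
        1 / real_of_int (- int R - 1 - m) + (\<Sum>n\<in>{-int R..int R - 1}. 1 / real_of_int (n - m))"
    proof -
      have "{-int R - 1..int R - 1} = insert (-int R - 1) {-int R..int R - 1}" by auto
      then show ?thesis by simp
    qed
    also have "(\<Sum>n\<in>{-int R..int R - 1}. 1 / real_of_int (n - m)) = h m R - 1 / real_of_int (int R - m)"
    proof -
      have "{-int R..int R} = insert (int R) {-int R..int R - 1}" by auto
      then show ?thesis by (simp add: h_def)
    qed
    also have "1 / real_of_int (- int R - 1 - m) = - (1 / (real R + real_of_int m + 1))"
    proof -
      have "real_of_int (- int R - 1 - m) = - (real R + real_of_int m + 1)" by simp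
      then show ?thesis by (simp only: divide_minus_right)
    qed
    finally show ?thesis by simp
  qed
  have inv: "(\<lambda>R. 1 / (real R + c)) \<longlonglongrightarrow> 0" for c :: real
    using tendsto_divide_0[OF tendsto_const filterlim_at_top_imp_at_infinity[OF
        filterlim_tendsto_add_at_top[OF tendsto_const filterlim_real_sequentially]], of 1 c]
    by (simp add: add.commute)
  have pos: "h (int k) \<longlonglongrightarrow> 0" for k :: nat
  proof (induction k)
    case 0 then show ?case using h0 by simp
  next
    case (Suc k)
    have "(\<lambda>R. h (int k) R - 1 / (real R + (- real k)) - 1 / (real R + (real k + 1))) \<longlonglongrightarrow> 0 - 0 - 0"
      by (intro tendsto_diff Suc inv)
    moreover have "h (int (Suc k)) = (\<lambda>R. h (int k) R - 1 / (real R + (- real k)) - 1 / (real R + (real k + 1)))"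
    proof
      fix R
      have "int (Suc k) = int k + 1" by simp
      then show "h (int (Suc k)) R = h (int k) R - 1 / (real R + (- real k)) - 1 / (real R + (real k + 1))"
        using step[of "int k" R] by (simp only: of_int_of_nat_eq) (simp add: add.assoc)
    qed
    ultimately show ?case by simp
  qed
  have "h m \<longlonglongrightarrow> 0"
  proof (cases "m \<ge> 0")
    case True then show ?thesis using pos[of "nat m"] by simp
  next
    case False
    then have "(\<lambda>R. - h (int (nat (-m))) R) \<longlonglongrightarrow> - 0" by (intro tendsto_minus pos)
    moreover have "- h (int (nat (-m))) R = h m R" for R using False neg[of "-m" R] by simp
    ultimately show ?thesis by simp
  qed
  moreover have "h m = (\<lambda>R. \<Sum>n\<in>{-int R..int R}. 1 / real_of_int (n - m))" by (simp add: h_def fun_eq_iff)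
  ultimately show ?thesis by simp
qed

text \<open>Partial fractions turn the sum into a difference of two shifted harmonic sums, which
  vanishes in the limit. At \<open>n = m\<close> and \<open>n = m'\<close>, where \<open>1/0 = 0\<close> makes the product 0, the
  identity needs the correction \<open>(1/(m - m'))\<^sup>2\<close>, and the two corrections are the limit.\<close>

lemma hilbert_gram_tendsto:
  assumes "m \<noteq> (m'::int)"
  shows "(\<lambda>R. \<Sum>n\<in>{-int R..int R}. 1 / real_of_int (n - m) * (1 / real_of_int (n - m'))) \<longlonglongrightarrow> 2 * (1 / real_of_int (m - m'))\<^sup>2"
proof -
  let ?h = "\<lambda>m R. \<Sum>n\<in>{-int R..int R}. 1 / real_of_int (n - m)"
  let ?d = "1 / real_of_int (m - m')"
  have pt: "1 / real_of_int (n - m) * (1 / real_of_int (n - m')) =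
      ?d * (1 / real_of_int (n - m) - 1 / real_of_int (n - m')) + (if n = m then ?d\<^sup>2 else 0) + (if n = m' then ?d\<^sup>2 else 0)" for n
  proof -
    consider "n = m" | "n = m'" | "n \<noteq> m" "n \<noteq> m'" by blast
    then show ?thesis
    proof cases
      case 1 then show ?thesis using assms by (simp add: power2_eq_square)
    next
      case 2
      have "real_of_int (m' - m) = - real_of_int (m - m')" by simp
      then have "1 / real_of_int (m' - m) = - ?d" by (simp only: divide_minus_right)
      then show ?thesis using 2 assms by (simp only: if_True) (simp add: power2_eq_square)
    next
      case 3
      then have "real_of_int n - real_of_int m \<noteq> 0" "real_of_int n - real_of_int m' \<noteq> 0" "real_of_int m - real_of_int m' \<noteq> 0"
        using assms by auto
      then show ?thesis using 3 by (simp add: divide_simps)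
    qed
  qed
  have "(\<lambda>R. ?d * (?h m R - ?h m' R) + 2 * ?d\<^sup>2) \<longlonglongrightarrow> ?d * (0 - 0) + 2 * ?d\<^sup>2"
    by (intro tendsto_intros shifted_harmonic_tendsto_0)
  then have "(\<lambda>R. ?d * (?h m R - ?h m' R) + 2 * ?d\<^sup>2) \<longlonglongrightarrow> 2 * ?d\<^sup>2" by simp
  moreover have "eventually (\<lambda>R. ?d * (?h m R - ?h m' R) + 2 * ?d\<^sup>2 =
      (\<Sum>n\<in>{-int R..int R}. 1 / real_of_int (n - m) * (1 / real_of_int (n - m')))) sequentially"
  proof (rule eventually_sequentiallyI)
    fix R assume R: "nat (max \<bar>m\<bar> \<bar>m'\<bar>) \<le> R"
    then have "m \<in> {-int R..int R}" "m' \<in> {-int R..int R}" by auto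
    then show "?d * (?h m R - ?h m' R) + 2 * ?d\<^sup>2 = (\<Sum>n\<in>{-int R..int R}. 1 / real_of_int (n - m) * (1 / real_of_int (n - m')))"
      unfolding pt sum.distrib sum_distrib_left[symmetric] sum_subtractf by simp
  qed
  ultimately show ?thesis by (rule Lim_transform_eventually)
qed

text \<open>With \<open>T\<close> the operator with kernel \<open>1/(n - m)\<close>, the Gram kernel of \<open>T\<close> is \<open>O(1/(m - m')\<^sup>2)\<close>,
  which is summable; Schur's test then bounds the square of the norm of \<open>T\<close> by \<open>12 \<le> 4\<^sup>2\<close>.\<close>

lemma hilbert_inequality:
  fixes F G :: "int \<Rightarrow> 'a::real_inner"
  assumes A: "finite A"
  shows "\<bar>\<Sum>m\<in>A. \<Sum>n\<in>A. 1 / real_of_int (n - m) * (F m \<bullet> G n)\<bar> \<le> 4 * sqrt (\<Sum>m\<in>A. (norm (F m))\<^sup>2) * sqrt (\<Sum>n\<in>A. (norm (G n))\<^sup>2)"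
proof -
  define u where "u n = (\<Sum>m\<in>A. (1 / real_of_int (n - m)) *\<^sub>R F m)" for n
  define S where "S R m m' = (\<Sum>n\<in>{-int R..int R}. 1 / real_of_int (n - m) * (1 / real_of_int (n - m')))" for R m m'
  define N2 where "N2 = (\<Sum>m\<in>A. (norm (F m))\<^sup>2)"
  obtain R0 where R0: "A \<subseteq> {-int R0..int R0}" using int_finite_symmetric_cover[OF A] by blast
  \<comment> \<open>summing over a large symmetric window and letting it grow makes the Gram kernel
    explicit; the diagonal is bounded by 4\<close>
  define Q where "Q R = 4 * N2 + (\<Sum>m\<in>A. \<Sum>m'\<in>A. if m = m' then 0 else S R m m' * (F m \<bullet> F m'))" for R
  have le: "(\<Sum>n\<in>A. (norm (u n))\<^sup>2) \<le> Q R" if R: "R \<ge> R0" for R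
  proof -
    have "(\<Sum>n\<in>A. (norm (u n))\<^sup>2) \<le> (\<Sum>n\<in>{-int R..int R}. (norm (u n))\<^sup>2)"
      using R0 R by (intro sum_mono2) force+
    also have "\<dots> = (\<Sum>n\<in>{-int R..int R}. \<Sum>m\<in>A. \<Sum>m'\<in>A. 1 / real_of_int (n - m) * (1 / real_of_int (n - m')) * (F m \<bullet> F m'))"
      unfolding u_def power2_norm_eq_inner inner_sum_left inner_sum_right by (simp add: mult_ac inner_commute)
    also have "\<dots> = (\<Sum>m\<in>A. \<Sum>m'\<in>A. S R m m' * (F m \<bullet> F m'))"
    proof -
      let ?h = "\<lambda>n m m'. 1 / real_of_int (n - m) * (1 / real_of_int (n - m')) * (F m \<bullet> F m')"
      have "(\<Sum>n\<in>{-int R..int R}. \<Sum>m\<in>A. \<Sum>m'\<in>A. ?h n m m') = (\<Sum>m\<in>A. \<Sum>n\<in>{-int R..int R}. \<Sum>m'\<in>A. ?h n m m')"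
        by (rule sum.swap)
      also have "\<dots> = (\<Sum>m\<in>A. \<Sum>m'\<in>A. \<Sum>n\<in>{-int R..int R}. ?h n m m')"
        by (rule sum.cong[OF refl], rule sum.swap)
      finally show ?thesis by (simp only: S_def sum_distrib_right)
    qed
    also have "\<dots> \<le> (\<Sum>m\<in>A. \<Sum>m'\<in>A. (if m = m' then 4 * (norm (F m))\<^sup>2 else 0) + (if m = m' then 0 else S R m m' * (F m \<bullet> F m')))"
    proof (intro sum_mono)
      fix m m'
      have "S R m m = (\<Sum>j\<in>(\<lambda>n. n - m) ` {-int R..int R}. (1 / real_of_int j)\<^sup>2)"
        unfolding S_def by (subst sum.reindex) (auto simp: inj_on_def power2_eq_square)
      also have "\<dots> \<le> 4" by (rule sum_inverse_squares_int) auto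
      finally have "S R m m * (norm (F m))\<^sup>2 \<le> 4 * (norm (F m))\<^sup>2" by (intro mult_right_mono) auto
      then show "S R m m' * (F m \<bullet> F m') \<le> (if m = m' then 4 * (norm (F m))\<^sup>2 else 0) + (if m = m' then 0 else S R m m' * (F m \<bullet> F m'))"
        by (auto simp: power2_norm_eq_inner)
    qed
    also have "\<dots> = Q R" using A by (simp add: Q_def N2_def sum.distrib sum_distrib_left)
    finally show ?thesis .
  qed
  define L where "L = 4 * N2 + (\<Sum>m\<in>A. \<Sum>m'\<in>A. if m = m' then 0 else 2 * (1 / real_of_int (m - m'))\<^sup>2 * (F m \<bullet> F m'))"
  have "Q \<longlonglongrightarrow> L"
  proof -
    have each: "(\<lambda>R. if m = m' then 0 else S R m m' * (F m \<bullet> F m')) \<longlonglongrightarrow>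
       (if m = m' then 0 else 2 * (1 / real_of_int (m - m'))\<^sup>2 * (F m \<bullet> F m'))" for m m'
    proof (cases "m = m'")
      case False
      then have "(\<lambda>R. S R m m' * (F m \<bullet> F m')) \<longlonglongrightarrow> 2 * (1 / real_of_int (m - m'))\<^sup>2 * (F m \<bullet> F m')"
        unfolding S_def by (intro tendsto_mult_right hilbert_gram_tendsto)
      then show ?thesis using False by simp
    qed simp
    show ?thesis unfolding Q_def L_def by (intro tendsto_add tendsto_const tendsto_sum each)
  qed
  then have u2: "(\<Sum>n\<in>A. (norm (u n))\<^sup>2) \<le> L"
    by (rule LIMSEQ_le_const) (use le in blast)
  have "(\<Sum>m\<in>A. \<Sum>m'\<in>A. if m = m' then 0 else 2 * (1 / real_of_int (m - m'))\<^sup>2 * (F m \<bullet> F m'))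
      \<le> (\<Sum>m\<in>A. \<Sum>m'\<in>A. 2 * (1 / real_of_int (m - m'))\<^sup>2 * \<bar>norm (F m)\<bar> * \<bar>norm (F m')\<bar>)"
  proof (intro sum_mono)
    fix m m'
    have "2 * (1 / real_of_int (m - m'))\<^sup>2 * (F m \<bullet> F m') \<le> 2 * (1 / real_of_int (m - m'))\<^sup>2 * (norm (F m) * norm (F m'))"
      by (intro mult_left_mono norm_cauchy_schwarz) auto
    then show "(if m = m' then 0 else 2 * (1 / real_of_int (m - m'))\<^sup>2 * (F m \<bullet> F m')) \<le> 2 * (1 / real_of_int (m - m'))\<^sup>2 * \<bar>norm (F m)\<bar> * \<bar>norm (F m')\<bar>"
      by (auto simp: mult.assoc)
  qed
  also have "\<dots> \<le> 8 * sqrt (\<Sum>x\<in>A. (norm (F x))\<^sup>2) * sqrt (\<Sum>x\<in>A. (norm (F x))\<^sup>2)"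
  proof (rule schur_test_real[OF A A])
    fix m
    have "(\<Sum>y\<in>A. (1 / real_of_int (m - y))\<^sup>2) = (\<Sum>j\<in>(\<lambda>y. m - y) ` A. (1 / real_of_int j)\<^sup>2)"
      by (subst sum.reindex) (auto simp: inj_on_def)
    then show "(\<Sum>y\<in>A. 2 * (1 / real_of_int (m - y))\<^sup>2) \<le> 8"
      using sum_inverse_squares_int[of "(\<lambda>y. m - y) ` A"] A by (simp flip: sum_distrib_left)
    have "(\<Sum>y\<in>A. (1 / real_of_int (y - m))\<^sup>2) = (\<Sum>j\<in>(\<lambda>y. y - m) ` A. (1 / real_of_int j)\<^sup>2)"
      by (subst sum.reindex) (auto simp: inj_on_def)
    then show "(\<Sum>y\<in>A. 2 * (1 / real_of_int (y - m))\<^sup>2) \<le> 8"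
      using sum_inverse_squares_int[of "(\<lambda>y. y - m) ` A"] A by (simp flip: sum_distrib_left)
  qed auto
  also have "\<dots> = 8 * N2" by (simp add: N2_def mult.assoc sum_nonneg)
  finally have "L \<le> 12 * N2" by (simp add: L_def)
  then have u3: "(\<Sum>n\<in>A. (norm (u n))\<^sup>2) \<le> 4\<^sup>2 * N2" using u2 by (simp add: N2_def) (smt (verit) sum_nonneg zero_le_power2)
  have "(\<Sum>m\<in>A. \<Sum>n\<in>A. 1 / real_of_int (n - m) * (F m \<bullet> G n)) = (\<Sum>n\<in>A. u n \<bullet> G n)"
    unfolding u_def inner_sum_left by (subst sum.swap) simp
  then have "\<bar>\<Sum>m\<in>A. \<Sum>n\<in>A. 1 / real_of_int (n - m) * (F m \<bullet> G n)\<bar> \<le> (\<Sum>n\<in>A. \<bar>norm (u n)\<bar> * \<bar>norm (G n)\<bar>)"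
    using order_trans[OF sum_abs[of "\<lambda>n. u n \<bullet> G n" A] sum_mono[OF Cauchy_Schwarz_ineq2]] by simp
  also have "\<dots> \<le> L2_set (\<lambda>n. norm (u n)) A * L2_set (\<lambda>n. norm (G n)) A" by (rule L2_set_mult_ineq)
  also have "\<dots> = sqrt (\<Sum>n\<in>A. (norm (u n))\<^sup>2) * sqrt (\<Sum>n\<in>A. (norm (G n))\<^sup>2)" by (simp add: L2_set_def)
  also have "\<dots> \<le> sqrt (4\<^sup>2 * N2) * sqrt (\<Sum>n\<in>A. (norm (G n))\<^sup>2)"
    by (intro mult_right_mono real_sqrt_le_mono u3) (simp add: sum_nonneg)
  finally show ?thesis by (simp add: real_sqrt_mult N2_def)
qed

section \<open>Dyadic intervals and the truncated Hilbert kernel\<close>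

text \<open>The dyadic interval of generation \<open>k\<close> with index \<open>u\<close>; its ancestor \<open>i\<close> generations up has
  the index \<open>u div 2 ^ i\<close>.\<close>

definition dyad :: "nat \<Rightarrow> int \<Rightarrow> int set" where "dyad k u = {2 ^ k * u..<2 ^ k * (u + 1)}"
text \<open>A dyadic interval with its two neighbours. It contains every point within distance \<open>2 ^ k\<close>
  of the interval.\<close>

definition tri :: "nat \<Rightarrow> int \<Rightarrow> int set" where "tri k u = {2 ^ k * (u - 1)..<2 ^ k * (u + 2)}"
text \<open>The value at \<open>m = 0\<close> is 0, by the convention for division.\<close>

definition hilbert_kernel :: "int \<Rightarrow> int \<Rightarrow> real" where "hilbert_kernel L m = (if \<bar>m\<bar> < L then 1 / real_of_int m else 0)"

lemma finite_dyad [simp]: "finite (dyad k u)" and finite_tri [simp]: "finite (tri k u)"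
  by (simp_all add: dyad_def tri_def)

lemma card_dyad: "real (card (dyad k u)) = 2 ^ k"
  by (simp add: dyad_def algebra_simps)

lemma card_tri: "real (card (tri k u)) = 3 * 2 ^ k"
  by (simp add: tri_def algebra_simps)

lemma in_dyad_iff: "x \<in> dyad k u \<longleftrightarrow> x div 2 ^ k = u"
proof
  assume "x \<in> dyad k u"
  then have "x = 2 ^ k * u + (x - 2 ^ k * u)" "0 \<le> x - 2 ^ k * u" "x - 2 ^ k * u < 2 ^ k"
    by (auto simp: dyad_def algebra_simps)
  then show "x div 2 ^ k = u" by (metis div_mult_self4 div_pos_pos_trivial add.commute add.right_neutral power_not_zero zero_neq_numeral)
next
  assume "x div 2 ^ k = u"
  moreover have "0 \<le> x mod 2 ^ k" "x mod 2 ^ k < 2 ^ k" by simp_all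
  moreover have "2 ^ k * u + x mod 2 ^ k = x" using \<open>x div 2 ^ k = u\<close> mult_div_mod_eq[of "2 ^ k" x] by simp
  ultimately have "2 ^ k * u \<le> x" "x < 2 ^ k * u + 2 ^ k" by linarith+
  then show "x \<in> dyad k u" by (simp add: dyad_def distrib_left)
qed

lemma dyad_ancestor:
  assumes "x \<in> dyad k u"
  shows "x \<in> dyad (k + i) (u div 2 ^ i)"
  using assms by (simp add: in_dyad_iff power_add zdiv_zmult2_eq)

lemma dyad_subset_ancestor: "dyad k u \<subseteq> dyad (k + i) (u div 2 ^ i)"
  using dyad_ancestor by blast

lemma dyad_subset_tri: "dyad k u \<subseteq> tri k u"
  by (auto simp: dyad_def tri_def algebra_simps)

lemma tri_eq: "tri k u = dyad k (u - 1) \<union> dyad k u \<union> dyad k (u + 1)"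
proof -
  have "2 ^ k * (u - 1) = 2 ^ k * u - 2 ^ k" "2 ^ k * (u + 1) = 2 ^ k * u + (2::int) ^ k" "2 ^ k * (u + 2) = 2 ^ k * u + 2 * (2::int) ^ k"
    by (simp_all add: algebra_simps)
  moreover have "(2::int) ^ k > 0" by simp
  ultimately show ?thesis unfolding tri_def dyad_def by (auto simp: algebra_simps)
qed

lemma in_tri_iff: "x \<in> tri k u \<longleftrightarrow> x div 2 ^ k \<in> {u - 1, u, u + 1}"
  unfolding tri_eq by (auto simp: in_dyad_iff)

lemma tri_nbhd:
  assumes "x \<in> dyad k u" "\<bar>x - z\<bar> < 2 ^ k"
  shows "z \<in> tri k u"
  using assms by (auto simp: dyad_def tri_def algebra_simps)

text \<open>Neighbours of an interval lie in its ancestor or in a neighbour of the ancestor.\<close>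

lemma tri_subset_tri_parent: "tri k u \<subseteq> tri (k + i) (u div 2 ^ i)"
proof
  fix x assume "x \<in> tri k u"
  then have "x div 2 ^ k \<in> {u - 1, u, u + 1}" by (simp add: in_tri_iff)
  then have "u div 2 ^ i - 1 \<le> x div 2 ^ k div 2 ^ i" "x div 2 ^ k div 2 ^ i \<le> u div 2 ^ i + 1"
  proof -
    assume "x div 2 ^ k \<in> {u - 1, u, u + 1}"
    then have a: "u - 1 \<le> x div 2 ^ k" "x div 2 ^ k \<le> u + 1" by auto
    have p: "(1::int) \<le> 2 ^ i" by simp
    have p1: "u - 2 ^ i \<le> x div 2 ^ k" "x div 2 ^ k \<le> u + 2 ^ i" using a p by linarith+
    have "(u - 2 ^ i) div 2 ^ i \<le> x div 2 ^ k div 2 ^ i" using p1 by (intro zdiv_mono1) auto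
    then show "u div 2 ^ i - 1 \<le> x div 2 ^ k div 2 ^ i"
      using div_mult_self2[of "2 ^ i" u "-1"] by simp
    have "x div 2 ^ k div 2 ^ i \<le> (u + 2 ^ i) div 2 ^ i" using p1 by (intro zdiv_mono1) auto
    then show "x div 2 ^ k div 2 ^ i \<le> u div 2 ^ i + 1" by simp
  qed
  then have "x div 2 ^ (k + i) \<in> {u div 2 ^ i - 1, u div 2 ^ i, u div 2 ^ i + 1}"
    by (simp add: power_add zdiv_zmult2_eq) linarith
  then show "x \<in> tri (k + i) (u div 2 ^ i)" by (simp add: in_tri_iff)
qed

lemma hilbert_kernel_minus: "hilbert_kernel L (- m) = - hilbert_kernel L m"
  by (simp add: hilbert_kernel_def)

lemma abs_hilbert_kernel_le: "\<bar>hilbert_kernel L m\<bar> \<le> 1 / real_of_int \<bar>m\<bar>"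
  by (simp add: hilbert_kernel_def)

text \<open>A summed form of \<open>a * b \<le> a powr (3/2) + b ^ 3\<close> after dividing \<open>g\<close> by \<open>y\<close>. It pairs a
  function with controlled average of its power 3/2 with a weight whose cube is summable, such
  as a logarithm.\<close>

lemma sum_young_le:
  fixes g w :: "'b \<Rightarrow> real"
  assumes "finite S" "\<And>n. g n \<ge> 0" "\<And>n. w n \<ge> 0" "y \<ge> 0" and C: "(\<Sum>n\<in>S. g n * sqrt (g n)) \<le> C * (y * sqrt y)"
  shows "(\<Sum>n\<in>S. g n * w n) \<le> y * (C + (\<Sum>n\<in>S. w n ^ 3))"
proof (cases "y = 0")
  case True
  have "0 \<le> (\<Sum>n\<in>S. g n * sqrt (g n))" using assms by (intro sum_nonneg) auto
  then have "(\<Sum>n\<in>S. g n * sqrt (g n)) = 0" using C True by simp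
  then have "\<forall>n\<in>S. g n * sqrt (g n) = 0" using assms by (subst (asm) sum_nonneg_eq_0_iff) auto
  then have "\<forall>n\<in>S. g n * w n = 0" by auto
  then show ?thesis using True by (simp add: sum.neutral)
next
  case False
  then have y: "y > 0" using assms by simp
  have pt: "g n * w n \<le> y * (g n * sqrt (g n) / (y * sqrt y) + w n ^ 3)" for n
  proof -
    define a where "a = g n / y"
    have a: "a \<ge> 0" using assms y by (simp add: a_def)
    have "a * w n \<le> a * sqrt a + w n ^ 3"
    proof (cases "w n \<le> sqrt a")
      case True
      then have "a * w n \<le> a * sqrt a" using a by (intro mult_left_mono) auto
      then show ?thesis using assms(3)[of n] by (simp add: add_increasing2)
    next
      case False
      have "a = sqrt a * sqrt a" using a by simp
      also have "\<dots> \<le> w n * w n" using False a assms(3)[of n] by (intro mult_mono) auto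
      finally have "a * w n \<le> (w n * w n) * w n" using assms(3) by (intro mult_right_mono) auto
      then show ?thesis using a by (simp add: power3_eq_cube add_increasing)
    qed
    then have "y * (a * w n) \<le> y * (a * sqrt a + w n ^ 3)" using y by (intro mult_left_mono) auto
    then show ?thesis using y by (simp add: a_def real_sqrt_divide)
  qed
  have "(\<Sum>n\<in>S. g n * w n) \<le> (\<Sum>n\<in>S. y * (g n * sqrt (g n) / (y * sqrt y) + w n ^ 3))" by (intro sum_mono pt)
  also have "\<dots> = y * ((\<Sum>n\<in>S. g n * sqrt (g n)) / (y * sqrt y) + (\<Sum>n\<in>S. w n ^ 3))"
    by (simp only: sum_distrib_left[symmetric] sum.distrib sum_divide_distrib[symmetric])
  also have "\<dots> \<le> y * (C + (\<Sum>n\<in>S. w n ^ 3))"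
  proof -
    have "(\<Sum>n\<in>S. g n * sqrt (g n)) / (y * sqrt y) \<le> C" using C y by (subst pos_divide_le_eq) auto
    then show ?thesis using y by (intro mult_left_mono add_right_mono) auto
  qed
  finally show ?thesis .
qed

lemma sum_shift_int: "(\<Sum>n'\<in>{a..<b}. \<phi> (n' - n)) = (\<Sum>j\<in>{a - n..<b - (n::int)}. \<phi> j)"
proof -
  have "(\<Sum>j\<in>(\<lambda>n'. n' - n) ` {a..<b}. \<phi> j) = (\<Sum>n'\<in>{a..<b}. \<phi> (n' - n))"
    by (subst sum.reindex) (auto simp: inj_on_def)
  moreover have "(\<lambda>n'. n' - n) ` {a..<b} = {a - n..<b - n}"
  proof (intro equalityI subsetI)
    fix j assume "j \<in> {a - n..<b - n}"
    then have "j = (j + n) - n" "j + n \<in> {a..<b}" by auto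
    then show "j \<in> (\<lambda>n'. n' - n) ` {a..<b}" by blast
  qed auto
  ultimately show ?thesis by simp
qed

lemma sum_reflect_int: "(\<Sum>n'\<in>{a..<b}. \<phi> (n - n')) = (\<Sum>j\<in>{n - b + 1..<n - a + (1::int)}. \<phi> j)"
proof -
  have "(\<Sum>j\<in>(\<lambda>n'. n - n') ` {a..<b}. \<phi> j) = (\<Sum>n'\<in>{a..<b}. \<phi> (n - n'))"
    by (subst sum.reindex) (auto simp: inj_on_def)
  moreover have "(\<lambda>n'. n - n') ` {a..<b} = {n - b + 1..<n - a + 1}"
  proof (intro equalityI subsetI)
    fix j assume "j \<in> {n - b + 1..<n - a + 1}"
    then have "j = n - (n - j)" "n - j \<in> {a..<b}" by auto
    then show "j \<in> (\<lambda>n'. n - n') ` {a..<b}" by blast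
  qed auto
  ultimately show ?thesis by simp
qed

text \<open>This is about \<open>ln (1 + b / a)\<close>.\<close>

definition harmonic_window :: "int \<Rightarrow> int \<Rightarrow> real" where "harmonic_window b a = (\<Sum>j\<in>{a..<a + b}. 1 / real_of_int j)"

lemma harmonic_window_nonneg: "a \<ge> 1 \<Longrightarrow> harmonic_window b a \<ge> 0"
  unfolding harmonic_window_def by (intro sum_nonneg) auto

text \<open>The summand is \<open>j powr (-3/4)\<close>; it telescopes against \<open>4 * j powr (1/4)\<close>.\<close>

lemma sum_quarter_power:
  fixes n :: int
  assumes "n \<ge> 0"
  shows "(\<Sum>j\<in>{1..<n + 1}. 1 / sqrt (sqrt (real_of_int j)) ^ 3) \<le> 4 * sqrt (sqrt (real_of_int n))"
  using assms
proof (induction n rule: int_ge_induct)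
  case (step n)
  define p where "p = sqrt (sqrt (real_of_int (n + 1)))"
  define r where "r = sqrt (sqrt (real_of_int n))"
  have p4: "p ^ 4 = of_int (n + 1)" and r4: "r ^ 4 = of_int n" using step
    by (simp_all add: p_def r_def power4_eq_xxxx flip: mult.assoc) (simp_all add: mult.assoc)
  have p0: "p > 0" "r \<ge> 0" "r \<le> p" using step by (auto simp: p_def r_def)
  have "1 = p ^ 4 - r ^ 4" using p4 r4 by simp
  also have "\<dots> = (p - r) * (p ^ 3 + p\<^sup>2 * r + p * r\<^sup>2 + r ^ 3)" by (simp add: algebra_simps power_numeral_reduce)
  also have "\<dots> \<le> (p - r) * (p ^ 3 + p\<^sup>2 * p + p * p\<^sup>2 + p ^ 3)"
    using p0 by (intro mult_left_mono add_mono mult_mono power_mono) auto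
  also have "\<dots> = (4 * p - 4 * r) * p ^ 3" by (simp add: algebra_simps power_numeral_reduce)
  finally have "1 / p ^ 3 \<le> 4 * p - 4 * r" using p0 by (simp add: field_simps)
  moreover have "{1..<n + 1 + 1} = insert (n + 1) {1..<n + 1}" using step by auto
  ultimately show ?case using step by (simp add: p_def r_def)
qed simp

text \<open>For \<open>d \<le> j\<close> one has \<open>1/j \<le> d powr (-1/4) * j powr (-3/4)\<close>, so the window is at most a
  constant times \<open>(b / d) powr (1/4)\<close>, and the sum of its cubes over \<open>d \<le> b\<close> is \<open>O(b)\<close>. Any
  bound by a power of \<open>b/d\<close> below 1/3 would do; it replaces the logarithm.\<close>

lemma harmonic_window_cube_sum:
  fixes b :: int
  assumes b: "b \<ge> 1"
  shows "(\<Sum>d\<in>{1..<b + 1}. harmonic_window b d ^ 3) \<le> 512 * of_int b"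
proof -
  define s where "s j = sqrt (sqrt (real_of_int j))" for j
  have s4: "s j ^ 4 = of_int j" if "j \<ge> 0" for j
    using that by (simp add: s_def power4_eq_xxxx flip: mult.assoc) (simp add: mult.assoc)
  have s0: "s j > 0" if "j \<ge> 1" for j using that by (simp add: s_def)
  have smono: "s i \<le> s j" if "i \<le> j" for i j using that by (simp add: s_def)
  have psi_le: "harmonic_window b d \<le> 4 * s (2 * b) / s d" if d: "d \<in> {1..<b + 1}" for d
  proof -
    have "harmonic_window b d \<le> (\<Sum>j\<in>{d..<d + b}. 1 / s d * (1 / s j ^ 3))"
      unfolding harmonic_window_def
    proof (rule sum_mono)
      fix j assume j: "j \<in> {d..<d + b}"
      then have pos: "0 < s d" "s d \<le> s j" using d s0 smono by auto
      have "s d * s j ^ 3 \<le> s j * s j ^ 3" using pos by (intro mult_right_mono) auto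
      also have "\<dots> = of_int j" using s4[of j] j d by (simp add: power_numeral_reduce)
      finally have "1 / of_int j \<le> 1 / (s d * s j ^ 3)" using pos j d by (intro divide_left_mono) auto
      then show "1 / real_of_int j \<le> 1 / s d * (1 / s j ^ 3)" by simp
    qed
    also have "\<dots> = 1 / s d * (\<Sum>j\<in>{d..<d + b}. 1 / s j ^ 3)" by (simp add: sum_distrib_left)
    also have "\<dots> \<le> 1 / s d * (\<Sum>j\<in>{1..<2 * b + 1}. 1 / s j ^ 3)"
      using d s0 by (intro mult_left_mono sum_mono2) (auto simp: s_def)
    also have "\<dots> \<le> 1 / s d * (4 * s (2 * b))"
      using sum_quarter_power[of "2 * b"] b d s0 by (intro mult_left_mono) (auto simp: s_def)
    finally show ?thesis by simp
  qed
  have "(\<Sum>d\<in>{1..<b + 1}. harmonic_window b d ^ 3) \<le> (\<Sum>d\<in>{1..<b + 1}. (4 * s (2 * b) / s d) ^ 3)"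
    by (intro sum_mono power_mono psi_le harmonic_window_nonneg) auto
  also have "\<dots> = 64 * s (2 * b) ^ 3 * (\<Sum>d\<in>{1..<b + 1}. 1 / s d ^ 3)"
    by (simp add: power_divide power_mult_distrib sum_distrib_left)
  also have "\<dots> \<le> 64 * s (2 * b) ^ 3 * (4 * s b)"
    using sum_quarter_power[of b] b s0[of "2 * b"] by (intro mult_left_mono) (auto simp: s_def)
  also have "\<dots> \<le> 64 * s (2 * b) ^ 3 * (4 * s (2 * b))"
    using smono[of b "2 * b"] b s0[of "2 * b"] by (intro mult_left_mono) auto
  also have "\<dots> = 256 * s (2 * b) ^ 4" by (simp add: power_numeral_reduce)
  also have "\<dots> = 512 * of_int b" using s4[of "2 * b"] b by simp
  finally show ?thesis .
qed

text \<open>The logarithmic profile of the truncated Hilbert transform of the indicator of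
  \<open>{l..<l + b}\<close>, with a singularity at each end of the block.\<close>

definition logw :: "int \<Rightarrow> int \<Rightarrow> int \<Rightarrow> real" where
  "logw l b n = (if l - b \<le> n \<and> n < l then harmonic_window b (l - n)
     else if l \<le> n \<and> n < l + b then harmonic_window b (n - l + 1) + harmonic_window b (l + b - n)
     else if l + b \<le> n \<and> n < l + 2 * b then harmonic_window b (n - l - b + 1) else 0)"

lemma logw_nonneg: "logw l b n \<ge> 0"
  unfolding logw_def by (auto intro!: harmonic_window_nonneg add_nonneg_nonneg)

lemma cube_sum_le: "a \<ge> 0 \<Longrightarrow> b \<ge> 0 \<Longrightarrow> (a + b) ^ 3 \<le> 4 * (a ^ 3 + (b::real) ^ 3)"
proof -
  assume "a \<ge> 0" "b \<ge> 0"
  then have "0 \<le> 3 * ((a + b) * (a - b)\<^sup>2)" by simp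
  also have "\<dots> = 4 * (a ^ 3 + b ^ 3) - (a + b) ^ 3" by (simp add: algebra_simps power_numeral_reduce)
  finally show ?thesis by simp
qed

lemma logw_cube_sum:
  fixes b :: int
  assumes b: "b \<ge> 1"
  shows "(\<Sum>n\<in>{l - b..<l + 2 * b}. logw l b n ^ 3) \<le> 5120 * of_int b"
proof -
  define P where "P = (\<Sum>d\<in>{1..<b + 1}. harmonic_window b d ^ 3)"
  have "{l - b..<l + 2 * b} = {l - b..<l} \<union> ({l..<l + b} \<union> {l + b..<l + 2 * b})" using b by auto
  then have "(\<Sum>n\<in>{l - b..<l + 2 * b}. logw l b n ^ 3) =
      (\<Sum>n\<in>{l - b..<l}. logw l b n ^ 3) + ((\<Sum>n\<in>{l..<l + b}. logw l b n ^ 3) + (\<Sum>n\<in>{l + b..<l + 2 * b}. logw l b n ^ 3))"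
    by (simp only:) (subst sum.union_disjoint; auto)+
  also have "(\<Sum>n\<in>{l - b..<l}. logw l b n ^ 3) = (\<Sum>n\<in>{l - b..<l}. harmonic_window b (l - n) ^ 3)"
    by (intro sum.cong) (auto simp: logw_def)
  also have "\<dots> = P" unfolding P_def by (subst sum_reflect_int[of "\<lambda>j. harmonic_window b j ^ 3" l]) simp
  also have "(\<Sum>n\<in>{l..<l + b}. logw l b n ^ 3) \<le> (\<Sum>n\<in>{l..<l + b}. 4 * (harmonic_window b (n - (l - 1)) ^ 3 + harmonic_window b (l + b - n) ^ 3))"
  proof (rule sum_mono)
    fix n assume n: "n \<in> {l..<l + b}"
    then have "logw l b n = harmonic_window b (n - (l - 1)) + harmonic_window b (l + b - n)" by (simp add: logw_def algebra_simps)
    then show "logw l b n ^ 3 \<le> 4 * (harmonic_window b (n - (l - 1)) ^ 3 + harmonic_window b (l + b - n) ^ 3)"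
      using n by (simp only:) (intro cube_sum_le harmonic_window_nonneg; simp)
  qed
  also have "\<dots> = 4 * ((\<Sum>n\<in>{l..<l + b}. harmonic_window b (n - (l - 1)) ^ 3) + (\<Sum>n\<in>{l..<l + b}. harmonic_window b (l + b - n) ^ 3))"
    by (simp only: sum_distrib_left[symmetric] sum.distrib)
  also have "(\<Sum>n\<in>{l..<l + b}. harmonic_window b (n - (l - 1)) ^ 3) = P"
    unfolding P_def by (subst sum_shift_int[of "\<lambda>j. harmonic_window b j ^ 3"]) simp
  also have "(\<Sum>n\<in>{l..<l + b}. harmonic_window b (l + b - n) ^ 3) = P"
    unfolding P_def by (subst sum_reflect_int[of "\<lambda>j. harmonic_window b j ^ 3"]) (simp add: algebra_simps)
  also have "(\<Sum>n\<in>{l + b..<l + 2 * b}. logw l b n ^ 3) = (\<Sum>n\<in>{l + b..<l + 2 * b}. harmonic_window b (n - (l + b - 1)) ^ 3)"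
    by (intro sum.cong) (auto simp: logw_def algebra_simps)
  also have "\<dots> = P"
    unfolding P_def by (subst sum_shift_int[of "\<lambda>j. harmonic_window b j ^ 3"]) (simp add: algebra_simps)
  finally show ?thesis using harmonic_window_cube_sum[OF b] by (simp add: P_def)
qed

lemma harmonic_diff_le_harmonic_window:
  fixes p r b :: int
  assumes "0 \<le> r" "r \<le> p" "p \<le> r + b"
  shows "0 \<le> (\<Sum>j\<in>{1..<p + 1}. 1 / real_of_int j) - (\<Sum>j\<in>{1..<r + 1}. 1 / real_of_int j)"
    "(\<Sum>j\<in>{1..<p + 1}. 1 / real_of_int j) - (\<Sum>j\<in>{1..<r + 1}. 1 / real_of_int j) \<le> harmonic_window b (r + 1)"
proof -
  have "{1..<p + 1} = {1..<r + 1} \<union> {r + 1..<p + 1}" using assms by auto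
  then have e: "(\<Sum>j\<in>{1..<p + 1}. 1 / real_of_int j) - (\<Sum>j\<in>{1..<r + 1}. 1 / real_of_int j) = (\<Sum>j\<in>{r + 1..<p + 1}. 1 / real_of_int j)"
    by (simp only:) (subst sum.union_disjoint; auto)
  show "0 \<le> (\<Sum>j\<in>{1..<p + 1}. 1 / real_of_int j) - (\<Sum>j\<in>{1..<r + 1}. 1 / real_of_int j)"
    unfolding e using assms by (intro sum_nonneg) auto
  show "(\<Sum>j\<in>{1..<p + 1}. 1 / real_of_int j) - (\<Sum>j\<in>{1..<r + 1}. 1 / real_of_int j) \<le> harmonic_window b (r + 1)"
    unfolding e harmonic_window_def using assms by (intro sum_mono2) auto
qed

text \<open>Outside the block all terms have one sign. Inside, cancellation around \<open>n\<close> leaves a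
  difference of two harmonic sums.\<close>

lemma sum_hilbert_kernel_block_le:
  fixes l b n :: int
  assumes b: "b \<ge> 1" and n: "n \<in> {l - b..<l + 2 * b}"
  shows "\<bar>\<Sum>n'\<in>{l..<l + b}. hilbert_kernel b (n - n')\<bar> \<le> logw l b n"
proof -
  consider "n < l" | "l \<le> n" "n < l + b" | "l + b \<le> n" by linarith
  then show ?thesis
  proof cases
    case 1
    have "\<bar>\<Sum>n'\<in>{l..<l + b}. hilbert_kernel b (n - n')\<bar> \<le> (\<Sum>n'\<in>{l..<l + b}. 1 / real_of_int (n' - n))"
      using 1 by (intro order_trans[OF sum_abs] sum_mono order_trans[OF abs_hilbert_kernel_le]) auto
    also have "\<dots> = harmonic_window b (l - n)" unfolding harmonic_window_def by (subst sum_shift_int[of "\<lambda>j. 1 / real_of_int j"]) (simp add: algebra_simps)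
    finally show ?thesis using 1 n by (simp add: logw_def)
  next
    case 3
    have "\<bar>\<Sum>n'\<in>{l..<l + b}. hilbert_kernel b (n - n')\<bar> \<le> (\<Sum>n'\<in>{l..<l + b}. 1 / real_of_int (n - n'))"
      using 3 by (intro order_trans[OF sum_abs] sum_mono order_trans[OF abs_hilbert_kernel_le]) auto
    also have "\<dots> = harmonic_window b (n - l - b + 1)" unfolding harmonic_window_def by (subst sum_reflect_int[of "\<lambda>j. 1 / real_of_int j"]) (simp add: algebra_simps)
    finally show ?thesis using 3 n b by (simp add: logw_def)
  next
    case 2
    let ?H = "\<lambda>p. \<Sum>j\<in>{1..<p + 1}. 1 / real_of_int j"
    have "{l..<l + b} = {l..<n} \<union> insert n {n + 1..<l + b}" using 2 by auto
    then have "(\<Sum>n'\<in>{l..<l + b}. hilbert_kernel b (n - n')) = (\<Sum>n'\<in>{l..<n}. hilbert_kernel b (n - n')) + (hilbert_kernel b (n - n) + (\<Sum>n'\<in>{n + 1..<l + b}. hilbert_kernel b (n - n')))"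
      by (simp only:) (subst sum.union_disjoint; auto)
    also have "hilbert_kernel b (n - n) = 0" by (simp add: hilbert_kernel_def)
    also have "(\<Sum>n'\<in>{l..<n}. hilbert_kernel b (n - n')) = (\<Sum>n'\<in>{l..<n}. 1 / real_of_int (n - n'))"
      using 2 by (intro sum.cong) (auto simp: hilbert_kernel_def)
    also have "\<dots> = ?H (n - l)" by (subst sum_reflect_int[of "\<lambda>j. 1 / real_of_int j"]) simp
    also have "(\<Sum>n'\<in>{n + 1..<l + b}. hilbert_kernel b (n - n')) = (\<Sum>n'\<in>{n + 1..<l + b}. - (1 / real_of_int (n' - n)))"
    proof (rule sum.cong[OF refl])
      fix n' assume n': "n' \<in> {n + 1..<l + b}"
      have "real_of_int (n - n') = - real_of_int (n' - n)" by simp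
      then have "1 / real_of_int (n - n') = - (1 / real_of_int (n' - n))" by (simp only: divide_minus_right)
      then show "hilbert_kernel b (n - n') = - (1 / real_of_int (n' - n))" using n' 2 by (simp add: hilbert_kernel_def)
    qed
    also have "\<dots> = - ?H (l + b - 1 - n)"
      unfolding sum_negf by (subst sum_shift_int[of "\<lambda>j. 1 / real_of_int j"]) (simp add: algebra_simps)
    finally have e: "(\<Sum>n'\<in>{l..<l + b}. hilbert_kernel b (n - n')) = ?H (n - l) - ?H (l + b - 1 - n)" by simp
    have w: "logw l b n = harmonic_window b (n - l + 1) + harmonic_window b (l + b - n)" using 2 by (simp add: logw_def)
    have w0: "harmonic_window b (n - l + 1) \<ge> 0" "harmonic_window b (l + b - n) \<ge> 0" using 2 by (auto intro: harmonic_window_nonneg)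
    show ?thesis
    proof (cases "l + b - 1 - n \<le> n - l")
      case True
      have "0 \<le> ?H (n - l) - ?H (l + b - 1 - n)" using 2 True by (intro harmonic_diff_le_harmonic_window(1)[where b = b]) auto
      moreover have "?H (n - l) - ?H (l + b - 1 - n) \<le> harmonic_window b (l + b - 1 - n + 1)"
        using 2 True by (intro harmonic_diff_le_harmonic_window(2)) auto
      moreover have "harmonic_window b (l + b - 1 - n + 1) = harmonic_window b (l + b - n)" by (rule arg_cong) simp
      ultimately show ?thesis unfolding e w using w0 by linarith
    next
      case False
      have "0 \<le> ?H (l + b - 1 - n) - ?H (n - l)" using 2 False by (intro harmonic_diff_le_harmonic_window(1)[where b = b]) auto
      moreover have "?H (l + b - 1 - n) - ?H (n - l) \<le> harmonic_window b (n - l + 1)"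
        using 2 False by (intro harmonic_diff_le_harmonic_window(2)) auto
      ultimately show ?thesis unfolding e w using w0 by linarith
    qed
  qed
qed

lemma sum_inverse_neighbours_le:
  fixes l b n :: int
  assumes b: "b \<ge> 1" and n: "n \<in> {l..<l + b}"
  shows "(\<Sum>n'\<in>{l - b..<l + 2 * b} - {l..<l + b}. 1 / real_of_int \<bar>n - n'\<bar>) \<le> logw l b n"
proof -
  have "{l - b..<l + 2 * b} - {l..<l + b} = {l - b..<l} \<union> {l + b..<l + 2 * b}" using b by auto
  then have "(\<Sum>n'\<in>{l - b..<l + 2 * b} - {l..<l + b}. 1 / real_of_int \<bar>n - n'\<bar>) =
      (\<Sum>n'\<in>{l - b..<l}. 1 / real_of_int \<bar>n - n'\<bar>) + (\<Sum>n'\<in>{l + b..<l + 2 * b}. 1 / real_of_int \<bar>n - n'\<bar>)"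
    by (simp only:) (subst sum.union_disjoint; auto)
  also have "(\<Sum>n'\<in>{l - b..<l}. 1 / real_of_int \<bar>n - n'\<bar>) = (\<Sum>n'\<in>{l - b..<l}. 1 / real_of_int (n - n'))"
    using n by (intro sum.cong) auto
  also have "\<dots> = harmonic_window b (n - l + 1)" unfolding harmonic_window_def by (subst sum_reflect_int[of "\<lambda>j. 1 / real_of_int j"]) (simp add: algebra_simps)
  also have "(\<Sum>n'\<in>{l + b..<l + 2 * b}. 1 / real_of_int \<bar>n - n'\<bar>) = (\<Sum>n'\<in>{l + b..<l + 2 * b}. 1 / real_of_int (n' - n))"
    using n by (intro sum.cong) auto
  also have "\<dots> = harmonic_window b (l + b - n)" unfolding harmonic_window_def by (subst sum_shift_int[of "\<lambda>j. 1 / real_of_int j"]) (simp add: algebra_simps)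
  finally show ?thesis using n by (simp add: logw_def)
qed

text \<open>Subtracting the kernel of generation \<open>k\<close> removes the singularity, and what is left varies
  slowly on the scale \<open>2 ^ k\<close>. If \<open>n\<close> first enters the tripled ancestor at generation \<open>k + i\<close>,
  its distance is about \<open>2 ^ (k + i)\<close> and the difference is at most \<open>2 ^ k / (2 ^ (k + i))\<^sup>2\<close>
  up to a constant. The extra \<open>2 / 2 ^ K\<close> covers the points at which only one of the two
  kernels is cut off by the truncation.\<close>

lemma kernel_difference_pointwise:
  fixes k K :: nat and u c n n' :: int
  assumes kK: "k < K" and c: "c \<in> dyad k u" "n' \<in> dyad k u" and n: "n \<in> tri K (u div 2 ^ (K - k))"
  defines "\<kappa> \<equiv> \<lambda>m. hilbert_kernel (2 ^ K) m - hilbert_kernel (2 ^ k) m"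
  shows "\<bar>\<kappa> (n - n') - \<kappa> (n - c)\<bar> \<le>
    (\<Sum>i\<le>K - k. if n \<in> tri (k + i) (u div 2 ^ i) then 4 / (4 ^ i * 2 ^ k) else 0) + 2 / 2 ^ K"
proof -
  \<comment> \<open>the generation at which the tripled ancestors of the small interval first reach \<open>n\<close>\<close>
  define i0 where "i0 = (LEAST i. n \<in> tri (k + i) (u div 2 ^ i))"
  have ex: "n \<in> tri (k + (K - k)) (u div 2 ^ (K - k))" using n kK by simp
  have i0: "n \<in> tri (k + i0) (u div 2 ^ i0)" unfolding i0_def by (rule LeastI[of "\<lambda>i. n \<in> tri (k + i) (u div 2 ^ i)", OF ex])
  have i0K: "i0 \<le> K - k" unfolding i0_def by (rule Least_le[of "\<lambda>i. n \<in> tri (k + i) (u div 2 ^ i)", OF ex])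
  have kap: "\<bar>\<kappa> m\<bar> \<le> 1 / 2 ^ k" for m
  proof (cases "\<bar>m\<bar> < 2 ^ k")
    case True
    have "(2::int) ^ k \<le> 2 ^ K" using kK by (intro power_increasing) auto
    then have "\<bar>m\<bar> < 2 ^ K" using True by linarith
    then show ?thesis using True by (simp add: \<kappa>_def hilbert_kernel_def)
  next
    case False
    then have "(2::int) ^ k \<le> \<bar>m\<bar>" by simp
    then have "real_of_int (2 ^ k) \<le> real_of_int \<bar>m\<bar>" by (simp only: of_int_le_iff)
    then have "1 / real_of_int \<bar>m\<bar> \<le> 1 / 2 ^ k" by (intro frac_le) auto
    then show ?thesis using False abs_hilbert_kernel_le[of "2 ^ K" m] by (simp add: \<kappa>_def hilbert_kernel_def)
  qed
  have cn: "\<bar>n' - c\<bar> < 2 ^ k" using c by (auto simp: dyad_def algebra_simps)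
  have main: "\<bar>\<kappa> (n - n') - \<kappa> (n - c)\<bar> \<le> 4 / (4 ^ i0 * 2 ^ k) + 2 / 2 ^ K"
  proof (cases i0)
    case 0
    have "\<bar>\<kappa> (n - n') - \<kappa> (n - c)\<bar> \<le> 1 / 2 ^ k + 1 / 2 ^ k" using kap[of "n - n'"] kap[of "n - c"] by linarith
    also have "\<dots> \<le> 4 / 2 ^ k" by (simp add: field_simps)
    finally show ?thesis using 0 by (simp add: add_increasing2)
  next
    case (Suc i)
    define P :: int where "P = 2 ^ (k + i)"
    have "n \<notin> tri (k + i) (u div 2 ^ i)" using not_less_Least[of i "\<lambda>i. n \<in> tri (k + i) (u div 2 ^ i)"] Suc by (simp add: i0_def)
    then have far: "\<bar>n - z\<bar> > P" if "z \<in> dyad k u" for z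
      using dyad_ancestor[OF that, of i] by (auto simp: P_def tri_def dyad_def algebra_simps)
    have Pk: "2 ^ k \<le> P" unfolding P_def by (intro power_increasing) auto
    define m m' where "m = n - n'" and "m' = n - c"
    have mm: "\<bar>m\<bar> > P" "\<bar>m'\<bar> > P" using far c by (auto simp: m_def m'_def)
    have d: "\<bar>m' - m\<bar> < 2 ^ k" using cn by (simp add: m_def m'_def)
    have kmm: "\<kappa> z = (if \<bar>z\<bar> < 2 ^ K then 1 / real_of_int z else 0)" if "\<bar>z\<bar> > P" for z
      using that Pk by (auto simp: \<kappa>_def hilbert_kernel_def)
    have half: "1 / \<bar>real_of_int z\<bar> \<le> 2 / 2 ^ K" if "\<bar>z\<bar> > 2 ^ K - 2 ^ k" for z
    proof -
      have "2 * (2::int) ^ k \<le> 2 ^ K" using kK power_increasing[of "Suc k" K "2::int"] by simp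
      then have "2 ^ K \<le> 2 * \<bar>z\<bar>" using that by linarith
      then have "real_of_int (2 ^ K) \<le> real_of_int (2 * \<bar>z\<bar>)" by (simp only: of_int_le_iff)
      moreover have "z \<noteq> 0" using \<open>2 ^ K \<le> 2 * \<bar>z\<bar>\<close> by (auto simp: not_le)
      ultimately show ?thesis by (simp add: field_simps)
    qed
    consider "\<bar>m\<bar> < 2 ^ K" "\<bar>m'\<bar> < 2 ^ K" | "\<not> \<bar>m\<bar> < 2 ^ K" "\<not> \<bar>m'\<bar> < 2 ^ K"
      | "\<bar>m\<bar> < 2 ^ K" "\<not> \<bar>m'\<bar> < 2 ^ K" | "\<not> \<bar>m\<bar> < 2 ^ K" "\<bar>m'\<bar> < 2 ^ K" by blast
    then have "\<bar>\<kappa> m - \<kappa> m'\<bar> \<le> 4 / (4 ^ i0 * 2 ^ k) + 2 / 2 ^ K"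
    proof cases
      case 1
      have P0: "P > 0" by (simp add: P_def)
      have nz: "m \<noteq> 0" "m' \<noteq> 0" using mm P0 by auto
      have "\<bar>\<kappa> m - \<kappa> m'\<bar> = \<bar>real_of_int (m' - m)\<bar> / (\<bar>real_of_int m\<bar> * \<bar>real_of_int m'\<bar>)"
        using 1 nz kmm[OF mm(1)] kmm[OF mm(2)] by (simp add: diff_frac_eq abs_mult)
      also have "\<dots> \<le> 2 ^ k / (of_int P * of_int P)"
      proof (intro frac_le mult_mono)
        have "real_of_int \<bar>m' - m\<bar> \<le> real_of_int (2 ^ k)" using d by (simp only: of_int_le_iff)
        then show "\<bar>real_of_int (m' - m)\<bar> \<le> 2 ^ k" by simp
        have "real_of_int P \<le> real_of_int \<bar>m\<bar>" "real_of_int P \<le> real_of_int \<bar>m'\<bar>" using mm by (simp_all only: of_int_le_iff)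
        then show "real_of_int P \<le> \<bar>real_of_int m\<bar>" "real_of_int P \<le> \<bar>real_of_int m'\<bar>" by simp_all
      qed (use P0 in auto)
      also have "\<dots> = 4 / (4 ^ i0 * 2 ^ k)"
      proof -
        have "(4::real) ^ i = 2 ^ i * 2 ^ i" by (simp flip: power_mult_distrib)
        then show ?thesis using Suc by (simp add: P_def power_add field_simps)
      qed
      finally show ?thesis by (simp add: add_increasing2)
    next
      case 2 then show ?thesis using kmm[OF mm(1)] kmm[OF mm(2)] by simp
    next
      case 3
      have "\<bar>\<kappa> m - \<kappa> m'\<bar> \<le> 2 / 2 ^ K" using 3 kmm[OF mm(1)] kmm[OF mm(2)] half[of m] d by simp
      then show ?thesis by (simp add: add_increasing)
    next
      case 4
      have "\<bar>\<kappa> m - \<kappa> m'\<bar> \<le> 2 / 2 ^ K" using 4 kmm[OF mm(1)] kmm[OF mm(2)] half[of m'] d by simp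
      then show ?thesis by (simp add: add_increasing)
    qed
    then show ?thesis by (simp add: m_def m'_def)
  qed
  also have "4 / (4 ^ i0 * 2 ^ k) = (if n \<in> tri (k + i0) (u div 2 ^ i0) then 4 / (4 ^ i0 * 2 ^ k) else (0::real))" using i0 by simp
  also have "\<dots> \<le> (\<Sum>i\<le>K - k. if n \<in> tri (k + i) (u div 2 ^ i) then 4 / (4 ^ i * 2 ^ k) else 0)"
    using i0K by (intro member_le_sum[of i0 "{..K - k}"]) auto
  finally show ?thesis by simp
qed

text \<open>Summing the pointwise bound, generation \<open>k + i\<close> contributes
  \<open>y * 2 ^ (k + i) * 4 / (4 ^ i * 2 ^ k)\<close>, a geometric series in \<open>i\<close>.\<close>

lemma kernel_difference_sum:
  fixes k K :: nat and u c n' :: int and g :: "int \<Rightarrow> real"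
  assumes kK: "k < K" and c: "c \<in> dyad k u" "n' \<in> dyad k u" and g: "\<And>n. g n \<ge> 0"
    and y: "\<And>i. i \<le> K - k \<Longrightarrow> (\<Sum>n\<in>tri (k + i) (u div 2 ^ i). g n) \<le> y * 2 ^ (k + i)"
  defines "\<kappa> \<equiv> \<lambda>m. hilbert_kernel (2 ^ K) m - hilbert_kernel (2 ^ k) m"
  shows "(\<Sum>n\<in>tri K (u div 2 ^ (K - k)). \<bar>\<kappa> (n - n') - \<kappa> (n - c)\<bar> * g n) \<le> 10 * y"
proof -
  let ?T = "tri K (u div 2 ^ (K - k))"
  have "0 \<le> (\<Sum>n\<in>tri (k + 0) (u div 2 ^ 0). g n)" by (intro sum_nonneg g)
  also have "\<dots> \<le> y * 2 ^ (k + 0)" by (rule y) simp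
  finally have "0 * 2 ^ (k + 0) \<le> y * 2 ^ (k + 0)" by simp
  then have y0: "y \<ge> 0" by (rule mult_right_le_imp_le) simp
  have "(\<Sum>n\<in>?T. \<bar>\<kappa> (n - n') - \<kappa> (n - c)\<bar> * g n) \<le>
    (\<Sum>n\<in>?T. ((\<Sum>i\<le>K - k. if n \<in> tri (k + i) (u div 2 ^ i) then 4 / (4 ^ i * 2 ^ k) else 0) + 2 / 2 ^ K) * g n)"
    unfolding \<kappa>_def by (intro sum_mono mult_right_mono kernel_difference_pointwise kK c g)
  also have "\<dots> = (\<Sum>n\<in>?T. \<Sum>i\<le>K - k. if n \<in> tri (k + i) (u div 2 ^ i) then 4 / (4 ^ i * 2 ^ k) * g n else 0) + 2 / 2 ^ K * (\<Sum>n\<in>?T. g n)"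
    by (simp add: distrib_right sum.distrib sum_distrib_left sum_distrib_right if_distrib if_distribR cong: if_cong)
  also have "(\<Sum>n\<in>?T. \<Sum>i\<le>K - k. if n \<in> tri (k + i) (u div 2 ^ i) then 4 / (4 ^ i * 2 ^ k) * g n else 0) =
      (\<Sum>i\<le>K - k. \<Sum>n\<in>?T. if n \<in> tri (k + i) (u div 2 ^ i) then 4 / (4 ^ i * 2 ^ k) * g n else 0)"
    by (rule sum.swap)
  also have "\<dots> \<le> (\<Sum>i\<le>K - k. 4 * y * (1 / 2) ^ i)"
  proof (rule sum_mono)
    fix i assume i: "i \<in> {..K - k}"
    have "(\<Sum>n\<in>?T. if n \<in> tri (k + i) (u div 2 ^ i) then 4 / (4 ^ i * 2 ^ k) * g n else 0) =
       (\<Sum>n\<in>?T \<inter> tri (k + i) (u div 2 ^ i). 4 / (4 ^ i * 2 ^ k) * g n)"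
      by (rule sum.inter_restrict[symmetric]) simp
    also have "\<dots> \<le> (\<Sum>n\<in>tri (k + i) (u div 2 ^ i). 4 / (4 ^ i * 2 ^ k) * g n)"
      by (intro sum_mono2) (auto intro!: divide_nonneg_nonneg mult_nonneg_nonneg g)
    also have "\<dots> = 4 / (4 ^ i * 2 ^ k) * (\<Sum>n\<in>tri (k + i) (u div 2 ^ i). g n)" by (simp add: sum_distrib_left)
    also have "\<dots> \<le> 4 / (4 ^ i * 2 ^ k) * (y * 2 ^ (k + i))" using i by (intro mult_left_mono y) auto
    also have "\<dots> = 4 * y * (1 / 2) ^ i"
    proof -
      have "(4::real) ^ i = 2 ^ i * 2 ^ i" by (simp flip: power_mult_distrib)
      then show ?thesis by (simp add: power_add field_simps)
    qed
    finally show "(\<Sum>n\<in>?T. if n \<in> tri (k + i) (u div 2 ^ i) then 4 / (4 ^ i * 2 ^ k) * g n else 0) \<le> 4 * y * (1 / 2) ^ i" .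
  qed
  also have "(\<Sum>i\<le>K - k. 4 * y * (1 / 2) ^ i) = 4 * y * (\<Sum>i\<le>K - k. (1 / 2) ^ i)" by (simp add: sum_distrib_left)
  also have "\<dots> \<le> 4 * y * 2"
  proof (rule mult_left_mono)
    have "(\<Sum>i\<le>m. (1 / 2 :: real) ^ i) \<le> 2 - (1/2) ^ m" for m by (induction m) auto
    from this[of "K - k"] show "(\<Sum>i\<le>K - k. (1 / 2 :: real) ^ i) \<le> 2"
      using zero_le_power[of "1/2::real" "K - k"] by linarith
  qed (use y0 in auto)
  also have "2 / 2 ^ K * (\<Sum>n\<in>?T. g n) \<le> 2 / 2 ^ K * (y * 2 ^ K)"
    using y[of "K - k"] kK by (intro mult_left_mono) auto
  also have "2 / 2 ^ K * (y * 2 ^ K) = 2 * y" by simp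
  finally show ?thesis by simp
qed

section \<open>The form on one dyadic interval\<close>

text \<open>\<open>F\<close> is restricted to the interval and \<open>G\<close> to its triple. By the truncation this is the
  complete interaction of the restricted \<open>F\<close> with \<open>G\<close>.\<close>

definition lform :: "nat \<Rightarrow> int \<Rightarrow> (int \<Rightarrow> 'a::real_inner) \<Rightarrow> (int \<Rightarrow> 'a) \<Rightarrow> real" where
  "lform k u F G = (\<Sum>n'\<in>dyad k u. \<Sum>n\<in>tri k u. hilbert_kernel (2 ^ k) (n - n') * (F n' \<bullet> G n))"

abbreviation dyad_of :: "nat \<times> int \<Rightarrow> int set" where "dyad_of p \<equiv> dyad (fst p) (snd p)"

text \<open>Since \<open>h\<close> has mean zero, \<open>\<kappa> (n - c)\<close> may be subtracted from the kernel.\<close>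

lemma mean_zero_form_le:
  fixes h G :: "int \<Rightarrow> 'a::real_inner" and \<kappa> :: "int \<Rightarrow> real"
  assumes "finite P" "finite T" "(\<Sum>n'\<in>P. h n') = 0"
    and M: "\<And>n'. n' \<in> P \<Longrightarrow> (\<Sum>n\<in>T. \<bar>\<kappa> (n - n') - \<kappa> (n - c)\<bar> * norm (G n)) \<le> M"
  shows "\<bar>\<Sum>n'\<in>P. \<Sum>n\<in>T. \<kappa> (n - n') * (h n' \<bullet> G n)\<bar> \<le> (\<Sum>n'\<in>P. norm (h n')) * M"
proof -
  have "(\<Sum>n'\<in>P. \<Sum>n\<in>T. \<kappa> (n - c) * (h n' \<bullet> G n)) = (\<Sum>n\<in>T. \<kappa> (n - c) * ((\<Sum>n'\<in>P. h n') \<bullet> G n))"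
    by (subst sum.swap) (simp add: inner_sum_left sum_distrib_left)
  also have "\<dots> = 0" using assms by simp
  finally have "(\<Sum>n'\<in>P. \<Sum>n\<in>T. \<kappa> (n - n') * (h n' \<bullet> G n)) = (\<Sum>n'\<in>P. \<Sum>n\<in>T. (\<kappa> (n - n') - \<kappa> (n - c)) * (h n' \<bullet> G n))"
    by (simp add: left_diff_distrib sum_subtractf)
  also have "\<bar>\<dots>\<bar> \<le> (\<Sum>n'\<in>P. \<Sum>n\<in>T. \<bar>\<kappa> (n - n') - \<kappa> (n - c)\<bar> * (norm (h n') * norm (G n)))"
    by (intro order_trans[OF sum_abs] sum_mono) (simp add: abs_mult Cauchy_Schwarz_ineq2 mult_left_mono)
  also have "\<dots> = (\<Sum>n'\<in>P. norm (h n') * (\<Sum>n\<in>T. \<bar>\<kappa> (n - n') - \<kappa> (n - c)\<bar> * norm (G n)))"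
    by (simp add: sum_distrib_left mult_ac)
  also have "\<dots> \<le> (\<Sum>n'\<in>P. norm (h n') * M)" by (intro sum_mono mult_left_mono M) auto
  finally show ?thesis by (simp add: sum_distrib_right)
qed

lemma sum_over_blocks:
  fixes h :: "int \<Rightarrow> real"
  assumes "finite Bs" "finite T" "\<And>p. p \<in> Bs \<Longrightarrow> dyad_of p \<subseteq> T"
    and "\<And>p p'. p \<in> Bs \<Longrightarrow> p' \<in> Bs \<Longrightarrow> p \<noteq> p' \<Longrightarrow> dyad_of p \<inter> dyad_of p' = {}"
    and "\<And>n. n \<in> T \<Longrightarrow> n \<notin> \<Union>(dyad_of ` Bs) \<Longrightarrow> h n = 0"
  shows "sum h T = (\<Sum>p\<in>Bs. sum h (dyad_of p))"
proof -
  have "sum h T = sum h (\<Union>(dyad_of ` Bs))" using assms by (intro sum.mono_neutral_right) auto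
  also have "\<dots> = (\<Sum>p\<in>Bs. sum h (dyad_of p))" using assms by (intro sum.UNION_disjoint) auto
  finally show ?thesis .
qed

lemma sum_card_blocks_le:
  assumes "finite Bs" "finite T" "\<And>p. p \<in> Bs \<Longrightarrow> dyad_of p \<subseteq> T"
    and "\<And>p p'. p \<in> Bs \<Longrightarrow> p' \<in> Bs \<Longrightarrow> p \<noteq> p' \<Longrightarrow> dyad_of p \<inter> dyad_of p' = {}"
  shows "(\<Sum>p\<in>Bs. (2::real) ^ fst p) \<le> real (card T)"
proof -
  have "(\<Sum>p\<in>Bs. (2::real) ^ fst p) = real (\<Sum>p\<in>Bs. card (dyad_of p))" by (simp add: card_dyad)
  also have "(\<Sum>p\<in>Bs. card (dyad_of p)) = card (\<Union>(dyad_of ` Bs))"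
    using assms by (intro card_UN_disjoint[symmetric]) auto
  also have "\<dots> \<le> card T" using assms by (intro card_mono) auto
  finally show ?thesis by simp
qed

lemma dyad_subset_or_disjoint:
  assumes "k \<le> K" "x \<in> dyad k u" "x \<in> dyad K U"
  shows "dyad k u \<subseteq> dyad K U" "u div 2 ^ (K - k) = U"
proof -
  have "x \<in> dyad (k + (K - k)) (u div 2 ^ (K - k))" by (rule dyad_ancestor[OF assms(2)])
  then show U: "u div 2 ^ (K - k) = U" using assms by (simp add: in_dyad_iff)
  show "dyad k u \<subseteq> dyad K U" using dyad_subset_ancestor[of k u "K - k"] assms U by simp
qed

text \<open>Truncating \<open>1/m\<close> changes it by at most \<open>1 / 2 ^ K\<close> per entry, which is harmless for bounded
  functions on \<open>O(2 ^ K)\<close> points. The complete kernel is handled by Hilbert's inequality.\<close>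

lemma truncated_hilbert_local:
  fixes F G :: "int \<Rightarrow> 'a::real_inner"
  assumes "x \<ge> 0" "y \<ge> 0" "\<And>n. n \<in> tri K U \<Longrightarrow> norm (F n) \<le> x" "\<And>n. n \<in> tri K U \<Longrightarrow> norm (G n) \<le> y"
  shows "\<bar>lform K U F G\<bar> \<le> 11 * (x * y * 2 ^ K)"
proof -
  define F' where "F' n = (if n \<in> dyad K U then F n else 0)" for n
  have IT: "dyad K U \<subseteq> tri K U" by (rule dyad_subset_tri)
  have F': "norm (F' n) \<le> (if n \<in> dyad K U then x else 0)" for n using assms(3) IT by (auto simp: F'_def)
  define e where "e m = 1 / real_of_int m - hilbert_kernel (2 ^ K) m" for m
  have e: "\<bar>e m\<bar> \<le> 1 / 2 ^ K" for m
  proof (cases "\<bar>m\<bar> < 2 ^ K")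
    case False
    then have "(2::int) ^ K \<le> \<bar>m\<bar>" by simp
    then have "real_of_int (2 ^ K) \<le> real_of_int \<bar>m\<bar>" by (simp only: of_int_le_iff)
    then have "1 / real_of_int \<bar>m\<bar> \<le> 1 / 2 ^ K" by (intro frac_le) auto
    then show ?thesis using False by (simp add: e_def hilbert_kernel_def)
  qed (simp add: e_def hilbert_kernel_def)
  have "lform K U F G = (\<Sum>n'\<in>tri K U. \<Sum>n\<in>tri K U. hilbert_kernel (2 ^ K) (n - n') * (F' n' \<bullet> G n))"
    unfolding lform_def using IT by (intro sum.mono_neutral_cong_left) (auto simp: F'_def)
  also have "\<dots> = (\<Sum>n'\<in>tri K U. \<Sum>n\<in>tri K U. 1 / real_of_int (n - n') * (F' n' \<bullet> G n)) - (\<Sum>n'\<in>tri K U. \<Sum>n\<in>tri K U. e (n - n') * (F' n' \<bullet> G n))"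
    by (simp only: sum_subtractf[symmetric] left_diff_distrib[symmetric] e_def) simp
  also have "\<bar>\<dots>\<bar> \<le> 8 * (x * y * 2 ^ K) + 3 * (x * y * 2 ^ K)"
  proof (rule order_trans[OF abs_triangle_ineq4], rule add_mono)
    have "\<bar>\<Sum>n'\<in>tri K U. \<Sum>n\<in>tri K U. 1 / real_of_int (n - n') * (F' n' \<bullet> G n)\<bar>
        \<le> 4 * sqrt (\<Sum>n\<in>tri K U. (norm (F' n))\<^sup>2) * sqrt (\<Sum>n\<in>tri K U. (norm (G n))\<^sup>2)"
      by (rule hilbert_inequality) simp
    also have "\<dots> \<le> 4 * sqrt (x\<^sup>2 * 2 ^ K) * sqrt (y\<^sup>2 * (3 * 2 ^ K))"
    proof (intro mult_mono real_sqrt_le_mono order_refl)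
      have "(\<Sum>n\<in>tri K U. (norm (F' n))\<^sup>2) \<le> (\<Sum>n\<in>tri K U. if n \<in> dyad K U then x\<^sup>2 else 0)"
        using F' assms by (intro sum_mono) (auto simp: F'_def intro!: power_mono)
      also have "\<dots> = (\<Sum>n\<in>tri K U \<inter> dyad K U. x\<^sup>2)" by (rule sum.inter_restrict[symmetric]) simp
      also have "tri K U \<inter> dyad K U = dyad K U" using IT by auto
      finally show "(\<Sum>n\<in>tri K U. (norm (F' n))\<^sup>2) \<le> x\<^sup>2 * 2 ^ K" by (simp add: card_dyad mult.commute)
      have "(\<Sum>n\<in>tri K U. (norm (G n))\<^sup>2) \<le> (\<Sum>n\<in>tri K U. y\<^sup>2)" using assms by (intro sum_mono power_mono) auto
      then show "(\<Sum>n\<in>tri K U. (norm (G n))\<^sup>2) \<le> y\<^sup>2 * (3 * 2 ^ K)" by (simp add: card_tri mult.commute)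
    qed (auto simp: sum_nonneg)
    also have "\<dots> = 4 * sqrt 3 * (x * y * 2 ^ K)" using assms by (simp add: real_sqrt_mult)
    also have "\<dots> \<le> 8 * (x * y * 2 ^ K)"
    proof (rule mult_right_mono)
      have "sqrt 3 \<le> 2" by (rule real_le_lsqrt) auto
      then show "4 * sqrt 3 \<le> (8::real)" by simp
    qed (use assms in auto)
    finally show "\<bar>\<Sum>n'\<in>tri K U. \<Sum>n\<in>tri K U. 1 / real_of_int (n - n') * (F' n' \<bullet> G n)\<bar> \<le> 8 * (x * y * 2 ^ K)" .
    have "\<bar>\<Sum>n'\<in>tri K U. \<Sum>n\<in>tri K U. e (n - n') * (F' n' \<bullet> G n)\<bar> \<le> (\<Sum>n'\<in>tri K U. \<Sum>n\<in>tri K U. 1 / 2 ^ K * ((if n' \<in> dyad K U then x else 0) * y))"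
    proof (intro order_trans[OF sum_abs] sum_mono)
      fix n' n assume n: "n \<in> tri K U"
      have "\<bar>F' n' \<bullet> G n\<bar> \<le> norm (F' n') * norm (G n)" by (rule Cauchy_Schwarz_ineq2)
      also have "\<dots> \<le> (if n' \<in> dyad K U then x else 0) * y" using F' assms n by (intro mult_mono) auto
      finally show "\<bar>e (n - n') * (F' n' \<bullet> G n)\<bar> \<le> 1 / 2 ^ K * ((if n' \<in> dyad K U then x else 0) * y)"
        unfolding abs_mult by (intro mult_mono e) auto
    qed
    also have "\<dots> = (\<Sum>n'\<in>tri K U. if n' \<in> dyad K U then 3 * x * y else 0)"
      by (intro sum.cong refl) (simp add: card_tri)
    also have "\<dots> = (\<Sum>n\<in>tri K U \<inter> dyad K U. 3 * x * y)" by (rule sum.inter_restrict[symmetric]) simp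
    also have "tri K U \<inter> dyad K U = dyad K U" using IT by auto
    finally show "\<bar>\<Sum>n'\<in>tri K U. \<Sum>n\<in>tri K U. e (n - n') * (F' n' \<bullet> G n)\<bar> \<le> 3 * (x * y * 2 ^ K)"
      by (simp add: card_dyad mult_ac)
  qed
  finally show ?thesis by simp
qed

lemma tri_eq_logw_range: "tri k u = {2 ^ k * u - 2 ^ k..<2 ^ k * u + 2 * 2 ^ k}"
  by (simp add: tri_def algebra_simps)

lemma dyad_eq_range: "dyad k u = {2 ^ k * u..<2 ^ k * u + 2 ^ k}"
  by (simp add: dyad_def algebra_simps)

text \<open>Let \<open>gF\<close> and \<open>gG\<close> be the good parts: they equal the mean of \<open>F\<close> resp. \<open>G\<close> on each stopping
  interval and agree with the function elsewhere, so they are bounded by multiples of \<open>x\<close> and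
  \<open>y\<close>. First \<open>F\<close> is replaced by \<open>gF\<close> while \<open>G\<close> is left as it is. On a stopping interval \<open>p\<close>
  the kernel splits into the truncation at the scale of \<open>p\<close> and a smooth remainder. Against
  the remainder the mean zero function \<open>F - aF p\<close> is small; the truncated part is \<open>lform\<close> on
  \<open>p\<close> itself, minus the same form of a constant, for which the kernel integrates to a
  logarithmic weight. Then \<open>G\<close> is replaced by \<open>gG\<close> in the same way. The form of \<open>gF\<close> and \<open>gG\<close>
  is a matter for \<open>\<ell>\<^sup>2\<close>. Keeping \<open>G\<close> in the first step is what makes the truncated parts
  reappear as forms of the original pair, so that the estimate can be iterated.\<close>

lemma local_estimate:
  fixes F G :: "int \<Rightarrow> 'a::real_inner" and Bs :: "(nat \<times> int) set"
  assumes Bs: "finite Bs" "\<And>p. p \<in> Bs \<Longrightarrow> fst p < K \<and> dyad_of p \<subseteq> tri K U"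
    and dj: "\<And>p p'. p \<in> Bs \<Longrightarrow> p' \<in> Bs \<Longrightarrow> p \<noteq> p' \<Longrightarrow> dyad_of p \<inter> dyad_of p' = {}"
    and off: "\<And>n. n \<in> tri K U \<Longrightarrow> n \<notin> \<Union>(dyad_of ` Bs) \<Longrightarrow> norm (F n) \<le> x \<and> norm (G n) \<le> y"
    and pF: "\<And>p i. p \<in> Bs \<Longrightarrow> i \<le> K - fst p \<Longrightarrow>
      (\<Sum>n\<in>tri (fst p + i) (snd p div 2 ^ i). norm (F n) * sqrt (norm (F n))) \<le> 6 * 2 ^ (fst p + i) * (x * sqrt x)"
    and pG: "\<And>p i. p \<in> Bs \<Longrightarrow> i \<le> K - fst p \<Longrightarrow>
      (\<Sum>n\<in>tri (fst p + i) (snd p div 2 ^ i). norm (G n) * sqrt (norm (G n))) \<le> 6 * 2 ^ (fst p + i) * (y * sqrt y)"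
    and xy: "x \<ge> 0" "y \<ge> 0"
  defines "BI \<equiv> {p\<in>Bs. dyad_of p \<subseteq> dyad K U}"
  shows "\<bar>lform K U F G - (\<Sum>p\<in>BI. lform (fst p) (snd p) F G)\<bar> \<le> 3000000 * (x * y * 2 ^ K)"
proof -
  define I where "I = dyad K U"
  define T where "T = tri K U"
  have fIT: "finite I" "finite T" and IT: "I \<subseteq> T" by (simp_all add: I_def T_def dyad_subset_tri)
  have fBI: "finite BI" and BIBs: "BI \<subseteq> Bs" using Bs by (auto simp: BI_def)
  \<comment> \<open>the weight of the truncated kernel integrated over \<open>p\<close>\<close>
  define W where "W p n = logw (2 ^ fst p * snd p) (2 ^ fst p) n" for p n
  have W0: "W p n \<ge> 0" for p n by (simp add: W_def logw_nonneg)
  have W3: "(\<Sum>n\<in>tri (fst p) (snd p). W p n ^ 3) \<le> 5120 * 2 ^ fst p" for p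
    using logw_cube_sum[of "2 ^ fst p" "2 ^ fst p * snd p"] by (simp add: W_def tri_eq_logw_range)
  \<comment> \<open>control of the power 3/2 implies control of the mean, by Young with the weight 1\<close>
  have sF: "(\<Sum>n\<in>tri (fst p + i) (snd p div 2 ^ i). norm (F n)) \<le> 9 * x * 2 ^ (fst p + i)" if "p \<in> Bs" "i \<le> K - fst p" for p i
    using sum_young_le[of "tri (fst p + i) (snd p div 2 ^ i)" "\<lambda>n. norm (F n)" "\<lambda>_. 1" x, OF _ _ _ _ pF[OF that]] xy
    by (simp add: card_tri algebra_simps)
  have sG: "(\<Sum>n\<in>tri (fst p + i) (snd p div 2 ^ i). norm (G n)) \<le> 9 * y * 2 ^ (fst p + i)" if "p \<in> Bs" "i \<le> K - fst p" for p i
    using sum_young_le[of "tri (fst p + i) (snd p div 2 ^ i)" "\<lambda>n. norm (G n)" "\<lambda>_. 1" y, OF _ _ _ _ pG[OF that]] xy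
    by (simp add: card_tri algebra_simps)
  have GW: "(\<Sum>n\<in>tri (fst p) (snd p). norm (G n) * W p n) \<le> 5126 * y * 2 ^ fst p" if "p \<in> Bs" for p
  proof -
    have "(\<Sum>n\<in>tri (fst p) (snd p). norm (G n) * W p n) \<le> y * (6 * 2 ^ fst p + (\<Sum>n\<in>tri (fst p) (snd p). W p n ^ 3))"
      using pG[OF that, of 0] xy W0 by (intro sum_young_le) auto
    also have "\<dots> \<le> y * (6 * 2 ^ fst p + 5120 * 2 ^ fst p)" using W3 xy by (intro mult_left_mono add_left_mono) auto
    finally show ?thesis by simp
  qed
  have W1: "(\<Sum>n\<in>dyad_of p. W p n) \<le> 5121 * 2 ^ fst p" for p
  proof -
    have "(\<Sum>n\<in>dyad_of p. W p n) \<le> (\<Sum>n\<in>dyad_of p. 1 + W p n ^ 3)"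
    proof (rule sum_mono)
      fix n
      show "W p n \<le> 1 + W p n ^ 3"
      proof (cases "W p n \<le> 1")
        case True then show ?thesis using W0[of p n] by (simp add: add_increasing2)
      next
        case False
        then have "W p n ^ 1 \<le> W p n ^ 3" by (intro power_increasing) auto
        then show ?thesis by simp
      qed
    qed
    also have "\<dots> = 2 ^ fst p + (\<Sum>n\<in>dyad_of p. W p n ^ 3)" by (simp add: sum.distrib card_dyad)
    also have "(\<Sum>n\<in>dyad_of p. W p n ^ 3) \<le> (\<Sum>n\<in>tri (fst p) (snd p). W p n ^ 3)"
      using dyad_subset_tri W0 by (intro sum_mono2) auto
    finally show ?thesis using W3[of p] by simp
  qed
  have dF: "(\<Sum>n\<in>dyad_of p. norm (F n)) \<le> 9 * x * 2 ^ fst p" if "p \<in> Bs" for p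
    using order_trans[OF sum_mono2 sF[OF that, of 0]] dyad_subset_tri[of "fst p" "snd p"] by simp
  have dG: "(\<Sum>n\<in>dyad_of p. norm (G n)) \<le> 9 * y * 2 ^ fst p" if "p \<in> Bs" for p
    using order_trans[OF sum_mono2 sG[OF that, of 0]] dyad_subset_tri[of "fst p" "snd p"] by simp
  define aF where "aF p = (1 / 2 ^ fst p) *\<^sub>R (\<Sum>n\<in>dyad_of p. F n)" for p
  define aG where "aG p = (1 / 2 ^ fst p) *\<^sub>R (\<Sum>n\<in>dyad_of p. G n)" for p
  have aF: "norm (aF p) \<le> 9 * x" if "p \<in> Bs" for p
    using order_trans[OF norm_sum dF[OF that]] by (simp add: aF_def field_simps)
  have aG: "norm (aG p) \<le> 9 * y" if "p \<in> Bs" for p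
    using order_trans[OF norm_sum dG[OF that]] by (simp add: aG_def field_simps)
  have zF: "(\<Sum>n\<in>dyad_of p. F n - aF p) = 0" for p
  proof -
    have "(\<Sum>n\<in>dyad_of p. aF p) = (real (card (dyad_of p))) *\<^sub>R aF p" by (rule sum_constant_scaleR)
    then show ?thesis by (simp add: sum_subtractf card_dyad aF_def)
  qed
  have zG: "(\<Sum>n\<in>dyad_of p. G n - aG p) = 0" for p
  proof -
    have "(\<Sum>n\<in>dyad_of p. aG p) = (real (card (dyad_of p))) *\<^sub>R aG p" by (rule sum_constant_scaleR)
    then show ?thesis by (simp add: sum_subtractf card_dyad aG_def)
  qed
  have oF: "(\<Sum>n\<in>dyad_of p. norm (F n - aF p)) \<le> 18 * x * 2 ^ fst p" if "p \<in> Bs" for p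
  proof -
    have "(\<Sum>n\<in>dyad_of p. norm (F n - aF p)) \<le> (\<Sum>n\<in>dyad_of p. norm (F n) + 9 * x)"
      using aF[OF that] by (intro sum_mono order_trans[OF norm_triangle_ineq4]) simp
    then show ?thesis using dF[OF that] by (simp add: sum.distrib card_dyad algebra_simps)
  qed
  have oG: "(\<Sum>n\<in>dyad_of p. norm (G n - aG p)) \<le> 18 * y * 2 ^ fst p" if "p \<in> Bs" for p
  proof -
    have "(\<Sum>n\<in>dyad_of p. norm (G n - aG p)) \<le> (\<Sum>n\<in>dyad_of p. norm (G n) + 9 * y)"
      using aG[OF that] by (intro sum_mono order_trans[OF norm_triangle_ineq4]) simp
    then show ?thesis using dG[OF that] by (simp add: sum.distrib card_dyad algebra_simps)
  qed

  \<comment> \<open>the stopping interval containing \<open>n\<close>, unique by disjointness\<close>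
  define st where "st n = (SOME p. p \<in> Bs \<and> n \<in> dyad_of p)" for n
  have st: "st n = p" if "p \<in> Bs" "n \<in> dyad_of p" for n p
  proof -
    have "st n \<in> Bs \<and> n \<in> dyad_of (st n)" unfolding st_def by (rule someI[of _ p]) (use that in auto)
    then show ?thesis using dj[of "st n" p] that by auto
  qed
  define gF where "gF n = (if n \<in> \<Union>(dyad_of ` Bs) then aF (st n) else F n)" for n
  define gG where "gG n = (if n \<in> \<Union>(dyad_of ` Bs) then aG (st n) else G n)" for n
  have gFp: "gF n = aF p" and gGp: "gG n = aG p" if "p \<in> Bs" "n \<in> dyad_of p" for n p
    using that st[OF that] by (auto simp: gF_def gG_def)
  have gFle: "norm (gF n) \<le> 9 * x" if "n \<in> T" for n
  proof (cases "n \<in> \<Union>(dyad_of ` Bs)")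
    case True
    then obtain p where p: "p \<in> Bs" "n \<in> dyad_of p" by auto
    then show ?thesis using aF gFp by simp
  next
    case False
    have "x \<le> 9 * x" using xy by simp
    then show ?thesis using False off[of n] that by (auto simp: gF_def T_def)
  qed
  have gGle: "norm (gG n) \<le> 9 * y" if "n \<in> T" for n
  proof (cases "n \<in> \<Union>(dyad_of ` Bs)")
    case True
    then obtain p where p: "p \<in> Bs" "n \<in> dyad_of p" by auto
    then show ?thesis using aG gGp by simp
  next
    case False
    have "y \<le> 9 * y" using xy by simp
    then show ?thesis using False off[of n] that by (auto simp: gG_def T_def)
  qed
  define t where "t = hilbert_kernel (2 ^ K)"
  define tp where "tp p = hilbert_kernel (2 ^ fst p)" for p :: "nat \<times> int"
  define \<kappa> where "\<kappa> p m = t m - tp p m" for p m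
  have tsplit: "t m = tp p m + \<kappa> p m" for p m by (simp add: \<kappa>_def)

  define X where "X p = (\<Sum>n'\<in>dyad_of p. \<Sum>n\<in>T. \<kappa> p (n - n') * ((F n' - aF p) \<bullet> G n))" for p
  have ancestor: "snd p div 2 ^ (K - fst p) = U" "tri (fst p) (snd p) \<subseteq> T" if "p \<in> BI" for p
  proof -
    have p: "p \<in> Bs" "dyad_of p \<subseteq> dyad K U" "fst p < K" using that Bs by (auto simp: BI_def)
    have "2 ^ fst p * snd p \<in> dyad_of p" by (simp add: dyad_def)
    then show a: "snd p div 2 ^ (K - fst p) = U" using dyad_subset_or_disjoint(2)[of "fst p" K] p by (meson less_imp_le subsetD)
    show "tri (fst p) (snd p) \<subseteq> T"
      using tri_subset_tri_parent[of "fst p" "snd p" "K - fst p"] p a by (simp add: T_def)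
  qed
  have "lform K U F G - lform K U gF G = (\<Sum>n'\<in>I. \<Sum>n\<in>T. t (n - n') * ((F n' - gF n') \<bullet> G n))"
    by (simp add: lform_def I_def T_def t_def sum_subtractf inner_diff_left right_diff_distrib)
  also have "\<dots> = (\<Sum>p\<in>BI. \<Sum>n'\<in>dyad_of p. \<Sum>n\<in>T. t (n - n') * ((F n' - gF n') \<bullet> G n))"
  proof (rule sum_over_blocks[OF fBI fIT(1)])
    fix n assume n: "n \<in> I" "n \<notin> \<Union>(dyad_of ` BI)"
    have "n \<notin> \<Union>(dyad_of ` Bs)"
    proof
      assume "n \<in> \<Union>(dyad_of ` Bs)"
      then obtain p where p: "p \<in> Bs" "n \<in> dyad_of p" by auto
      then have "dyad_of p \<subseteq> dyad K U" using dyad_subset_or_disjoint(1)[of "fst p" K n] Bs n by (simp add: I_def less_imp_le)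
      then show False using p n by (auto simp: BI_def)
    qed
    then show "(\<Sum>n'\<in>T. t (n' - n) * ((F n - gF n) \<bullet> G n')) = 0" by (simp add: gF_def)
  qed (use dj BIBs in \<open>auto simp: BI_def I_def\<close>)
  also have "\<dots> = (\<Sum>p\<in>BI. lform (fst p) (snd p) F G - lform (fst p) (snd p) (\<lambda>_. aF p) G + X p)"
  proof (rule sum.cong[OF refl])
    fix p assume p: "p \<in> BI"
    then have pB: "p \<in> Bs" using BIBs by auto
    have "(\<Sum>n'\<in>dyad_of p. \<Sum>n\<in>T. t (n - n') * ((F n' - gF n') \<bullet> G n)) = (\<Sum>n'\<in>dyad_of p. \<Sum>n\<in>T. t (n - n') * ((F n' - aF p) \<bullet> G n))"
      by (intro sum.cong refl) (simp add: gFp[OF pB])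
    also have "\<dots> = (\<Sum>n'\<in>dyad_of p. \<Sum>n\<in>T. tp p (n - n') * ((F n' - aF p) \<bullet> G n)) + X p"
      by (simp only: X_def tsplit[of _ p] distrib_right sum.distrib)
    also have "(\<Sum>n'\<in>dyad_of p. \<Sum>n\<in>T. tp p (n - n') * ((F n' - aF p) \<bullet> G n)) = (\<Sum>n'\<in>dyad_of p. \<Sum>n\<in>tri (fst p) (snd p). tp p (n - n') * ((F n' - aF p) \<bullet> G n))"
    proof (rule sum.cong[OF refl])
      fix n' assume n': "n' \<in> dyad_of p"
      show "(\<Sum>n\<in>T. tp p (n - n') * ((F n' - aF p) \<bullet> G n)) = (\<Sum>n\<in>tri (fst p) (snd p). tp p (n - n') * ((F n' - aF p) \<bullet> G n))"
      proof (rule sum.mono_neutral_right[OF fIT(2) ancestor(2)[OF p]])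
        show "\<forall>n\<in>T - tri (fst p) (snd p). tp p (n - n') * ((F n' - aF p) \<bullet> G n) = 0"
        proof
          fix n assume "n \<in> T - tri (fst p) (snd p)"
          then have "\<not> \<bar>n' - n\<bar> < 2 ^ fst p" using tri_nbhd[OF n', of n] by auto
          then show "tp p (n - n') * ((F n' - aF p) \<bullet> G n) = 0" by (simp add: tp_def hilbert_kernel_def abs_minus_commute)
        qed
      qed
    qed
    also have "\<dots> = lform (fst p) (snd p) F G - lform (fst p) (snd p) (\<lambda>_. aF p) G"
      by (simp add: lform_def tp_def sum_subtractf inner_diff_left right_diff_distrib)
    finally show "(\<Sum>n'\<in>dyad_of p. \<Sum>n\<in>T. t (n - n') * ((F n' - gF n') \<bullet> G n)) = lform (fst p) (snd p) F G - lform (fst p) (snd p) (\<lambda>_. aF p) G + X p" .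
  qed
  finally have stepA: "lform K U F G - (\<Sum>p\<in>BI. lform (fst p) (snd p) F G) =
      lform K U gF G - (\<Sum>p\<in>BI. lform (fst p) (snd p) (\<lambda>_. aF p) G) + (\<Sum>p\<in>BI. X p)"
    by (simp add: sum.distrib sum_subtractf)
  have Xle: "\<bar>X p\<bar> \<le> 1620 * (x * y * 2 ^ fst p)" if p: "p \<in> BI" for p
  proof -
    have pB: "p \<in> Bs" using BIBs p by auto
    define c where "c = 2 ^ fst p * snd p"
    have c: "c \<in> dyad_of p" by (simp add: c_def dyad_def)
    have "\<bar>X p\<bar> \<le> (\<Sum>n'\<in>dyad_of p. norm (F n' - aF p)) * (10 * (9 * y))"
      unfolding X_def
    proof (rule mean_zero_form_le[where c = c])
      fix n' assume n': "n' \<in> dyad_of p"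
      have "(\<Sum>n\<in>tri K (snd p div 2 ^ (K - fst p)). \<bar>(hilbert_kernel (2 ^ K) (n - n') - hilbert_kernel (2 ^ fst p) (n - n')) - (hilbert_kernel (2 ^ K) (n - c) - hilbert_kernel (2 ^ fst p) (n - c))\<bar> * norm (G n)) \<le> 10 * (9 * y)"
        by (rule kernel_difference_sum) (use c n' Bs pB sG[OF pB] in auto)
      then show "(\<Sum>n\<in>T. \<bar>\<kappa> p (n - n') - \<kappa> p (n - c)\<bar> * norm (G n)) \<le> 10 * (9 * y)"
        using ancestor(1)[OF p] by (simp add: T_def \<kappa>_def t_def tp_def)
    qed (use fIT zF in auto)
    also have "\<dots> \<le> (18 * x * 2 ^ fst p) * (10 * (9 * y))" using oF[OF pB] xy by (intro mult_right_mono) auto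
    finally show ?thesis by (simp add: mult_ac)
  qed
  have Yle: "\<bar>lform (fst p) (snd p) (\<lambda>_. aF p) G\<bar> \<le> 46134 * (x * y * 2 ^ fst p)" if pB: "p \<in> Bs" for p
  proof -
    have "lform (fst p) (snd p) (\<lambda>_. aF p) G = (\<Sum>n\<in>tri (fst p) (snd p). (\<Sum>n'\<in>dyad_of p. hilbert_kernel (2 ^ fst p) (n - n')) * (aF p \<bullet> G n))"
      unfolding lform_def by (subst sum.swap) (simp add: sum_distrib_right)
    also have "\<bar>\<dots>\<bar> \<le> (\<Sum>n\<in>tri (fst p) (snd p). W p n * (9 * x * norm (G n)))"
    proof (intro order_trans[OF sum_abs] sum_mono)
      fix n assume n: "n \<in> tri (fst p) (snd p)"
      have "\<bar>\<Sum>n'\<in>dyad_of p. hilbert_kernel (2 ^ fst p) (n - n')\<bar> \<le> W p n"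
        using sum_hilbert_kernel_block_le[of "2 ^ fst p" n "2 ^ fst p * snd p"] n by (simp add: W_def dyad_eq_range tri_eq_logw_range)
      moreover have "\<bar>aF p \<bullet> G n\<bar> \<le> 9 * x * norm (G n)"
        by (rule order_trans[OF Cauchy_Schwarz_ineq2]) (use aF[OF pB] in \<open>auto intro: mult_right_mono\<close>)
      ultimately show "\<bar>(\<Sum>n'\<in>dyad_of p. hilbert_kernel (2 ^ fst p) (n - n')) * (aF p \<bullet> G n)\<bar> \<le> W p n * (9 * x * norm (G n))"
        unfolding abs_mult using W0 by (intro mult_mono) auto
    qed
    also have "\<dots> = 9 * x * (\<Sum>n\<in>tri (fst p) (snd p). norm (G n) * W p n)" by (simp add: sum_distrib_left mult_ac)
    also have "\<dots> \<le> 9 * x * (5126 * y * 2 ^ fst p)" using GW[OF pB] xy by (intro mult_left_mono) auto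
    finally show ?thesis by (simp add: mult_ac)
  qed

  define V where "V p = (\<Sum>n\<in>dyad_of p. \<Sum>n'\<in>I. t (n - n') * (gF n' \<bullet> (G n - aG p)))" for p
  have "lform K U gF G - lform K U gF gG = (\<Sum>n'\<in>I. \<Sum>n\<in>T. t (n - n') * (gF n' \<bullet> (G n - gG n)))"
    by (simp add: lform_def I_def T_def t_def sum_subtractf inner_diff_right right_diff_distrib)
  also have "\<dots> = (\<Sum>n\<in>T. \<Sum>n'\<in>I. t (n - n') * (gF n' \<bullet> (G n - gG n)))" by (rule sum.swap)
  also have "\<dots> = (\<Sum>p\<in>Bs. \<Sum>n\<in>dyad_of p. \<Sum>n'\<in>I. t (n - n') * (gF n' \<bullet> (G n - gG n)))"
    by (rule sum_over_blocks[OF Bs(1) fIT(2)]) (use Bs dj in \<open>auto simp: T_def gG_def\<close>)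
  also have "\<dots> = (\<Sum>p\<in>Bs. V p)" unfolding V_def by (intro sum.cong refl) (simp add: gGp)
  finally have stepB: "lform K U gF G = lform K U gF gG + (\<Sum>p\<in>Bs. V p)" by simp
  have Vle: "\<bar>V p\<bar> \<le> 927540 * (x * y * 2 ^ fst p)" if pB: "p \<in> Bs" for p
  proof -
    define u where "u = snd p div 2 ^ (K - fst p)"
    define c where "c = 2 ^ fst p * snd p"
    have c: "c \<in> dyad_of p" by (simp add: c_def dyad_def)
    have pK: "fst p < K" "dyad_of p \<subseteq> T" using Bs pB by (auto simp: T_def)
    have cu: "c \<in> dyad K u" using dyad_ancestor[OF c, of "K - fst p"] pK by (simp add: u_def)
    have "c \<in> tri K U" using c pK by (auto simp: T_def)
    then have uU: "u \<in> {U - 1, U, U + 1}" using cu by (simp add: in_tri_iff in_dyad_iff)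
    have IT': "I \<subseteq> tri K u" using uU by (auto simp: I_def in_dyad_iff in_tri_iff)
    define gI where "gI n = (if n \<in> I then gF n else 0)" for n
    have gI: "norm (gI n) \<le> 9 * x" for n using gFle IT xy by (auto simp: gI_def)
    define V1 where "V1 = (\<Sum>n\<in>dyad_of p. \<Sum>n'\<in>I. tp p (n - n') * (gF n' \<bullet> (G n - aG p)))"
    define V2 where "V2 = (\<Sum>n\<in>dyad_of p. \<Sum>n'\<in>I. \<kappa> p (n - n') * (gF n' \<bullet> (G n - aG p)))"
    have "V p = V1 + V2" by (simp only: V_def V1_def V2_def tsplit[of _ p] distrib_right sum.distrib)
    moreover have "\<bar>V2\<bar> \<le> 4860 * (x * y * 2 ^ fst p)"
    proof -
      have neg: "\<kappa> p (n - n') = - \<kappa> p (n' - n)" for n n'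
      proof -
        have "n - n' = - (n' - n)" by simp
        then show ?thesis unfolding \<kappa>_def t_def tp_def by (simp only: hilbert_kernel_minus)
      qed
      have "V2 = (\<Sum>n\<in>dyad_of p. \<Sum>n'\<in>tri K u. \<kappa> p (n - n') * (gI n' \<bullet> (G n - aG p)))"
        unfolding V2_def using IT' by (intro sum.cong refl sum.mono_neutral_cong_left) (auto simp: gI_def)
      also have "\<dots> = (\<Sum>n\<in>dyad_of p. \<Sum>n'\<in>tri K u. - (\<kappa> p (n' - n) * ((G n - aG p) \<bullet> gI n')))"
      proof (rule sum.cong[OF refl], rule sum.cong[OF refl])
        fix n n'
        show "\<kappa> p (n - n') * (gI n' \<bullet> (G n - aG p)) = - (\<kappa> p (n' - n) * ((G n - aG p) \<bullet> gI n'))"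
          using neg[of n n'] by (simp add: inner_commute)
      qed
      also have "\<dots> = - (\<Sum>n\<in>dyad_of p. \<Sum>n'\<in>tri K u. \<kappa> p (n' - n) * ((G n - aG p) \<bullet> gI n'))"
        by (simp only: sum_negf)
      finally have "\<bar>V2\<bar> = \<bar>\<Sum>n\<in>dyad_of p. \<Sum>n'\<in>tri K u. \<kappa> p (n' - n) * ((G n - aG p) \<bullet> gI n')\<bar>" by simp
      also have "\<dots> \<le> (\<Sum>n\<in>dyad_of p. norm (G n - aG p)) * (10 * (27 * x))"
      proof (rule mean_zero_form_le[where c = c])
        fix n' assume n': "n' \<in> dyad_of p"
        have "(\<Sum>n\<in>tri K (snd p div 2 ^ (K - fst p)). \<bar>(hilbert_kernel (2 ^ K) (n - n') - hilbert_kernel (2 ^ fst p) (n - n')) - (hilbert_kernel (2 ^ K) (n - c) - hilbert_kernel (2 ^ fst p) (n - c))\<bar> * norm (gI n)) \<le> 10 * (27 * x)"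
        proof (rule kernel_difference_sum)
          fix i
          have "(\<Sum>n\<in>tri (fst p + i) (snd p div 2 ^ i). norm (gI n)) \<le> (\<Sum>n\<in>tri (fst p + i) (snd p div 2 ^ i). 9 * x)"
            by (intro sum_mono gI)
          then show "(\<Sum>n\<in>tri (fst p + i) (snd p div 2 ^ i). norm (gI n)) \<le> 27 * x * 2 ^ (fst p + i)"
            by (simp add: card_tri mult_ac)
        qed (use c n' pK in auto)
        then show "(\<Sum>n\<in>tri K u. \<bar>\<kappa> p (n - n') - \<kappa> p (n - c)\<bar> * norm (gI n)) \<le> 10 * (27 * x)"
          by (simp add: u_def \<kappa>_def t_def tp_def)
      qed (use zG in auto)
      also have "\<dots> \<le> (18 * y * 2 ^ fst p) * (10 * (27 * x))" using oG[OF pB] xy by (intro mult_right_mono) auto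
      finally show ?thesis by (simp add: mult_ac)
    qed
    moreover have "\<bar>V1\<bar> \<le> 922680 * (x * y * 2 ^ fst p)"
    proof -
      have inner: "norm (\<Sum>n'\<in>I. tp p (n - n') *\<^sub>R gF n') \<le> 18 * x * W p n" if n: "n \<in> dyad_of p" for n
      proof -
        have "(\<Sum>n'\<in>I. tp p (n - n') *\<^sub>R gF n') = (\<Sum>n'\<in>I \<inter> dyad_of p. tp p (n - n') *\<^sub>R gF n') + (\<Sum>n'\<in>I - dyad_of p. tp p (n - n') *\<^sub>R gF n')"
          by (rule sum.Int_Diff[OF fIT(1)])
        moreover have "norm (\<Sum>n'\<in>I \<inter> dyad_of p. tp p (n - n') *\<^sub>R gF n') \<le> 9 * x * W p n"
        proof (cases "I \<inter> dyad_of p = {}")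
          case True then show ?thesis using xy W0 by simp
        next
          case False
          then obtain z where "z \<in> I" "z \<in> dyad_of p" by auto
          then have "dyad_of p \<subseteq> I" using dyad_subset_or_disjoint(1)[of "fst p" K z] pK by (simp add: I_def less_imp_le)
          then have "I \<inter> dyad_of p = dyad_of p" by auto
          then have "(\<Sum>n'\<in>I \<inter> dyad_of p. tp p (n - n') *\<^sub>R gF n') = (\<Sum>n'\<in>dyad_of p. tp p (n - n')) *\<^sub>R aF p"
            by (simp add: gFp[OF pB] scaleR_sum_left)
          moreover have "\<bar>\<Sum>n'\<in>dyad_of p. tp p (n - n')\<bar> \<le> W p n"
            using sum_hilbert_kernel_block_le[of "2 ^ fst p" n "2 ^ fst p * snd p"] n dyad_subset_tri[of "fst p" "snd p"]
            by (simp add: W_def dyad_eq_range tri_eq_logw_range tp_def subset_iff)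
          ultimately have "norm (\<Sum>n'\<in>I \<inter> dyad_of p. tp p (n - n') *\<^sub>R gF n') \<le> W p n * (9 * x)"
            using aF[OF pB] W0[of p n] xy by (simp only: norm_scaleR) (intro mult_mono; simp)
          then show ?thesis by (simp add: mult.commute)
        qed
        moreover have "norm (\<Sum>n'\<in>I - dyad_of p. tp p (n - n') *\<^sub>R gF n') \<le> 9 * x * W p n"
        proof -
          have "norm (\<Sum>n'\<in>I - dyad_of p. tp p (n - n') *\<^sub>R gF n') \<le> (\<Sum>n'\<in>I - dyad_of p. (if n' \<in> tri (fst p) (snd p) then 1 / real_of_int \<bar>n - n'\<bar> else 0) * (9 * x))"
          proof (intro order_trans[OF norm_sum] sum_mono)
            fix n' assume n': "n' \<in> I - dyad_of p"
            have "\<bar>tp p (n - n')\<bar> \<le> (if n' \<in> tri (fst p) (snd p) then 1 / real_of_int \<bar>n - n'\<bar> else 0)"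
            proof (cases "n' \<in> tri (fst p) (snd p)")
              case True then show ?thesis using abs_hilbert_kernel_le[of "2 ^ fst p" "n - n'"] by (simp add: tp_def)
            next
              case False
              then have "\<not> \<bar>n - n'\<bar> < 2 ^ fst p" using tri_nbhd[OF n, of n'] by auto
              then show ?thesis using False by (simp add: tp_def hilbert_kernel_def)
            qed
            then show "norm (tp p (n - n') *\<^sub>R gF n') \<le> (if n' \<in> tri (fst p) (snd p) then 1 / real_of_int \<bar>n - n'\<bar> else 0) * (9 * x)"
              unfolding norm_scaleR using gFle[of n'] n' IT by (intro mult_mono) auto
          qed
          also have "\<dots> = 9 * x * (\<Sum>n'\<in>(I - dyad_of p) \<inter> tri (fst p) (snd p). 1 / real_of_int \<bar>n - n'\<bar>)"
          proof -
            have "(\<Sum>n'\<in>I - dyad_of p. (if n' \<in> tri (fst p) (snd p) then 1 / real_of_int \<bar>n - n'\<bar> else 0) * (9 * x)) =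
                9 * x * (\<Sum>n'\<in>I - dyad_of p. if n' \<in> tri (fst p) (snd p) then 1 / real_of_int \<bar>n - n'\<bar> else 0)"
              unfolding sum_distrib_left by (rule sum.cong[OF refl]) (rule mult.commute)
            also have "(\<Sum>n'\<in>I - dyad_of p. if n' \<in> tri (fst p) (snd p) then 1 / real_of_int \<bar>n - n'\<bar> else 0) =
                (\<Sum>n'\<in>(I - dyad_of p) \<inter> tri (fst p) (snd p). 1 / real_of_int \<bar>n - n'\<bar>)"
              using fIT by (intro sum.inter_restrict[symmetric]) auto
            finally show ?thesis .
          qed
          also have "(\<Sum>n'\<in>(I - dyad_of p) \<inter> tri (fst p) (snd p). 1 / real_of_int \<bar>n - n'\<bar>) \<le> (\<Sum>n'\<in>tri (fst p) (snd p) - dyad_of p. 1 / real_of_int \<bar>n - n'\<bar>)"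
            by (intro sum_mono2) auto
          also have "\<dots> \<le> W p n"
            using sum_inverse_neighbours_le[of "2 ^ fst p" n "2 ^ fst p * snd p"] n by (simp add: W_def dyad_eq_range tri_eq_logw_range)
          finally show ?thesis using xy by (simp add: mult_left_mono)
        qed
        ultimately show ?thesis
          using norm_triangle_ineq[of "\<Sum>n'\<in>I \<inter> dyad_of p. tp p (n - n') *\<^sub>R gF n'" "\<Sum>n'\<in>I - dyad_of p. tp p (n - n') *\<^sub>R gF n'"] by simp
      qed
      have "V1 = (\<Sum>n\<in>dyad_of p. (\<Sum>n'\<in>I. tp p (n - n') *\<^sub>R gF n') \<bullet> (G n - aG p))"
        by (simp add: V1_def inner_sum_left)
      also have "\<bar>\<dots>\<bar> \<le> (\<Sum>n\<in>dyad_of p. (18 * x * W p n) * (norm (G n) + 9 * y))"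
      proof (intro order_trans[OF sum_abs] sum_mono order_trans[OF Cauchy_Schwarz_ineq2] mult_mono inner)
        fix n
        show "norm (G n - aG p) \<le> norm (G n) + 9 * y" using norm_triangle_ineq4[of "G n" "aG p"] aG[OF pB] by linarith
      qed (use xy W0 in auto)
      also have "\<dots> = 18 * x * ((\<Sum>n\<in>dyad_of p. norm (G n) * W p n) + 9 * y * (\<Sum>n\<in>dyad_of p. W p n))"
      proof -
        have "(18 * x * W p n) * (norm (G n) + 9 * y) = 18 * x * (norm (G n) * W p n + 9 * y * W p n)" for n
          by (simp add: algebra_simps)
        then show ?thesis by (simp only: sum_distrib_left[symmetric] sum.distrib)
      qed
      also have "\<dots> \<le> 18 * x * (5126 * y * 2 ^ fst p + 9 * y * (5126 * 2 ^ fst p))"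
      proof (intro mult_left_mono add_mono)
        have "(\<Sum>n\<in>dyad_of p. norm (G n) * W p n) \<le> (\<Sum>n\<in>tri (fst p) (snd p). norm (G n) * W p n)"
          using dyad_subset_tri W0 by (intro sum_mono2) auto
        then show "(\<Sum>n\<in>dyad_of p. norm (G n) * W p n) \<le> 5126 * y * 2 ^ fst p" using GW[OF pB] by simp
        have "(\<Sum>n\<in>dyad_of p. W p n) \<le> 5121 * 2 ^ fst p" by (rule W1)
        also have "\<dots> \<le> 5126 * 2 ^ fst p" by simp
        finally show "(\<Sum>n\<in>dyad_of p. W p n) \<le> 5126 * 2 ^ fst p" .
      qed (use xy in auto)
      finally show ?thesis by (simp add: mult_ac)
    qed
    ultimately show ?thesis by linarith
  qed
  have main: "\<bar>lform K U gF gG\<bar> \<le> 891 * (x * y * 2 ^ K)"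
    using truncated_hilbert_local[of "9 * x" "9 * y" K U gF gG] gFle gGle xy by (simp add: T_def)
  have cI: "(\<Sum>p\<in>BI. (2::real) ^ fst p) \<le> 2 ^ K"
    using sum_card_blocks_le[OF fBI fIT(1)] dj BIBs by (auto simp: BI_def I_def card_dyad)
  have cT: "(\<Sum>p\<in>Bs. (2::real) ^ fst p) \<le> 3 * 2 ^ K"
    using sum_card_blocks_le[OF Bs(1) fIT(2)] dj Bs by (auto simp: T_def card_tri)
  have sumle: "\<bar>\<Sum>p\<in>S. h p\<bar> \<le> C * (x * y * D)" if "\<And>p. p \<in> S \<Longrightarrow> \<bar>h p\<bar> \<le> C * (x * y * 2 ^ fst p)" "(\<Sum>p\<in>S. (2::real) ^ fst p) \<le> D" "C \<ge> 0"
    for S and h :: "nat \<times> int \<Rightarrow> real" and C D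
  proof -
    have "\<bar>\<Sum>p\<in>S. h p\<bar> \<le> (\<Sum>p\<in>S. C * (x * y * 2 ^ fst p))" by (intro order_trans[OF sum_abs] sum_mono that)
    also have "\<dots> = C * (x * y * (\<Sum>p\<in>S. 2 ^ fst p))" by (simp add: sum_distrib_left)
    also have "\<dots> \<le> C * (x * y * D)" using that xy by (intro mult_left_mono) auto
    finally show ?thesis .
  qed
  have e1: "\<bar>\<Sum>p\<in>BI. X p\<bar> \<le> 1620 * (x * y * 2 ^ K)" by (rule sumle[OF Xle cI]) auto
  have e2: "\<bar>\<Sum>p\<in>BI. lform (fst p) (snd p) (\<lambda>_. aF p) G\<bar> \<le> 46134 * (x * y * 2 ^ K)"
    by (rule sumle[OF Yle cI]) (use BIBs in auto)
  have e3: "\<bar>\<Sum>p\<in>Bs. V p\<bar> \<le> 927540 * (x * y * (3 * 2 ^ K))" by (rule sumle[OF Vle cT]) auto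
  have "x * y * 2 ^ K \<ge> 0" using xy by simp
  then show ?thesis using stepA stepB main e1 e2 e3 by linarith
qed

section \<open>Stopping times and the truncated Hilbert transform\<close>

text \<open>Dyadic intervals are addressed by the pair of generation and index.\<close>

definition ancestor :: "nat \<times> int \<Rightarrow> nat \<Rightarrow> nat \<times> int" where
  "ancestor p j = (fst p + j, snd p div 2 ^ j)"

definition maximals :: "(nat \<times> int) set \<Rightarrow> (nat \<times> int) set" where
  "maximals C = {p\<in>C. \<forall>j>0. ancestor p j \<notin> C}"

lemma ancestor_ancestor: "ancestor (ancestor p i) j = ancestor p (i + j)"
  by (simp add: ancestor_def power_add zdiv_zmult2_eq add.assoc)

lemma ancestor_0 [simp]: "ancestor p 0 = p" by (simp add: ancestor_def)

lemma dyad_subset_anc: "dyad_of p \<subseteq> dyad_of (ancestor p j)"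
  using dyad_subset_ancestor[of "fst p" "snd p" j] by (simp add: ancestor_def)

lemma tri_subset_anc: "tri (fst p) (snd p) \<subseteq> tri (fst (ancestor p j)) (snd (ancestor p j))"
  using tri_subset_tri_parent[of "fst p" "snd p" j] by (simp add: ancestor_def)

text \<open>Only finitely many ancestors of \<open>p\<close> lie in \<open>C\<close>; take the last one.\<close>

lemma maximal_ancestor:
  assumes "finite C" "p \<in> C"
  obtains j where "ancestor p j \<in> maximals C"
proof -
  let ?J = "{j. ancestor p j \<in> C}"
  have "inj (ancestor p)" by (auto simp: inj_on_def ancestor_def)
  then have fin: "finite ?J" using finite_vimageI[OF assms(1), of "ancestor p"] by (simp add: vimage_def)
  have ne: "?J \<noteq> {}" using assms(2) by (auto intro: exI[of _ 0])
  define j where "j = Max ?J"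
  have "ancestor p j \<in> C" using Max_in[OF fin ne] by (simp add: j_def)
  moreover have "ancestor (ancestor p j) i \<notin> C" if "i > 0" for i
  proof
    assume "ancestor (ancestor p j) i \<in> C"
    then have "j + i \<in> ?J" by (simp add: ancestor_ancestor)
    then have "j + i \<le> Max ?J" by (rule Max_ge[OF fin])
    then show False using that by (simp add: j_def)
  qed
  ultimately show ?thesis using that by (auto simp: maximals_def)
qed

lemma maximals_disjoint:
  assumes "p \<in> maximals C" "p' \<in> maximals C" "p \<noteq> p'"
  shows "dyad_of p \<inter> dyad_of p' = {}"
proof (rule ccontr)
  assume "dyad_of p \<inter> dyad_of p' \<noteq> {}"
  then obtain n where n: "n \<in> dyad_of p" "n \<in> dyad_of p'" by auto
  have aux: False if "q \<in> maximals C" "q' \<in> maximals C" "n \<in> dyad_of q" "n \<in> dyad_of q'" "fst q < fst q'" for q q'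
  proof -
    have "n \<in> dyad_of (ancestor q (fst q' - fst q))" using that dyad_subset_anc by blast
    then have "ancestor q (fst q' - fst q) = q'"
      using that by (intro prod_eqI) (auto simp: ancestor_def in_dyad_iff)
    then show False using that unfolding maximals_def by (metis (mono_tags, lifting) mem_Collect_eq zero_less_diff)
  qed
  show False
  proof (cases "fst p = fst p'")
    case True
    then show False using n assms(3) by (auto simp: in_dyad_iff prod_eq_iff)
  next
    case False
    then show False using aux[of p p'] aux[of p' p] assms n by linarith
  qed
qed

text \<open>The weak type inequality for the maximal function over tripled dyadic intervals: the maximal
  intervals are disjoint, and tripling costs the factor 3.\<close>

lemma dyadic_weak_type:
  fixes w :: "int \<Rightarrow> real"
  assumes C: "finite C" "\<And>p. p \<in> C \<Longrightarrow> dyad_of p \<subseteq> S \<and> c * 2 ^ fst p \<le> sum w (dyad_of p)" and S: "finite S"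
    and w: "\<And>n. w n \<ge> 0" and c: "c \<ge> 0"
  shows "c * real (card (\<Union>p\<in>C. tri (fst p) (snd p))) \<le> 3 * sum w S"
proof -
  define M where "M = maximals C"
  have MC: "M \<subseteq> C" by (auto simp: M_def maximals_def)
  have fM: "finite M" using MC C finite_subset by blast
  have "(\<Union>p\<in>C. tri (fst p) (snd p)) \<subseteq> (\<Union>p\<in>M. tri (fst p) (snd p))"
  proof
    fix n assume "n \<in> (\<Union>p\<in>C. tri (fst p) (snd p))"
    then obtain p where p: "p \<in> C" "n \<in> tri (fst p) (snd p)" by auto
    obtain j where "ancestor p j \<in> M" using maximal_ancestor[OF C(1) p(1)] M_def by blast
    then show "n \<in> (\<Union>p\<in>M. tri (fst p) (snd p))" using p(2) tri_subset_anc[of p j] by blast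
  qed
  then have "card (\<Union>p\<in>C. tri (fst p) (snd p)) \<le> card (\<Union>p\<in>M. tri (fst p) (snd p))"
    using fM by (intro card_mono) auto
  also have "\<dots> \<le> (\<Sum>p\<in>M. card (tri (fst p) (snd p)))" by (rule card_UN_le[OF fM])
  finally have "real (card (\<Union>p\<in>C. tri (fst p) (snd p))) \<le> (\<Sum>p\<in>M. real (card (tri (fst p) (snd p))))"
    by (simp only: of_nat_le_iff of_nat_sum[symmetric])
  then have "c * real (card (\<Union>p\<in>C. tri (fst p) (snd p))) \<le> c * (\<Sum>p\<in>M. 3 * 2 ^ fst p)"
    using c by (intro mult_left_mono) (auto simp: card_tri)
  also have "\<dots> = 3 * (\<Sum>p\<in>M. c * 2 ^ fst p)" by (simp add: sum_distrib_left mult_ac)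
  also have "(\<Sum>p\<in>M. c * 2 ^ fst p) \<le> (\<Sum>p\<in>M. sum w (dyad_of p))" using C MC by (intro sum_mono) auto
  also have "\<dots> = sum w (\<Union>p\<in>M. dyad_of p)"
    using fM maximals_disjoint[of _ C] by (intro sum.UNION_disjoint[symmetric]) (auto simp: M_def)
  also have "\<dots> \<le> sum w S" using C MC S w by (intro sum_mono2) auto
  finally show ?thesis by simp
qed

lemma sqrt_product_mono: "0 \<le> s \<Longrightarrow> s * sqrt s \<le> t * sqrt t \<Longrightarrow> 0 \<le> t \<Longrightarrow> s \<le> (t::real)"
proof (rule ccontr)
  assume a: "0 \<le> s" "s * sqrt s \<le> t * sqrt t" "0 \<le> t" "\<not> s \<le> t"
  have "t * sqrt t < s * sqrt s" using a by (intro mult_strict_mono') auto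
  then show False using a by simp
qed

text \<open>A dyadic interval with two neighbours on each side. It contains the triples of all three
  intervals that make up \<open>tri k u\<close>, which is why averages over it dominate everything that the
  form on the interval can see.\<close>

definition five :: "nat \<Rightarrow> int \<Rightarrow> int set" where "five k u = {2 ^ k * (u - 2)..2 ^ k * (u + 3) - 1}"

lemma finite_five [simp]: "finite (five k u)" by (simp add: five_def)

lemma card_five: "real (card (five k u)) = 5 * 2 ^ k"
  by (simp add: five_def algebra_simps)

lemma five_nonempty [simp]: "five k u \<noteq> {}"
proof -
  have "real (card (five k u)) > 0" by (simp add: card_five)
  then show ?thesis by auto
qed

lemma in_five_iff: "n \<in> five k u \<longleftrightarrow> n div 2 ^ k \<in> {u - 2, u - 1, u, u + 1, u + 2}"
proof -
  define P where "P = (2::int) ^ k"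
  define d where "d = n div P"
  have P: "P > 0" by (simp add: P_def)
  have "P * d + n mod P = n" "0 \<le> n mod P" "n mod P < P" using P by (simp_all add: d_def)
  then have n: "P * d \<le> n" "n < P * (d + 1)" unfolding distrib_left by linarith+
  have mono: "P * s \<le> P * t" if "s \<le> t" for s t using P that by simp
  have "P * (u - 2) \<le> n \<longleftrightarrow> u - 2 \<le> d" using mono[of "u - 2" d] mono[of "d + 1" "u - 2"] n by linarith
  moreover have "n \<le> P * (u + 3) - 1 \<longleftrightarrow> d \<le> u + 2" using mono[of "d + 1" "u + 3"] mono[of "u + 3" d] n by linarith
  ultimately show ?thesis unfolding five_def P_def[symmetric] d_def[symmetric] by auto
qed

lemma tri_subset_five: "u' \<in> {u - 1, u, u + 1} \<Longrightarrow> tri k u' \<subseteq> five k u"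
  by (auto simp: in_tri_iff in_five_iff)

lemma dyad_subset_of_tri:
  assumes "k \<le> K" "n \<in> dyad k w" "n \<in> tri K U"
  shows "dyad k w \<subseteq> tri K U" "w div 2 ^ (K - k) \<in> {U - 1, U, U + 1}"
proof -
  have "n \<in> dyad (k + (K - k)) (w div 2 ^ (K - k))" by (rule dyad_ancestor[OF assms(2)])
  then have n: "n \<in> dyad K (w div 2 ^ (K - k))" using assms(1) by simp
  then show a: "w div 2 ^ (K - k) \<in> {U - 1, U, U + 1}" using assms(3) by (auto simp: in_tri_iff in_dyad_iff)
  have "dyad k w \<subseteq> dyad K (w div 2 ^ (K - k))" using dyad_subset_ancestor[of k w "K - k"] assms(1) by simp
  also have "\<dots> \<subseteq> tri K U" using a by (auto simp: in_tri_iff in_dyad_iff)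
  finally show "dyad k w \<subseteq> tri K U" .
qed

text \<open>An interval is stopped if it or one of its two neighbours is heavy for \<open>\<phi>\<close> or for \<open>\<gamma>\<close>,
  meaning that the average exceeds 125 times the top average, and \<open>Bs\<close> consists of the maximal
  stopped intervals. Including the neighbours gives control of tripled ancestors: an ancestor
  of a maximal interval is not stopped, so the sums over its triple are bounded; the interval
  itself is compared with its parent. Points outside are not stopped as singletons. By the
  weak type inequality heavy intervals for \<open>\<phi>\<close>, together with their neighbours, cover at most
  \<open>15/125\<close> of the interval, and the same holds for \<open>\<gamma>\<close>.\<close>

lemma stopping_family:
  fixes \<phi> \<gamma> :: "int \<Rightarrow> real" and a b :: real
  assumes nn: "\<And>n. \<phi> n \<ge> 0" "\<And>n. \<gamma> n \<ge> 0" and ab: "a \<ge> 0" "b \<ge> 0"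
    and a: "(\<Sum>n\<in>five K U. \<phi> n) = 5 * 2 ^ K * a" and b: "(\<Sum>n\<in>five K U. \<gamma> n) = 5 * 2 ^ K * b"
  obtains Bs where "finite Bs" "\<And>p. p \<in> Bs \<Longrightarrow> fst p < K \<and> dyad_of p \<subseteq> tri K U"
    "\<And>p p'. p \<in> Bs \<Longrightarrow> p' \<in> Bs \<Longrightarrow> p \<noteq> p' \<Longrightarrow> dyad_of p \<inter> dyad_of p' = {}"
    "\<And>n. n \<in> tri K U \<Longrightarrow> n \<notin> \<Union>(dyad_of ` Bs) \<Longrightarrow> \<phi> n \<le> 125 * a \<and> \<gamma> n \<le> 125 * b"
    "\<And>p i. p \<in> Bs \<Longrightarrow> i \<le> K - fst p \<Longrightarrow> (\<Sum>n\<in>tri (fst p + i) (snd p div 2 ^ i). \<phi> n) \<le> 6 * 2 ^ (fst p + i) * (125 * a)"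
    "\<And>p i. p \<in> Bs \<Longrightarrow> i \<le> K - fst p \<Longrightarrow> (\<Sum>n\<in>tri (fst p + i) (snd p div 2 ^ i). \<gamma> n) \<le> 6 * 2 ^ (fst p + i) * (125 * b)"
    "real (card (\<Union>(dyad_of ` {p\<in>Bs. dyad_of p \<subseteq> dyad K U}))) \<le> 1/2 * 2 ^ K"
proof -
  \<comment> \<open>125 is \<open>25 powr (3/2)\<close>: for \<open>\<phi> = norm F powr (3/2)\<close> the threshold for \<open>norm F\<close> is 25
    times its average with exponent 3/2\<close>
  define heavy where "heavy h c p \<longleftrightarrow> (\<Sum>n\<in>dyad_of p. h n) > 2 ^ fst p * (125 * c)" for h :: "int \<Rightarrow> real" and c :: real and p :: "nat \<times> int"
  define nb where "nb p = {(fst p, snd p - 1), p, (fst p, snd p + 1)}" for p :: "nat \<times> int"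
  define bad where "bad p \<longleftrightarrow> (\<exists>q\<in>nb p. heavy \<phi> a q \<or> heavy \<gamma> b q)" for p
  define C where "C = {p. fst p < K \<and> dyad_of p \<subseteq> tri K U \<and> bad p}"
  have fC: "finite C"
  proof (rule finite_subset)
    show "C \<subseteq> (\<lambda>(k, n). (k, n div 2 ^ k)) ` ({..<K} \<times> tri K U)"
    proof
      fix p assume p: "p \<in> C"
      have "2 ^ fst p * snd p \<in> dyad_of p" by (simp add: dyad_def)
      then have "(fst p, 2 ^ fst p * snd p) \<in> {..<K} \<times> tri K U" using p by (auto simp: C_def)
      then show "p \<in> (\<lambda>(k, n). (k, n div 2 ^ k)) ` ({..<K} \<times> tri K U)"
        by (rule rev_image_eqI) (simp add: prod_eq_iff)
    qed
  qed auto
  define Bs where "Bs = maximals C"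
  have BC: "Bs \<subseteq> C" by (auto simp: Bs_def maximals_def)
  have fBs: "finite Bs" using BC fC finite_subset by blast
  have tri_nb: "(\<Sum>n\<in>tri (fst p) (snd p). h n) = (\<Sum>q\<in>nb p. \<Sum>n\<in>dyad_of q. h n)" for h :: "int \<Rightarrow> real" and p
  proof -
    have "tri (fst p) (snd p) = (\<Union>q\<in>nb p. dyad_of q)" by (auto simp: nb_def tri_eq)
    also have "sum h \<dots> = (\<Sum>q\<in>nb p. sum h (dyad_of q))"
      by (rule sum.UNION_disjoint) (auto simp: nb_def in_dyad_iff prod_eq_iff)
    finally show ?thesis .
  qed
  have card_nb: "card (nb p) = 3" for p by (cases p) (simp add: nb_def)
  have good: "(\<Sum>n\<in>tri (fst p) (snd p). \<phi> n) \<le> 3 * 2 ^ fst p * (125 * a)" "(\<Sum>n\<in>tri (fst p) (snd p). \<gamma> n) \<le> 3 * 2 ^ fst p * (125 * b)"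
    if "\<not> bad p" for p
  proof -
    have q: "fst q = fst p" if "q \<in> nb p" for q using that by (auto simp: nb_def)
    have "(\<Sum>q\<in>nb p. \<Sum>n\<in>dyad_of q. \<phi> n) \<le> of_nat (card (nb p)) * (2 ^ fst p * (125 * a))"
      using that q by (intro sum_bounded_above) (auto simp: bad_def heavy_def not_less)
    then show "(\<Sum>n\<in>tri (fst p) (snd p). \<phi> n) \<le> 3 * 2 ^ fst p * (125 * a)" by (simp add: tri_nb card_nb)
    have "(\<Sum>q\<in>nb p. \<Sum>n\<in>dyad_of q. \<gamma> n) \<le> of_nat (card (nb p)) * (2 ^ fst p * (125 * b))"
      using that q by (intro sum_bounded_above) (auto simp: bad_def heavy_def not_less)
    then show "(\<Sum>n\<in>tri (fst p) (snd p). \<gamma> n) \<le> 3 * 2 ^ fst p * (125 * b)" by (simp add: tri_nb card_nb)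
  qed
  have top: "(\<Sum>n\<in>tri K u. \<phi> n) \<le> 5 * 2 ^ K * a" "(\<Sum>n\<in>tri K u. \<gamma> n) \<le> 5 * 2 ^ K * b" if "u \<in> {U - 1, U, U + 1}" for u
  proof -
    have "(\<Sum>n\<in>tri K u. \<phi> n) \<le> (\<Sum>n\<in>five K U. \<phi> n)" "(\<Sum>n\<in>tri K u. \<gamma> n) \<le> (\<Sum>n\<in>five K U. \<gamma> n)"
      using nn tri_subset_five[OF that] by (auto intro!: sum_mono2)
    then show "(\<Sum>n\<in>tri K u. \<phi> n) \<le> 5 * 2 ^ K * a" "(\<Sum>n\<in>tri K u. \<gamma> n) \<le> 5 * 2 ^ K * b" using a b by simp_all
  qed
  have strict: "(\<Sum>n\<in>tri (fst (ancestor p i)) (snd (ancestor p i)). \<phi> n) \<le> 3 * 2 ^ fst (ancestor p i) * (125 * a) \<and>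
      (\<Sum>n\<in>tri (fst (ancestor p i)) (snd (ancestor p i)). \<gamma> n) \<le> 3 * 2 ^ fst (ancestor p i) * (125 * b)"
    if p: "p \<in> Bs" and i: "0 < i" "i \<le> K - fst p" for p i
  proof -
    have pC: "fst p < K" "dyad_of p \<subseteq> tri K U" using p BC by (auto simp: C_def)
    define z where "z = 2 ^ fst p * snd p"
    have z: "z \<in> dyad_of p" by (simp add: z_def dyad_def)
    have zT: "z \<in> tri K U" using z pC by auto
    show ?thesis
    proof (cases "fst p + i = K")
      case True
      then have i': "i = K - fst p" by simp
      have "snd p div 2 ^ i \<in> {U - 1, U, U + 1}" unfolding i' using dyad_subset_of_tri(2)[OF _ z zT] pC by simp
      from top[OF this] have t: "(\<Sum>n\<in>tri K (snd p div 2 ^ i). \<phi> n) \<le> 5 * 2 ^ K * a" "(\<Sum>n\<in>tri K (snd p div 2 ^ i). \<gamma> n) \<le> 5 * 2 ^ K * b" .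
      have "5 * 2 ^ K * a \<le> 3 * 2 ^ K * (125 * a)" "5 * 2 ^ K * b \<le> 3 * 2 ^ K * (125 * b)" using ab by (auto simp: mult_right_mono)
      then show ?thesis using order_trans[OF t(1)] order_trans[OF t(2)] True by (simp add: ancestor_def)
    next
      case False
      then have lt: "fst p + i < K" using i by simp
      have "ancestor p i \<notin> C" using p i by (simp add: Bs_def maximals_def)
      moreover have "z \<in> dyad_of (ancestor p i)" using z dyad_subset_anc by blast
      then have "dyad_of (ancestor p i) \<subseteq> tri K U" using dyad_subset_of_tri(1)[of "fst (ancestor p i)" K z "snd (ancestor p i)" U] zT lt by (simp add: ancestor_def)
      ultimately have "\<not> bad (ancestor p i)" using lt by (auto simp: C_def ancestor_def)
      then show ?thesis using good by blast
    qed
  qed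
  have pow: "(\<Sum>n\<in>tri (fst (ancestor p i)) (snd (ancestor p i)). \<phi> n) \<le> 6 * 2 ^ fst (ancestor p i) * (125 * a) \<and>
      (\<Sum>n\<in>tri (fst (ancestor p i)) (snd (ancestor p i)). \<gamma> n) \<le> 6 * 2 ^ fst (ancestor p i) * (125 * b)"
    if p: "p \<in> Bs" and i: "i \<le> K - fst p" for p i
  proof (cases "i = 0")
    case True
    have "fst p < K" using p BC by (auto simp: C_def)
    then have s: "(\<Sum>n\<in>tri (fst (ancestor p 1)) (snd (ancestor p 1)). \<phi> n) \<le> 3 * 2 ^ fst (ancestor p 1) * (125 * a) \<and>
      (\<Sum>n\<in>tri (fst (ancestor p 1)) (snd (ancestor p 1)). \<gamma> n) \<le> 3 * 2 ^ fst (ancestor p 1) * (125 * b)"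
      using p by (intro strict) auto
    have m: "(\<Sum>n\<in>tri (fst p) (snd p). h n) \<le> (\<Sum>n\<in>tri (fst (ancestor p 1)) (snd (ancestor p 1)). h n)" if "\<And>n. h n \<ge> 0" for h :: "int \<Rightarrow> real"
      using tri_subset_anc that by (intro sum_mono2) auto
    have e: "fst (ancestor p 1) = Suc (fst p)" by (simp add: ancestor_def)
    show ?thesis using s m[of \<phi>] m[of \<gamma>] nn True unfolding e by simp
  next
    case False
    then have "i > 0" by simp
    have "3 * 2 ^ fst (ancestor p i) * (125 * a) \<le> 6 * 2 ^ fst (ancestor p i) * (125 * a)" "3 * 2 ^ fst (ancestor p i) * (125 * b) \<le> 6 * 2 ^ fst (ancestor p i) * (125 * b)"
      using ab by (auto simp: mult_right_mono)
    then show ?thesis using strict[OF p \<open>i > 0\<close> i] by linarith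
  qed
  have off: "\<phi> n \<le> 125 * a \<and> \<gamma> n \<le> 125 * b" if n: "n \<in> tri K U" "n \<notin> \<Union>(dyad_of ` Bs)" for n
  proof (cases "K = 0")
    case True
    have "n \<in> five K U" using n tri_subset_five[of U U K] by auto
    then have "\<phi> n \<le> (\<Sum>n\<in>five K U. \<phi> n)" "\<gamma> n \<le> (\<Sum>n\<in>five K U. \<gamma> n)" using nn by (auto intro!: member_le_sum)
    then show ?thesis using a b True ab by simp
  next
    case False
    have nd: "n \<in> dyad_of (0, n)" by (simp add: in_dyad_iff)
    have "(0, n) \<notin> C"
    proof
      assume "(0, n) \<in> C"
      then obtain j where "ancestor (0, n) j \<in> Bs" using maximal_ancestor[OF fC] Bs_def by blast
      then show False using n(2) nd dyad_subset_anc[of "(0, n)" j] by blast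
    qed
    moreover have "dyad_of (0, n) \<subseteq> tri K U" using n(1) by (auto simp: in_dyad_iff)
    ultimately have "\<not> bad (0, n)" using False by (auto simp: C_def)
    then have "\<not> heavy \<phi> a (0, n)" "\<not> heavy \<gamma> b (0, n)" by (auto simp: bad_def nb_def)
    moreover have "dyad_of (0, n) = {n}" by (auto simp: in_dyad_iff)
    ultimately show ?thesis by (simp add: heavy_def)
  qed
  define BI where "BI = {p\<in>Bs. dyad_of p \<subseteq> dyad K U}"
  have small: "real (card (\<Union>(dyad_of ` BI))) \<le> 1/2 * 2 ^ K"
  proof -
    \<comment> \<open>every interval heavy for \<open>h\<close> that stops some \<open>p\<close> inside \<open>dyad K U\<close> lies in
      \<open>five K U\<close>\<close>
    have cover: "real (card (\<Union>p\<in>{q. heavy h c q \<and> (\<exists>p\<in>BI. q \<in> nb p)}. tri (fst p) (snd p))) \<le> 1/8 * 2 ^ K"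
      if h: "\<And>n. h n \<ge> 0" "(\<Sum>n\<in>five K U. h n) = 5 * 2 ^ K * c" "c \<ge> 0" for h :: "int \<Rightarrow> real" and c
    proof -
      define D where "D = {q. heavy h c q \<and> (\<exists>p\<in>BI. q \<in> nb p)}"
      have "D \<subseteq> (\<Union>p\<in>BI. nb p)" by (auto simp: D_def)
      then have fD: "finite D" by (rule finite_subset) (use fBs in \<open>auto simp: BI_def nb_def\<close>)
      have sub: "dyad_of q \<subseteq> five K U" if "q \<in> D" for q
      proof -
        have "\<exists>p\<in>BI. q \<in> nb p" using that by (simp add: D_def)
        then obtain p where p: "p \<in> BI" "q \<in> nb p" by blast
        have pK: "fst p < K" "dyad_of p \<subseteq> dyad K U" using p BC by (auto simp: BI_def C_def)
        have z: "2 ^ fst p * snd p \<in> dyad_of p" by (simp add: dyad_def)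
        have U: "snd p div 2 ^ (K - fst p) = U" using dyad_subset_or_disjoint(2)[OF _ z, of K U] pK z by auto
        have "dyad_of q \<subseteq> tri (fst p) (snd p)" using p by (auto simp: nb_def tri_eq)
        also have "\<dots> \<subseteq> tri K U" using tri_subset_anc[of p "K - fst p"] pK U by (simp add: ancestor_def)
        also have "\<dots> \<subseteq> five K U" by (rule tri_subset_five) simp
        finally show ?thesis .
      qed
      show ?thesis
      proof (cases "c = 0")
        case True
        have "D = {}"
        proof -
          { fix q assume q: "q \<in> D"
            have "(\<Sum>n\<in>dyad_of q. h n) \<le> (\<Sum>n\<in>five K U. h n)" using sub[OF q] h by (intro sum_mono2) auto
            then have False using q h True by (simp add: D_def heavy_def) }
          then show ?thesis by auto
        qed
        then show ?thesis unfolding D_def[symmetric] by simp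
      next
        case False
        have "(125 * c) * real (card (\<Union>p\<in>D. tri (fst p) (snd p))) \<le> 3 * sum h (five K U)"
          using sub h by (intro dyadic_weak_type fD) (auto simp: D_def heavy_def mult_ac intro: less_imp_le)
        also have "\<dots> = c * (15 * 2 ^ K)" using h by simp
        finally have "c * (125 * real (card (\<Union>p\<in>D. tri (fst p) (snd p)))) \<le> c * (15 * 2 ^ K)" by simp
        then have "125 * real (card (\<Union>p\<in>D. tri (fst p) (snd p))) \<le> 15 * 2 ^ K" using False h by simp
        then have "real (card (\<Union>p\<in>D. tri (fst p) (snd p))) \<le> 15/125 * 2 ^ K" by simp
        also have "\<dots> \<le> 1/8 * 2 ^ K" by (intro mult_right_mono) auto
        finally show ?thesis unfolding D_def .
      qed
    qed
    define D1 where "D1 = (\<Union>p\<in>{q. heavy \<phi> a q \<and> (\<exists>p\<in>BI. q \<in> nb p)}. tri (fst p) (snd p))"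
    define D2 where "D2 = (\<Union>p\<in>{q. heavy \<gamma> b q \<and> (\<exists>p\<in>BI. q \<in> nb p)}. tri (fst p) (snd p))"
    have "\<Union>(dyad_of ` BI) \<subseteq> D1 \<union> D2"
    proof
      fix n assume "n \<in> \<Union>(dyad_of ` BI)"
      then obtain p where p: "p \<in> BI" "n \<in> dyad_of p" by auto
      then have "bad p" using BC by (auto simp: BI_def C_def)
      then obtain q where q: "q \<in> nb p" "heavy \<phi> a q \<or> heavy \<gamma> b q" by (auto simp: bad_def)
      have "n \<in> tri (fst q) (snd q)" using p q by (auto simp: nb_def in_tri_iff in_dyad_iff)
      then show "n \<in> D1 \<union> D2" using p q unfolding D1_def D2_def by blast
    qed
    moreover have "finite (D1 \<union> D2)"
    proof -
      have "finite (\<Union>p\<in>BI. nb p)" using fBs by (auto simp: BI_def nb_def)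
      then have "finite {q. heavy h c q \<and> (\<exists>p\<in>BI. q \<in> nb p)}" for h c
        by (rule finite_subset[rotated]) blast
      then show ?thesis by (auto simp: D1_def D2_def)
    qed
    ultimately have "card (\<Union>(dyad_of ` BI)) \<le> card (D1 \<union> D2)" by (intro card_mono)
    also have "\<dots> \<le> card D1 + card D2" by (rule card_Un_le)
    finally have "real (card (\<Union>(dyad_of ` BI))) \<le> real (card D1) + real (card D2)" by simp
    also have "\<dots> \<le> 1/8 * 2 ^ K + 1/8 * 2 ^ K"
      unfolding D1_def D2_def using nn a b ab by (intro add_mono cover) auto
    also have "\<dots> \<le> 1/2 * 2 ^ K" by simp
    finally show ?thesis .
  qed
  show ?thesis
  proof (rule that[OF fBs])
    show "fst p < K \<and> dyad_of p \<subseteq> tri K U" if "p \<in> Bs" for p using that BC by (auto simp: C_def)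
    show "dyad_of p \<inter> dyad_of p' = {}" if "p \<in> Bs" "p' \<in> Bs" "p \<noteq> p'" for p p'
      using that maximals_disjoint by (auto simp: Bs_def)
    show "(\<Sum>n\<in>tri (fst p + i) (snd p div 2 ^ i). \<phi> n) \<le> 6 * 2 ^ (fst p + i) * (125 * a)" if "p \<in> Bs" "i \<le> K - fst p" for p i
      using pow[OF that] by (simp add: ancestor_def)
    show "(\<Sum>n\<in>tri (fst p + i) (snd p div 2 ^ i). \<gamma> n) \<le> 6 * 2 ^ (fst p + i) * (125 * b)" if "p \<in> Bs" "i \<le> K - fst p" for p i
      using pow[OF that] by (simp add: ancestor_def)
    show "\<phi> n \<le> 125 * a \<and> \<gamma> n \<le> 125 * b" if "n \<in> tri K U" "n \<notin> \<Union>(dyad_of ` Bs)" for n using off[OF that] .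
    show "real (card (\<Union>(dyad_of ` {p\<in>Bs. dyad_of p \<subseteq> dyad K U}))) \<le> 1/2 * 2 ^ K" using small by (simp add: BI_def)
  qed
qed

text \<open>Complex values make the averages and the maximal product available for norms of
  vector-valued functions.\<close>

abbreviation nrm :: "(int \<Rightarrow> 'a::real_inner) \<Rightarrow> int \<Rightarrow> complex" where
  "nrm F \<equiv> (\<lambda>n. complex_of_real (norm (F n)))"

text \<open>Induction on the generation. By \<open>local_estimate\<close> the form differs from the sum of the forms
  on the stopping intervals inside by a multiple of \<open>a * b * 2 ^ K\<close>, where \<open>a\<close> and \<open>b\<close> are the
  averages on \<open>five K U\<close>. At least half of the interval is free of stopping intervals, and
  there \<open>maxprod \<ge> a * b\<close> pays for this error. The induction hypothesis uses \<open>maxprod\<close> only on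
  the stopped half, so the constant does not grow.\<close>

lemma lform_le_maxprod:
  fixes F G :: "int \<Rightarrow> 'a::real_inner"
  assumes fs: "finitely_supported (nrm F)" "finitely_supported (nrm G)"
  shows "\<bar>lform K U F G\<bar> \<le> 3750000000 * (\<Sum>n\<in>dyad K U. maxprod (nrm F) (nrm G) n)"
proof (induction K arbitrary: U rule: less_induct)
  case (less K)
  define M where "M = maxprod (nrm F) (nrm G)"
  have M0: "M n \<ge> 0" for n unfolding M_def by (rule maxprod_nonneg[OF fs])
  define a where "a = avg (five K U) (3/2) (nrm F)"
  define b where "b = avg (five K U) (3/2) (nrm G)"
  have ab: "a \<ge> 0" "b \<ge> 0" by (simp_all add: a_def b_def avg_nonneg)
  have abM: "a * b \<le> M n" if "n \<in> dyad K U" for n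
  proof -
    have "n \<in> five K U" using that by (auto simp: in_dyad_iff in_five_iff)
    then show ?thesis unfolding a_def b_def M_def five_def by (intro maxprod_upper fs) auto
  qed
  define \<phi> where "\<phi> n = norm (F n) * sqrt (norm (F n))" for n
  define \<gamma> where "\<gamma> n = norm (G n) * sqrt (norm (G n))" for n
  have sa: "(\<Sum>n\<in>five K U. \<phi> n) = 5 * 2 ^ K * (a * sqrt a)"
    using avg_three_halves[of "five K U" "nrm F"] by (simp add: \<phi>_def a_def card_five)
  have sb: "(\<Sum>n\<in>five K U. \<gamma> n) = 5 * 2 ^ K * (b * sqrt b)"
    using avg_three_halves[of "five K U" "nrm G"] by (simp add: \<gamma>_def b_def card_five)
  have nn: "\<phi> n \<ge> 0" "\<gamma> n \<ge> 0" for n by (simp_all add: \<phi>_def \<gamma>_def)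
  have ab2: "0 \<le> a * sqrt a" "0 \<le> b * sqrt b" using ab by simp_all
  obtain Bs where Bs: "finite Bs" "\<And>p. p \<in> Bs \<Longrightarrow> fst p < K \<and> dyad_of p \<subseteq> tri K U"
    and dj: "\<And>p p'. p \<in> Bs \<Longrightarrow> p' \<in> Bs \<Longrightarrow> p \<noteq> p' \<Longrightarrow> dyad_of p \<inter> dyad_of p' = {}"
    and off: "\<And>n. n \<in> tri K U \<Longrightarrow> n \<notin> \<Union>(dyad_of ` Bs) \<Longrightarrow> \<phi> n \<le> 125 * (a * sqrt a) \<and> \<gamma> n \<le> 125 * (b * sqrt b)"
    and p1: "\<And>p i. p \<in> Bs \<Longrightarrow> i \<le> K - fst p \<Longrightarrow> (\<Sum>n\<in>tri (fst p + i) (snd p div 2 ^ i). \<phi> n) \<le> 6 * 2 ^ (fst p + i) * (125 * (a * sqrt a))"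
    and p2: "\<And>p i. p \<in> Bs \<Longrightarrow> i \<le> K - fst p \<Longrightarrow> (\<Sum>n\<in>tri (fst p + i) (snd p div 2 ^ i). \<gamma> n) \<le> 6 * 2 ^ (fst p + i) * (125 * (b * sqrt b))"
    and small: "real (card (\<Union>(dyad_of ` {p\<in>Bs. dyad_of p \<subseteq> dyad K U}))) \<le> 1/2 * 2 ^ K"
    by (rule stopping_family[OF nn ab2 sa sb]) (rule that; assumption)
  have sq: "sqrt (25 * s) = 5 * sqrt s" for s :: real by (simp add: real_sqrt_mult)
  have t25: "(25 * s) * sqrt (25 * s) = 125 * (s * sqrt s)" for s :: real by (simp add: sq)
  define BI where "BI = {p\<in>Bs. dyad_of p \<subseteq> dyad K U}"
  have off': "norm (F n) \<le> 25 * a \<and> norm (G n) \<le> 25 * b" if n: "n \<in> tri K U" "n \<notin> \<Union>(dyad_of ` Bs)" for n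
  proof
    have "norm (F n) * sqrt (norm (F n)) \<le> (25 * a) * sqrt (25 * a)" using off[OF n] unfolding t25 \<phi>_def by (rule conjunct1)
    then show "norm (F n) \<le> 25 * a" using ab by (intro sqrt_product_mono[OF norm_ge_zero]) auto
    have "norm (G n) * sqrt (norm (G n)) \<le> (25 * b) * sqrt (25 * b)" using off[OF n] unfolding t25 \<gamma>_def by (rule conjunct2)
    then show "norm (G n) \<le> 25 * b" using ab by (intro sqrt_product_mono[OF norm_ge_zero]) auto
  qed
  have q1: "(\<Sum>n\<in>tri (fst p + i) (snd p div 2 ^ i). norm (F n) * sqrt (norm (F n))) \<le> 6 * 2 ^ (fst p + i) * (25 * a * sqrt (25 * a))"
    if "p \<in> Bs" "i \<le> K - fst p" for p i using p1[OF that] unfolding t25 \<phi>_def .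
  have q2: "(\<Sum>n\<in>tri (fst p + i) (snd p div 2 ^ i). norm (G n) * sqrt (norm (G n))) \<le> 6 * 2 ^ (fst p + i) * (25 * b * sqrt (25 * b))"
    if "p \<in> Bs" "i \<le> K - fst p" for p i using p2[OF that] unfolding t25 \<gamma>_def .
  have "0 \<le> 25 * a" "0 \<le> 25 * b" using ab by simp_all
  from local_estimate[OF Bs dj off' q1 q2 this]
  have est: "\<bar>lform K U F G - (\<Sum>p\<in>BI. lform (fst p) (snd p) F G)\<bar> \<le> 3000000 * ((25 * a) * (25 * b) * 2 ^ K)"
    unfolding BI_def .
  define E where "E = \<Union>(dyad_of ` BI)"
  have fBI: "finite BI" using Bs by (simp add: BI_def)
  have EI: "E \<subseteq> dyad K U" by (auto simp: E_def BI_def)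
  have "real (card (dyad K U - E)) = 2 ^ K - real (card E)"
  proof -
    have "finite E" by (rule finite_subset[OF EI]) simp
    then have "card (dyad K U - E) = card (dyad K U) - card E" by (rule card_Diff_subset[OF _ EI])
    moreover have "card E \<le> card (dyad K U)" using EI by (intro card_mono) auto
    ultimately show ?thesis by (simp add: of_nat_diff card_dyad)
  qed
  then have half: "2 ^ K \<le> 2 * real (card (dyad K U - E))" using small by (simp add: E_def BI_def)
  have "(a * b) * 2 ^ K \<le> (a * b) * (2 * real (card (dyad K U - E)))" using half ab by (intro mult_left_mono) auto
  also have "\<dots> = 2 * (\<Sum>n\<in>dyad K U - E. a * b)" by simp
  also have "\<dots> \<le> 2 * (\<Sum>n\<in>dyad K U - E. M n)" using abM by (intro mult_left_mono sum_mono) auto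
  finally have ab2: "(a * b) * 2 ^ K \<le> 2 * (\<Sum>n\<in>dyad K U - E. M n)" .
  have "\<bar>\<Sum>p\<in>BI. lform (fst p) (snd p) F G\<bar> \<le> (\<Sum>p\<in>BI. 3750000000 * (\<Sum>n\<in>dyad_of p. M n))"
    using less.IH Bs unfolding M_def BI_def by (intro order_trans[OF sum_abs] sum_mono) blast
  also have "\<dots> = 3750000000 * (\<Sum>n\<in>E. M n)"
  proof -
    have "(\<Sum>n\<in>E. M n) = (\<Sum>p\<in>BI. \<Sum>n\<in>dyad_of p. M n)"
      unfolding E_def using fBI dj by (intro sum.UNION_disjoint) (auto simp: BI_def)
    then show ?thesis by (simp add: sum_distrib_left)
  qed
  finally have ih: "\<bar>\<Sum>p\<in>BI. lform (fst p) (snd p) F G\<bar> \<le> 3750000000 * (\<Sum>n\<in>E. M n)" .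
  have "(\<Sum>n\<in>dyad K U. M n) = (\<Sum>n\<in>dyad K U - E. M n) + (\<Sum>n\<in>E. M n)"
    by (rule sum.subset_diff[OF EI]) simp
  then show ?case using est ih ab2 by (simp add: M_def)
qed

text \<open>For a truncation at a power of two the form is the sum of \<open>lform\<close> over the dyadic intervals
  of one generation. Moving the truncation from \<open>2 ^ K\<close> to \<open>L < 2 ^ (K + 1)\<close> changes the
  kernel on a single scale.\<close>

lemma truncated_hilbert_maxprod:
  fixes F G :: "int \<Rightarrow> 'a::real_inner" and L :: int
  assumes fs: "finitely_supported (nrm F)" "finitely_supported (nrm G)" and L: "L \<ge> 1"
    and A: "finite A" "\<And>n. n \<notin> A \<Longrightarrow> F n = 0 \<and> G n = 0"
    and Z: "\<And>X. finite X \<Longrightarrow> (\<Sum>x\<in>X. maxprod (nrm F) (nrm G) x) \<le> Z"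
  shows "\<bar>\<Sum>n'\<in>A. \<Sum>n\<in>A. hilbert_kernel L (n - n') * (F n' \<bullet> G n)\<bar> \<le> 4000000000 * Z"
proof -
  obtain K :: nat where K: "2 ^ K \<le> L" "L < 2 ^ (K + 1)"
  proof -
    obtain k where k: "2 ^ k \<le> nat L" "nat L < 2 ^ (k + 1)" using ex_power_ivl1[of 2 "nat L"] L by (auto simp: Suc_le_eq)
    have "int (2 ^ k) \<le> L" "L < int (2 ^ (k + 1))" using k L by linarith+
    then show ?thesis using that[of k] by simp
  qed
  define V where "V = (\<lambda>n. n div 2 ^ K) ` A"
  have fV: "finite V" using A by (simp add: V_def)
  have Z0: "Z \<ge> 0" using Z[of "{}"] by simp
  have "(\<Sum>n'\<in>A. \<Sum>n\<in>A. hilbert_kernel (2 ^ K) (n - n') * (F n' \<bullet> G n)) = (\<Sum>u\<in>V. \<Sum>n'\<in>{x\<in>A. x div 2 ^ K = u}. \<Sum>n\<in>A. hilbert_kernel (2 ^ K) (n - n') * (F n' \<bullet> G n))"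
    by (rule sum.group[symmetric]) (use A fV in \<open>auto simp: V_def\<close>)
  also have "\<dots> = (\<Sum>u\<in>V. lform K u F G)"
  proof (rule sum.cong[OF refl])
    fix u
    have "(\<Sum>n'\<in>{x\<in>A. x div 2 ^ K = u}. \<Sum>n\<in>A. hilbert_kernel (2 ^ K) (n - n') * (F n' \<bullet> G n)) =
        (\<Sum>n'\<in>dyad K u. \<Sum>n\<in>A. hilbert_kernel (2 ^ K) (n - n') * (F n' \<bullet> G n))"
    proof (rule sum.mono_neutral_left)
      show "\<forall>n'\<in>dyad K u - {x\<in>A. x div 2 ^ K = u}. (\<Sum>n\<in>A. hilbert_kernel (2 ^ K) (n - n') * (F n' \<bullet> G n)) = 0"
      proof
        fix n' assume "n' \<in> dyad K u - {x\<in>A. x div 2 ^ K = u}"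
        then have "n' \<notin> A" by (auto simp: in_dyad_iff)
        then have "F n' = 0" using A(2) by blast
        then show "(\<Sum>n\<in>A. hilbert_kernel (2 ^ K) (n - n') * (F n' \<bullet> G n)) = 0" by simp
      qed
    qed (auto simp: in_dyad_iff)
    also have "\<dots> = lform K u F G" unfolding lform_def
    proof (rule sum.cong[OF refl])
      fix n' assume n': "n' \<in> dyad K u"
      have "(\<Sum>n\<in>A. hilbert_kernel (2 ^ K) (n - n') * (F n' \<bullet> G n)) = (\<Sum>n\<in>A \<union> tri K u. hilbert_kernel (2 ^ K) (n - n') * (F n' \<bullet> G n))"
        using A by (intro sum.mono_neutral_left) auto
      also have "\<dots> = (\<Sum>n\<in>tri K u. hilbert_kernel (2 ^ K) (n - n') * (F n' \<bullet> G n))"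
      proof (rule sum.mono_neutral_right)
        show "\<forall>n\<in>(A \<union> tri K u) - tri K u. hilbert_kernel (2 ^ K) (n - n') * (F n' \<bullet> G n) = 0"
        proof
          fix n assume "n \<in> (A \<union> tri K u) - tri K u"
          then have "\<not> \<bar>n' - n\<bar> < 2 ^ K" using tri_nbhd[OF n', of n] by auto
          then show "hilbert_kernel (2 ^ K) (n - n') * (F n' \<bullet> G n) = 0" by (simp add: hilbert_kernel_def abs_minus_commute)
        qed
      qed (use A in auto)
      finally show "(\<Sum>n\<in>A. hilbert_kernel (2 ^ K) (n - n') * (F n' \<bullet> G n)) = (\<Sum>n\<in>tri K u. hilbert_kernel (2 ^ K) (n - n') * (F n' \<bullet> G n))" .
    qed
    finally show "(\<Sum>n'\<in>{x\<in>A. x div 2 ^ K = u}. \<Sum>n\<in>A. hilbert_kernel (2 ^ K) (n - n') * (F n' \<bullet> G n)) = lform K u F G" .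
  qed
  finally have "\<bar>\<Sum>n'\<in>A. \<Sum>n\<in>A. hilbert_kernel (2 ^ K) (n - n') * (F n' \<bullet> G n)\<bar> \<le> (\<Sum>u\<in>V. 3750000000 * (\<Sum>n\<in>dyad K u. maxprod (nrm F) (nrm G) n))"
    by (simp only:) (intro order_trans[OF sum_abs] sum_mono lform_le_maxprod fs)
  also have "\<dots> = 3750000000 * (\<Sum>u\<in>V. \<Sum>n\<in>dyad K u. maxprod (nrm F) (nrm G) n)" by (simp add: sum_distrib_left)
  also have "\<dots> \<le> 3750000000 * Z"
    using sum_blocks_le[of "2 ^ K" V "maxprod (nrm F) (nrm G)" Z] fV Z by (simp add: dyad_def)
  finally have e1: "\<bar>\<Sum>n'\<in>A. \<Sum>n\<in>A. hilbert_kernel (2 ^ K) (n - n') * (F n' \<bullet> G n)\<bar> \<le> 3750000000 * Z" .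
  \<comment> \<open>supported on \<open>2 ^ K \<le> \<bar>m\<bar> < 2 ^ (K + 1)\<close>, hence a kernel of a single scale\<close>
  define d where "d m = \<bar>hilbert_kernel L m - hilbert_kernel (2 ^ K) m\<bar>" for m
  have d: "d m = (if 2 ^ K \<le> \<bar>m\<bar> \<and> \<bar>m\<bar> < L then 1 / real_of_int \<bar>m\<bar> else 0)" for m
    using K by (auto simp: d_def hilbert_kernel_def)
  have d0: "d m \<noteq> 0 \<Longrightarrow> \<bar>m\<bar> < 2 ^ (K + 1)" for m using K by (auto simp: d split: if_splits)
  have d1: "d m \<le> 1 / 2 ^ K" for m
  proof (cases "2 ^ K \<le> \<bar>m\<bar>")
    case True
    then have "real_of_int (2 ^ K) \<le> real_of_int \<bar>m\<bar>" by (simp only: of_int_le_iff)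
    then have "1 / real_of_int \<bar>m\<bar> \<le> 1 / 2 ^ K" by (intro frac_le) auto
    then show ?thesis by (simp add: d)
  qed (simp add: d)
  have dnn: "d m \<ge> 0" for m by (simp add: d_def)
  have dsum: "(\<Sum>m\<in>X. d m) \<le> 4" if "finite X" for X
  proof -
    have "(\<Sum>m\<in>X. d m) \<le> (\<Sum>m\<in>X \<inter> {-(2 ^ (K + 1))<..<2 ^ (K + 1)}. d m)"
    proof (rule eq_refl, intro sum.mono_neutral_right ballI)
      fix m assume "m \<in> X - X \<inter> {-(2 ^ (K + 1))<..<2 ^ (K + 1)}"
      then have "\<not> \<bar>m\<bar> < 2 ^ (K + 1)" by auto
      then show "d m = 0" using d0 by blast
    qed (use that in auto)
    also have "\<dots> \<le> (\<Sum>m\<in>{-(2 ^ (K + 1))<..<(2::int) ^ (K + 1)}. 1 / 2 ^ K)"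
      using dnn d1 that by (intro order_trans[OF sum_mono2 sum_mono]) auto
    also have "\<dots> = real (card {-(2 ^ (K + 1))<..<(2::int) ^ (K + 1)}) * (1 / 2 ^ K)" by (rule sum_constant)
    also have "\<dots> \<le> (4 * 2 ^ K) * (1 / 2 ^ K)" by (rule mult_right_mono) auto
    finally show ?thesis by simp
  qed
  have op: "op_le (\<lambda>n' n. complex_of_real (d (n - n'))) 4"
  proof (rule op_le_schur)
    fix n' :: int and A :: "int set" assume A: "finite A"
    have "(\<Sum>n\<in>A. d (n - n')) = (\<Sum>m\<in>(\<lambda>n. n - n') ` A. d m)" by (subst sum.reindex) (auto simp: inj_on_def)
    then show "(\<Sum>n\<in>A. norm (complex_of_real (d (n - n')))) \<le> 4" using dsum[of "(\<lambda>n. n - n') ` A"] A dnn by simp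
    have "(\<Sum>n\<in>A. d (n' - n)) = (\<Sum>m\<in>(\<lambda>n. n' - n) ` A. d m)" by (subst sum.reindex) (auto simp: inj_on_def)
    then show "(\<Sum>n\<in>A. norm (complex_of_real (d (n' - n)))) \<le> 4" using dsum[of "(\<lambda>n. n' - n) ` A"] A dnn by simp
  qed
  have "norm (bform A (\<lambda>n' n. complex_of_real (d (n - n'))) (nrm F) (nrm G)) \<le> 9 * (1 + 36 * 1) * sqrt 4 * Z"
  proof (rule single_scale_bound[OF _ _ _ op _ A(1) fs Z])
    show "(0::int) < 2 ^ K" by simp
    show "\<bar>n - n'\<bar> \<le> 4 * 2 ^ K" if "complex_of_real (d (n - n')) \<noteq> 0" for n' n
    proof -
      have "\<bar>n - n'\<bar> < 2 ^ (K + 1)" using d0[of "n - n'"] that by simp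
      moreover have "(2::int) ^ (K + 1) \<le> 4 * 2 ^ K" by simp
      ultimately show ?thesis by linarith
    qed
    show "norm (complex_of_real (d (n - n'))) \<le> 1 / real_of_int (2 ^ K)" for n' n using d1[of "n - n'"] dnn by simp
  qed auto
  moreover have "bform A (\<lambda>n' n. complex_of_real (d (n - n'))) (nrm F) (nrm G) = complex_of_real (\<Sum>n'\<in>A. \<Sum>n\<in>A. d (n - n') * norm (F n') * norm (G n))"
    by (simp add: bform_def)
  then have "norm (bform A (\<lambda>n' n. complex_of_real (d (n - n'))) (nrm F) (nrm G)) = \<bar>\<Sum>n'\<in>A. \<Sum>n\<in>A. d (n - n') * norm (F n') * norm (G n)\<bar>"
    by (simp only: norm_of_real)
  ultimately have e2: "(\<Sum>n'\<in>A. \<Sum>n\<in>A. d (n - n') * norm (F n') * norm (G n)) \<le> 666 * Z" by simp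
  have "\<bar>\<Sum>n'\<in>A. \<Sum>n\<in>A. (hilbert_kernel L (n - n') - hilbert_kernel (2 ^ K) (n - n')) * (F n' \<bullet> G n)\<bar> \<le> (\<Sum>n'\<in>A. \<Sum>n\<in>A. d (n - n') * norm (F n') * norm (G n))"
  proof (intro order_trans[OF sum_abs] sum_mono)
    fix n' n
    show "\<bar>(hilbert_kernel L (n - n') - hilbert_kernel (2 ^ K) (n - n')) * (F n' \<bullet> G n)\<bar> \<le> d (n - n') * norm (F n') * norm (G n)"
      unfolding abs_mult d_def mult.assoc by (intro mult_left_mono Cauchy_Schwarz_ineq2) auto
  qed
  then have "\<bar>(\<Sum>n'\<in>A. \<Sum>n\<in>A. hilbert_kernel L (n - n') * (F n' \<bullet> G n)) - (\<Sum>n'\<in>A. \<Sum>n\<in>A. hilbert_kernel (2 ^ K) (n - n') * (F n' \<bullet> G n))\<bar> \<le> 666 * Z"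
    using e2 by (simp add: left_diff_distrib sum_subtractf)
  then show ?thesis using e1 Z0 by linarith
qed

section \<open>Weyl sums and quadratic phases\<close>

definition ee :: "real \<Rightarrow> complex" where "ee x = cis (2 * pi * x)"

lemma ee_add: "ee (x + y) = ee x * ee y" by (simp add: ee_def cis_mult distrib_left)
lemma ee_of_int [simp]: "ee (of_int k) = 1" using cis_multiple_2pi[of "of_int k"] by (simp add: ee_def mult_ac)
lemma norm_ee [simp]: "norm (ee x) = 1" by (simp add: ee_def)
lemma cnj_ee: "cnj (ee x) = ee (- x)" by (simp add: ee_def cis_cnj)
lemma ee_0 [simp]: "ee 0 = 1" by (simp add: ee_def)
lemma ee_add_int: "ee (x + of_int k) = ee x" by (simp add: ee_add)

lemma norm_one_minus_ee_ge:
  assumes "0 \<le> y" "y \<le> 1/2"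
  shows "norm (1 - ee y) \<ge> y"
proof (cases "y \<le> 1/6")
  case True
  have "sin (2 * pi * y) \<ge> 1/2 * (2 * pi * y)"
  proof (cases "y = 0")
    case False
    then have "0 < 2 * pi * y" using assms by simp
    from MVT2[OF this, of sin cos] obtain z where z: "0 < z" "z < 2 * pi * y" "sin (2 * pi * y) - sin 0 = (2 * pi * y - 0) * cos z"
      by (auto intro: derivative_eq_intros)
    have "2 * pi * y \<le> 2 * pi * (1/6)" using True by (intro mult_left_mono) auto
    then have "z \<le> pi / 3" using z by linarith
    then have "cos z \<ge> cos (pi/3)" using z by (intro cos_monotone_0_pi_le) auto
    then have "cos z \<ge> 1/2" by (simp add: cos_60)
    then have "(2 * pi * y) * cos z \<ge> (2 * pi * y) * (1/2)" using assms by (intro mult_left_mono) auto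
    then show ?thesis using z by simp
  qed simp
  also have "1/2 * (2 * pi * y) \<ge> y" using pi_gt3 assms mult_right_mono[of 1 pi y] by simp
  finally have "y \<le> \<bar>Im (1 - ee y)\<bar>" by (simp add: ee_def)
  also have "\<dots> \<le> norm (1 - ee y)" by (rule abs_Im_le_cmod)
  finally show ?thesis .
next
  case False
  have "2 * pi * y \<ge> 2 * pi * (1/6)" using False by (intro mult_left_mono) auto
  moreover have "2 * pi * y \<le> 2 * pi * (1/2)" using assms by (intro mult_left_mono) auto
  ultimately have "cos (2 * pi * y) \<le> cos (pi / 3)" by (intro cos_monotone_0_pi_le) auto
  then have "y \<le> \<bar>Re (1 - ee y)\<bar>" using assms by (simp add: ee_def cos_60)
  also have "\<dots> \<le> norm (1 - ee y)" by (rule abs_Re_le_cmod)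
  finally show ?thesis .
qed

definition int_dist :: "real \<Rightarrow> real" where "int_dist x = \<bar>x - of_int (round x)\<bar>"

lemma int_dist_le: "int_dist x \<le> \<bar>x - of_int k\<bar>"
  using round_diff_minimal[of x k] by (simp add: int_dist_def abs_minus_commute)

lemma int_dist_nonneg: "int_dist x \<ge> 0" by (simp add: int_dist_def)

lemma int_dist_le_half: "int_dist x \<le> 1/2"
  using of_int_round_abs_le[of x] by (simp add: int_dist_def abs_minus_commute)

lemma int_dist_diff: "int_dist y - \<bar>x - y\<bar> \<le> int_dist x"
  using int_dist_le[of y "round x"] by (simp add: int_dist_def)

lemma int_dist_eq:
  assumes "\<bar>x - of_int k\<bar> < 1/2"
  shows "int_dist x = \<bar>x - of_int k\<bar>"
proof -
  have "round x = k" using assms by (intro round_unique') auto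
  then show ?thesis by (simp add: int_dist_def)
qed

lemma int_dist_le_norm_one_minus_ee: "int_dist x \<le> norm (1 - ee x)"
proof -
  define y where "y = x - of_int (round x)"
  have x: "ee x = ee y" using ee_add_int[of y "round x"] by (simp add: y_def)
  have y: "\<bar>y\<bar> \<le> 1/2" using int_dist_le_half[of x] by (simp add: int_dist_def y_def)
  have sym: "norm (1 - ee (-y)) = norm (1 - ee y)"
    using complex_mod_cnj[of "1 - ee y"] by (simp add: cnj_ee)
  have "\<bar>y\<bar> \<le> norm (1 - ee \<bar>y\<bar>)" using y by (intro norm_one_minus_ee_ge) auto
  also have "norm (1 - ee \<bar>y\<bar>) = norm (1 - ee y)" using sym by (cases "y \<ge> 0") auto
  finally show ?thesis using x by (simp add: int_dist_def y_def)
qed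

lemma sum_ee_telescope:
  fixes l u :: int
  assumes "l \<le> u"
  shows "(1 - ee \<beta>) * (\<Sum>m\<in>{l..<u}. ee (\<beta> * of_int m)) = ee (\<beta> * of_int l) - ee (\<beta> * of_int u)"
  using assms
proof (induction u rule: int_ge_induct)
  case (step i)
  have "{l..<i+1} = insert i {l..<i}" using step by auto
  then have "(1 - ee \<beta>) * (\<Sum>m\<in>{l..<i+1}. ee (\<beta> * of_int m)) = (1 - ee \<beta>) * ee (\<beta> * of_int i) + (ee (\<beta> * of_int l) - ee (\<beta> * of_int i))"
    using step by (simp add: distrib_left)
  also have "\<dots> = ee (\<beta> * of_int l) - ee \<beta> * ee (\<beta> * of_int i)" by (simp add: left_diff_distrib)
  also have "ee \<beta> * ee (\<beta> * of_int i) = ee (\<beta> * of_int (i + 1))" by (simp add: distrib_left mult.commute flip: ee_add) (simp add: add.commute)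
  finally show ?case .
qed simp

text \<open>A bound for an exponential sum over at most \<open>N\<close> consecutive integers: the smaller of \<open>N\<close> and
  \<open>2 / int_dist x\<close>. The test is written as a product so that no division by zero occurs for
  integers \<open>x\<close>.\<close>

definition progression_weight :: "real \<Rightarrow> real \<Rightarrow> real" where
  "progression_weight N x = (if int_dist x * N \<le> 2 then N else 2 / int_dist x)"

lemma progression_weight_le_N: "N \<ge> 0 \<Longrightarrow> progression_weight N x \<le> N"
  by (cases "int_dist x = 0") (auto simp: progression_weight_def field_simps int_dist_nonneg less_le)

lemma progression_weight_nonneg: "N \<ge> 0 \<Longrightarrow> progression_weight N x \<ge> 0"
  by (simp add: progression_weight_def int_dist_nonneg)

lemma progression_weight_le_inverse:
  assumes "0 < d" "d \<le> int_dist x"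
  shows "progression_weight N x \<le> 2 / d"
proof -
  have "2 / int_dist x \<le> 2 / d" using assms by (intro divide_left_mono) auto
  moreover have "N \<le> 2 / int_dist x" if "int_dist x * N \<le> 2" using that assms by (simp add: field_simps)
  ultimately show ?thesis by (auto simp: progression_weight_def)
qed

lemma norm_sum_ee_le:
  fixes l u :: int
  assumes "of_int (u - l) \<le> N" "N \<ge> 0"
  shows "norm (\<Sum>m\<in>{l..<u}. ee (\<beta> * of_int m)) \<le> progression_weight N \<beta>"
proof (cases "l \<le> u")
  case True
  show ?thesis
  proof (cases "int_dist \<beta> * N \<le> 2")
    case True
    have "norm (\<Sum>m\<in>{l..<u}. ee (\<beta> * of_int m)) \<le> (\<Sum>m\<in>{l..<u}. 1)"
      by (rule order_trans[OF norm_sum]) simp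
    also have "\<dots> \<le> N" using assms \<open>l \<le> u\<close> by simp
    finally show ?thesis using True by (simp add: progression_weight_def)
  next
    case False
    then have d: "int_dist \<beta> > 0" using int_dist_nonneg[of \<beta>] by (cases "int_dist \<beta> = 0") auto
    have "int_dist \<beta> * norm (\<Sum>m\<in>{l..<u}. ee (\<beta> * of_int m)) \<le> norm (1 - ee \<beta>) * norm (\<Sum>m\<in>{l..<u}. ee (\<beta> * of_int m))"
      by (intro mult_right_mono int_dist_le_norm_one_minus_ee) auto
    also have "\<dots> = norm (ee (\<beta> * of_int l) - ee (\<beta> * of_int u))"
      using sum_ee_telescope[OF \<open>l \<le> u\<close>, of \<beta>] by (simp flip: norm_mult)
    also have "\<dots> \<le> 2" using norm_triangle_ineq4[of "ee (\<beta> * of_int l)" "ee (\<beta> * of_int u)"] by simp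
    finally show ?thesis using False d by (simp add: progression_weight_def field_simps)
  qed
qed (use assms progression_weight_nonneg in auto)

definition weyl_sum :: "real \<Rightarrow> int \<Rightarrow> real" where
  "weyl_sum \<theta> N = (\<Sum>h\<in>{-N<..<N}. progression_weight (of_int N) (\<theta> * of_int h))"

lemma weyl_sum_nonneg: "N > 0 \<Longrightarrow> weyl_sum \<theta> N \<ge> 0"
  unfolding weyl_sum_def by (intro sum_nonneg progression_weight_nonneg) auto

text \<open>Weyl differencing: the autocorrelation of \<open>e(\<alpha> m\<^sup>2)\<close> at lag \<open>h\<close> is a geometric sum with
  ratio \<open>e(2 \<alpha> h)\<close>.\<close>

lemma quadratic_phase_op_le:
  fixes N l u :: int
  assumes N: "N > 0" "u - l \<le> N"
  shows "op_le (\<lambda>n' n. if n - n' \<in> {l..<u} then ee (\<alpha> * (of_int (n - n'))\<^sup>2) else 0) (sqrt (weyl_sum (2 * \<alpha>) N))"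
proof -
  define c where "c m = (if m \<in> {l..<u} then ee (\<alpha> * (of_int m)\<^sup>2) else 0)" for m :: int
  have S: "norm (\<Sum>m\<in>{l..<u}. c (m + h) * cnj (c m)) \<le> (if h \<in> {-N<..<N} then progression_weight (of_int N) (2 * \<alpha> * of_int h) else 0)" for h
  proof -
    define l' u' where "l' = max l (l - h)" and "u' = min u (u - h)"
    have "(\<Sum>m\<in>{l..<u}. c (m + h) * cnj (c m)) = (\<Sum>m\<in>{l'..<u'}. c (m + h) * cnj (c m))"
      by (rule sum.mono_neutral_right) (auto simp: l'_def u'_def c_def)
    also have "\<dots> = (\<Sum>m\<in>{l'..<u'}. ee (\<alpha> * (of_int h)\<^sup>2) * ee (2 * \<alpha> * of_int h * of_int m))"
    proof (rule sum.cong[OF refl])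
      fix m assume "m \<in> {l'..<u'}"
      then have "m \<in> {l..<u}" "m + h \<in> {l..<u}" by (auto simp: l'_def u'_def)
      then have "c (m + h) * cnj (c m) = ee (\<alpha> * (of_int (m + h))\<^sup>2 + - (\<alpha> * (of_int m)\<^sup>2))"
        by (simp only: c_def if_True cnj_ee ee_add)
      also have "\<alpha> * (of_int (m + h))\<^sup>2 + - (\<alpha> * (of_int m)\<^sup>2) = \<alpha> * (of_int h)\<^sup>2 + 2 * \<alpha> * of_int h * of_int m"
        by (simp add: power2_eq_square algebra_simps)
      finally show "c (m + h) * cnj (c m) = ee (\<alpha> * (of_int h)\<^sup>2) * ee (2 * \<alpha> * of_int h * of_int m)"
        by (simp only: ee_add)
    qed
    also have "norm \<dots> = norm (\<Sum>m\<in>{l'..<u'}. ee (2 * \<alpha> * of_int h * of_int m))"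
      by (simp add: norm_mult flip: sum_distrib_left)
    finally have e: "norm (\<Sum>m\<in>{l..<u}. c (m + h) * cnj (c m)) = norm (\<Sum>m\<in>{l'..<u'}. ee (2 * \<alpha> * of_int h * of_int m))" .
    show ?thesis
    proof (cases "h \<in> {-N<..<N}")
      case True
      have "u' - l' \<le> N" using N by (auto simp: l'_def u'_def)
      then have "real_of_int (u' - l') \<le> of_int N" by (simp only: of_int_le_iff)
      then show ?thesis unfolding e using True N by (simp add: norm_sum_ee_le)
    next
      case False
      then have "{l'..<u'} = {}" using N by (auto simp: l'_def u'_def)
      then show ?thesis unfolding e using False by auto
    qed
  qed
  have "op_le (\<lambda>n' n. c (n - n')) (sqrt (weyl_sum (2 * \<alpha>) N))"
  proof (rule op_le_convolution[where W = "{l..<u}"])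
    fix H :: "int set" assume H: "finite H"
    have "(\<Sum>h\<in>H. norm (\<Sum>m\<in>{l..<u}. c (m + h) * cnj (c m))) \<le>
        (\<Sum>h\<in>H. if h \<in> {-N<..<N} then progression_weight (of_int N) (2 * \<alpha> * of_int h) else 0)"
      by (intro sum_mono S)
    also have "\<dots> = (\<Sum>h\<in>H \<inter> {-N<..<N}. progression_weight (of_int N) (2 * \<alpha> * of_int h))"
      using H by (simp add: sum.inter_restrict)
    also have "\<dots> \<le> weyl_sum (2 * \<alpha>) N" unfolding weyl_sum_def
      using N by (intro sum_mono2) (auto intro: progression_weight_nonneg)
    also have "\<dots> = (sqrt (weyl_sum (2 * \<alpha>) N))\<^sup>2" using weyl_sum_nonneg N by simp
    finally show "(\<Sum>h\<in>H. norm (\<Sum>m\<in>{l..<u}. c (m + h) * cnj (c m))) \<le> (sqrt (weyl_sum (2 * \<alpha>) N))\<^sup>2" .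
  qed (use N in \<open>auto simp: c_def weyl_sum_nonneg\<close>)
  then show ?thesis by (simp add: c_def)
qed

definition quadratic_kernel :: "real \<Rightarrow> int \<Rightarrow> complex" where
  "quadratic_kernel \<alpha> m = ee (\<alpha> * (of_int m)\<^sup>2) / of_int m"

definition shell :: "real \<Rightarrow> int \<Rightarrow> int \<Rightarrow> complex" where
  "shell \<alpha> N m = (if N \<le> \<bar>m\<bar> \<and> \<bar>m\<bar> < 2 * N then quadratic_kernel \<alpha> m else 0)"

lemma inverse_telescope:
  fixes l u :: int
  assumes "l \<le> u"
  shows "(\<Sum>v\<in>{l..<u}. 1 / real_of_int v - 1 / of_int (v + 1)) = 1 / of_int l - 1 / of_int u"
  using assms
proof (induction u rule: int_ge_induct)
  case (step i)
  have "{l..<i+1} = insert i {l..<i}" using step by auto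
  then show ?case using step by simp
qed simp

text \<open>Partial summation writes \<open>1/m\<close> on \<open>N \<le> m < 2 N\<close> as a combination of indicators of \<open>{N..v}\<close>
  with total mass \<open>1/N\<close>; the negative half is a reflection.\<close>

lemma shell_op_le:
  fixes N :: int
  assumes N: "N > 0"
  shows "op_le (\<lambda>n' n. shell \<alpha> N (n - n')) (2 / of_int N * sqrt (weyl_sum (2 * \<alpha>) N))"
proof -
  define B where "B = sqrt (weyl_sum (2 * \<alpha>) N)"
  define ph where "ph u m = (if m \<in> {N..<u} then ee (\<alpha> * (of_int m)\<^sup>2) else 0)" for u m :: int
  define cp where "cp m = (if m \<in> {N..<2*N} then quadratic_kernel \<alpha> m else 0)" for m :: int
  define w where "w v = 1 / real_of_int v - 1 / of_int (v + 1)" for v :: int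
  have w0: "w v \<ge> 0" if "v \<in> {N..<2*N}" for v using that N by (simp add: w_def field_simps)
  have ph: "op_le (\<lambda>n' n. ph u (n - n')) B" if "u \<le> 2 * N" for u
    unfolding ph_def B_def using that by (intro quadratic_phase_op_le N) auto
  have cp_eq: "cp m = (\<Sum>v\<in>{N..<2*N}. of_real (w v) * ph (v + 1) m) + of_real (1 / (2 * of_int N)) * ph (2 * N) m" for m
  proof (cases "m \<in> {N..<2*N}")
    case True
    have "(\<Sum>v\<in>{N..<2*N}. of_real (w v) * ph (v + 1) m) = (\<Sum>v\<in>{m..<2*N}. of_real (w v) * ee (\<alpha> * (of_int m)\<^sup>2))"
      using True by (intro sum.mono_neutral_cong_right) (auto simp: ph_def)
    also have "\<dots> = of_real (\<Sum>v\<in>{m..<2*N}. w v) * ee (\<alpha> * (of_int m)\<^sup>2)"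
      by (simp add: sum_distrib_right)
    also have "(\<Sum>v\<in>{m..<2*N}. w v) = 1 / of_int m - 1 / of_int (2 * N)"
      unfolding w_def using True by (intro inverse_telescope) auto
    finally show ?thesis using True by (simp add: cp_def ph_def quadratic_kernel_def left_diff_distrib)
  qed (auto simp: cp_def ph_def intro!: sum.neutral)
  have "op_le (\<lambda>n' n. (\<Sum>v\<in>{N..<2*N}. of_real (w v) * ph (v + 1) (n - n')) + of_real (1 / (2 * of_int N)) * ph (2 * N) (n - n'))
     ((\<Sum>v\<in>{N..<2*N}. norm (complex_of_real (w v)) * B) + norm (complex_of_real (1 / (2 * of_int N))) * B)"
    by (intro op_le_add op_le_sum op_le_scale ph) auto
  also have "(\<Sum>v\<in>{N..<2*N}. norm (complex_of_real (w v)) * B) = (\<Sum>v\<in>{N..<2*N}. w v) * B"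
    using w0 by (simp add: sum_distrib_right)
  also have "(\<Sum>v\<in>{N..<2*N}. w v) = 1 / of_int N - 1 / of_int (2 * N)"
    unfolding w_def using N by (intro inverse_telescope) auto
  also have "(1 / of_int N - 1 / of_int (2 * N)) * B + norm (complex_of_real (1 / (2 * of_int N))) * B = B / of_int N"
    using N by (simp add: field_simps norm_divide)
  finally have p: "op_le (\<lambda>n' n. cp (n - n')) (B / of_int N)" unfolding cp_eq .
  have m: "op_le (\<lambda>n' n. cp (n' - n)) (B / of_int N)" by (rule op_le_reflect[OF p])
  have "op_le (\<lambda>n' n. cp (n - n') - cp (n' - n)) (B / of_int N + B / of_int N)"
    by (rule op_le_diff[OF p m])
  moreover have "cp (n - n') - cp (n' - n) = shell \<alpha> N (n - n')" for n n'
  proof -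
    have s: "quadratic_kernel \<alpha> (n' - n) = - quadratic_kernel \<alpha> (n - n')"
    proof -
      have "n' - n = - (n - n')" by simp
      then show ?thesis unfolding quadratic_kernel_def by (simp only: of_int_minus power2_minus divide_minus_right)
    qed
    consider "n - n' \<in> {N..<2*N}" | "n' - n \<in> {N..<2*N}" | "n - n' \<notin> {N..<2*N}" "n' - n \<notin> {N..<2*N}" by blast
    then show ?thesis
    proof cases
      case 1
      then have "n' - n \<notin> {N..<2*N}" "N \<le> \<bar>n - n'\<bar>" "\<bar>n - n'\<bar> < 2 * N" using N by auto
      then show ?thesis using 1 by (simp only: cp_def shell_def) simp
    next
      case 2
      then have "n - n' \<notin> {N..<2*N}" "N \<le> \<bar>n - n'\<bar>" "\<bar>n - n'\<bar> < 2 * N" using N by auto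
      then show ?thesis using 2 s by (simp only: cp_def shell_def) simp
    next
      case 3
      then have "\<not> (N \<le> \<bar>n - n'\<bar> \<and> \<bar>n - n'\<bar> < 2 * N)" by auto
      then show ?thesis using 3 by (simp only: cp_def shell_def) simp
    qed
  qed
  ultimately show ?thesis by (simp add: B_def)
qed

lemma int_dist_rational_ge:
  fixes a q h :: int
  assumes "coprime a q" "q > 0" "\<not> q dvd h"
  shows "int_dist (of_int a / of_int q * of_int h) \<ge> 1 / of_int q"
proof -
  define k where "k = round (of_int a / of_int q * of_int h :: real)"
  have "a * h - k * q \<noteq> 0"
  proof
    assume "a * h - k * q = 0"
    then have "q dvd a * h" by (metis dvd_triv_right eq_iff_diff_eq_0)
    then show False using assms by (simp add: coprime_commute coprime_dvd_mult_right_iff)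
  qed
  then have "\<bar>a * h - k * q\<bar> \<ge> 1" by linarith
  then have "real_of_int \<bar>a * h - k * q\<bar> \<ge> 1" by linarith
  moreover have "int_dist (of_int a / of_int q * of_int h) = real_of_int \<bar>a * h - k * q\<bar> / of_int q"
    unfolding int_dist_def k_def[symmetric] using assms(2) by (simp add: field_simps abs_divide)
  ultimately show ?thesis using assms(2) by (simp add: divide_right_mono)
qed

lemma sum_inverse_sqrt_le: "(\<Sum>l\<in>{1..n::nat}. 1 / sqrt (real l)) \<le> 2 * sqrt (real n)"
proof (induction n)
  case (Suc n)
  have "1 / sqrt (real (Suc n)) \<le> 2 * sqrt (real (Suc n)) - 2 * sqrt (real n)"
  proof -
    have "(sqrt (real (Suc n)) - sqrt (real n)) * (sqrt (real (Suc n)) + sqrt (real n)) = 1"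
      by (simp add: algebra_simps)
    moreover have "sqrt (real n) \<le> sqrt (real (Suc n))" by simp
    ultimately have "1 \<le> (sqrt (real (Suc n)) - sqrt (real n)) * (2 * sqrt (real (Suc n)))"
      by (smt (verit) mult_left_mono)
    then show ?thesis by (simp add: field_simps)
  qed
  then show ?case using Suc by simp
qed simp

text \<open>If \<open>q\<close> does not divide \<open>h\<close>, then \<open>\<theta> h\<close> stays \<open>3/(4 q)\<close> away from the integers, because
  \<open>a h / q\<close> does by \<open>1/q\<close> and the error is at most \<open>1/(4 q)\<close>. Only the multiples of \<open>q\<close> can
  produce large terms.\<close>

lemma weyl_sum_le_multiples:
  fixes N a q :: int
  assumes N: "N > 0" and q: "coprime a q" "0 < q" "q \<le> N"
    and ap: "\<bar>\<theta> - of_int a / of_int q\<bar> \<le> 1 / (4 * of_int N * of_int q)"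
  shows "weyl_sum \<theta> N \<le> 6 * of_int q * of_int N + (\<Sum>l\<in>{-(N div q)..N div q}. progression_weight (of_int N) (\<theta> * of_int (q * l)))"
proof -
  define \<beta> where "\<beta> = \<theta> - of_int a / of_int q"
  have hb: "\<bar>of_int h * \<beta>\<bar> \<le> 1 / (4 * of_int q)" if "h \<in> {-N<..<N}" for h
  proof -
    have "\<bar>of_int h * \<beta>\<bar> = real_of_int \<bar>h\<bar> * \<bar>\<beta>\<bar>" by (simp add: abs_mult)
    also have "\<dots> \<le> of_int N * (1 / (4 * of_int N * of_int q))"
      using that N q ap unfolding \<beta>_def by (intro mult_mono) (auto simp: abs_if)
    finally show ?thesis using N by simp
  qed
  let ?H0 = "{h\<in>{-N<..<N}. \<not> q dvd h}" and ?H1 = "{h\<in>{-N<..<N}. q dvd h}"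
  have "weyl_sum \<theta> N = (\<Sum>h\<in>?H0. progression_weight (of_int N) (\<theta> * of_int h)) + (\<Sum>h\<in>?H1. progression_weight (of_int N) (\<theta> * of_int h))"
    unfolding weyl_sum_def by (subst sum.union_disjoint[symmetric]) (auto intro!: sum.cong intro: finite_subset[of _ "{-N<..<N}"])
  moreover have "(\<Sum>h\<in>?H0. progression_weight (of_int N) (\<theta> * of_int h)) \<le> 6 * of_int q * of_int N"
  proof -
    have "(\<Sum>h\<in>?H0. progression_weight (of_int N) (\<theta> * of_int h)) \<le> (\<Sum>h\<in>?H0. 3 * of_int q)"
    proof (rule sum_mono)
      fix h assume h: "h \<in> ?H0"
      have "\<theta> * of_int h = of_int a / of_int q * of_int h + of_int h * \<beta>" by (simp add: \<beta>_def algebra_simps)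
      then have "\<bar>\<theta> * of_int h - of_int a / of_int q * of_int h\<bar> \<le> 1 / (4 * of_int q)" using hb[of h] h by simp
      then have "1 / of_int q - 1 / (4 * of_int q) \<le> int_dist (\<theta> * of_int h)"
        using int_dist_rational_ge[OF q(1,2), of h] h int_dist_diff[of "of_int a / of_int q * of_int h" "\<theta> * of_int h"] by auto
      then have "3 / (4 * of_int q) \<le> int_dist (\<theta> * of_int h)" using q by (simp add: field_simps)
      then have "progression_weight (of_int N) (\<theta> * of_int h) \<le> 2 / (3 / (4 * of_int q))" using q by (intro progression_weight_le_inverse) auto
      then show "progression_weight (of_int N) (\<theta> * of_int h) \<le> 3 * of_int q" using q by simp
    qed
    also have "\<dots> = real (card ?H0) * (3 * of_int q)" by simp
    also have "\<dots> \<le> (2 * of_int N) * (3 * of_int q)"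
    proof (rule mult_right_mono)
      have "card ?H0 \<le> card {-N<..<N}" by (rule card_mono) auto
      then show "real (card ?H0) \<le> 2 * of_int N" using N by simp
    qed (use q in auto)
    finally show ?thesis by (simp add: mult_ac)
  qed
  moreover have "(\<Sum>h\<in>?H1. progression_weight (of_int N) (\<theta> * of_int h)) \<le> (\<Sum>l\<in>{-(N div q)..N div q}. progression_weight (of_int N) (\<theta> * of_int (q * l)))"
  proof -
    have inj: "inj_on (\<lambda>l. q * l) A" for A using q by (auto simp: inj_on_def)
    have "?H1 \<subseteq> (\<lambda>l. q * l) ` {-(N div q)..N div q}"
    proof
      fix h assume h: "h \<in> ?H1"
      then obtain l where l: "h = q * l" by auto
      have "q * l \<le> N" "q * (- l) \<le> N" using h l by auto
      then have "l \<le> N div q" "- l \<le> N div q" using q zdiv_mono1[of "q * l" N q] zdiv_mono1[of "q * (- l)" N q]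
          nonzero_mult_div_cancel_left[of q l] nonzero_mult_div_cancel_left[of q "- l"] by linarith+
      then show "h \<in> (\<lambda>l. q * l) ` {-(N div q)..N div q}" using l by auto
    qed
    then have "(\<Sum>h\<in>?H1. progression_weight (of_int N) (\<theta> * of_int h)) \<le> (\<Sum>h\<in>(\<lambda>l. q * l) ` {-(N div q)..N div q}. progression_weight (of_int N) (\<theta> * of_int h))"
      using N by (intro sum_mono2) (auto intro: progression_weight_nonneg)
    then show ?thesis by (simp add: sum.reindex[OF inj])
  qed
  ultimately show ?thesis by linarith
qed

text \<open>The at most \<open>3 N / q\<close> multiples of \<open>q\<close> are estimated trivially.\<close>

lemma weyl_sum_major:
  fixes N a q :: int
  assumes N: "N > 0" and q: "coprime a q" "0 < q" "q \<le> N"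
    and ap: "\<bar>\<theta> - of_int a / of_int q\<bar> \<le> 1 / (4 * of_int N * of_int q)"
  shows "weyl_sum \<theta> N \<le> 6 * of_int q * of_int N + 3 * (of_int N)\<^sup>2 / of_int q"
proof -
  have nq: "N div q \<ge> 1" using q by (simp add: pos_imp_zdiv_pos_iff int_one_le_iff_zero_less)
  have nq2: "real_of_int (N div q) \<le> of_int N / of_int q" using floor_divide_of_int_eq[of N q] of_int_floor_le by metis
  have "(\<Sum>l\<in>{-(N div q)..N div q}. progression_weight (of_int N) (\<theta> * of_int (q * l))) \<le> (\<Sum>l\<in>{-(N div q)..N div q}. of_int N)"
    using N by (intro sum_mono progression_weight_le_N) auto
  also have "\<dots> = (2 * of_int (N div q) + 1) * of_int N" using nq by simp
  also have "\<dots> \<le> (3 * of_int (N div q)) * of_int N" using nq N by (intro mult_right_mono) auto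
  also have "\<dots> \<le> (3 * (of_int N / of_int q)) * of_int N" using nq2 N by (intro mult_right_mono) auto
  also have "\<dots> = 3 * (of_int N)\<^sup>2 / of_int q" by (simp add: power2_eq_square)
  finally show ?thesis using weyl_sum_le_multiples[OF assms] by linarith
qed

text \<open>At a multiple \<open>q * l\<close> the distance of \<open>\<theta> q l\<close> to the integers is exactly \<open>q * \<bar>l\<bar> * \<bar>\<beta>\<bar>\<close>.
  The weight is at most the geometric mean of its two bounds, which leaves a sum of
  \<open>1 / sqrt l\<close>.\<close>

lemma weyl_sum_major_decay:
  fixes N a q :: int
  assumes N: "N > 0" and q: "coprime a q" "0 < q" "q \<le> N"
    and ap: "\<bar>\<theta> - of_int a / of_int q\<bar> \<le> 1 / (4 * of_int N * of_int q)"
    and \<beta>: "\<beta> = \<theta> - of_int a / of_int q" "\<beta> \<noteq> 0"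
  shows "weyl_sum \<theta> N \<le> 7 * of_int q * of_int N + 6 * of_int N / (of_int q * sqrt \<bar>\<beta>\<bar>)"
proof -
  define K where "K = nat (N div q)"
  have nq: "N div q \<ge> 1" using q by (simp add: pos_imp_zdiv_pos_iff int_one_le_iff_zero_less)
  have K: "int K = N div q" using nq by (simp add: K_def)
  have nq2: "real K \<le> of_int N / of_int q"
    using floor_divide_of_int_eq[of N q] of_int_floor_le K by (metis of_int_of_nat_eq)
  define D where "D = sqrt (2 * of_int N / (of_int q * \<bar>\<beta>\<bar>))"
  have D0: "D \<ge> 0" using N q by (simp add: D_def)
  have trm: "progression_weight (of_int N) (\<theta> * of_int (q * l)) \<le> D * (1 / sqrt (real_of_int \<bar>l\<bar>))" if l: "l \<noteq> 0" "\<bar>l\<bar> \<le> N div q" for l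
  proof -
    have "\<bar>q * l\<bar> \<le> N"
    proof -
      have "\<bar>q * l\<bar> = q * \<bar>l\<bar>" using q by (simp add: abs_mult)
      also have "\<dots> \<le> q * (N div q)" using l q by (intro mult_left_mono) auto
      also have "\<dots> \<le> N" using q pos_mod_sign[of q N] mult_div_mod_eq[of q N] by linarith
      finally show ?thesis .
    qed
    then have ql: "real_of_int \<bar>q * l\<bar> \<le> of_int N" by (simp only: of_int_le_iff)
    have e: "\<theta> * of_int (q * l) - of_int (a * l) = of_int (q * l) * \<beta>" using q by (simp add: \<beta> field_simps)
    have "\<bar>of_int (q * l) * \<beta>\<bar> \<le> of_int N * (1 / (4 * of_int N * of_int q))"
      using ql ap N q unfolding \<beta> by (simp only: abs_mult of_int_abs[symmetric]) (intro mult_mono; simp)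
    also have "\<dots> = 1 / (4 * of_int q)" using N by simp
    also have "\<dots> < 1/2" using q by (simp add: field_simps)
    finally have "int_dist (\<theta> * of_int (q * l)) = \<bar>of_int (q * l) * \<beta>\<bar>" using int_dist_eq[of "\<theta> * of_int (q * l)" "a * l"] e by simp
    then have dn: "int_dist (\<theta> * of_int (q * l)) = of_int q * real_of_int \<bar>l\<bar> * \<bar>\<beta>\<bar>" using q by (simp add: abs_mult)
    have pos: "of_int q * real_of_int \<bar>l\<bar> * \<bar>\<beta>\<bar> > 0" using q l \<beta> by simp
    define w where "w = progression_weight (of_int N) (\<theta> * of_int (q * l))"
    have w: "0 \<le> w" "w \<le> of_int N" "w \<le> 2 / (of_int q * real_of_int \<bar>l\<bar> * \<bar>\<beta>\<bar>)"
      unfolding w_def using N pos dn by (auto intro: progression_weight_nonneg progression_weight_le_N progression_weight_le_inverse)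
    have "w * w \<le> of_int N * (2 / (of_int q * real_of_int \<bar>l\<bar> * \<bar>\<beta>\<bar>))" using w N by (intro mult_mono) auto
    then have "sqrt (w * w) \<le> sqrt ((2 * of_int N / (of_int q * \<bar>\<beta>\<bar>)) * (1 / real_of_int \<bar>l\<bar>))"
      by (intro real_sqrt_le_mono) (simp add: mult_ac)
    then have "w \<le> sqrt ((2 * of_int N / (of_int q * \<bar>\<beta>\<bar>)) * (1 / real_of_int \<bar>l\<bar>))" using w by simp
    then show ?thesis unfolding D_def w_def by (simp only: real_sqrt_mult real_sqrt_divide real_sqrt_one)
  qed
  let ?w = "\<lambda>l. progression_weight (of_int N) (\<theta> * of_int (q * l))"
  have "{-(N div q)..N div q} = insert 0 (int ` {1..K} \<union> (\<lambda>l. - int l) ` {1..K})"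
  proof -
    have "l \<in> insert 0 (int ` {1..K} \<union> (\<lambda>l. - int l) ` {1..K})" if "\<bar>l\<bar> \<le> N div q" for l
    proof -
      consider "l = 0" | "l > 0" | "l < 0" by linarith
      then show ?thesis
      proof cases
        case 2
        then have "l = int (nat l)" "nat l \<in> {1..K}" using that K by auto
        then show ?thesis by blast
      next
        case 3
        then have "l = - int (nat (-l))" "nat (-l) \<in> {1..K}" using that K by auto
        then show ?thesis by blast
      qed auto
    qed
    then show ?thesis using K by (auto simp: abs_le_iff) (metis abs_le_iff minus_le_iff)
  qed
  then have "(\<Sum>l\<in>{-(N div q)..N div q}. ?w l) = ?w 0 + (\<Sum>l\<in>int ` {1..K} \<union> (\<lambda>l. - int l) ` {1..K}. ?w l)"
    by (simp only:) (subst sum.insert; auto)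
  also have "\<dots> = ?w 0 + ((\<Sum>l\<in>int ` {1..K}. ?w l) + (\<Sum>l\<in>(\<lambda>l. - int l) ` {1..K}. ?w l))"
    by (subst sum.union_disjoint) auto
  also have "(\<Sum>l\<in>int ` {1..K}. ?w l) = (\<Sum>l\<in>{1..K}. ?w (int l))" by (subst sum.reindex) auto
  also have "(\<Sum>l\<in>(\<lambda>l. - int l) ` {1..K}. ?w l) = (\<Sum>l\<in>{1..K}. ?w (- int l))" by (subst sum.reindex) (auto simp: inj_on_def)
  also have "?w 0 + ((\<Sum>l\<in>{1..K}. ?w (int l)) + (\<Sum>l\<in>{1..K}. ?w (- int l))) \<le>
      of_int N + ((\<Sum>l\<in>{1..K}. D * (1 / sqrt (real l))) + (\<Sum>l\<in>{1..K}. D * (1 / sqrt (real l))))"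
  proof (intro add_mono sum_mono)
    show "?w 0 \<le> of_int N" using N by (intro progression_weight_le_N) auto
    fix l assume l: "l \<in> {1..K}"
    show "?w (int l) \<le> D * (1 / sqrt (real l))" using trm[of "int l"] l K by auto
    show "?w (- int l) \<le> D * (1 / sqrt (real l))" using trm[of "- int l"] l K by auto
  qed
  also have "\<dots> = of_int N + 2 * D * (\<Sum>l\<in>{1..K}. 1 / sqrt (real l))" by (simp add: sum_distrib_left)
  also have "\<dots> \<le> of_int N + 2 * D * (2 * sqrt (of_int N / of_int q))"
  proof -
    have "(\<Sum>l\<in>{1..K}. 1 / sqrt (real l)) \<le> 2 * sqrt (of_int N / of_int q)"
      using sum_inverse_sqrt_le[of K] nq2 real_sqrt_le_mono[OF nq2] by linarith
    then show ?thesis using D0 by (intro add_left_mono mult_left_mono) auto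
  qed
  also have "2 * D * (2 * sqrt (of_int N / of_int q)) = 4 * sqrt 2 * (of_int N / (of_int q * sqrt \<bar>\<beta>\<bar>))"
  proof -
    have "D * sqrt (of_int N / of_int q) = sqrt (2 * (of_int N / of_int q)\<^sup>2 / \<bar>\<beta>\<bar>)"
      unfolding D_def by (simp add: power2_eq_square mult_ac flip: real_sqrt_mult)
    also have "\<dots> = sqrt 2 * (of_int N / of_int q) / sqrt \<bar>\<beta>\<bar>" using N q by (simp add: real_sqrt_mult real_sqrt_divide)
    finally show ?thesis by simp
  qed
  also have "\<dots> \<le> 6 * (of_int N / (of_int q * sqrt \<bar>\<beta>\<bar>))"
  proof (rule mult_right_mono)
    have "sqrt 2 \<le> 3/2" by (rule real_le_lsqrt) (auto simp: power2_eq_square)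
    then show "4 * sqrt 2 \<le> (6::real)" by simp
  qed (use N q in auto)
  finally have "(\<Sum>l\<in>{-(N div q)..N div q}. ?w l) \<le> of_int N + 6 * of_int N / (of_int q * sqrt \<bar>\<beta>\<bar>)" by simp
  moreover have "real_of_int N \<le> of_int q * of_int N" using N q by simp
  ultimately show ?thesis using weyl_sum_le_multiples[OF N q ap] by (simp add: algebra_simps)
qed

text \<open>Among about \<open>q/2\<close> consecutive values of \<open>h\<close> the points \<open>\<theta> h\<close> modulo 1 are separated by
  \<open>1/(2 q)\<close>. So the number of \<open>h\<close> for which \<open>\<theta> h\<close> is within \<open>\<eta>\<close> of an integer is
  \<open>O(N / q * (q * \<eta> + 1))\<close>. These are estimated by \<open>N\<close> and the others by \<open>2 / \<eta>\<close>; the choice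
  \<open>\<eta> = 1 / sqrt N\<close> balances the two.\<close>

lemma weyl_sum_minor:
  fixes N a q :: int
  assumes N: "N > 0" and q: "coprime a q" "0 < q" "q \<le> 4 * N"
    and ap: "\<bar>\<theta> - of_int a / of_int q\<bar> \<le> 1 / (4 * of_int N * of_int q)"
  shows "weyl_sum \<theta> N \<le> 52 * of_int N * sqrt (of_int N) + 24 * (of_int N)\<^sup>2 / of_int q"
proof -
  define \<beta> where "\<beta> = \<theta> - of_int a / of_int q"
  define \<eta> where "\<eta> = 1 / sqrt (real_of_int N)"
  have \<eta>: "\<eta> > 0" using N by (simp add: \<eta>_def)
  \<comment> \<open>half of \<open>q\<close>, rounded up: differences below \<open>b\<close> are not divisible by \<open>q\<close>, and the
    approximation error is still at most half of the spacing \<open>1/q\<close>\<close>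
  define b where "b = (q + 1) div 2"
  have b: "b \<ge> 1" "2 * b \<ge> q" "2 * b \<le> q + 1" using q by (auto simp: b_def)
  define H where "H = {h\<in>{-N<..<N}. int_dist (\<theta> * of_int h) \<le> \<eta>}"
  define v where "v h = \<theta> * of_int h - of_int (round (\<theta> * of_int h))" for h :: int
  \<comment> \<open>the block of \<open>h\<close> and the cell of length \<open>1/(2 q)\<close> that contains the signed distance;
    injective on \<open>H\<close> by the separation\<close>
  define \<phi> where "\<phi> h = (h div b, \<lfloor>2 * of_int q * v h\<rfloor>)" for h :: int
  have sep: "int_dist (\<theta> * of_int k) \<ge> 1 / (2 * of_int q)" if k: "k \<noteq> 0" "\<bar>k\<bar> < b" for k :: int
  proof -
    have k2: "2 * \<bar>k\<bar> < q" using k b by linarith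
    have nd: "\<not> q dvd k" using k2 k by (auto dest: zdvd_imp_le simp: dvd_imp_le_int) (smt (verit) dvd_imp_le_int)
    have "\<bar>\<theta> * of_int k - of_int a / of_int q * of_int k\<bar> = real_of_int \<bar>k\<bar> * \<bar>\<beta>\<bar>"
      by (simp add: \<beta>_def left_diff_distrib abs_mult flip: abs_mult) (simp add: algebra_simps abs_mult[symmetric])
    also have "\<dots> \<le> (of_int q / 2) * (1 / (4 * of_int N * of_int q))"
    proof (intro mult_mono)
      have "real_of_int (2 * \<bar>k\<bar>) < of_int q" using k2 by (simp only: of_int_less_iff)
      then show "real_of_int \<bar>k\<bar> \<le> of_int q / 2" by simp
    qed (use ap q in \<open>auto simp: \<beta>_def\<close>)
    also have "\<dots> = 1 / (8 * of_int N)" using q by simp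
    also have "\<dots> \<le> 1 / (2 * of_int q)"
    proof -
      have "real_of_int q \<le> of_int (4 * N)" using q by (simp only: of_int_le_iff)
      then show ?thesis using N q by (simp add: field_simps)
    qed
    finally have "\<bar>\<theta> * of_int k - of_int a / of_int q * of_int k\<bar> \<le> 1 / (2 * of_int q)" .
    then have "1 / of_int q - 1 / (2 * of_int q) \<le> int_dist (\<theta> * of_int k)"
      using int_dist_rational_ge[OF q(1,2) nd] int_dist_diff[of "of_int a / of_int q * of_int k" "\<theta> * of_int k"] by linarith
    then show ?thesis using q by (simp add: field_simps)
  qed
  have inj: "inj_on \<phi> H"
  proof (rule inj_onI, rule ccontr)
    fix h h' assume hh: "h \<in> H" "h' \<in> H" "\<phi> h = \<phi> h'" "h \<noteq> h'"
    have d: "h div b = h' div b" and f: "\<lfloor>2 * of_int q * v h\<rfloor> = \<lfloor>2 * of_int q * v h'\<rfloor>" using hh by (auto simp: \<phi>_def)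
    have "\<bar>h - h'\<bar> < b"
    proof -
      have "h = b * (h div b) + h mod b" "h' = b * (h' div b) + h' mod b" by simp_all
      moreover have "0 \<le> h mod b" "h mod b < b" "0 \<le> h' mod b" "h' mod b < b" using b by simp_all
      ultimately show ?thesis using d by (smt (verit))
    qed
    then have "int_dist (\<theta> * of_int (h - h')) \<ge> 1 / (2 * of_int q)" using sep[of "h - h'"] hh by simp
    moreover have "\<bar>2 * of_int q * v h - 2 * of_int q * v h'\<bar> < 1" using f by linarith
    then have "2 * of_int q * \<bar>v h - v h'\<bar> < 1"
      using q by (simp add: abs_mult flip: right_diff_distrib)
    then have "\<bar>v h - v h'\<bar> < 1 / (2 * of_int q)" using q by (simp add: field_simps)
    moreover have "int_dist (\<theta> * of_int (h - h')) \<le> \<bar>v h - v h'\<bar>"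
      using int_dist_le[of "\<theta> * of_int (h - h')" "round (\<theta> * of_int h) - round (\<theta> * of_int h')"]
      by (simp add: v_def algebra_simps)
    ultimately show False by linarith
  qed
  define T where "T = {(-N) div b..N div b} \<times> {\<lfloor>- (2 * of_int q * \<eta>)\<rfloor>..\<lfloor>2 * of_int q * \<eta>\<rfloor>}"
  have "\<phi> ` H \<subseteq> T"
  proof (rule image_subsetI)
    fix h assume h: "h \<in> H"
    have "(-N) div b \<le> h div b" "h div b \<le> N div b" using h b by (auto simp: H_def intro: zdiv_mono1)
    moreover have "\<bar>v h\<bar> \<le> \<eta>" using h by (simp add: H_def int_dist_def v_def)
    then have "2 * of_int q * v h \<le> 2 * of_int q * \<eta>" "2 * of_int q * (- v h) \<le> 2 * of_int q * \<eta>"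
      using q by (intro mult_left_mono; simp)+
    then have "\<lfloor>- (2 * of_int q * \<eta>)\<rfloor> \<le> \<lfloor>2 * of_int q * v h\<rfloor>" "\<lfloor>2 * of_int q * v h\<rfloor> \<le> \<lfloor>2 * of_int q * \<eta>\<rfloor>"
      by (intro floor_mono; simp)+
    ultimately show "\<phi> h \<in> T" by (simp add: \<phi>_def T_def)
  qed
  then have "card H \<le> card T" by (intro card_inj_on_le[OF inj]) (auto simp: T_def)
  have cT: "real (card T) \<le> (12 * of_int N / of_int q) * (4 * of_int q * \<eta> + 2)"
  proof -
    have "real (card T) = real (card {(-N) div b..N div b}) * real (card {\<lfloor>- (2 * of_int q * \<eta>)\<rfloor>..\<lfloor>2 * of_int q * \<eta>\<rfloor>})"
      by (simp add: T_def card_cartesian_product)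
    also have "\<dots> \<le> (12 * of_int N / of_int q) * (4 * of_int q * \<eta> + 2)"
    proof (intro mult_mono)
      have "real_of_int (N div b) \<le> of_int N / of_int b" using floor_divide_of_int_eq[of N b] of_int_floor_le by metis
      moreover have "real_of_int ((-N) div b) \<ge> - (of_int N / of_int b) - 1"
        using floor_divide_of_int_eq[of "-N" b, where ?'a = real] real_of_int_floor_gt_diff_one[of "of_int (-N) / of_int b"] by simp
      moreover have "(-N) div b \<le> N div b" using N b by (intro zdiv_mono1) auto
      ultimately have "real (card {(-N) div b..N div b}) \<le> 2 * (of_int N / of_int b) + 2" by simp
      also have "of_int N / of_int b \<le> 2 * (of_int N / real_of_int q)"
      proof -
        have "real_of_int q \<le> of_int (2 * b)" using b by (simp only: of_int_le_iff)
        then show ?thesis using N q b by (simp add: field_simps)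
      qed
      also have "2 * (2 * (of_int N / of_int q)) + 2 \<le> 12 * of_int N / real_of_int q"
      proof -
        have "real_of_int q \<le> of_int (4 * N)" using q by (simp only: of_int_le_iff)
        then show ?thesis using q by (simp add: field_simps)
      qed
      finally show "real (card {(-N) div b..N div b}) \<le> 12 * of_int N / of_int q" by simp
      have "\<lfloor>- (2 * of_int q * \<eta>)\<rfloor> \<le> \<lfloor>2 * of_int q * \<eta>\<rfloor>" using q \<eta> by (intro floor_mono) auto
      then have "real (card {\<lfloor>- (2 * of_int q * \<eta>)\<rfloor>..\<lfloor>2 * of_int q * \<eta>\<rfloor>}) = of_int \<lfloor>2 * of_int q * \<eta>\<rfloor> - of_int \<lfloor>- (2 * of_int q * \<eta>)\<rfloor> + 1" by simp
      then show "real (card {\<lfloor>- (2 * of_int q * \<eta>)\<rfloor>..\<lfloor>2 * of_int q * \<eta>\<rfloor>}) \<le> 4 * of_int q * \<eta> + 2" by linarith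
    qed (use N q in auto)
    finally show ?thesis .
  qed
  have "weyl_sum \<theta> N \<le> (\<Sum>h\<in>{-N<..<N}. (if h \<in> H then of_int N else 0) + 2 / \<eta>)"
    unfolding weyl_sum_def
  proof (rule sum_mono)
    fix h assume h: "h \<in> {-N<..<N}"
    show "progression_weight (of_int N) (\<theta> * of_int h) \<le> (if h \<in> H then of_int N else 0) + 2 / \<eta>"
    proof (cases "h \<in> H")
      case True
      have "progression_weight (of_int N) (\<theta> * of_int h) \<le> of_int N" using N by (intro progression_weight_le_N) auto
      then show ?thesis using True \<eta> by (simp add: add_increasing2)
    next
      case False
      then have "\<eta> \<le> int_dist (\<theta> * of_int h)" using h by (auto simp: H_def)
      then show ?thesis using False progression_weight_le_inverse[OF \<eta>] by auto
    qed
  qed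
  also have "\<dots> = real (card H) * of_int N + real (card {-N<..<N}) * (2 / \<eta>)"
  proof -
    have "{-N<..<N} \<inter> H = H" by (auto simp: H_def)
    then have "(\<Sum>h\<in>{-N<..<N}. if h \<in> H then real_of_int N else 0) = real (card H) * of_int N"
      by (simp flip: sum.inter_restrict)
    then show ?thesis by (simp add: sum.distrib)
  qed
  also have "\<dots> \<le> ((12 * of_int N / of_int q) * (4 * of_int q * \<eta> + 2)) * of_int N + (2 * of_int N) * (2 / \<eta>)"
    using \<open>card H \<le> card T\<close> cT N \<eta> by (intro add_mono mult_right_mono) auto
  also have "\<dots> = 48 * ((of_int N)\<^sup>2 * \<eta>) + 24 * (of_int N)\<^sup>2 / of_int q + 4 * (of_int N / \<eta>)"
    using q \<eta> by (simp add: field_simps power2_eq_square)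
  also have "(of_int N)\<^sup>2 * \<eta> = of_int N * sqrt (of_int N)"
  proof -
    have "of_int N * \<eta> = sqrt (of_int N)" using N by (simp add: \<eta>_def real_div_sqrt)
    then show ?thesis by (simp add: power2_eq_square mult.assoc)
  qed
  also have "of_int N / \<eta> = of_int N * sqrt (of_int N)" by (simp add: \<eta>_def)
  finally show ?thesis by simp
qed

section \<open>Residue classes as vector-valued functions\<close>

text \<open>Finitely supported complex sequences as a real inner product space. The number of residue
  classes varies with \<open>q\<close> and cannot be a type, but \<open>\<ell>\<^sup>2\<close> over any number of classes embeds
  here.\<close>

typedef fsv = "{f :: nat \<Rightarrow> complex. finite {i. f i \<noteq> 0}}"
  morphisms coords Abs_fsv
  by (rule exI[of _ "\<lambda>_. 0"]) simp

setup_lifting type_definition_fsv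

lemma finite_coords: "finite {i. coords v i \<noteq> 0}"
  using coords[of v] by simp

instantiation fsv :: real_vector
begin

lift_definition zero_fsv :: fsv is "\<lambda>_. 0" by simp
lift_definition plus_fsv :: "fsv \<Rightarrow> fsv \<Rightarrow> fsv" is "\<lambda>f g i. f i + g i"
  subgoal for f g by (rule finite_subset[of _ "{i. f i \<noteq> 0} \<union> {i. g i \<noteq> 0}"]) auto
  done
lift_definition uminus_fsv :: "fsv \<Rightarrow> fsv" is "\<lambda>f i. - f i" by simp
lift_definition minus_fsv :: "fsv \<Rightarrow> fsv \<Rightarrow> fsv" is "\<lambda>f g i. f i - g i"
  subgoal for f g by (rule finite_subset[of _ "{i. f i \<noteq> 0} \<union> {i. g i \<noteq> 0}"]) auto
  done
lift_definition scaleR_fsv :: "real \<Rightarrow> fsv \<Rightarrow> fsv" is "\<lambda>c f i. c *\<^sub>R f i"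
  by (rule finite_subset) auto

instance
  by standard (transfer; auto simp: fun_eq_iff algebra_simps scaleR_add_right scaleR_add_left)+

end

text \<open>The sum over the support of the first argument alone keeps the definition finite and is
  symmetric all the same, since the product vanishes off both supports.\<close>

definition fsv_inner :: "fsv \<Rightarrow> fsv \<Rightarrow> real" where
  "fsv_inner v w = (\<Sum>i | coords v i \<noteq> 0. coords v i \<bullet> coords w i)"

lemma fsv_inner_eq:
  assumes "finite S" "\<And>i. i \<notin> S \<Longrightarrow> coords v i = 0"
  shows "fsv_inner v w = (\<Sum>i\<in>S. coords v i \<bullet> coords w i)"
  unfolding fsv_inner_def using assms by (intro sum.mono_neutral_left) auto

instantiation fsv :: real_inner
begin

definition inner_fsv :: "fsv \<Rightarrow> fsv \<Rightarrow> real" where "inner_fsv = fsv_inner"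
definition norm_fsv :: "fsv \<Rightarrow> real" where "norm_fsv v = sqrt (inner v v)"
definition dist_fsv :: "fsv \<Rightarrow> fsv \<Rightarrow> real" where "dist_fsv v w = norm (v - w)"
definition sgn_fsv :: "fsv \<Rightarrow> fsv" where "sgn_fsv v = v /\<^sub>R norm v"
definition uniformity_fsv :: "(fsv \<times> fsv) filter" where
  "uniformity_fsv = (INF e\<in>{0 <..}. principal {(x, y). dist x y < e})"
definition open_fsv :: "fsv set \<Rightarrow> bool" where
  "open_fsv U \<longleftrightarrow> (\<forall>x\<in>U. eventually (\<lambda>(x', y). x' = x \<longrightarrow> y \<in> U) uniformity)"

instance
proof
  fix v w z :: fsv and r :: real
  define S where "S = {i. coords v i \<noteq> 0} \<union> {i. coords w i \<noteq> 0}"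
  have S: "finite S" by (simp add: S_def finite_coords)
  have e: "inner x y = (\<Sum>i\<in>S. coords x i \<bullet> coords y i)" if "x \<in> {v, w, v + w, r *\<^sub>R v}" for x y
    unfolding inner_fsv_def using that
    by (intro fsv_inner_eq S) (auto simp: S_def plus_fsv.rep_eq scaleR_fsv.rep_eq)
  show "v \<bullet> w = w \<bullet> v" by (simp add: e inner_commute)
  show "(v + w) \<bullet> z = v \<bullet> z + w \<bullet> z" by (simp add: e plus_fsv.rep_eq inner_add_left sum.distrib)
  show "r *\<^sub>R v \<bullet> w = r * (v \<bullet> w)" by (simp add: e scaleR_fsv.rep_eq sum_distrib_left)
  show "0 \<le> v \<bullet> v" by (simp add: e sum_nonneg)
  show "(v \<bullet> v = 0) = (v = 0)"
  proof
    assume "v \<bullet> v = 0"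
    then have "\<forall>i\<in>S. coords v i \<bullet> coords v i = 0" using S by (subst (asm) e) (auto simp: sum_nonneg_eq_0_iff)
    then have "coords v i = 0" if "i \<in> S" for i using that by (simp only: inner_eq_zero_iff ball_simps)
    moreover have "coords v i = 0" if "i \<notin> S" for i using that by (simp add: S_def)
    ultimately have "coords v i = 0" for i by blast
    then show "v = 0" by (simp add: coords_inject[symmetric] zero_fsv.rep_eq fun_eq_iff)
  next
    assume "v = 0" then show "v \<bullet> v = 0" by (simp add: e zero_fsv.rep_eq)
  qed
  show "norm v = sqrt (v \<bullet> v)" by (simp add: norm_fsv_def)
qed (simp_all add: dist_fsv_def sgn_fsv_def uniformity_fsv_def open_fsv_def)

end

lift_definition fsv_of :: "nat \<Rightarrow> (nat \<Rightarrow> complex) \<Rightarrow> fsv" is "\<lambda>n f i. if i < n then f i else 0"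
  by (rule finite_subset[of _ "{..<n}" for n]) auto

lemma inner_fsv_of: "fsv_of n f \<bullet> fsv_of n g = (\<Sum>i<n. f i \<bullet> g i)"
  unfolding inner_fsv_def by (subst fsv_inner_eq[of "{..<n}"]) (auto simp: fsv_of.rep_eq)

lemma norm_fsv_of: "norm (fsv_of n f) = sqrt (\<Sum>i<n. (norm (f i))\<^sup>2)"
  by (simp add: norm_fsv_def inner_fsv_of power2_norm_eq_inner)

lemma fsv_of_eq_0: "(\<And>i. i < n \<Longrightarrow> f i = 0) \<Longrightarrow> fsv_of n f = 0"
  by (simp add: coords_inject[symmetric] fsv_of.rep_eq zero_fsv.rep_eq fun_eq_iff)

definition vec :: "nat \<Rightarrow> (int \<Rightarrow> complex) \<Rightarrow> int \<Rightarrow> fsv" where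
  "vec Q f s = fsv_of Q (\<lambda>t. f (int Q * s + int t))"

lemma sum_residues:
  fixes h :: "int \<Rightarrow> 'b::comm_monoid_add"
  assumes Q: "Q > 0"
  shows "(\<Sum>x\<in>{int Q * a..<int Q * b}. h x) = (\<Sum>s\<in>{a..<b}. \<Sum>t<Q. h (int Q * s + int t))"
proof -
  have "(\<Sum>s\<in>{a..<b}. \<Sum>t<Q. h (int Q * s + int t)) = (\<Sum>(s,t)\<in>{a..<b} \<times> {..<Q}. h (int Q * s + int t))"
    by (simp add: sum.cartesian_product)
  also have "\<dots> = (\<Sum>x\<in>{int Q * a..<int Q * b}. h x)"
  proof (rule sum.reindex_bij_witness[where i = "\<lambda>x. (x div int Q, nat (x mod int Q))" and j = "\<lambda>(s,t). int Q * s + int t"])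
    fix p assume "p \<in> {a..<b} \<times> {..<Q}"
    then obtain s t where p: "p = (s, t)" "s \<in> {a..<b}" "t < Q" by auto
    have "(int Q * s + int t) div int Q = s" "(int Q * s + int t) mod int Q = int t" using p Q by simp_all
    then show "((case p of (s, t) \<Rightarrow> int Q * s + int t) div int Q, nat ((case p of (s, t) \<Rightarrow> int Q * s + int t) mod int Q)) = p"
      using p by simp
    have "int Q * a \<le> int Q * s" using p by (intro mult_left_mono) auto
    moreover have "int Q * (s + 1) \<le> int Q * b" using p by (intro mult_left_mono) auto
    ultimately have "int Q * a \<le> int Q * s + int t" "int Q * s + int t < int Q * b" using p unfolding distrib_left by linarith+
    then show "(case p of (s, t) \<Rightarrow> int Q * s + int t) \<in> {int Q * a..<int Q * b}" using p by simp
  next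
    fix x assume x: "x \<in> {int Q * a..<int Q * b}"
    have m: "0 \<le> x mod int Q" "x mod int Q < int Q" using Q by simp_all
    show "(case (x div int Q, nat (x mod int Q)) of (s, t) \<Rightarrow> int Q * s + int t) = x" using m by simp
    have "a \<le> x div int Q" using zdiv_mono1[of "int Q * a" x "int Q"] x Q by simp
    moreover have "x div int Q < b"
    proof (rule ccontr)
      assume "\<not> x div int Q < b"
      then have "int Q * b \<le> int Q * (x div int Q)" by (intro mult_left_mono) auto
      also have "\<dots> \<le> x" using m mult_div_mod_eq[of "int Q" x] by linarith
      finally show False using x by simp
    qed
    moreover have "nat (x mod int Q) < Q" using m by linarith
    ultimately show "(x div int Q, nat (x mod int Q)) \<in> {a..<b} \<times> {..<Q}" by auto
  qed auto
  finally show ?thesis by simp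
qed

text \<open>The norms of \<open>\<ell>\<^sup>p\<close> decrease in \<open>p\<close>; here \<open>p = 3/2\<close> and \<open>p = 2\<close>, both sides raised to the
  power 3/2.\<close>

lemma l2_le_l_three_halves:
  fixes v :: "'b \<Rightarrow> real"
  assumes "finite S" "\<And>i. v i \<ge> 0"
  shows "sqrt (\<Sum>i\<in>S. (v i)\<^sup>2) * sqrt (sqrt (\<Sum>i\<in>S. (v i)\<^sup>2)) \<le> (\<Sum>i\<in>S. v i * sqrt (v i))"
proof -
  define T where "T = (\<Sum>i\<in>S. v i * sqrt (v i))"
  define N where "N = T powr (2/3)"
  have T0: "T \<ge> 0" unfolding T_def using assms by (intro sum_nonneg) auto
  have N0: "N \<ge> 0" by (simp add: N_def)
  have NT: "N * sqrt N = T"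
    using powr_three_halves[OF N0] T0 by (cases "T = 0") (auto simp: N_def powr_powr)
  have vN: "v i \<le> N" if "i \<in> S" for i
  proof (rule sqrt_product_mono)
    have "v i * sqrt (v i) \<le> T" unfolding T_def using assms that by (intro member_le_sum) auto
    then show "v i * sqrt (v i) \<le> N * sqrt N" by (simp add: NT)
  qed (use assms N0 in auto)
  have "(\<Sum>i\<in>S. (v i)\<^sup>2) = (\<Sum>i\<in>S. (v i * sqrt (v i)) * sqrt (v i))"
    using assms(2) by (simp add: power2_eq_square mult.assoc)
  also have "\<dots> \<le> (\<Sum>i\<in>S. (v i * sqrt (v i)) * sqrt N)"
    using assms vN by (intro sum_mono mult_left_mono) auto
  also have "\<dots> = T * sqrt N" by (simp add: T_def sum_distrib_right)
  also have "\<dots> = N\<^sup>2" using N0 by (simp add: NT[symmetric] power2_eq_square mult.assoc)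
  finally have "sqrt (\<Sum>i\<in>S. (v i)\<^sup>2) \<le> N" using N0 by (simp add: real_le_lsqrt sum_nonneg)
  then have "sqrt (\<Sum>i\<in>S. (v i)\<^sup>2) * sqrt (sqrt (\<Sum>i\<in>S. (v i)\<^sup>2)) \<le> N * sqrt N"
    using N0 by (intro mult_mono) (auto simp: sum_nonneg)
  then show ?thesis by (simp add: NT T_def)
qed

text \<open>The \<open>\<ell>\<^sup>2\<close> norm of a block is at most its \<open>\<ell>\<close>-norm with exponent 3/2, and the average over
  blocks is over \<open>Q\<close> times fewer terms.\<close>

lemma avg_vec_le:
  assumes Q: "Q > 0" and ab: "a \<le> b"
  shows "avg {a..b} (3/2) (nrm (vec Q f)) \<le> real Q powr (2/3) * avg {int Q * a..int Q * (b + 1) - 1} (3/2) f"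
proof -
  let ?A = "avg {a..b} (3/2) (nrm (vec Q f))" and ?B = "avg {int Q * a..int Q * (b + 1) - 1} (3/2) f"
  have i1: "{a..b} = {a..<b + 1}" and i2: "{int Q * a..int Q * (b + 1) - 1} = {int Q * a..<int Q * (b + 1)}" by auto
  have lt: "int Q * a < int Q * (b + 1)" using Q ab by (intro mult_strict_left_mono) auto
  have ne: "{a..b} \<noteq> {}" "{int Q * a..int Q * (b + 1) - 1} \<noteq> {}" using ab lt by auto
  have c: "real (card {int Q * a..int Q * (b + 1) - 1}) = real Q * real (card {a..b})"
  proof -
    have "real (card {int Q * a..int Q * (b + 1) - 1}) = real_of_int (int Q * (b + 1) - int Q * a)" using lt by simp
    also have "\<dots> = real Q * real_of_int (b + 1 - a)" by (simp add: algebra_simps)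
    finally show ?thesis using ab by simp
  qed
  have "real (card {a..b}) * (?A * sqrt ?A) = (\<Sum>s\<in>{a..<b + 1}. norm (vec Q f s) * sqrt (norm (vec Q f s)))"
    using avg_three_halves[of "{a..b}" "nrm (vec Q f)"] ne by (simp add: i1)
  also have "\<dots> \<le> (\<Sum>s\<in>{a..<b + 1}. \<Sum>t<Q. norm (f (int Q * s + int t)) * sqrt (norm (f (int Q * s + int t))))"
    unfolding vec_def norm_fsv_of by (intro sum_mono l2_le_l_three_halves) auto
  also have "\<dots> = (\<Sum>x\<in>{int Q * a..<int Q * (b + 1)}. norm (f x) * sqrt (norm (f x)))"
    by (rule sum_residues[OF Q, symmetric])
  also have "\<dots> = real Q * real (card {a..b}) * (?B * sqrt ?B)"
    using avg_three_halves[OF _ ne(2), of f] c by (simp add: i2)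
  finally have "real (card {a..b}) * (?A * sqrt ?A) \<le> real (card {a..b}) * (real Q * (?B * sqrt ?B))" by (simp add: mult_ac)
  then have le: "?A * sqrt ?A \<le> real Q * (?B * sqrt ?B)" using ab by simp
  have "(real Q powr (2/3) * ?B) * sqrt (real Q powr (2/3) * ?B) = (real Q powr (2/3) * sqrt (real Q powr (2/3))) * (?B * sqrt ?B)"
    by (simp add: real_sqrt_mult)
  also have "real Q powr (2/3) * sqrt (real Q powr (2/3)) = real Q"
    using powr_three_halves[of "real Q powr (2/3)"] Q by (simp add: powr_powr)
  finally have "(real Q powr (2/3) * ?B) * sqrt (real Q powr (2/3) * ?B) = real Q * (?B * sqrt ?B)" .
  then have "?A * sqrt ?A \<le> (real Q powr (2/3) * ?B) * sqrt (real Q powr (2/3) * ?B)" using le by (simp only:)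
  then show ?thesis by (rule sqrt_product_mono[OF avg_nonneg]) (simp add: avg_nonneg)
qed

lemma finitely_supported_nrm_vec:
  assumes "finitely_supported f" "Q > 0"
  shows "finitely_supported (nrm (vec Q f))"
proof -
  have "{s. nrm (vec Q f) s \<noteq> 0} \<subseteq> (\<lambda>x. x div int Q) ` {n. f n \<noteq> 0}"
  proof
    fix s assume "s \<in> {s. nrm (vec Q f) s \<noteq> 0}"
    then have "vec Q f s \<noteq> 0" by simp
    then have "\<exists>t<Q. f (int Q * s + int t) \<noteq> 0"
      using fsv_of_eq_0[of Q "\<lambda>t. f (int Q * s + int t)"] by (auto simp: vec_def)
    then obtain t where t: "t < Q" "f (int Q * s + int t) \<noteq> 0" by blast
    have "(int Q * s + int t) div int Q = s" using t by simp
    then have "s = (int Q * s + int t) div int Q" ..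
    then show "s \<in> (\<lambda>x. x div int Q) ` {n. f n \<noteq> 0}" by (rule image_eqI) (use t in simp)
  qed
  then show ?thesis using assms by (auto simp: finitely_supported_def intro: finite_subset)
qed

lemma maxprod_vec_le:
  assumes fs: "finitely_supported f" "finitely_supported g" and Q: "Q > 0"
    and FG: "\<And>s. norm (F s) \<le> c * norm (vec Q f s)" "\<And>s. norm (G s) \<le> norm (vec Q g s)" and c: "c \<ge> 0"
    and x: "x \<in> {int Q * s..<int Q * (s + 1)}"
  shows "maxprod (nrm F) (nrm G) s \<le> c * real Q powr (4/3) * maxprod f g x"
  unfolding maxprod_def[of "nrm F"]
proof (rule cSUP_least)
  show "{(a, b). a \<le> s \<and> s \<le> b} \<noteq> {}" by auto
  fix p assume "p \<in> {(a, b). a \<le> s \<and> s \<le> b}"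
  then obtain a b where p: "p = (a, b)" "a \<le> s" "s \<le> b" by auto
  have 1: "avg {a..b} (3/2) (nrm F) \<le> c * (real Q powr (2/3) * avg {int Q * a..int Q * (b + 1) - 1} (3/2) f)"
  proof -
    have "avg {a..b} (3/2) (nrm F) \<le> avg {a..b} (3/2) (\<lambda>s. of_real c * nrm (vec Q f) s)"
      using FG c by (intro avg_mono) (auto simp: norm_mult)
    also have "\<dots> = c * avg {a..b} (3/2) (nrm (vec Q f))" using c by (intro avg_scale) auto
    also have "\<dots> \<le> c * (real Q powr (2/3) * avg {int Q * a..int Q * (b + 1) - 1} (3/2) f)"
      using p c by (intro mult_left_mono avg_vec_le Q) auto
    finally show ?thesis .
  qed
  have 2: "avg {a..b} (3/2) (nrm G) \<le> real Q powr (2/3) * avg {int Q * a..int Q * (b + 1) - 1} (3/2) g"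
  proof -
    have "avg {a..b} (3/2) (nrm G) \<le> avg {a..b} (3/2) (nrm (vec Q g))" using FG by (intro avg_mono) auto
    also have "\<dots> \<le> real Q powr (2/3) * avg {int Q * a..int Q * (b + 1) - 1} (3/2) g"
      using p by (intro avg_vec_le Q) auto
    finally show ?thesis .
  qed
  have mp: "avg {int Q * a..int Q * (b + 1) - 1} (3/2) f * avg {int Q * a..int Q * (b + 1) - 1} (3/2) g \<le> maxprod f g x"
  proof (rule maxprod_upper[OF fs])
    have "int Q * a \<le> int Q * s" "int Q * (s + 1) \<le> int Q * (b + 1)" using p by (auto intro: mult_left_mono)
    then show "int Q * a \<le> x" "x \<le> int Q * (b + 1) - 1" using x by auto
  qed
  have "avg {a..b} (3/2) (nrm F) * avg {a..b} (3/2) (nrm G) \<le>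
      (c * (real Q powr (2/3) * avg {int Q * a..int Q * (b + 1) - 1} (3/2) f)) * (real Q powr (2/3) * avg {int Q * a..int Q * (b + 1) - 1} (3/2) g)"
    using 1 2 c by (intro mult_mono mult_nonneg_nonneg) (auto simp: avg_nonneg)
  also have "\<dots> = c * (real Q powr (2/3) * real Q powr (2/3)) * (avg {int Q * a..int Q * (b + 1) - 1} (3/2) f * avg {int Q * a..int Q * (b + 1) - 1} (3/2) g)"
    by (simp only: mult_ac)
  also have "real Q powr (2/3) * real Q powr (2/3) = real Q powr (4/3)" by (simp flip: powr_add)
  also have "c * real Q powr (4/3) * (avg {int Q * a..int Q * (b + 1) - 1} (3/2) f * avg {int Q * a..int Q * (b + 1) - 1} (3/2) g) \<le> c * real Q powr (4/3) * maxprod f g x"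
    using mp c by (intro mult_left_mono) auto
  finally show "(case p of (a, b) \<Rightarrow> avg {a..b} (3/2) (nrm F) * avg {a..b} (3/2) (nrm G)) \<le> c * real Q powr (4/3) * maxprod f g x"
    using p by simp
qed

text \<open>Each block has \<open>Q\<close> points, all of which can be used on the right, so the factor
  \<open>Q powr (4/3)\<close> drops to \<open>Q powr (1/3)\<close>.\<close>

lemma sum_maxprod_vec_le:
  assumes fs: "finitely_supported f" "finitely_supported g" and Q: "Q > 0"
    and FG: "\<And>s. norm (F s) \<le> c * norm (vec Q f s)" "\<And>s. norm (G s) \<le> norm (vec Q g s)" and c: "c \<ge> 0"
    and Z: "\<And>X. finite X \<Longrightarrow> (\<Sum>x\<in>X. maxprod f g x) \<le> Z" and X: "finite X"
  shows "(\<Sum>s\<in>X. maxprod (nrm F) (nrm G) s) \<le> c * real Q powr (1/3) * Z"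
proof -
  have "real Q * (\<Sum>s\<in>X. maxprod (nrm F) (nrm G) s) = (\<Sum>s\<in>X. \<Sum>x\<in>{int Q * s..<int Q * (s + 1)}. maxprod (nrm F) (nrm G) s)"
    by (simp add: sum_distrib_left algebra_simps)
  also have "\<dots> \<le> (\<Sum>s\<in>X. \<Sum>x\<in>{int Q * s..<int Q * (s + 1)}. c * real Q powr (4/3) * maxprod f g x)"
    by (intro sum_mono maxprod_vec_le assms)
  also have "\<dots> = c * real Q powr (4/3) * (\<Sum>s\<in>X. \<Sum>x\<in>{int Q * s..<int Q * (s + 1)}. maxprod f g x)"
    by (simp add: sum_distrib_left)
  also have "\<dots> \<le> c * real Q powr (4/3) * Z"
    using sum_blocks_le[of "int Q" X "maxprod f g" Z] Q X Z c by (intro mult_left_mono) auto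
  also have "real Q powr (4/3) = real Q * real Q powr (1/3)"
    using Q powr_add[of "real Q" 1 "1/3"] by simp
  finally have "real Q * (\<Sum>s\<in>X. maxprod (nrm F) (nrm G) s) \<le> real Q * (c * real Q powr (1/3) * Z)" by (simp add: mult_ac)
  then show ?thesis using Q by simp
qed

text \<open>A sum of powers of a root of unity different from 1 over two full periods.\<close>

lemma full_period_sum:
  fixes a q h :: int
  assumes q: "coprime a q" "q > 0" "\<not> q dvd h"
  shows "(\<Sum>t\<in>{0..<2 * q}. ee (of_int a / of_int q * of_int h * of_int t)) = 0"
proof -
  define \<beta> where "\<beta> = real_of_int a / of_int q * of_int h"
  have "0 < 1 / real_of_int q" using q by simp
  also have "\<dots> \<le> int_dist \<beta>" unfolding \<beta>_def by (rule int_dist_rational_ge[OF q])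
  also have "\<dots> \<le> norm (1 - ee \<beta>)" by (rule int_dist_le_norm_one_minus_ee)
  finally have ne: "1 - ee \<beta> \<noteq> 0" by auto
  have "\<beta> * of_int (2 * q) = of_int (2 * a * h)" using q by (simp add: \<beta>_def)
  then have "ee (\<beta> * of_int (2 * q)) = 1" by (simp only: ee_of_int)
  then have "(1 - ee \<beta>) * (\<Sum>t\<in>{0..<2 * q}. ee (\<beta> * of_int t)) = 0"
    using sum_ee_telescope[of 0 "2 * q" \<beta>] q by simp
  then show ?thesis using ne by (simp add: \<beta>_def)
qed

lemma square_difference_linear:
  fixes k x y z :: real
  shows "k * (x - y)\<^sup>2 + - (k * (x - z)\<^sup>2) = k * (y\<^sup>2 - z\<^sup>2) + 2 * k * (z - y) * x"
  unfolding power2_eq_square by algebra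

text \<open>The inner product of the columns \<open>t'\<close> and \<open>t''\<close> is a complete geometric sum and vanishes
  unless \<open>q\<close> divides \<open>t'' - t'\<close>. Each column therefore meets only two columns, with inner
  products at most \<open>2 q\<close>.\<close>

lemma gauss_matrix_bound:
  fixes q :: nat and a :: int and f :: "nat \<Rightarrow> complex"
  assumes q: "coprime a (int q)" "q > 0"
  shows "(\<Sum>t<2 * q. (norm (\<Sum>t'<2 * q. ee (of_int a / (2 * real q) * (real t - real t')\<^sup>2) * f t'))\<^sup>2)
    \<le> 4 * real q * (\<Sum>t<2 * q. (norm (f t))\<^sup>2)"
proof -
  let ?Q = "2 * q"
  define e where "e t t' = ee (of_int a / (2 * real q) * (real t - real t')\<^sup>2)" for t t' :: nat
  define S where "S t' t'' = (\<Sum>t<?Q. e t t' * cnj (e t t''))" for t' t''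
  have S: "norm (S t' t'') \<le> (if int q dvd int t'' - int t' then 2 * real q else 0)" for t' t''
  proof (cases "int q dvd int t'' - int t'")
    case True
    have "norm (S t' t'') \<le> (\<Sum>t<?Q. 1)" unfolding S_def by (intro order_trans[OF norm_sum] sum_mono) (simp add: e_def norm_mult)
    then show ?thesis using True by simp
  next
    case False
    define c where "c = of_int a / (2 * real q) * ((real t')\<^sup>2 - (real t'')\<^sup>2)"
    define k where "k = of_int a / (2 * real q)"
    define D where "D t = of_int a / of_int (int q) * of_int (int t'' - int t') * real_of_int (int t)" for t
    have k2: "of_int a / of_int (int q) = 2 * k" using q by (simp add: k_def)
    have "e t t' * cnj (e t t'') = ee c * ee (D t)" for t
    proof -
      have "e t t' * cnj (e t t'') = ee (k * (real t - real t')\<^sup>2 + - (k * (real t - real t'')\<^sup>2))"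
        unfolding ee_add by (simp add: e_def k_def cnj_ee)
      moreover have "ee (k * (real t - real t')\<^sup>2 + - (k * (real t - real t'')\<^sup>2)) = ee (c + D t)"
      proof (rule arg_cong[where f = ee])
        have cc: "c = k * ((real t')\<^sup>2 - (real t'')\<^sup>2)" by (simp only: c_def k_def)
        have dd: "D t = 2 * k * (real t'' - real t') * real t"
          unfolding D_def k2 by (simp only: of_int_diff of_int_of_nat_eq)
        show "k * (real t - real t')\<^sup>2 + - (k * (real t - real t'')\<^sup>2) = c + D t"
          by (rule trans[OF square_difference_linear arg_cong2[where f = "(+)", OF cc[symmetric] dd[symmetric]]])
      qed
      ultimately show ?thesis by (simp only: ee_add)
    qed
    note eq = this
    have "S t' t'' = ee c * (\<Sum>t<?Q. ee (of_int a / of_int (int q) * of_int (int t'' - int t') * of_int (int t)))"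
      unfolding S_def eq sum_distrib_left D_def ..
    also have "(\<Sum>t<?Q. ee (of_int a / of_int (int q) * of_int (int t'' - int t') * of_int (int t))) =
        (\<Sum>t\<in>int ` {..<?Q}. ee (of_int a / of_int (int q) * of_int (int t'' - int t') * of_int t))"
      by (subst sum.reindex) auto
    also have "int ` {..<?Q} = {0..<2 * int q}" by (simp add: lessThan_atLeast0 image_int_atLeastLessThan)
    also have "(\<Sum>t\<in>{0..<2 * int q}. ee (of_int a / of_int (int q) * of_int (int t'' - int t') * of_int t)) = 0"
      using q False by (intro full_period_sum) auto
    finally show ?thesis using False by simp
  qed
  have "complex_of_real (\<Sum>t<?Q. (norm (\<Sum>t'<?Q. e t t' * f t'))\<^sup>2) = (\<Sum>t<?Q. (\<Sum>t'<?Q. e t t' * f t') * cnj (\<Sum>t''<?Q. e t t'' * f t''))"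
    by (simp add: complex_norm_square del: of_real_power flip: of_real_power)
  also have "\<dots> = (\<Sum>t<?Q. \<Sum>t'<?Q. \<Sum>t''<?Q. f t' * cnj (f t'') * (e t t' * cnj (e t t'')))"
    unfolding cnj_sum sum_product by (simp add: mult_ac)
  also have "\<dots> = (\<Sum>t'<?Q. \<Sum>t<?Q. \<Sum>t''<?Q. f t' * cnj (f t'') * (e t t' * cnj (e t t'')))" by (rule sum.swap)
  also have "\<dots> = (\<Sum>t'<?Q. \<Sum>t''<?Q. \<Sum>t<?Q. f t' * cnj (f t'') * (e t t' * cnj (e t t'')))"
    by (rule sum.cong[OF refl], rule sum.swap)
  also have "\<dots> = (\<Sum>t'<?Q. \<Sum>t''<?Q. f t' * cnj (f t'') * S t' t'')" by (simp add: S_def sum_distrib_left)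
  finally have "norm (complex_of_real (\<Sum>t<?Q. (norm (\<Sum>t'<?Q. e t t' * f t'))\<^sup>2)) = norm (\<Sum>t'<?Q. \<Sum>t''<?Q. f t' * cnj (f t'') * S t' t'')"
    by (rule arg_cong)
  then have "(\<Sum>t<?Q. (norm (\<Sum>t'<?Q. e t t' * f t'))\<^sup>2) = norm (\<Sum>t'<?Q. \<Sum>t''<?Q. f t' * cnj (f t'') * S t' t'')"
    by (simp only: norm_of_real abs_of_nonneg[OF sum_nonneg[OF zero_le_power2]])
  also have "\<dots> \<le> (\<Sum>t'<?Q. \<Sum>t''<?Q. (if int q dvd int t'' - int t' then 2 * real q else 0) * \<bar>norm (f t')\<bar> * \<bar>norm (f t'')\<bar>)"
  proof (rule order_trans[OF norm_sum], rule sum_mono, rule order_trans[OF norm_sum], rule sum_mono)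
    fix t' t''
    have "norm (f t' * cnj (f t'') * S t' t'') = norm (S t' t'') * (norm (f t') * norm (f t''))" by (simp add: norm_mult)
    also have "\<dots> \<le> (if int q dvd int t'' - int t' then 2 * real q else 0) * (norm (f t') * norm (f t''))"
      by (intro mult_right_mono S) auto
    finally show "norm (f t' * cnj (f t'') * S t' t'') \<le> (if int q dvd int t'' - int t' then 2 * real q else 0) * \<bar>norm (f t')\<bar> * \<bar>norm (f t'')\<bar>"
      by simp
  qed
  also have "\<dots> \<le> (4 * real q) * sqrt (\<Sum>t<?Q. (norm (f t))\<^sup>2) * sqrt (\<Sum>t<?Q. (norm (f t))\<^sup>2)"
  proof (rule schur_test_real)
    have row: "(\<Sum>y<?Q. if int q dvd int y - int x then 2 * real q else 0) \<le> 4 * real q" if "x < ?Q" for x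
    proof -
      have "{y\<in>{..<?Q}. int q dvd int y - int x} \<subseteq> {x mod q, x mod q + q}"
      proof
        fix y assume y: "y \<in> {y\<in>{..<?Q}. int q dvd int y - int x}"
        then have "int y mod int q = int x mod int q" by (auto simp: mod_eq_dvd_iff)
        then have m: "y mod q = x mod q" by (metis of_nat_eq_iff of_nat_mod)
        have "y = q * (y div q) + y mod q" by simp
        moreover have "y div q < 2" using y by (auto simp: less_mult_imp_div_less)
        then have "y div q = 0 \<or> y div q = 1" by linarith
        ultimately show "y \<in> {x mod q, x mod q + q}" using m by auto
      qed
      then have "card {y\<in>{..<?Q}. int q dvd int y - int x} \<le> card {x mod q, x mod q + q}" by (intro card_mono) auto
      also have "\<dots> \<le> 2" by (simp add: card_insert_if)
      finally have "real (card {y\<in>{..<?Q}. int q dvd int y - int x}) \<le> 2" by simp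
      then have "real (card {y\<in>{..<?Q}. int q dvd int y - int x}) * (2 * real q) \<le> 2 * (2 * real q)" by (rule mult_right_mono) simp
      moreover have "(\<Sum>y<?Q. if int q dvd int y - int x then 2 * real q else 0) = (\<Sum>y\<in>{y\<in>{..<?Q}. int q dvd int y - int x}. 2 * real q)"
        by (rule sum.inter_filter[symmetric]) simp
      ultimately show ?thesis by simp
    qed
    show "(\<Sum>y<?Q. if int q dvd int y - int x then 2 * real q else 0) \<le> 4 * real q" if "x \<in> {..<?Q}" for x using row that by simp
    show "(\<Sum>x<?Q. if int q dvd int y - int x then 2 * real q else 0) \<le> 4 * real q" if "y \<in> {..<?Q}" for y
    proof -
      have "(int q dvd int y - int x) = (int q dvd int x - int y)" for x by (metis dvd_minus_iff minus_diff_eq)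
      then show ?thesis using row[of y] that by simp
    qed
  qed auto
  also have "\<dots> = 4 * real q * (\<Sum>t<?Q. (norm (f t))\<^sup>2)" by (simp add: mult.assoc sum_nonneg)
  finally show ?thesis by (simp add: e_def)
qed

section \<open>Rational phases\<close>

text \<open>The kernel of the rational phase with \<open>1/(n - n')\<close> replaced by the reciprocal of the
  distance of the blocks of length \<open>2 * q\<close> in which \<open>n\<close> and \<open>n'\<close> lie.\<close>

definition block_kernel :: "nat \<Rightarrow> int \<Rightarrow> int \<Rightarrow> int \<Rightarrow> int \<Rightarrow> complex" where
  "block_kernel q a L n' n = ee (of_int a / (2 * real q) * (of_int (n - n'))\<^sup>2) *
     of_real (hilbert_kernel L (n div int (2 * q) - n' div int (2 * q)) / (2 * real q))"

text \<open>With \<open>2 q\<close> in the denominator the phase has period \<open>2 q\<close> for even and odd \<open>a\<close>: shifting \<open>\<tau>\<close>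
  by \<open>2 q \<sigma>\<close> adds \<open>a (2 q \<sigma>\<^sup>2 + 2 \<sigma> \<tau>)\<close>, an integer.\<close>

lemma ee_rational_periodic:
  fixes q :: nat and a m \<sigma> \<tau> :: int
  assumes q: "q > 0" and m: "m = int (2 * q) * \<sigma> + \<tau>"
  shows "ee (of_int a / (2 * real q) * (of_int m)\<^sup>2) = ee (of_int a / (2 * real q) * (of_int \<tau>)\<^sup>2)"
proof -
  define k where "k = of_int a / (2 * real q)"
  have ka: "k * (2 * real q) = of_int a" using q by (simp add: k_def)
  have "k * (2 * real q * of_int \<sigma> + of_int \<tau>)\<^sup>2 = k * (of_int \<tau>)\<^sup>2 + k * (2 * real q) * (2 * real q * (of_int \<sigma>)\<^sup>2 + 2 * of_int \<sigma> * of_int \<tau>)"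
    by (simp add: power2_eq_square distrib_left distrib_right)
  then have "k * (of_int m)\<^sup>2 = k * (of_int \<tau>)\<^sup>2 + of_int (a * (int (2 * q) * \<sigma>\<^sup>2 + 2 * \<sigma> * \<tau>))"
    by (simp add: ka m)
  then have "of_int a / (2 * real q) * (of_int m)\<^sup>2 = of_int a / (2 * real q) * (of_int \<tau>)\<^sup>2 + of_int (a * (int (2 * q) * \<sigma>\<^sup>2 + 2 * \<sigma> * \<tau>))"
    unfolding k_def .
  then show ?thesis by (simp only: ee_add_int)
qed

lemma bform_extend:
  assumes "finite B" "A \<subseteq> B" "\<And>n. n \<notin> A \<Longrightarrow> f n = 0 \<and> g n = 0"
  shows "bform A \<kappa> f g = bform B \<kappa> f g"
proof -
  have "bform B \<kappa> f g = (\<Sum>n'\<in>A. \<Sum>n\<in>B. \<kappa> n' n * f n' * cnj (g n))"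
    unfolding bform_def using assms by (intro sum.mono_neutral_right) auto
  also have "\<dots> = bform A \<kappa> f g"
    unfolding bform_def using assms by (intro sum.cong refl sum.mono_neutral_right) auto
  finally show ?thesis by simp
qed

lemma inner_complex_eq: "(x::complex) \<bullet> y = Re (x * cnj y)"
  by (simp add: inner_complex_def)

lemma finite_subset_block_interval:
  assumes "finite (A :: int set)" "Q > 0"
  obtains a b where "A \<subseteq> {int Q * a..<int Q * b}"
proof -
  obtain R where R: "A \<subseteq> {-int R..int R}" using int_finite_symmetric_cover[OF assms(1)] by blast
  have "x \<in> {int Q * ((- int R) div int Q)..<int Q * (int R div int Q + 1)}" if "x \<in> A" for x
  proof -
    have x: "- int R \<le> x" "x \<le> int R" using R that by auto
    have m: "int Q * (y div int Q) + y mod int Q = y" "0 \<le> y mod int Q" "y mod int Q < int Q" for y using assms(2) by simp_all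
    have "int Q * ((- int R) div int Q) \<le> x" using m(1)[of "- int R"] m(2)[of "- int R"] x by linarith
    moreover have "x < int Q * (int R div int Q + 1)" unfolding distrib_left using m(1)[of "int R"] m(3)[of "int R"] x by linarith
    ultimately show ?thesis by simp
  qed
  then show ?thesis using that by blast
qed

text \<open>By periodicity the kernel is a truncated Hilbert kernel in the block indices times the Gauss
  matrix in the residues. The Gauss matrix is absorbed into the vector-valued function \<open>F\<close>,
  whose norm grows by \<open>c = sqrt (4 q)\<close>. Collecting \<open>1/Q\<close> from the kernel, \<open>c\<close>, and
  \<open>Q powr (1/3)\<close> from \<open>sum_maxprod_vec_le\<close> with \<open>Q = 2 q\<close> gives the power \<open>-1/6\<close>.\<close>

lemma block_kernel_form_bound:
  fixes f g :: "int \<Rightarrow> complex"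
  assumes q: "coprime a (int q)" "q > 0" and L: "L \<ge> 1"
    and fs: "finitely_supported f" "finitely_supported g"
    and A: "finite A" "\<And>n. n \<notin> A \<Longrightarrow> f n = 0 \<and> g n = 0"
    and Z: "\<And>X. finite X \<Longrightarrow> (\<Sum>x\<in>X. maxprod f g x) \<le> Z"
  shows "norm (bform A (block_kernel q a L) f g) \<le> 6000000000 * real q powr (-1/6) * Z"
proof -
  define Q where "Q = 2 * q"
  have Q: "Q > 0" using q by (simp add: Q_def)
  have Z0: "Z \<ge> 0" using Z[of "{}"] by simp
  obtain a0 b0 where B: "A \<subseteq> {int Q * a0..<int Q * b0}" using finite_subset_block_interval[OF A(1) Q] by blast
  define z where "z = bform A (block_kernel q a L) f g"
  \<comment> \<open>a unimodular factor (0 if \<open>z = 0\<close>) that makes the form real, since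
    \<open>truncated_hilbert_maxprod\<close> speaks of real inner products\<close>
  define w where "w = cnj (sgn z)"
  have w1: "norm w \<le> 1" by (simp add: w_def norm_sgn)
  have wz: "w * z = of_real (norm z)"
  proof (cases "z = 0")
    case False
    have "w * z = (z * cnj z) / of_real (norm z)"
      by (simp add: w_def sgn_div_norm scaleR_conv_of_real divide_inverse mult_ac)
    also have "z * cnj z = (of_real (norm z))\<^sup>2" by (simp flip: complex_norm_square)
    finally show ?thesis using False by (simp add: power2_eq_square)
  qed (simp add: w_def)
  define f' where "f' n = w * f n" for n
  have f'0: "f' n = 0" "g n = 0" if "n \<notin> {int Q * a0..<int Q * b0}" for n
  proof -
    have "n \<notin> A" using that B by auto
    then show "f' n = 0" "g n = 0" using A(2)[of n] by (simp_all add: f'_def)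
  qed
  have f'le: "norm (f' n) \<le> norm (f n)" for n using w1 by (simp add: f'_def norm_mult mult_left_le_one_le)
  define E where "E t t' = ee (of_int a / (2 * real q) * (real t - real t')\<^sup>2)" for t t' :: nat
  define F where "F s = fsv_of Q (\<lambda>t. \<Sum>t'<Q. E t t' * f' (int Q * s + int t'))" for s
  define G where "G s = vec Q g s" for s
  define c where "c = sqrt (4 * real q)"
  have c0: "c \<ge> 0" by (simp add: c_def)
  have Fle: "norm (F s) \<le> c * norm (vec Q f s)" for s
  proof -
    have "(\<Sum>t<Q. (norm (\<Sum>t'<Q. E t t' * f' (int Q * s + int t')))\<^sup>2) \<le> 4 * real q * (\<Sum>t<Q. (norm (f' (int Q * s + int t)))\<^sup>2)"
      unfolding Q_def E_def by (rule gauss_matrix_bound[OF q])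
    also have "\<dots> \<le> 4 * real q * (\<Sum>t<Q. (norm (f (int Q * s + int t)))\<^sup>2)"
      by (intro mult_left_mono sum_mono power_mono f'le) auto
    finally show ?thesis
      unfolding F_def vec_def norm_fsv_of c_def real_sqrt_mult[symmetric] by (rule real_sqrt_le_mono)
  qed
  have fsF: "finitely_supported (nrm F)"
  proof -
    have "F s = 0" if "vec Q f s = 0" for s
    proof -
      have "norm (F s) \<le> 0" using Fle[of s] that by simp
      then show ?thesis by simp
    qed
    then have "{s. nrm F s \<noteq> 0} \<subseteq> {s. nrm (vec Q f) s \<noteq> 0}" by auto
    then show ?thesis using finitely_supported_nrm_vec[OF fs(1) Q] by (auto simp: finitely_supported_def intro: finite_subset)
  qed
  have fsG: "finitely_supported (nrm G)" unfolding G_def by (rule finitely_supported_nrm_vec[OF fs(2) Q])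
  have out: "int Q * s + int t \<notin> {int Q * a0..<int Q * b0}" if "s \<notin> {a0..<b0}" "t < Q" for s t
  proof -
    have "(int Q * s + int t) div int Q = s" using that by simp
    moreover have "x div int Q \<in> {a0..<b0}" if x: "x \<in> {int Q * a0..<int Q * b0}" for x
    proof -
      have m: "int Q * (x div int Q) + x mod int Q = x" "0 \<le> x mod int Q" "x mod int Q < int Q" using Q by simp_all
      have xx: "int Q * a0 \<le> x" "x < int Q * b0" using x by auto
      have "int Q * a0 < int Q * (x div int Q + 1)" unfolding distrib_left using m xx by linarith
      moreover have "int Q * (x div int Q) < int Q * b0" using m xx by linarith
      ultimately show ?thesis using Q by simp
    qed
    ultimately show ?thesis using that by metis
  qed
  have FG0: "F s = 0 \<and> G s = 0" if "s \<notin> {a0..<b0}" for s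
    unfolding F_def G_def vec_def using out[OF that] f'0 by (auto intro!: fsv_of_eq_0 sum.neutral)
  have "\<bar>\<Sum>s'\<in>{a0..<b0}. \<Sum>s\<in>{a0..<b0}. hilbert_kernel L (s - s') * (F s' \<bullet> G s)\<bar> \<le> 4000000000 * (c * real Q powr (1/3) * Z)"
  proof (rule truncated_hilbert_maxprod[OF fsF fsG L])
    show "(\<Sum>x\<in>X. maxprod (nrm F) (nrm G) x) \<le> c * real Q powr (1/3) * Z" if "finite X" for X
      by (rule sum_maxprod_vec_le[OF fs Q Fle _ c0 Z that]) (simp add: G_def)
  qed (use FG0 in auto)
  moreover have "norm z = (1 / real Q) * (\<Sum>s'\<in>{a0..<b0}. \<Sum>s\<in>{a0..<b0}. hilbert_kernel L (s - s') * (F s' \<bullet> G s))"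
  proof -
    have "norm z = Re (w * z)" by (simp add: wz)
    also have "w * z = bform A (block_kernel q a L) f' g"
      unfolding z_def bform_def f'_def by (simp add: sum_distrib_left mult_ac)
    also have "\<dots> = bform {int Q * a0..<int Q * b0} (block_kernel q a L) f' g"
      using A(2) by (intro bform_extend B) (auto simp: f'_def)
    also have "\<dots> = (\<Sum>s'\<in>{a0..<b0}. \<Sum>t'<Q. \<Sum>s\<in>{a0..<b0}. \<Sum>t<Q.
        block_kernel q a L (int Q * s' + int t') (int Q * s + int t) * f' (int Q * s' + int t') * cnj (g (int Q * s + int t)))"
      unfolding bform_def sum_residues[OF Q] ..
    also have "\<dots> = (\<Sum>s'\<in>{a0..<b0}. \<Sum>t'<Q. \<Sum>s\<in>{a0..<b0}. \<Sum>t<Q.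
        of_real (hilbert_kernel L (s - s') / real Q) * (E t t' * f' (int Q * s' + int t') * cnj (g (int Q * s + int t))))"
    proof (rule sum.cong[OF refl], rule sum.cong[OF refl], rule sum.cong[OF refl], rule sum.cong[OF refl])
      fix s' s t' t assume t: "t' \<in> {..<Q}" "t \<in> {..<Q}"
      have d: "(int Q * s + int t) div int Q = s" "(int Q * s' + int t') div int Q = s'" using t by simp_all
      have "int Q * s + int t - (int Q * s' + int t') = int (2 * q) * (s - s') + (int t - int t')"
        by (simp add: Q_def algebra_simps)
      from ee_rational_periodic[OF q(2) this, of a]
      have "block_kernel q a L (int Q * s' + int t') (int Q * s + int t) = E t t' * of_real (hilbert_kernel L (s - s') / real Q)"
        using d by (simp add: block_kernel_def E_def Q_def)
      then show "block_kernel q a L (int Q * s' + int t') (int Q * s + int t) * f' (int Q * s' + int t') * cnj (g (int Q * s + int t)) =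
          of_real (hilbert_kernel L (s - s') / real Q) * (E t t' * f' (int Q * s' + int t') * cnj (g (int Q * s + int t)))" by simp
    qed
    also have "\<dots> = (\<Sum>s'\<in>{a0..<b0}. \<Sum>s\<in>{a0..<b0}. \<Sum>t'<Q. \<Sum>t<Q.
        of_real (hilbert_kernel L (s - s') / real Q) * (E t t' * f' (int Q * s' + int t') * cnj (g (int Q * s + int t))))"
      by (rule sum.cong[OF refl], rule sum.swap)
    also have "\<dots> = (\<Sum>s'\<in>{a0..<b0}. \<Sum>s\<in>{a0..<b0}. \<Sum>t<Q. \<Sum>t'<Q.
        of_real (hilbert_kernel L (s - s') / real Q) * (E t t' * f' (int Q * s' + int t') * cnj (g (int Q * s + int t))))"
      by (rule sum.cong[OF refl], rule sum.cong[OF refl], rule sum.swap)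
    also have "\<dots> = (\<Sum>s'\<in>{a0..<b0}. \<Sum>s\<in>{a0..<b0}. of_real (hilbert_kernel L (s - s') / real Q) *
        (\<Sum>t<Q. (\<Sum>t'<Q. E t t' * f' (int Q * s' + int t')) * cnj (g (int Q * s + int t))))"
      by (simp only: sum_distrib_left sum_distrib_right)
    also have "Re \<dots> = (\<Sum>s'\<in>{a0..<b0}. \<Sum>s\<in>{a0..<b0}. (hilbert_kernel L (s - s') / real Q) * (F s' \<bullet> G s))"
      by (simp add: F_def G_def vec_def inner_fsv_of inner_complex_eq)
    also have "\<dots> = (1 / real Q) * (\<Sum>s'\<in>{a0..<b0}. \<Sum>s\<in>{a0..<b0}. hilbert_kernel L (s - s') * (F s' \<bullet> G s))"
      by (simp add: sum_distrib_left)
    finally show ?thesis .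
  qed
  ultimately have "norm z \<le> (1 / real Q) * (4000000000 * (c * real Q powr (1/3) * Z))"
    using Q by (simp only:) (intro mult_left_mono; simp)
  also have "\<dots> = 4000000000 * (1 / real Q * (c * real Q powr (1/3))) * Z" by simp
  also have "1 / real Q * (c * real Q powr (1/3)) = sqrt 2 * real Q powr (-1/6)"
  proof -
    have "c = sqrt 2 * real Q powr (1/2)" using q by (simp add: c_def Q_def powr_half_sqrt flip: real_sqrt_mult)
    moreover have "1 / real Q = real Q powr (-1)" using Q by (simp add: powr_minus_divide)
    ultimately have "1 / real Q * (c * real Q powr (1/3)) = sqrt 2 * (real Q powr (-1) * real Q powr (1/2) * real Q powr (1/3))" by simp
    also have "real Q powr (-1) * real Q powr (1/2) * real Q powr (1/3) = real Q powr (-1 + 1/2 + 1/3)"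
      by (simp only: powr_add)
    also have "(-1 + 1/2 + 1/3 :: real) = -1/6" by simp
    finally show ?thesis .
  qed
  also have "4000000000 * (sqrt 2 * real Q powr (-1/6)) * Z \<le> 4000000000 * (3/2 * real q powr (-1/6)) * Z"
  proof (intro mult_right_mono mult_left_mono mult_mono Z0)
    show "sqrt 2 \<le> (3/2::real)" by (rule real_le_lsqrt) (auto simp: power2_eq_square)
    show "real Q powr (-1/6) \<le> real q powr (-1/6)" using q by (intro powr_mono2') (auto simp: Q_def)
  qed auto
  finally show ?thesis by (simp add: z_def)
qed

text \<open>The least number of blocks of length \<open>2 * q\<close> that reach a distance of at least \<open>N\<close>.\<close>

definition block_threshold :: "int \<Rightarrow> nat \<Rightarrow> int" where "block_threshold N q = (N - 1) div int (2 * q) + 1"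

lemma less_block_threshold_iff:
  assumes "q > 0"
  shows "s < block_threshold N q \<longleftrightarrow> int (2 * q) * s < N"
proof -
  define Q where "Q = int (2 * q)"
  have Q: "Q > 0" using assms by (simp add: Q_def)
  define d where "d = (N - 1) div Q"
  have m: "Q * d + (N - 1) mod Q = N - 1" "0 \<le> (N - 1) mod Q" "(N - 1) mod Q < Q" using Q by (simp_all add: d_def)
  have mono: "Q * x \<le> Q * y" if "x \<le> y" for x y using Q that by simp
  have "s \<le> d \<longleftrightarrow> Q * s < N"
  proof
    assume "s \<le> d" then show "Q * s < N" using mono[of s d] m by linarith
  next
    assume "Q * s < N"
    show "s \<le> d"
    proof (rule ccontr)
      assume "\<not> s \<le> d"
      then have "Q * (d + 1) \<le> Q * s" by (intro mono) linarith
      then show False using m \<open>Q * s < N\<close> unfolding distrib_left by linarith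
    qed
  qed
  then show ?thesis by (simp add: block_threshold_def Q_def d_def)
qed

lemma block_threshold_ge_1: "q > 0 \<Longrightarrow> N \<ge> 1 \<Longrightarrow> block_threshold N q \<ge> 1"
  by (simp add: block_threshold_def pos_imp_zdiv_nonneg_iff)

text \<open>Moving both points to the start of their blocks changes \<open>n - n'\<close> by less than \<open>2 q\<close>. So
  \<open>1/m\<close> changes by \<open>O(q / N\<^sup>2)\<close>, and the cut-offs are misplaced only within \<open>2 q\<close> of the ends
  of the shell. Both effects have row sums \<open>O(q / N)\<close>, to which Schur's test and
  \<open>single_scale_bound\<close> apply.\<close>

lemma shell_block_kernel_comparison:
  fixes f g :: "int \<Rightarrow> complex" and N :: int
  assumes q: "q > 0" and N: "16 * int q \<le> N"
    and fs: "finitely_supported f" "finitely_supported g" and A: "finite A"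
    and Z: "\<And>X. finite X \<Longrightarrow> (\<Sum>x\<in>X. maxprod f g x) \<le> Z"
  shows "norm (bform A (\<lambda>n' n. shell (of_int a / (2 * real q)) N (n - n') - (block_kernel q a (block_threshold (2 * N) q) n' n - block_kernel q a (block_threshold N q) n' n)) f g)
    \<le> 657 * sqrt (24 * real q / of_int N) * Z"
proof -
  define Q where "Q = int (2 * q)"
  define D where "D n' n = shell (of_int a / (2 * real q)) N (n - n') - (block_kernel q a (block_threshold (2 * N) q) n' n - block_kernel q a (block_threshold N q) n' n)" for n' n
  have Q0: "Q > 0" and QN: "8 * Q \<le> N" and N0: "N > 0" using q N by (auto simp: Q_def)
  \<comment> \<open>the first term covers the case that the true and the block distance both lie in the
    shell, the second one points near the ends of the shell\<close>
  define Bd where "Bd m = (if N \<le> \<bar>m\<bar> \<and> \<bar>m\<bar> < 2 * N then of_int Q / (of_int N)\<^sup>2 else 0) +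
      (if \<bar>\<bar>m\<bar> - N\<bar> < Q \<or> \<bar>\<bar>m\<bar> - 2 * N\<bar> < Q then 1 / real_of_int N else 0)" for m
  have Bd0: "Bd m \<ge> 0" for m using Q0 N0 by (simp add: Bd_def)
  have DB: "norm (D n' n) \<le> Bd (n - n')" for n' n
  proof -
    define m where "m = n - n'"
    define \<sigma> where "\<sigma> = n div Q - n' div Q"
    define \<tau> where "\<tau> = n mod Q - n' mod Q"
    have m: "m = Q * \<sigma> + \<tau>"
    proof -
      have "n = Q * (n div Q) + n mod Q" "n' = Q * (n' div Q) + n' mod Q" by simp_all
      then show ?thesis unfolding m_def \<sigma>_def \<tau>_def right_diff_distrib by linarith
    qed
    have \<tau>: "\<bar>\<tau>\<bar> < Q"
    proof -
      have "0 \<le> n mod Q" "n mod Q < Q" "0 \<le> n' mod Q" "n' mod Q < Q" using Q0 by simp_all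
      then show ?thesis unfolding \<tau>_def by linarith
    qed
    define S where "S = Q * \<sigma>"
    have absS: "Q * \<bar>\<sigma>\<bar> = \<bar>S\<bar>" using Q0 by (simp add: S_def abs_mult)
    define x where "x = (if N \<le> \<bar>m\<bar> \<and> \<bar>m\<bar> < 2 * N then 1 / real_of_int m else 0)"
    define y where "y = (if N \<le> \<bar>S\<bar> \<and> \<bar>S\<bar> < 2 * N then 1 / real_of_int S else 0)"
    have t: "(hilbert_kernel (block_threshold (2 * N) q) \<sigma> - hilbert_kernel (block_threshold N q) \<sigma>) / (2 * real q) = y"
    proof -
      have "\<bar>\<sigma>\<bar> < block_threshold (2 * N) q \<longleftrightarrow> \<bar>S\<bar> < 2 * N" "\<bar>\<sigma>\<bar> < block_threshold N q \<longleftrightarrow> \<bar>S\<bar> < N"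
        using less_block_threshold_iff[OF q] absS by (simp_all add: Q_def)
      moreover have "1 / real_of_int \<sigma> / (2 * real q) = 1 / real_of_int S" using q by (simp add: S_def Q_def)
      ultimately show ?thesis using N0 by (auto simp: hilbert_kernel_def y_def)
    qed
    have "D n' n = ee (of_int a / (2 * real q) * (of_int m)\<^sup>2) * of_real x - ee (of_int a / (2 * real q) * (of_int m)\<^sup>2) * of_real y"
      unfolding D_def block_kernel_def t[symmetric] shell_def quadratic_kernel_def x_def
      by (simp add: m_def \<sigma>_def Q_def right_diff_distrib diff_divide_distrib)
    also have "\<dots> = ee (of_int a / (2 * real q) * (of_int m)\<^sup>2) * of_real (x - y)" by (simp add: right_diff_distrib)
    finally have nD: "norm (D n' n) = \<bar>x - y\<bar>" by (simp add: norm_mult del: of_real_diff)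
    have inv: "\<bar>1 / real_of_int r\<bar> \<le> 1 / of_int N" if "N \<le> \<bar>r\<bar>" for r
    proof -
      have "real_of_int N \<le> real_of_int \<bar>r\<bar>" using that by (simp only: of_int_le_iff)
      then show ?thesis using N0 by (simp add: frac_le)
    qed
    have mS: "\<bar>m - S\<bar> < Q" using \<tau> m by (simp add: S_def)
    consider (both) "N \<le> \<bar>m\<bar> \<and> \<bar>m\<bar> < 2 * N" "N \<le> \<bar>S\<bar> \<and> \<bar>S\<bar> < 2 * N"
      | (left) "N \<le> \<bar>m\<bar> \<and> \<bar>m\<bar> < 2 * N" "\<not> (N \<le> \<bar>S\<bar> \<and> \<bar>S\<bar> < 2 * N)"
      | (right) "\<not> (N \<le> \<bar>m\<bar> \<and> \<bar>m\<bar> < 2 * N)" "N \<le> \<bar>S\<bar> \<and> \<bar>S\<bar> < 2 * N"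
      | (none) "\<not> (N \<le> \<bar>m\<bar> \<and> \<bar>m\<bar> < 2 * N)" "\<not> (N \<le> \<bar>S\<bar> \<and> \<bar>S\<bar> < 2 * N)" by blast
    then have "\<bar>x - y\<bar> \<le> Bd m"
    proof cases
      case both
      have nz: "m \<noteq> 0" "S \<noteq> 0" using both N0 by auto
      have "\<bar>x - y\<bar> = \<bar>real_of_int (S - m)\<bar> * (\<bar>1 / real_of_int m\<bar> * \<bar>1 / real_of_int S\<bar>)"
        using both nz by (simp add: x_def y_def diff_frac_eq abs_mult)
      also have "\<dots> \<le> of_int Q * (1 / of_int N * (1 / of_int N))"
      proof (intro mult_mono inv)
        have "real_of_int \<bar>S - m\<bar> \<le> of_int Q" using mS by (simp only: of_int_le_iff)
        then show "\<bar>real_of_int (S - m)\<bar> \<le> of_int Q" by simp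
      qed (use both Q0 N0 in auto)
      also have "\<dots> = of_int Q / (of_int N)\<^sup>2" by (simp add: power2_eq_square)
      also have "\<dots> \<le> Bd m" using both N0 by (simp add: Bd_def)
      finally show ?thesis .
    next
      case left
      then have "\<bar>\<bar>m\<bar> - N\<bar> < Q \<or> \<bar>\<bar>m\<bar> - 2 * N\<bar> < Q" using mS by linarith
      then have "1 / of_int N \<le> Bd m" using Q0 N0 by (simp add: Bd_def)
      moreover have "\<bar>x - y\<bar> \<le> 1 / of_int N" 
      proof -
        have "x = 1 / real_of_int m" using left(1) by (simp only: x_def if_True simp_thms)
        moreover have "y = 0" using left(2) by (simp only: y_def if_False)
        ultimately show ?thesis using inv[of m] left(1) by simp
      qed
      ultimately show ?thesis by linarith
    next
      case right
      then have "\<bar>\<bar>m\<bar> - N\<bar> < Q \<or> \<bar>\<bar>m\<bar> - 2 * N\<bar> < Q" using mS by linarith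
      then have "1 / of_int N \<le> Bd m" using Q0 N0 by (simp add: Bd_def)
      moreover have "\<bar>x - y\<bar> \<le> 1 / of_int N" 
      proof -
        have "x = 0" using right(1) by (simp only: x_def if_False)
        moreover have "y = 1 / real_of_int S" using right(2) by (simp only: y_def if_True simp_thms)
        ultimately show ?thesis using inv[of S] right(2) by simp
      qed
      ultimately show ?thesis by linarith
    next
      case none
      then have "x = 0" "y = 0" by (simp_all only: x_def y_def if_False)
      then show ?thesis using Bd0[of m] by simp
    qed
    then show ?thesis using nD by (simp add: m_def)
  qed
  define R where "R = {-(2 * N)<..<2 * N}"
  define R' where "R' = {N - Q<..<N + Q} \<union> {-N - Q<..<-N + Q} \<union> {2 * N - Q<..<2 * N + Q} \<union> {-2 * N - Q<..<-2 * N + Q}"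
  have Bsum: "(\<Sum>m\<in>X. Bd m) \<le> 12 * of_int Q / of_int N" if X: "finite X" for X
  proof -
    have "(\<Sum>m\<in>X. Bd m) \<le> (\<Sum>m\<in>X. (if m \<in> R then of_int Q / (of_int N)\<^sup>2 else 0) + (if m \<in> R' then 1 / real_of_int N else 0))"
    proof (intro sum_mono)
      fix m
      have 1: "m \<in> R" if "N \<le> \<bar>m\<bar> \<and> \<bar>m\<bar> < 2 * N" using that by (auto simp: R_def)
      have 2: "m \<in> R'" if "\<bar>\<bar>m\<bar> - N\<bar> < Q \<or> \<bar>\<bar>m\<bar> - 2 * N\<bar> < Q"
      proof -
        have "(N - Q < m \<and> m < N + Q) \<or> (-N - Q < m \<and> m < -N + Q) \<or> (2 * N - Q < m \<and> m < 2 * N + Q) \<or> (-2 * N - Q < m \<and> m < -2 * N + Q)"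
          using that by linarith
        then show ?thesis by (auto simp: R'_def)
      qed
      show "Bd m \<le> (if m \<in> R then of_int Q / (of_int N)\<^sup>2 else 0) + (if m \<in> R' then 1 / real_of_int N else 0)"
        unfolding Bd_def using 1 2 Q0 N0 by (intro add_mono) auto
    qed
    also have "\<dots> = (\<Sum>m\<in>X \<inter> R. of_int Q / (of_int N)\<^sup>2) + (\<Sum>m\<in>X \<inter> R'. 1 / real_of_int N)"
      using X by (simp only: sum.distrib sum.inter_restrict)
    also have "\<dots> \<le> (\<Sum>m\<in>R. of_int Q / (of_int N)\<^sup>2) + (\<Sum>m\<in>R'. 1 / real_of_int N)"
      using Q0 N0 by (intro add_mono sum_mono2) (auto simp: R_def R'_def)
    also have "\<dots> = real (card R) * (of_int Q / (of_int N)\<^sup>2) + real (card R') * (1 / of_int N)" by simp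
    also have "\<dots> \<le> (4 * of_int N) * (of_int Q / (of_int N)\<^sup>2) + (8 * of_int Q) * (1 / of_int N)"
    proof (intro add_mono mult_right_mono)
      show "real (card R) \<le> 4 * of_int N" using N0 by (simp add: R_def)
      have "card R' \<le> card {N - Q<..<N + Q} + card {-N - Q<..<-N + Q} + card {2 * N - Q<..<2 * N + Q} + card {-2 * N - Q<..<-2 * N + Q}"
        unfolding R'_def by (meson card_Un_le add_mono order_refl order_trans)
      then have "real (card R') \<le> real (card {N - Q<..<N + Q} + card {-N - Q<..<-N + Q} + card {2 * N - Q<..<2 * N + Q} + card {-2 * N - Q<..<-2 * N + Q})"
        by (simp only: of_nat_le_iff)
      also have "\<dots> \<le> 8 * of_int Q" using Q0 by simp
      finally show "real (card R') \<le> 8 * of_int Q" .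
    qed (use Q0 N0 in auto)
    also have "\<dots> = 12 * of_int Q / of_int N" using N0 by (simp add: power2_eq_square)
    finally show ?thesis .
  qed
  have op: "op_le D (12 * of_int Q / of_int N)"
  proof (rule op_le_schur)
    fix n' :: int and X :: "int set" assume X: "finite X"
    have "(\<Sum>n\<in>X. norm (D n' n)) \<le> (\<Sum>n\<in>X. Bd (n - n'))" by (intro sum_mono DB)
    also have "\<dots> = (\<Sum>m\<in>(\<lambda>n. n - n') ` X. Bd m)" by (subst sum.reindex) (auto simp: inj_on_def)
    also have "\<dots> \<le> 12 * of_int Q / of_int N" using X by (intro Bsum) auto
    finally show "(\<Sum>n\<in>X. norm (D n' n)) \<le> 12 * of_int Q / of_int N" .
    have "(\<Sum>n\<in>X. norm (D n n')) \<le> (\<Sum>n\<in>X. Bd (n' - n))" by (intro sum_mono DB)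
    also have "\<dots> = (\<Sum>m\<in>(\<lambda>n. n' - n) ` X. Bd m)" by (subst sum.reindex) (auto simp: inj_on_def)
    also have "\<dots> \<le> 12 * of_int Q / of_int N" using X by (intro Bsum) auto
    finally show "(\<Sum>n\<in>X. norm (D n n')) \<le> 12 * of_int Q / of_int N" .
  qed
  have "norm (bform A D f g) \<le> 9 * (1 + 36 * 2) * sqrt (12 * of_int Q / of_int N) * Z"
  proof (rule single_scale_bound[OF N0 _ _ op _ A fs Z])
    fix n' n
    show "\<bar>n - n'\<bar> \<le> 4 * N" if "D n' n \<noteq> 0"
    proof -
      have "Bd (n - n') \<noteq> 0" using DB[of n' n] that by auto
      then show ?thesis using QN N0 Q0 unfolding Bd_def by (auto split: if_splits)
    qed
    have "Bd (n - n') \<le> of_int Q / (of_int N)\<^sup>2 + 1 / of_int N" using Q0 N0 unfolding Bd_def by (intro add_mono) auto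
    also have "of_int Q / (of_int N)\<^sup>2 \<le> 1 / real_of_int N"
    proof -
      have "real_of_int Q \<le> of_int N" using QN Q0 by (simp only: of_int_le_iff)
      then show ?thesis using N0 by (simp add: power2_eq_square divide_simps)
    qed
    finally show "norm (D n' n) \<le> 2 / of_int N" using DB[of n' n] by simp
  qed (use Q0 N0 in auto)
  moreover have "D = (\<lambda>n' n. shell (of_int a / (2 * real q)) N (n - n') - (block_kernel q a (block_threshold (2 * N) q) n' n - block_kernel q a (block_threshold N q) n' n))"
    by (intro ext) (rule D_def)
  ultimately show ?thesis by (simp add: Q_def)
qed

lemma geometric_sqrt_half_sum:
  "(\<Sum>j\<in>{J0..<J1::nat}. sqrt (c / 2 ^ j)) \<le> 4 * sqrt (c / 2 ^ J0)" if c: "c \<ge> 0"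
proof -
  define x where "x = sqrt (1/2)"
  have x: "0 < x" "x \<le> 3/4"
  proof -
    show "0 < x" by (simp add: x_def)
    show "x \<le> 3/4" unfolding x_def by (rule real_le_lsqrt) (auto simp: power2_eq_square)
  qed
  have e: "sqrt (c / 2 ^ j) = sqrt c * x ^ j" for j
    by (simp add: x_def real_sqrt_divide real_sqrt_power power_one_over power_divide)
  have "(\<Sum>j\<in>{J0..<J0 + n}. x ^ j) \<le> 4 * x ^ J0 - 4 * x ^ (J0 + n)" for n
  proof (induction n)
    case (Suc n)
    have "x ^ (J0 + n) \<le> 4 * x ^ (J0 + n) - 4 * x ^ (J0 + Suc n)"
      using mult_left_mono[OF x(2), of "4 * x ^ (J0 + n)"] x by simp
    then show ?case using Suc by simp
  qed simp
  from this[of "J1 - J0"] have "(\<Sum>j\<in>{J0..<J1}. x ^ j) \<le> 4 * x ^ J0"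
    using x by (cases "J0 \<le> J1") (auto intro: order_trans simp: less_imp_le)
  then have "sqrt c * (\<Sum>j\<in>{J0..<J1}. x ^ j) \<le> sqrt c * (4 * x ^ J0)" using c by (intro mult_left_mono) auto
  then show ?thesis by (simp add: e sum_distrib_left mult_ac)
qed

text \<open>The block kernels of consecutive shells telescope to two of them. The comparison errors
  decay geometrically from \<open>sqrt (q / 2 ^ J0)\<close>, which is at most \<open>q powr (-3/2)\<close> because
  \<open>q ^ 4 \<le> 2 ^ J0\<close>.\<close>

lemma rational_scales_bound:
  fixes f g :: "int \<Rightarrow> complex"
  assumes q: "coprime a (int q)" "q > 0" and J: "J0 \<le> J1" "q ^ 4 \<le> 2 ^ J0" "16 * q \<le> 2 ^ J0"
    and fs: "finitely_supported f" "finitely_supported g"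
    and A: "finite A" "\<And>n. n \<notin> A \<Longrightarrow> f n = 0 \<and> g n = 0"
    and Z: "\<And>X. finite X \<Longrightarrow> (\<Sum>x\<in>X. maxprod f g x) \<le> Z"
  shows "norm (\<Sum>j\<in>{J0..<J1}. bform A (\<lambda>n' n. shell (of_int a / (2 * real q)) (2 ^ j) (n - n')) f g)
    \<le> 13000000000 * real q powr (-1/6) * Z"
proof -
  define v where "v j = block_kernel q a (block_threshold (2 ^ j) q)" for j :: nat
  define D where "D j n' n = shell (of_int a / (2 * real q)) (2 ^ j) (n - n') - (v (Suc j) n' n - v j n' n)" for j n' n
  have Z0: "Z \<ge> 0" using Z[of "{}"] by simp
  have split: "bform A (\<lambda>n' n. shell (of_int a / (2 * real q)) (2 ^ j) (n - n')) f g =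
      bform A (D j) f g + (bform A (v (Suc j)) f g - bform A (v j) f g)" for j
    unfolding D_def bform_diff_kernel by simp
  have "(\<Sum>j\<in>{J0..<J1}. bform A (\<lambda>n' n. shell (of_int a / (2 * real q)) (2 ^ j) (n - n')) f g) =
      (\<Sum>j\<in>{J0..<J1}. bform A (D j) f g) + (bform A (v J1) f g - bform A (v J0) f g)"
    unfolding split sum.distrib using sum_Suc_diff'[OF J(1), of "\<lambda>j. bform A (v j) f g"] by simp
  also have "norm \<dots> \<le> norm (\<Sum>j\<in>{J0..<J1}. bform A (D j) f g) + (norm (bform A (v J1) f g) + norm (bform A (v J0) f g))"
    by (rule order_trans[OF norm_triangle_ineq]) (intro add_left_mono norm_triangle_ineq4)
  also have "\<dots> \<le> 26280 * real q powr (-1/6) * Z + (6000000000 * real q powr (-1/6) * Z + 6000000000 * real q powr (-1/6) * Z)"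
  proof (intro add_mono)
    have vj: "norm (bform A (v j) f g) \<le> 6000000000 * real q powr (-1/6) * Z" for j
      unfolding v_def by (rule block_kernel_form_bound[OF q block_threshold_ge_1[OF q(2)] fs A Z]) simp_all
    show "norm (bform A (v J1) f g) \<le> 6000000000 * real q powr (-1/6) * Z" "norm (bform A (v J0) f g) \<le> 6000000000 * real q powr (-1/6) * Z"
      by (rule vj)+
    have "norm (\<Sum>j\<in>{J0..<J1}. bform A (D j) f g) \<le> (\<Sum>j\<in>{J0..<J1}. 657 * sqrt (24 * real q / 2 ^ j) * Z)"
    proof (intro order_trans[OF norm_sum] sum_mono)
      fix j assume j: "j \<in> {J0..<J1}"
      have "int (16 * q) \<le> int (2 ^ J0)" using J(3) by (simp only: of_nat_le_iff)
      then have "16 * int q \<le> 2 ^ J0" by simp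
      also have "\<dots> \<le> 2 ^ j" using j by (intro power_increasing) auto
      finally have "16 * int q \<le> 2 ^ j" .
      from shell_block_kernel_comparison[OF q(2) this fs A(1) Z, of a]
      show "norm (bform A (D j) f g) \<le> 657 * sqrt (24 * real q / 2 ^ j) * Z" unfolding D_def v_def by simp
    qed
    also have "\<dots> = 657 * (\<Sum>j\<in>{J0..<J1}. sqrt (24 * real q / 2 ^ j)) * Z" by (simp add: sum_distrib_left sum_distrib_right)
    also have "\<dots> \<le> 657 * (4 * sqrt (24 * real q / 2 ^ J0)) * Z"
      using Z0 geometric_sqrt_half_sum[of "24 * real q" J0 J1] by (intro mult_right_mono mult_left_mono) auto
    also have "\<dots> \<le> 657 * (4 * (10 * real q powr (-1/6))) * Z"
    proof (intro mult_right_mono mult_left_mono Z0)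
      have q1: "real q \<ge> 1" using q by simp
      have "real (q ^ 4) \<le> real (2 ^ J0)" using J(2) by (simp only: of_nat_le_iff)
      then have "24 * real q / 2 ^ J0 \<le> 24 * real q / real q ^ 4" using q1 by (intro divide_left_mono) auto
      also have "\<dots> \<le> 100 * real q powr (-1/3)"
      proof -
        have "real q / real q ^ 4 = real q powr (-3)" using q1 by (simp add: powr_minus powr_numeral power_numeral_reduce field_simps)
        also have "\<dots> \<le> real q powr (-1/3)" using q1 by (intro powr_mono) auto
        finally have "24 * (real q / real q ^ 4) \<le> 24 * real q powr (-1/3)" by simp
        also have "\<dots> \<le> 100 * real q powr (-1/3)" by simp
        finally show ?thesis by simp
      qed
      also have "\<dots> = (10 * real q powr (-1/6))\<^sup>2" by (simp add: power_mult_distrib power2_eq_square flip: powr_add)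
      finally have le: "24 * real q / 2 ^ J0 \<le> (10 * real q powr (-1/6))\<^sup>2" .
      show "sqrt (24 * real q / 2 ^ J0) \<le> 10 * real q powr (-1/6)" by (rule real_le_lsqrt[OF _ le]) simp
    qed auto
    finally show "norm (\<Sum>j\<in>{J0..<J1}. bform A (D j) f g) \<le> 26280 * real q powr (-1/6) * Z" by simp
  qed
  also have "\<dots> = 12000026280 * (real q powr (-1/6) * Z)" by simp
  also have "\<dots> \<le> 13000000000 * (real q powr (-1/6) * Z)" using Z0 by (intro mult_right_mono) auto
  finally show ?thesis by (simp add: mult.assoc)
qed

section \<open>Bounds for the individual scales\<close>

lemma powr_le_of_power_le:
  fixes b t c :: real
  assumes "b > 1" "b ^ u \<le> t" "c \<ge> 0"
  shows "t powr (-c) \<le> (b powr (-c)) ^ u"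
proof -
  have "t powr (-c) \<le> (b ^ u) powr (-c)"
    using assms by (intro powr_mono2') auto
  also have "\<dots> = (b powr real u) powr (-c)" using assms by (simp add: powr_realpow)
  also have "\<dots> = (b powr (-c)) powr real u" by (simp add: powr_powr mult.commute)
  also have "\<dots> = (b powr (-c)) ^ u" using assms by (intro powr_realpow) auto
  finally show ?thesis .
qed

lemma powr_neg_less_1: "b > 1 \<Longrightarrow> c > 0 \<Longrightarrow> (b::real) powr (-c) < 1"
  using powr_less_mono[of "-c" 0 b] by simp

lemma sum_geometric_le:
  fixes x :: real
  assumes "finite S" "0 \<le> x" "x < 1"
  shows "(\<Sum>n\<in>S. x ^ n) \<le> 1 / (1 - x)"
proof -
  have "(\<Sum>n\<in>S. x ^ n) \<le> (\<Sum>n. x ^ n)"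
    using assms by (intro sum_le_suminf summable_geometric) auto
  also have "\<dots> = 1 / (1 - x)" using assms by (intro suminf_geometric) auto
  finally show ?thesis .
qed

lemma sum_geometric_inj_le:
  fixes x :: real
  assumes "finite S" "inj_on u S" "0 \<le> x" "x < 1"
  shows "(\<Sum>j\<in>S. x ^ u j) \<le> 1 / (1 - x)"
  using sum_geometric_le[of "u ` S" x] assms by (simp add: sum.reindex)

lemma sum_geometric_inj2_le:
  fixes x y :: real
  assumes S: "finite S" "inj_on (\<lambda>j. (u j, v j)) S" and x: "0 \<le> x" "x < 1" and y: "0 \<le> y" "y < 1"
  shows "(\<Sum>j\<in>S. x ^ u j * y ^ v j) \<le> 1 / (1 - x) * (1 / (1 - y))"
proof -
  define P where "P = (\<lambda>j. (u j, v j)) ` S"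
  have "(\<Sum>j\<in>S. x ^ u j * y ^ v j) = (\<Sum>p\<in>P. x ^ fst p * y ^ snd p)"
    unfolding P_def using S(2) by (simp add: sum.reindex)
  also have "\<dots> \<le> (\<Sum>p\<in>fst ` P \<times> snd ` P. x ^ fst p * y ^ snd p)"
    using S(1) x y by (intro sum_mono2 subset_fst_snd) (auto simp: P_def)
  also have "\<dots> = (\<Sum>a\<in>fst ` P. x ^ a) * (\<Sum>b\<in>snd ` P. y ^ b)"
    by (simp add: sum_product sum.cartesian_product case_prod_unfold)
  also have "\<dots> \<le> 1 / (1 - x) * (1 / (1 - y))"
    using S(1) x y by (intro mult_mono sum_geometric_le sum_nonneg) (auto simp: P_def)
  finally show ?thesis .
qed

lemma norm_shell_le: "N > 0 \<Longrightarrow> norm (shell \<alpha> N m) \<le> 1 / of_int N"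
  by (auto simp: shell_def quadratic_kernel_def norm_divide intro!: divide_left_mono)

lemma shell_nonzeroD: "shell \<alpha> N m \<noteq> 0 \<Longrightarrow> \<bar>m\<bar> < 2 * N"
  by (auto simp: shell_def split: if_splits)

lemma shell_form_bound:
  fixes f g :: "int \<Rightarrow> complex" and N :: int
  assumes N: "N > 0" and op: "op_le (\<lambda>n' n. shell \<alpha> N (n - n')) \<nu>" and \<nu>: "\<nu> > 0"
    and fs: "finitely_supported f" "finitely_supported g" and A: "finite A"
    and Z: "\<And>X. finite X \<Longrightarrow> (\<Sum>x\<in>X. maxprod f g x) \<le> Z"
  shows "norm (bform A (\<lambda>n' n. shell \<alpha> N (n - n')) f g) \<le> 333 * sqrt \<nu> * Z"
proof -
  have "norm (bform A (\<lambda>n' n. shell \<alpha> N (n - n')) f g) \<le> 9 * (1 + 36 * 1) * sqrt \<nu> * Z"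
    by (rule single_scale_bound[OF N _ _ op \<nu> A fs Z])
      (use N norm_shell_le[OF N] in \<open>auto dest!: shell_nonzeroD\<close>)
  then show ?thesis by simp
qed

lemma sqrt_powr: "x > 0 \<Longrightarrow> sqrt (x powr c) = x powr (c / 2)"
  using powr_half_sqrt[of "x powr c"] by (simp add: powr_powr)

lemma powr_squared: "(x powr c)\<^sup>2 = x powr (2 * c)" for x :: real
  by (simp add: power2_eq_square flip: powr_add)

lemma fourth_power_powr: "x > 0 \<Longrightarrow> (x ^ 4) powr (1/4) = (x::real)"
  using powr_powr[of x 4 "1/4"] by (simp add: powr_numeral)

text \<open>For \<open>q ^ 4 > N\<close> both terms of the Weyl sum are \<open>O(N powr (7/4))\<close>. The scales \<open>j < 8\<close> satisfy
  the same bound trivially at the cost of a constant.\<close>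

lemma minor_scale_bound:
  fixes f g :: "int \<Rightarrow> complex" and a :: int and q j :: nat
  assumes q: "coprime a (int q)" "0 < q" "int q \<le> 4 * 2 ^ j" "j < 8 \<or> 2 ^ j < q ^ 4"
    and ap: "\<bar>2 * \<alpha> - of_int a / real q\<bar> \<le> 1 / (4 * 2 ^ j * real q)"
    and fs: "finitely_supported f" "finitely_supported g" and A: "finite A"
    and Z: "\<And>X. finite X \<Longrightarrow> (\<Sum>x\<in>X. maxprod f g x) \<le> Z"
  shows "norm (bform A (\<lambda>n' n. shell \<alpha> (2 ^ j) (n - n')) f g) \<le> 1998 * (2 powr (-1/16)) ^ j * Z"
proof -
  have Z0: "Z \<ge> 0" using Z[of "{}"] by simp
  define N where "N = (2::real) ^ j"
  have N: "N \<ge> 1" by (simp add: N_def)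
  have q1: "real q \<ge> 1" using q by simp
  have W: "weyl_sum (2 * \<alpha>) (2 ^ j) \<le> 52 * N * sqrt N + 24 * N\<^sup>2 / real q"
    using weyl_sum_minor[of "2 ^ j" a "int q" "2 * \<alpha>"] q ap by (simp add: N_def)
  have iq: "1 / real q \<le> 4 * N powr (-1/4)"
  proof (cases "j < 8")
    case True
    have "N \<le> 2 ^ 8" unfolding N_def using True by (intro power_increasing) auto
    then have "N \<le> 4 ^ 4" by simp
    then have "N powr (1/4) \<le> (4 ^ 4) powr (1/4)" using N by (intro powr_mono2) auto
    also have "\<dots> = 4" by (rule fourth_power_powr) simp
    finally have "1 \<le> 4 * N powr (-1/4)" using N by (simp add: powr_minus field_simps)
    moreover have "1 / real q \<le> 1" using q1 by simp
    ultimately show ?thesis by linarith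
  next
    case False
    then have "2 ^ j \<le> q ^ 4" using q(4) by simp
    then have "real (2 ^ j) \<le> real (q ^ 4)" by (simp only: of_nat_le_iff)
    then have "N powr (1/4) \<le> (real q ^ 4) powr (1/4)" using N by (intro powr_mono2) (auto simp: N_def)
    also have "\<dots> = real q" using q1 by (intro fourth_power_powr) simp
    finally have "1 / real q \<le> 1 / N powr (1/4)" using N q1 by (intro divide_left_mono) auto
    also have "\<dots> = N powr (-1/4)" by (simp add: powr_minus_divide)
    also have "\<dots> \<le> 4 * N powr (-1/4)" by simp
    finally show ?thesis .
  qed
  have "sqrt N = N powr (1/2)" using N by (simp add: powr_half_sqrt)
  then have "N * sqrt N = N powr 1 * N powr (1/2)" using N by simp
  also have "\<dots> \<le> N powr (7/4)" unfolding powr_add[symmetric] using N by (intro powr_mono) auto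
  finally have s1: "N * sqrt N \<le> N powr (7/4)" .
  have "N\<^sup>2 * (1 / real q) \<le> N powr 2 * (4 * N powr (-1/4))" using iq N by (intro mult_mono) (auto simp: powr_numeral)
  also have "\<dots> = 4 * N powr (7/4)" by (simp add: powr_add[symmetric])
  finally have s2: "N\<^sup>2 / real q \<le> 4 * N powr (7/4)" by simp
  have W2: "weyl_sum (2 * \<alpha>) (2 ^ j) \<le> 148 * N powr (7/4)" using W s1 s2 by simp
  have "sqrt (weyl_sum (2 * \<alpha>) (2 ^ j)) \<le> sqrt (148 * N powr (7/4))" using W2 by (rule real_sqrt_le_mono)
  also have "\<dots> = sqrt 148 * N powr (7/8)" using N by (simp add: real_sqrt_mult sqrt_powr)
  also have "\<dots> \<le> 18 * N powr (7/8)" by (intro mult_right_mono real_le_lsqrt) auto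
  finally have "2 / N * sqrt (weyl_sum (2 * \<alpha>) (2 ^ j)) \<le> 2 / N * (18 * N powr (7/8))"
    using N by (intro mult_left_mono) auto
  also have "\<dots> = 36 * (N powr (7/8) * N powr (-1))" using N by (simp add: powr_minus_divide)
  also have "\<dots> = 36 * N powr (-1/8)" by (subst powr_add[symmetric]) simp
  finally have \<nu>_le: "2 / N * sqrt (weyl_sum (2 * \<alpha>) (2 ^ j)) \<le> 36 * N powr (-1/8)" .
  have "op_le (\<lambda>n' n. shell \<alpha> (2 ^ j) (n - n')) (2 / N * sqrt (weyl_sum (2 * \<alpha>) (2 ^ j)))"
    unfolding N_def using shell_op_le[of "2 ^ j" \<alpha>] by simp
  from op_le_mono[OF this \<nu>_le] have op: "op_le (\<lambda>n' n. shell \<alpha> (2 ^ j) (n - n')) (36 * N powr (-1/8))" .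
  have "norm (bform A (\<lambda>n' n. shell \<alpha> (2 ^ j) (n - n')) f g) \<le> 333 * sqrt (36 * N powr (-1/8)) * Z"
    using N by (intro shell_form_bound[OF _ op _ fs A Z]) auto
  also have "sqrt (36 * N powr (-1/8)) = 6 * N powr (-1/16)"
    using N by (simp add: real_sqrt_mult sqrt_powr)
  also have "333 * (6 * N powr (-1/16)) * Z \<le> 333 * (6 * (2 powr (-1/16)) ^ j) * Z"
    using Z0 powr_le_of_power_le[of 2 j N "1/16"] by (intro mult_right_mono mult_left_mono) (auto simp: N_def)
  finally show ?thesis by simp
qed

text \<open>Here \<open>\<bar>\<beta>\<bar> = \<mu> / N\<^sup>2\<close> turns the second term of \<open>weyl_sum_major_decay\<close> into
  \<open>6 N\<^sup>2 / (q * sqrt \<mu>)\<close>. The first one is smaller since \<open>q ^ 4 * \<mu> \<le> N\<^sup>2\<close>, which follows from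
  \<open>q ^ 4 \<le> N\<close> and \<open>\<mu> \<le> N / (4 q)\<close>.\<close>

lemma transitional_scale_bound:
  fixes f g :: "int \<Rightarrow> complex" and a :: int and q j :: nat
  assumes q: "coprime a (int q)" "0 < q" "q ^ 4 \<le> 2 ^ j"
    and ap: "\<bar>2 * \<alpha> - of_int a / real q\<bar> \<le> 1 / (4 * 2 ^ j * real q)"
    and \<mu>: "\<mu> = 4 ^ j * \<bar>2 * \<alpha> - of_int a / real q\<bar>" "\<mu> > 1"
    and fs: "finitely_supported f" "finitely_supported g" and A: "finite A"
    and Z: "\<And>X. finite X \<Longrightarrow> (\<Sum>x\<in>X. maxprod f g x) \<le> Z"
  shows "norm (bform A (\<lambda>n' n. shell \<alpha> (2 ^ j) (n - n')) f g) \<le> 999 * real q powr (-1/4) * \<mu> powr (-1/8) * Z"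
proof -
  have Z0: "Z \<ge> 0" using Z[of "{}"] by simp
  define N where "N = (2::real) ^ j"
  define \<beta> where "\<beta> = 2 * \<alpha> - of_int a / real q"
  have N: "N \<ge> 1" by (simp add: N_def)
  have q1: "real q \<ge> 1" using q by simp
  have NN: "(4::real) ^ j = N\<^sup>2" by (simp add: N_def power2_eq_square flip: power_mult_distrib)
  have \<mu>N: "\<mu> = N\<^sup>2 * \<bar>\<beta>\<bar>" using \<mu>(1) NN by (simp add: \<beta>_def)
  have \<beta>0: "\<beta> \<noteq> 0" using \<mu>N \<mu>(2) by auto
  have q4: "real q ^ 4 \<le> N"
  proof -
    have "real (q ^ 4) \<le> real (2 ^ j)" using q(3) by (simp only: of_nat_le_iff)
    then show ?thesis by (simp add: N_def)
  qed
  have qN: "int q \<le> 2 ^ j"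
  proof -
    have "q ^ 1 \<le> q ^ 4" using q(2) by (intro power_increasing) auto
    then have "q \<le> 2 ^ j" using q(3) by simp
    then have "int q \<le> int (2 ^ j)" by (simp only: of_nat_le_iff)
    then show ?thesis by simp
  qed
  have sb: "sqrt \<bar>\<beta>\<bar> = sqrt \<mu> / N" using N by (simp add: \<mu>N real_sqrt_mult)
  have sl: "sqrt \<mu> > 0" using \<mu>(2) by simp
  have "weyl_sum (2 * \<alpha>) (2 ^ j) \<le> 7 * real q * N + 6 * N / (real q * sqrt \<bar>\<beta>\<bar>)"
    using weyl_sum_major_decay[of "2 ^ j" a "int q" "2 * \<alpha>" \<beta>] q(1,2) qN ap \<beta>0 by (simp add: N_def \<beta>_def)
  also have "6 * N / (real q * sqrt \<bar>\<beta>\<bar>) = 6 * N\<^sup>2 / (real q * sqrt \<mu>)" using N by (simp add: sb power2_eq_square)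
  also have "7 * real q * N \<le> 7 * N\<^sup>2 / (real q * sqrt \<mu>)"
  proof -
    have "\<mu> \<le> N\<^sup>2 * (1 / (4 * N * real q))" unfolding \<mu>N using ap by (intro mult_left_mono) (auto simp: \<beta>_def N_def)
    also have "\<dots> = N / (4 * real q)" using N q1 by (simp add: power2_eq_square)
    also have "\<dots> \<le> N / 1" using N q1 by (intro divide_left_mono) auto
    finally have lN: "\<mu> \<le> N" by simp
    have "((real q)\<^sup>2 * sqrt \<mu>)\<^sup>2 = real q ^ 4 * \<mu>" using \<mu>(2) by (simp add: power_mult_distrib)
    also have "\<dots> \<le> N * N" using q4 lN N \<mu>(2) by (intro mult_mono) auto
    also have "\<dots> = N\<^sup>2" by (simp add: power2_eq_square)
    finally have "(real q)\<^sup>2 * sqrt \<mu> \<le> N" by (rule power2_le_imp_le) (use N in auto)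
    then have "real q * N * (real q * sqrt \<mu>) \<le> N * N" using N by (simp add: power2_eq_square mult_ac)
    then have "real q * N \<le> N * N / (real q * sqrt \<mu>)" using sl q1 by (subst pos_le_divide_eq) auto
    then show ?thesis by (simp add: power2_eq_square)
  qed
  finally have W: "weyl_sum (2 * \<alpha>) (2 ^ j) \<le> 13 * (N\<^sup>2 / (real q * sqrt \<mu>))" by simp
  have "sqrt (weyl_sum (2 * \<alpha>) (2 ^ j)) \<le> sqrt (13 * (N\<^sup>2 / (real q * sqrt \<mu>)))" using W by (rule real_sqrt_le_mono)
  also have "\<dots> = sqrt 13 * (N * (real q powr (-1/2) * \<mu> powr (-1/4)))"
  proof -
    have "(N * (real q powr (-1/2) * \<mu> powr (-1/4)))\<^sup>2 = N\<^sup>2 * (real q powr (-1) * \<mu> powr (-(1/2)))"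
      by (simp add: power_mult_distrib powr_squared)
    also have "real q powr (-1) = 1 / real q" using q1 by (simp add: powr_minus_divide)
    also have "\<mu> powr (-(1/2)) = 1 / sqrt \<mu>" using \<mu>(2) powr_half_sqrt[of \<mu>] by (simp only: powr_minus_divide)
    also have "N\<^sup>2 * (1 / real q * (1 / sqrt \<mu>)) = N\<^sup>2 / (real q * sqrt \<mu>)" by simp
    finally have e: "N\<^sup>2 / (real q * sqrt \<mu>) = (N * (real q powr (-1/2) * \<mu> powr (-1/4)))\<^sup>2" ..
    have "N * (real q powr (-1/2) * \<mu> powr (-1/4)) \<ge> 0" using N by simp
    then show ?thesis unfolding e real_sqrt_mult real_sqrt_abs by (simp only: abs_of_nonneg)
  qed
  also have "\<dots> \<le> 4 * (N * (real q powr (-1/2) * \<mu> powr (-1/4)))"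
    using N by (intro mult_right_mono real_le_lsqrt) auto
  finally have "2 / N * sqrt (weyl_sum (2 * \<alpha>) (2 ^ j)) \<le> 2 / N * (4 * (N * (real q powr (-1/2) * \<mu> powr (-1/4))))"
    using N by (intro mult_left_mono) auto
  also have "\<dots> = 8 * (real q powr (-1/2) * \<mu> powr (-1/4))" using N by simp
  also have "\<dots> \<le> 9 * (real q powr (-1/2) * \<mu> powr (-1/4))" by (intro mult_right_mono) auto
  finally have \<nu>_le: "2 / N * sqrt (weyl_sum (2 * \<alpha>) (2 ^ j)) \<le> 9 * (real q powr (-1/2) * \<mu> powr (-1/4))" .
  have "op_le (\<lambda>n' n. shell \<alpha> (2 ^ j) (n - n')) (2 / N * sqrt (weyl_sum (2 * \<alpha>) (2 ^ j)))"
    unfolding N_def using shell_op_le[of "2 ^ j" \<alpha>] by simp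
  from op_le_mono[OF this \<nu>_le] have op: "op_le (\<lambda>n' n. shell \<alpha> (2 ^ j) (n - n')) (9 * (real q powr (-1/2) * \<mu> powr (-1/4)))" .
  have "norm (bform A (\<lambda>n' n. shell \<alpha> (2 ^ j) (n - n')) f g) \<le> 333 * sqrt (9 * (real q powr (-1/2) * \<mu> powr (-1/4))) * Z"
    using q1 \<mu>(2) by (intro shell_form_bound[OF _ op _ fs A Z]) auto
  also have "sqrt (9 * (real q powr (-1/2) * \<mu> powr (-1/4))) = 3 * (real q powr (-1/4) * \<mu> powr (-1/8))"
    using q1 \<mu>(2) by (simp add: real_sqrt_mult sqrt_powr)
  finally show ?thesis by (simp add: mult_ac)
qed

lemma norm_ee_minus_1_le: "norm (ee x - 1) \<le> 2 * pi * \<bar>x\<bar>"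
proof -
  have c: "cos (2 * pi * x) = 1 - 2 * (sin (pi * x))\<^sup>2" using cos_double_sin[of "pi * x"] by (simp add: mult_ac)
  have sc: "(sin (2 * pi * x))\<^sup>2 = 1 - (cos (2 * pi * x))\<^sup>2" by (rule sin_squared_eq)
  have "(norm (ee x - 1))\<^sup>2 = (cos (2 * pi * x) - 1)\<^sup>2 + (sin (2 * pi * x))\<^sup>2"
    by (simp add: cmod_power2 ee_def)
  also have "\<dots> = 2 - 2 * cos (2 * pi * x)"
    unfolding sc by (simp add: power2_eq_square algebra_simps)
  also have "\<dots> = (2 * \<bar>sin (pi * x)\<bar>)\<^sup>2" by (simp add: c power_mult_distrib)
  finally have "norm (ee x - 1) = 2 * \<bar>sin (pi * x)\<bar>" by (rule power2_eq_imp_eq) auto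
  also have "\<dots> \<le> 2 * \<bar>pi * x\<bar>" by (intro mult_left_mono abs_sin_x_le_abs_x) auto
  finally show ?thesis by (simp add: abs_mult)
qed

lemma op_le_convolution_bounded:
  fixes N :: int and c :: "int \<Rightarrow> complex"
  assumes N: "N > 0" and c: "\<And>m. norm (c m) \<le> b" "\<And>m. 2 * N \<le> \<bar>m\<bar> \<Longrightarrow> c m = 0"
  shows "op_le (\<lambda>n' n. c (n - n')) (4 * of_int N * b)"
proof -
  have b: "b \<ge> 0" using c(1)[of 0] norm_ge_zero[of "c 0"] by linarith
  have c0: "c m = 0" if "m \<notin> {-2 * N..<2 * N}" for m using that by (intro c(2)) auto
  have *: "(\<Sum>m\<in>X. norm (c m)) \<le> 4 * of_int N * b" if X: "finite X" for X
  proof -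
    have "(\<Sum>m\<in>X. norm (c m)) = (\<Sum>m\<in>X \<inter> {-2 * N..<2 * N}. norm (c m))"
      using X c0 by (intro sum.mono_neutral_right) auto
    also have "\<dots> \<le> (\<Sum>m\<in>X \<inter> {-2 * N..<2 * N}. b)" by (intro sum_mono c(1))
    also have "\<dots> = real (card (X \<inter> {-2 * N..<2 * N})) * b" by simp
    also have "\<dots> \<le> real (card {-2 * N..<2 * N}) * b"
      using b by (intro mult_right_mono of_nat_mono card_mono) auto
    also have "real (card {-2 * N..<2 * N}) = 4 * of_int N" using N by simp
    finally show ?thesis .
  qed
  show ?thesis
  proof (rule op_le_schur)
    fix n' :: int and X :: "int set" assume X: "finite X"
    have "(\<Sum>n\<in>X. norm (c (n - n'))) = (\<Sum>m\<in>(\<lambda>n. n - n') ` X. norm (c m))" by (subst sum.reindex) (auto simp: inj_on_def)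
    then show "(\<Sum>n\<in>X. norm (c (n - n'))) \<le> 4 * of_int N * b" using *[OF finite_imageI[OF X]] by simp
    have "(\<Sum>n\<in>X. norm (c (n' - n))) = (\<Sum>m\<in>(\<lambda>n. n' - n) ` X. norm (c m))" by (subst sum.reindex) (auto simp: inj_on_def)
    then show "(\<Sum>n\<in>X. norm (c (n' - n))) \<le> 4 * of_int N * b" using *[OF finite_imageI[OF X]] by simp
  qed
qed

lemma norm_shell_difference_le:
  fixes N :: int
  assumes N: "N > 0"
  shows "norm (shell \<alpha> N m - shell \<alpha>' N m) \<le> 16 * of_int N * \<bar>\<alpha> - \<alpha>'\<bar>"
proof (cases "N \<le> \<bar>m\<bar> \<and> \<bar>m\<bar> < 2 * N")
  case True
  have m0: "m \<noteq> 0" using True N by auto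
  have "ee (\<alpha> * (of_int m)\<^sup>2) = ee (\<alpha>' * (of_int m)\<^sup>2) * ee ((\<alpha> - \<alpha>') * (of_int m)\<^sup>2)"
    by (simp add: left_diff_distrib flip: ee_add)
  then have "shell \<alpha> N m - shell \<alpha>' N m = ee (\<alpha>' * (of_int m)\<^sup>2) * (ee ((\<alpha> - \<alpha>') * (of_int m)\<^sup>2) - 1) / of_int m"
    using True by (simp add: shell_def quadratic_kernel_def diff_divide_distrib right_diff_distrib)
  then have "norm (shell \<alpha> N m - shell \<alpha>' N m) = norm (ee ((\<alpha> - \<alpha>') * (of_int m)\<^sup>2) - 1) / \<bar>of_int m\<bar>"
    by (simp add: norm_divide norm_mult)
  also have "\<dots> \<le> 2 * pi * \<bar>(\<alpha> - \<alpha>') * (of_int m)\<^sup>2\<bar> / \<bar>of_int m\<bar>"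
    by (intro divide_right_mono norm_ee_minus_1_le) auto
  also have "\<dots> = 2 * pi * \<bar>\<alpha> - \<alpha>'\<bar> * \<bar>of_int m\<bar>" 
  proof -
    have "\<bar>(\<alpha> - \<alpha>') * (of_int m)\<^sup>2\<bar> = \<bar>\<alpha> - \<alpha>'\<bar> * \<bar>real_of_int m\<bar> * \<bar>of_int m\<bar>"
      unfolding power2_eq_square abs_mult by simp
    then show ?thesis using m0 by simp
  qed
  also have "\<dots> \<le> 2 * 4 * \<bar>\<alpha> - \<alpha>'\<bar> * (2 * of_int N)"
  proof (intro mult_mono)
    show "pi \<le> 4" using pi_less_4 by simp
    have "\<bar>m\<bar> \<le> 2 * N" using True by simp
    then have "real_of_int \<bar>m\<bar> \<le> real_of_int (2 * N)" by (simp only: of_int_le_iff)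
    then show "\<bar>of_int m\<bar> \<le> 2 * real_of_int N" by simp
  qed auto
  finally show ?thesis by (simp add: mult_ac)
next
  case False
  then show ?thesis using N by (auto simp: shell_def)
qed

text \<open>There are two bounds for the operator norm of the difference: \<open>12 * q powr (-1/2)\<close> from Weyl
  sums for both phases, and \<open>32 * \<mu>\<close> from Schur's test, because the phases differ by \<open>O(\<mu>)\<close> on
  the shell. Their geometric mean decays in \<open>q\<close> and in \<open>1/\<mu>\<close> simultaneously.\<close>

lemma main_scale_comparison:
  fixes f g :: "int \<Rightarrow> complex" and a :: int and q j :: nat
  assumes q: "coprime a (int q)" "0 < q" "q ^ 4 \<le> 2 ^ j"
    and ap: "\<bar>2 * \<alpha> - of_int a / real q\<bar> \<le> 1 / (4 * 2 ^ j * real q)"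
    and \<mu>: "\<mu> = 4 ^ j * \<bar>2 * \<alpha> - of_int a / real q\<bar>" "\<mu> > 0"
    and fs: "finitely_supported f" "finitely_supported g" and A: "finite A"
    and Z: "\<And>X. finite X \<Longrightarrow> (\<Sum>x\<in>X. maxprod f g x) \<le> Z"
  shows "norm (bform A (\<lambda>n' n. shell \<alpha> (2 ^ j) (n - n') - shell (of_int a / (2 * real q)) (2 ^ j) (n - n')) f g)
    \<le> 3285 * real q powr (-1/8) * \<mu> powr (1/4) * Z"
proof -
  have Z0: "Z \<ge> 0" using Z[of "{}"] by simp
  define N where "N = (2::real) ^ j"
  define \<alpha>' where "\<alpha>' = of_int a / (2 * real q)"
  have N: "N \<ge> 1" by (simp add: N_def)
  have q1: "real q \<ge> 1" using q by simp
  have NN: "(4::real) ^ j = N\<^sup>2" by (simp add: N_def power2_eq_square flip: power_mult_distrib)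
  have q4: "real q ^ 4 \<le> N"
  proof -
    have "real (q ^ 4) \<le> real (2 ^ j)" using q(3) by (simp only: of_nat_le_iff)
    then show ?thesis by (simp add: N_def)
  qed
  have qN: "int q \<le> 2 ^ j"
  proof -
    have "q ^ 1 \<le> q ^ 4" using q(2) by (intro power_increasing) auto
    then have "q \<le> 2 ^ j" using q(3) by simp
    then have "int q \<le> int (2 ^ j)" by (simp only: of_nat_le_iff)
    then show ?thesis by simp
  qed
  have op1: "op_le (\<lambda>n' n. shell \<gamma> (2 ^ j) (n - n')) (6 * real q powr (-1/2))"
    if \<gamma>: "\<bar>2 * \<gamma> - of_int a / real q\<bar> \<le> 1 / (4 * 2 ^ j * real q)" for \<gamma>
  proof -
    have "weyl_sum (2 * \<gamma>) (2 ^ j) \<le> 6 * real q * N + 3 * N\<^sup>2 / real q"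
      using weyl_sum_major[of "2 ^ j" a "int q" "2 * \<gamma>"] q(1,2) qN \<gamma> by (simp add: N_def)
    also have "6 * real q * N \<le> 6 * N\<^sup>2 / real q"
    proof -
      have "real q ^ 2 \<le> real q ^ 4" using q1 by (intro power_increasing) auto
      then have "real q ^ 2 * N \<le> N * N" using q4 N by (intro mult_right_mono) auto
      then have "real q * N \<le> N * N / real q" using q1 by (subst pos_le_divide_eq) (auto simp: power2_eq_square mult_ac)
      then show ?thesis by (simp add: power2_eq_square)
    qed
    finally have W: "weyl_sum (2 * \<gamma>) (2 ^ j) \<le> 9 * (N\<^sup>2 / real q)" by simp
    have "sqrt (weyl_sum (2 * \<gamma>) (2 ^ j)) \<le> sqrt (9 * (N\<^sup>2 / real q))" using W by (rule real_sqrt_le_mono)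
    also have "\<dots> = 3 * (N * real q powr (-1/2))"
    proof -
      have "(N * real q powr (-1/2))\<^sup>2 = N\<^sup>2 * real q powr (-1)"
        by (simp add: power_mult_distrib powr_squared)
      also have "\<dots> = N\<^sup>2 / real q" using q1 by (simp add: powr_minus_divide)
      finally have e: "N\<^sup>2 / real q = (N * real q powr (-1/2))\<^sup>2" ..
      have "N * real q powr (-1/2) \<ge> 0" using N by simp
      then show ?thesis unfolding e real_sqrt_mult real_sqrt_abs by (simp only: abs_of_nonneg) simp
    qed
    finally have "2 / N * sqrt (weyl_sum (2 * \<gamma>) (2 ^ j)) \<le> 2 / N * (3 * (N * real q powr (-1/2)))"
      using N by (intro mult_left_mono) auto
    also have "\<dots> = 6 * real q powr (-1/2)" using N by simp
    finally have \<nu>_le: "2 / N * sqrt (weyl_sum (2 * \<gamma>) (2 ^ j)) \<le> 6 * real q powr (-1/2)" .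
    have "op_le (\<lambda>n' n. shell \<gamma> (2 ^ j) (n - n')) (2 / N * sqrt (weyl_sum (2 * \<gamma>) (2 ^ j)))"
      unfolding N_def using shell_op_le[of "2 ^ j" \<gamma>] by simp
    from op_le_mono[OF this \<nu>_le] show ?thesis .
  qed
  define K where "K n' n = shell \<alpha> (2 ^ j) (n - n') - shell \<alpha>' (2 ^ j) (n - n')" for n' n
  have opw: "op_le K (12 * real q powr (-1/2))"
    using op_le_diff[OF op1[OF ap] op1[of \<alpha>']] q1 unfolding K_def by (simp add: \<alpha>'_def)
  have ab: "16 * N * \<bar>\<alpha> - \<alpha>'\<bar> = 8 * N * \<bar>2 * \<alpha> - of_int a / real q\<bar>"
  proof -
    have "2 * \<alpha> - of_int a / real q = 2 * (\<alpha> - \<alpha>')" by (simp add: \<alpha>'_def)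
    then show ?thesis by (simp only: abs_mult)
  qed
  have "op_le K (4 * of_int (2 ^ j) * (16 * of_int (2 ^ j) * \<bar>\<alpha> - \<alpha>'\<bar>))"
    unfolding K_def by (rule op_le_convolution_bounded[where c = "\<lambda>m. shell \<alpha> (2 ^ j) m - shell \<alpha>' (2 ^ j) m"])
      (use norm_shell_difference_le[of "2 ^ j"] in \<open>auto simp: shell_def\<close>)
  then have "op_le K (4 * N * (16 * N * \<bar>\<alpha> - \<alpha>'\<bar>))" by (simp add: N_def)
  then have ops: "op_le K (32 * \<mu>)" unfolding ab \<mu>(1) NN by (simp add: power2_eq_square mult_ac)
  \<comment> \<open>\<open>25\<^sup>2 \<ge> 12 * 32\<close>, so \<open>\<nu>\<close> is at least the geometric mean of the two bounds\<close>
  define \<nu> where "\<nu> = 25 * (\<mu> powr (1/2) * real q powr (-1/4))"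
  have op: "op_le K \<nu>"
  proof (cases "32 * \<mu> \<le> \<nu>")
    case False
    have "12 * real q powr (-1/2) * \<nu> \<le> 12 * real q powr (-1/2) * (32 * \<mu>)" using False by (intro mult_left_mono) auto
    also have "\<dots> \<le> \<nu> * \<nu>"
    proof -
      have "\<nu> * \<nu> = 625 * ((\<mu> powr (1/2) * \<mu> powr (1/2)) * (real q powr (-1/4) * real q powr (-1/4)))" by (simp add: \<nu>_def)
      also have "\<dots> = 625 * (\<mu> * real q powr (-1/2))" unfolding powr_add[symmetric] using \<mu>(2) by simp
      finally show ?thesis using \<mu>(2) by simp
    qed
    finally have "12 * real q powr (-1/2) \<le> \<nu>" using \<mu>(2) q1 by (simp add: \<nu>_def)
    then show ?thesis using opw by (rule op_le_mono[rotated])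
  qed (rule op_le_mono[OF ops])
  have "norm (bform A K f g) \<le> 9 * (1 + 36 * 2) * sqrt \<nu> * Z"
  proof (rule single_scale_bound[OF _ _ _ op _ A fs Z])
    fix n' n :: int
    show "\<bar>n - n'\<bar> \<le> 4 * 2 ^ j" if "K n' n \<noteq> 0"
      using that shell_nonzeroD[of \<alpha> "2 ^ j" "n - n'"] shell_nonzeroD[of \<alpha>' "2 ^ j" "n - n'"] by (force simp: K_def)
    have "norm (K n' n) \<le> 1 / of_int (2 ^ j) + 1 / of_int (2 ^ j)"
      unfolding K_def by (intro order_trans[OF norm_triangle_ineq4] add_mono norm_shell_le) auto
    then show "norm (K n' n) \<le> 2 / real_of_int (2 ^ j)" by simp
  qed (use \<mu>(2) q1 in \<open>auto simp: \<nu>_def\<close>)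
  also have "sqrt \<nu> = 5 * (\<mu> powr (1/4) * real q powr (-1/8))"
    using q1 \<mu>(2) by (simp add: \<nu>_def real_sqrt_mult sqrt_powr)
  finally show ?thesis by (simp add: K_def \<alpha>'_def mult_ac)
qed

section \<open>Summation over the scales\<close>

text \<open>The integer part of the logarithm of \<open>t \<ge> 1\<close> to the base \<open>b\<close>.\<close>

definition ilog :: "real \<Rightarrow> real \<Rightarrow> nat" where
  "ilog b t = (LEAST v. t < b ^ Suc v)"

lemma ilog_bounds:
  assumes "b > 1" "t \<ge> 1"
  shows "b ^ ilog b t \<le> t" "t < b ^ Suc (ilog b t)"
proof -
  obtain n where "t < b ^ n" using real_arch_pow[OF assms(1)] by blast
  also have "b ^ n \<le> b ^ Suc n" using assms by (intro power_increasing) auto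
  finally have n: "t < b ^ Suc n" .
  show "t < b ^ Suc (ilog b t)" unfolding ilog_def by (rule LeastI[of "\<lambda>v. t < b ^ Suc v", OF n])
  show "b ^ ilog b t \<le> t"
  proof (cases "ilog b t")
    case 0
    then show ?thesis using assms by simp
  next
    case (Suc m)
    then have "\<not> t < b ^ Suc m" unfolding ilog_def by (intro not_less_Least) simp
    then show ?thesis using Suc by simp
  qed
qed

lemma ilog_less:
  assumes "b > 1" "t \<ge> 1" "b * t \<le> t'"
  shows "ilog b t < ilog b t'"
proof -
  have "1 * t \<le> b * t" using assms(1,2) by (intro mult_right_mono) auto
  then have t': "t' \<ge> 1" using assms(2,3) by linarith
  have "b ^ Suc (ilog b t) \<le> b * t" using ilog_bounds(1)[OF assms(1,2)] assms(1) by simp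
  also have "\<dots> \<le> t'" by (rule assms(3))
  also have "\<dots> < b ^ Suc (ilog b t')" by (rule ilog_bounds(2)[OF assms(1) t'])
  finally have "Suc (ilog b t) < Suc (ilog b t')" using power_less_imp_less_exp[OF assms(1)] by blast
  then show ?thesis by simp
qed

lemma powr_le_ilog:
  assumes "b > 1" "t \<ge> 1" "c \<ge> 0"
  shows "t powr (-c) \<le> (b powr (-c)) ^ ilog b t"
  by (rule powr_le_of_power_le[OF assms(1) ilog_bounds(1)[OF assms(1,2)] assms(3)])

text \<open>The bound \<open>8 \<le> j\<close> guarantees \<open>16 * q \<le> 2 ^ j\<close>, so that a block of length \<open>2 * q\<close> is short
  compared with the scale.\<close>

definition major_fraction :: "real \<Rightarrow> nat \<Rightarrow> int \<Rightarrow> nat \<Rightarrow> bool" where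
  "major_fraction \<theta> j a q \<longleftrightarrow> 8 \<le> j \<and> 0 < q \<and> coprime a (int q) \<and> q ^ 4 \<le> 2 ^ j \<and>
     \<bar>\<theta> - of_int a / real q\<bar> \<le> 1 / (4 * 2 ^ j * real q)"

lemma coprime_fraction_unique:
  fixes a a' :: int and q q' :: nat
  assumes "coprime a (int q)" "coprime a' (int q')" "0 < q" "0 < q'" "a * int q' = a' * int q"
  shows "a = a' \<and> q = q'"
proof -
  have "int q dvd a * int q'" unfolding assms(5) by simp
  then have 1: "int q dvd int q'" using assms(1) by (simp add: coprime_commute coprime_dvd_mult_right_iff)
  have "int q' dvd a' * int q" unfolding assms(5)[symmetric] by simp
  then have 2: "int q' dvd int q" using assms(2) by (simp add: coprime_commute coprime_dvd_mult_right_iff)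
  have "q = q'" using 1 2 by (simp add: dvd_antisym)
  then show ?thesis using assms by simp
qed

text \<open>Two different fractions are at least \<open>1/(q q')\<close> apart, while both are close to \<open>\<theta>\<close>.\<close>

lemma major_unique:
  assumes m: "major_fraction \<theta> j a q" "major_fraction \<theta> j' a' q'" and i: "i \<le> j" "i \<le> j'" and q: "q + q' < 4 * 2 ^ i"
  shows "a = a' \<and> q = q'"
proof -
  have p: "real q > 0" "real q' > 0" using m by (simp_all add: major_fraction_def)
  have *: "\<bar>\<theta> - of_int b / real r\<bar> \<le> 1 / (4 * 2 ^ i * real r)" if "major_fraction \<theta> k b r" "i \<le> k" for k b r
  proof -
    have "(2::real) ^ i \<le> 2 ^ k" using that(2) by (intro power_increasing) auto
    then have "1 / (4 * 2 ^ k * real r) \<le> 1 / (4 * 2 ^ i * real r)"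
      using that(1) by (intro divide_left_mono mult_right_mono mult_left_mono) (auto simp: major_fraction_def)
    then show ?thesis using that(1) by (simp add: major_fraction_def)
  qed
  have "\<bar>of_int a / real q - of_int a' / real q'\<bar> \<le> 1 / (4 * 2 ^ i * real q) + 1 / (4 * 2 ^ i * real q')"
    using *[OF m(1) i(1)] *[OF m(2) i(2)] by linarith
  also have "\<dots> = (real q + real q') / (4 * 2 ^ i) / (real q * real q')"
    using p by (simp add: field_simps)
  also have "\<dots> < 1 / (real q * real q')"
  proof -
    have "real (q + q') < real (4 * 2 ^ i)" using q by (simp only: of_nat_less_iff)
    then have "(real q + real q') / (4 * 2 ^ i) < 1" by simp
    then show ?thesis using p by (intro divide_strict_right_mono) auto
  qed
  finally have "\<bar>of_int a / real q - of_int a' / real q'\<bar> * (real q * real q') < 1"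
    using p by (simp only: pos_less_divide_eq mult_pos_pos)
  also have "\<bar>of_int a / real q - of_int a' / real q'\<bar> * (real q * real q') =
      \<bar>(of_int a / real q - of_int a' / real q') * (real q * real q')\<bar>"
    using p by (simp add: abs_mult)
  also have "(of_int a / real q - of_int a' / real q') * (real q * real q') = of_int (a * int q' - a' * int q)"
    using p by (simp add: left_diff_distrib)
  finally have "real_of_int \<bar>a * int q' - a' * int q\<bar> < real_of_int 1" by simp
  then have "\<bar>a * int q' - a' * int q\<bar> < 1" by (simp only: of_int_less_iff)
  then have "a * int q' = a' * int q" by linarith
  then show ?thesis using m by (intro coprime_fraction_unique) (auto simp: major_fraction_def)
qed

text \<open>If \<open>q\<close> and \<open>q'\<close> lie in \<open>{2 ^ k..<2 ^ (k + 1)}\<close>, then \<open>2 ^ k\<close> is below both scales and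
  \<open>q + q' < 4 * 2 ^ k\<close>. This holds for fractions belonging to different scales, and it is the
  reason that sums over scales and over fractions converge.\<close>

lemma major_same_block:
  assumes m: "major_fraction \<theta> j a q" "major_fraction \<theta> j' a' q'" and l: "ilog 2 (real q) = ilog 2 (real q')"
  shows "a = a' \<and> q = q'"
proof -
  define k where "k = ilog 2 (real q)"
  have q1: "real q \<ge> 1" "real q' \<ge> 1" using m by (auto simp: major_fraction_def)
  have b: "2 ^ k \<le> real q" "real q < 2 ^ Suc k" "2 ^ k \<le> real q'" "real q' < 2 ^ Suc k"
    using ilog_bounds[of 2 "real q"] ilog_bounds[of 2 "real q'"] q1 l by (simp_all add: k_def)
  have le: "k \<le> i" if "major_fraction \<theta> i c r" "2 ^ k \<le> real r" for i c r
  proof -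
    have r1: "r \<ge> 1" using that(1) by (simp add: major_fraction_def)
    have "r ^ 1 \<le> r ^ 4" using r1 by (intro power_increasing) auto
    then have "r \<le> 2 ^ i" using that(1) by (simp add: major_fraction_def)
    then have "real r \<le> real (2 ^ i)" by (simp only: of_nat_le_iff)
    then have "real r \<le> 2 ^ i" by simp
    from order_trans[OF that(2) this] show ?thesis by (rule power_le_imp_le_exp[rotated]) simp
  qed
  have "real (q + q') < real (4 * 2 ^ k)" using b by simp
  then have "q + q' < 4 * 2 ^ k" by (simp only: of_nat_less_iff)
  then show ?thesis using major_unique[OF m le[OF m(1) b(1)] le[OF m(2) b(3)]] by simp
qed

text \<open>Dirichlet's approximation theorem with denominators up to \<open>4 N\<close>.\<close>

lemma exists_minor_fraction:
  assumes "\<And>a q. \<not> major_fraction \<theta> j a q"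
  obtains a q where "coprime a (int q)" "0 < q" "int q \<le> 4 * 2 ^ j" "j < 8 \<or> 2 ^ j < q ^ 4"
    "\<bar>\<theta> - of_int a / real q\<bar> \<le> 1 / (4 * 2 ^ j * real q)"
proof -
  obtain a k where k: "coprime a k" "0 < k" "k \<le> int (4 * 2 ^ j)" "\<bar>of_int k * \<theta> - of_int a\<bar> < 1 / real (4 * 2 ^ j)"
    using Dirichlet_approx_coprime[of "4 * 2 ^ j" \<theta>] by auto
  define q where "q = nat k"
  have q: "int q = k" "0 < q" "real q = of_int k" using k(2) by (simp_all add: q_def)
  have "\<theta> - of_int a / real q = (of_int k * \<theta> - of_int a) / real q" using q(2,3) by (simp add: diff_divide_distrib)
  then have "\<bar>\<theta> - of_int a / real q\<bar> = \<bar>of_int k * \<theta> - of_int a\<bar> / real q" by (simp add: abs_divide)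
  also have "\<dots> \<le> 1 / real (4 * 2 ^ j) / real q" using k(4) by (intro divide_right_mono) auto
  finally have ap: "\<bar>\<theta> - of_int a / real q\<bar> \<le> 1 / (4 * 2 ^ j * real q)" by simp
  have "j < 8 \<or> 2 ^ j < q ^ 4" using assms[of a q] k(1) q ap by (auto simp: major_fraction_def not_le)
  then show ?thesis using that[of a q] k q ap by simp
qed

lemma convex_finite_nat_set:
  fixes K :: "nat set"
  assumes "finite K" "K \<noteq> {}" "\<And>i j k. i \<in> K \<Longrightarrow> k \<in> K \<Longrightarrow> i \<le> j \<Longrightarrow> j \<le> k \<Longrightarrow> j \<in> K"
  shows "K = {Min K..<Suc (Max K)}"
proof
  show "K \<subseteq> {Min K..<Suc (Max K)}" using assms(1) by (auto simp: less_Suc_eq_le)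
  show "{Min K..<Suc (Max K)} \<subseteq> K"
  proof
    fix j assume "j \<in> {Min K..<Suc (Max K)}"
    then show "j \<in> K" using assms(3)[OF Min_in[OF assms(1,2)] Max_in[OF assms(1,2)]] by simp
  qed
qed

definition transitional_const :: real where
  "transitional_const = 999 * (1 / (1 - 2 powr (-1/4)) * (1 / (1 - 4 powr (-1/8))))"

definition error_const :: real where
  "error_const = 3285 * (1 / (1 - 2 powr (-1/8)) * (1 / (1 - 4 powr (-1/4))))"

definition all_scales_const :: real where
  "all_scales_const = 1998 * (1 / (1 - 2 powr (-1/16))) + transitional_const + error_const + 13000000000 * (1 / (1 - 2 powr (-1/6)))"

text \<open>The scales are divided into those without a major fraction, those with \<open>\<mu> j > 1\<close> and those
  with \<open>\<mu> j \<le> 1\<close>, and in the last case the shell is the sum of the error \<open>E j\<close> and the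
  rational shell \<open>T' j\<close>.\<close>

lemma sum_shells_bound:
  fixes f g :: "int \<Rightarrow> complex"
  assumes fs: "finitely_supported f" "finitely_supported g"
    and A: "finite A" "\<And>n. n \<notin> A \<Longrightarrow> f n = 0 \<and> g n = 0"
    and Z: "\<And>X. finite X \<Longrightarrow> (\<Sum>x\<in>X. maxprod f g x) \<le> Z"
  shows "norm (\<Sum>j<J. bform A (\<lambda>n' n. shell \<alpha> (2 ^ j) (n - n')) f g) \<le> all_scales_const * Z"
proof -
  have Z0: "Z \<ge> 0" using Z[of "{}"] by simp
  define \<theta> where "\<theta> = 2 * \<alpha>"
  define T where "T j = bform A (\<lambda>n' n. shell \<alpha> (2 ^ j) (n - n')) f g" for j :: nat
  define S where "S = {j \<in> {..<J}. \<exists>a q. major_fraction \<theta> j a q}"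
  \<comment> \<open>a scale \<open>j \<ge> 8\<close> has at most one major fraction, so the choice does not matter\<close>
  define h where "h j = (SOME p. major_fraction \<theta> j (fst p) (snd p))" for j
  define aa where "aa j = fst (h j)" for j
  define qq where "qq j = snd (h j)" for j
  have major: "major_fraction \<theta> j (aa j) (qq j)" if "j \<in> S" for j
  proof -
    from that obtain a q where "major_fraction \<theta> j a q" by (auto simp: S_def)
    then have "major_fraction \<theta> j (fst (a, q)) (snd (a, q))" by simp
    then show ?thesis unfolding aa_def qq_def h_def by (rule someI[of "\<lambda>p. major_fraction \<theta> j (fst p) (snd p)"])
  qed
  define \<mu> where "\<mu> j = 4 ^ j * \<bar>\<theta> - of_int (aa j) / real (qq j)\<bar>" for j
  have \<mu>0: "\<mu> j \<ge> 0" for j by (simp add: \<mu>_def)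
  define S1 where "S1 = {j \<in> S. \<mu> j \<le> 1}"
  \<comment> \<open>if \<open>\<mu> j = 0\<close>, the phase is rational and the error term vanishes\<close>
  define S0 where "S0 = {j \<in> S1. \<mu> j \<noteq> 0}"
  define S2 where "S2 = {j \<in> S. \<mu> j > 1}"
  define T' where "T' j = bform A (\<lambda>n' n. shell (of_int (aa j) / (2 * real (qq j))) (2 ^ j) (n - n')) f g" for j :: nat
  define E where "E j = bform A (\<lambda>n' n. shell \<alpha> (2 ^ j) (n - n') - shell (of_int (aa j) / (2 * real (qq j))) (2 ^ j) (n - n')) f g" for j :: nat
  have TE: "T j = E j + T' j" for j unfolding T_def E_def T'_def bform_diff_kernel by simp
  have finS: "finite S" "finite S1" "finite S0" "finite S2" by (simp_all add: S_def S1_def S0_def S2_def)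
  have split: "(\<Sum>j<J. T j) = (\<Sum>j\<in>{..<J} - S. T j) + ((\<Sum>j\<in>S2. T j) + ((\<Sum>j\<in>S1. E j) + (\<Sum>j\<in>S1. T' j)))"
  proof -
    have "(\<Sum>j<J. T j) = (\<Sum>j\<in>{..<J} - S. T j) + (\<Sum>j\<in>S. T j)"
      by (intro sum.subset_diff) (auto simp: S_def)
    also have "(\<Sum>j\<in>S. T j) = (\<Sum>j\<in>S2. T j) + (\<Sum>j\<in>S1. T j)"
    proof -
      have "S = S2 \<union> S1" by (auto simp: S1_def S2_def)
      then show ?thesis using finS by (simp only:) (intro sum.union_disjoint, auto simp: S1_def S2_def)
    qed
    also have "(\<Sum>j\<in>S1. T j) = (\<Sum>j\<in>S1. E j) + (\<Sum>j\<in>S1. T' j)" by (simp add: TE sum.distrib)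
    finally show ?thesis .
  qed
  have q1: "real (qq j) \<ge> 1" if "j \<in> S" for j using major[OF that] by (auto simp: major_fraction_def)
  have same: "aa i = aa j \<and> qq i = qq j" if "i \<in> S" "j \<in> S" "ilog 2 (real (qq i)) = ilog 2 (real (qq j))" for i j
    using major_same_block[OF major[OF that(1)] major[OF that(2)] that(3)] .
  have \<mu>4: "4 * \<mu> i \<le> \<mu> j" if "i < j" "aa i = aa j" "qq i = qq j" for i j
  proof -
    have "4 * (4::real) ^ i \<le> 4 ^ j" using power_increasing[of "Suc i" j "4::real"] that(1) by simp
    then have "4 * 4 ^ i * \<bar>\<theta> - of_int (aa j) / real (qq j)\<bar> \<le> 4 ^ j * \<bar>\<theta> - of_int (aa j) / real (qq j)\<bar>"
      by (intro mult_right_mono) auto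
    then show ?thesis unfolding \<mu>_def that by simp
  qed

  have minor: "norm (\<Sum>j\<in>{..<J} - S. T j) \<le> 1998 * (1 / (1 - 2 powr (-1/16))) * Z"
  proof -
    have "norm (\<Sum>j\<in>{..<J} - S. T j) \<le> (\<Sum>j\<in>{..<J} - S. 1998 * (2 powr (-1/16)) ^ j * Z)"
    proof (intro order_trans[OF norm_sum] sum_mono)
      fix j assume j: "j \<in> {..<J} - S"
      then have "\<not> major_fraction \<theta> j a q" for a q by (auto simp: S_def)
      then obtain a q where "coprime a (int q)" "0 < q" "int q \<le> 4 * 2 ^ j" "j < 8 \<or> 2 ^ j < q ^ 4"
        "\<bar>\<theta> - of_int a / real q\<bar> \<le> 1 / (4 * 2 ^ j * real q)" by (rule exists_minor_fraction)
      from minor_scale_bound[OF this[unfolded \<theta>_def] fs A(1) Z]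
      show "norm (T j) \<le> 1998 * (2 powr (-1/16)) ^ j * Z" unfolding T_def .
    qed
    also have "\<dots> = 1998 * (\<Sum>j\<in>{..<J} - S. (2 powr (-1/16)) ^ j) * Z" by (simp only: sum_distrib_left sum_distrib_right)
    also have "\<dots> \<le> 1998 * (1 / (1 - 2 powr (-1/16))) * Z"
      using powr_neg_less_1[of 2 "1/16"] by (intro mult_right_mono mult_left_mono sum_geometric_le Z0) auto
    finally show ?thesis .
  qed

  have transitional: "norm (\<Sum>j\<in>S2. T j) \<le> transitional_const * Z"
  proof -
    define u where "u j = ilog 2 (real (qq j))" for j
    define v where "v j = ilog 4 (\<mu> j)" for j
    have "norm (\<Sum>j\<in>S2. T j) \<le> (\<Sum>j\<in>S2. 999 * ((2 powr (-1/4)) ^ u j * (4 powr (-1/8)) ^ v j) * Z)"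
    proof (intro order_trans[OF norm_sum] sum_mono)
      fix j assume j: "j \<in> S2"
      then have jS: "j \<in> S" and \<mu>1: "\<mu> j > 1" by (auto simp: S2_def)
      have "norm (T j) \<le> 999 * real (qq j) powr (-1/4) * \<mu> j powr (-1/8) * Z"
        unfolding T_def using major[OF jS] \<mu>1
        by (intro transitional_scale_bound[OF _ _ _ _ \<mu>_def[unfolded \<theta>_def] _ fs A(1) Z]) (auto simp: major_fraction_def \<theta>_def)
      also have "\<dots> \<le> 999 * (2 powr (-1/4)) ^ u j * (4 powr (-1/8)) ^ v j * Z"
        using powr_le_ilog[of 2 "real (qq j)" "1/4"] powr_le_ilog[of 4 "\<mu> j" "1/8"] q1[OF jS] \<mu>1 Z0
        by (intro mult_right_mono mult_mono mult_left_mono) (auto simp: u_def v_def)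
      finally show "norm (T j) \<le> 999 * ((2 powr (-1/4)) ^ u j * (4 powr (-1/8)) ^ v j) * Z" by (simp add: mult.assoc)
    qed
    also have "\<dots> = 999 * (\<Sum>j\<in>S2. (2 powr (-1/4)) ^ u j * (4 powr (-1/8)) ^ v j) * Z" by (simp only: sum_distrib_left sum_distrib_right)
    also have "\<dots> \<le> 999 * (1 / (1 - 2 powr (-1/4)) * (1 / (1 - 4 powr (-1/8)))) * Z"
    proof (intro mult_right_mono mult_left_mono sum_geometric_inj2_le finS Z0)
      \<comment> \<open>equal dyadic sizes of the denominators force the same fraction, and then \<open>\<mu>\<close> grows
        by at least the factor 4 from \<open>i\<close> to \<open>j\<close>\<close>
      have neq: "v i \<noteq> v j" if "i \<in> S2" "j \<in> S2" "u i = u j" "i < j" for i j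
      proof -
        have "aa i = aa j \<and> qq i = qq j" using that by (intro same) (auto simp: S2_def u_def)
        then have "v i < v j" unfolding v_def using that \<mu>4[of i j] by (intro ilog_less) (auto simp: S2_def)
        then show ?thesis by simp
      qed
      show "inj_on (\<lambda>j. (u j, v j)) S2"
      proof (rule inj_onI)
        fix i j assume "i \<in> S2" "j \<in> S2" "(u i, v i) = (u j, v j)"
        then show "i = j" using neq[of i j] neq[of j i] by (metis linorder_neqE_nat prod.inject)
      qed
    qed (use powr_neg_less_1[of 2 "1/4"] powr_neg_less_1[of 4 "1/8"] in auto)
    finally show ?thesis by (simp add: transitional_const_def)
  qed

  have error: "norm (\<Sum>j\<in>S1. E j) \<le> error_const * Z"
  proof -
    define u where "u j = ilog 2 (real (qq j))" for j
    define v where "v j = ilog 4 (1 / \<mu> j)" for j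
    have E0: "E j = 0" if "j \<in> S1 - S0" for j
    proof -
      have "\<theta> = of_int (aa j) / real (qq j)" using that by (auto simp: S0_def \<mu>_def)
      then have "\<alpha> = of_int (aa j) / (2 * real (qq j))" by (simp add: \<theta>_def)
      then show ?thesis by (simp add: E_def bform_def)
    qed
    have "(\<Sum>j\<in>S1. E j) = (\<Sum>j\<in>S0. E j)"
      using finS E0 by (intro sum.mono_neutral_right) (auto simp: S0_def)
    also have "norm \<dots> \<le> (\<Sum>j\<in>S0. 3285 * ((2 powr (-1/8)) ^ u j * (4 powr (-1/4)) ^ v j) * Z)"
    proof (intro order_trans[OF norm_sum] sum_mono)
      fix j assume j: "j \<in> S0"
      then have jS: "j \<in> S" and \<mu>1: "\<mu> j > 0" "\<mu> j \<le> 1" using \<mu>0[of j] by (auto simp: S0_def S1_def)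
      have "norm (E j) \<le> 3285 * real (qq j) powr (-1/8) * \<mu> j powr (1/4) * Z"
        unfolding E_def using major[OF jS] \<mu>1
        by (intro main_scale_comparison[OF _ _ _ _ \<mu>_def[unfolded \<theta>_def] _ fs A(1) Z]) (auto simp: major_fraction_def \<theta>_def)
      also have "\<mu> j powr (1/4) = (1 / \<mu> j) powr (-(1/4))" using \<mu>1 by (simp add: powr_minus_divide powr_divide)
      also have "3285 * real (qq j) powr (-1/8) * (1 / \<mu> j) powr (-(1/4)) * Z \<le> 3285 * (2 powr (-1/8)) ^ u j * (4 powr (-1/4)) ^ v j * Z"
        using powr_le_ilog[of 2 "real (qq j)" "1/8"] powr_le_ilog[of 4 "1 / \<mu> j" "1/4"] q1[OF jS] \<mu>1 Z0
        by (intro mult_right_mono mult_mono mult_left_mono) (auto simp: u_def v_def)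
      finally show "norm (E j) \<le> 3285 * ((2 powr (-1/8)) ^ u j * (4 powr (-1/4)) ^ v j) * Z" by (simp add: mult.assoc)
    qed
    also have "\<dots> = 3285 * (\<Sum>j\<in>S0. (2 powr (-1/8)) ^ u j * (4 powr (-1/4)) ^ v j) * Z" by (simp only: sum_distrib_left sum_distrib_right)
    also have "\<dots> \<le> 3285 * (1 / (1 - 2 powr (-1/8)) * (1 / (1 - 4 powr (-1/4)))) * Z"
    proof (intro mult_right_mono mult_left_mono sum_geometric_inj2_le finS Z0)
      have neq: "v i \<noteq> v j" if "i \<in> S0" "j \<in> S0" "u i = u j" "i < j" for i j
      proof -
        have "aa i = aa j \<and> qq i = qq j" using that by (intro same) (auto simp: S0_def S1_def u_def)
        then have 4: "4 * \<mu> i \<le> \<mu> j" using that \<mu>4[of i j] by simp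
        have p: "\<mu> i > 0" "\<mu> j > 0" "\<mu> j \<le> 1" using that \<mu>0[of i] \<mu>0[of j] by (auto simp: S0_def S1_def)
        have "v j < v i" unfolding v_def using p 4 by (intro ilog_less) (auto simp: field_simps)
        then show ?thesis by simp
      qed
      show "inj_on (\<lambda>j. (u j, v j)) S0"
      proof (rule inj_onI)
        fix i j assume "i \<in> S0" "j \<in> S0" "(u i, v i) = (u j, v j)"
        then show "i = j" using neq[of i j] neq[of j i] by (metis linorder_neqE_nat prod.inject)
      qed
    qed (use powr_neg_less_1[of 2 "1/8"] powr_neg_less_1[of 4 "1/4"] in auto)
    finally show ?thesis by (simp add: error_const_def)
  qed

  have main: "norm (\<Sum>j\<in>S1. T' j) \<le> 13000000000 * (1 / (1 - 2 powr (-1/6))) * Z"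
  proof -
    define F where "F p = {j \<in> S1. h j = p}" for p
    define w where "w p = ilog 2 (real (snd p))" for p :: "int \<times> nat"
    have hj: "h j = (aa j, qq j)" for j by (simp add: aa_def qq_def)
    have "(\<Sum>j\<in>S1. T' j) = (\<Sum>p\<in>h ` S1. \<Sum>j\<in>F p. T' j)"
      unfolding F_def by (rule sum.image_gen[OF finS(2)])
    also have "norm \<dots> \<le> (\<Sum>p\<in>h ` S1. 13000000000 * (2 powr (-1/6)) ^ w p * Z)"
    proof (rule order_trans[OF norm_sum], rule sum_mono)
      fix p assume "p \<in> h ` S1"
      then obtain i where i: "i \<in> S1" "p = h i" by blast
      define a where "a = fst p"
      define q where "q = snd p"
      have p: "p = (a, q)" by (simp add: a_def q_def)
      have F_iff: "j \<in> F p \<longleftrightarrow> j \<in> S1 \<and> aa j = a \<and> qq j = q" for j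
        unfolding F_def p by (auto simp: hj)
      have ne: "F p \<noteq> {}" using i by (auto simp: F_def)
      have fin: "finite (F p)" using finS by (simp add: F_def)
      \<comment> \<open>the fraction qualifies at all scales between two scales at which it does, and by
        uniqueness it is the chosen one there\<close>
      have "F p = {Min (F p)..<Suc (Max (F p))}"
      proof (rule convex_finite_nat_set[OF fin ne])
        fix j0 j j1 assume j: "j0 \<in> F p" "j1 \<in> F p" "j0 \<le> j" "j \<le> j1"
        have m0: "major_fraction \<theta> j0 a q" and m1: "major_fraction \<theta> j1 a q" 
          using major[of j0] major[of j1] j(1,2) unfolding F_iff S1_def by simp_all
        have "q ^ 4 \<le> 2 ^ j0" using m0 by (simp add: major_fraction_def)
        also have "\<dots> \<le> 2 ^ j" using j(3) by (intro power_increasing) auto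
        finally have qj: "q ^ 4 \<le> 2 ^ j" .
        have "(2::real) ^ j \<le> 2 ^ j1" using j(4) by (intro power_increasing) auto
        then have "1 / (4 * 2 ^ j1 * real q) \<le> 1 / (4 * 2 ^ j * real q)"
          using m0 by (intro divide_left_mono mult_right_mono mult_left_mono) (auto simp: major_fraction_def)
        then have mj: "major_fraction \<theta> j a q" using m0 m1 j(3) qj by (simp add: major_fraction_def)
        have "j1 < J" using j(2) by (simp add: F_iff S1_def S_def)
        then have jS: "j \<in> S" using mj j(4) by (auto simp: S_def)
        have "aa j = a \<and> qq j = q"
        proof (rule major_unique[OF major[OF jS] mj, of j])
          have "r \<le> 2 ^ j" if "major_fraction \<theta> j b r" for b r
          proof -
            have r: "r \<ge> 1" "r ^ 4 \<le> 2 ^ j" using that by (simp_all add: major_fraction_def)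
            have "r ^ 1 \<le> r ^ 4" using r(1) by (intro power_increasing) auto
            then show ?thesis using r(2) by simp
          qed
          from this[OF mj] this[OF major[OF jS]] show "qq j + q < 4 * 2 ^ j"
            using zero_less_power[of "2::nat" j] by linarith
        qed simp_all
        moreover have "\<mu> j \<le> 1"
        proof -
          have "\<mu> j = 4 ^ j * \<bar>\<theta> - of_int a / real q\<bar>" using calculation by (simp add: \<mu>_def)
          also have "\<dots> \<le> 4 ^ j1 * \<bar>\<theta> - of_int a / real q\<bar>" using j(4) by (intro mult_right_mono power_increasing) auto
          also have "\<dots> = \<mu> j1" using j(2) by (simp add: \<mu>_def F_iff)
          also have "\<dots> \<le> 1" using j(2) by (simp add: F_iff S1_def)
          finally show ?thesis .
        qed
        ultimately show "j \<in> F p" using jS by (simp add: F_iff S1_def)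
      qed
      then obtain J0 J1 where J: "F p = {J0..<J1}" by blast
      have J01: "J0 < J1" using ne J by auto
      then have "J0 \<in> F p" unfolding J by simp
      then have m: "major_fraction \<theta> J0 a q" using major[of J0] unfolding F_iff S1_def by simp
      have q16: "16 * q \<le> 2 ^ J0"
      proof (cases "q \<le> 16")
        case True
        have "(2::nat) ^ 8 \<le> 2 ^ J0" using m by (intro power_increasing) (auto simp: major_fraction_def)
        then show ?thesis using True by simp
      next
        case False
        have "16 ^ 3 * q \<le> q ^ 3 * q" using False by (intro mult_right_mono power_mono) auto
        moreover have "16 * q \<le> 16 ^ 3 * q" by simp
        moreover have "q ^ 3 * q = q ^ 4" by (simp add: power_numeral_reduce)
        ultimately have "16 * q \<le> q ^ 4" by linarith
        then show ?thesis using m by (simp add: major_fraction_def)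
      qed
      have "(\<Sum>j\<in>F p. T' j) = (\<Sum>j\<in>{J0..<J1}. bform A (\<lambda>n' n. shell (of_int a / (2 * real q)) (2 ^ j) (n - n')) f g)"
        unfolding T'_def J[symmetric] by (intro sum.cong refl) (simp add: F_iff)
      also have "norm \<dots> \<le> 13000000000 * real q powr (-1/6) * Z"
        using m J01 q16 by (intro rational_scales_bound[OF _ _ _ _ _ fs A Z]) (auto simp: major_fraction_def)
      also have "\<dots> \<le> 13000000000 * (2 powr (-1/6)) ^ w p * Z"
        using powr_le_ilog[of 2 "real q" "1/6"] m Z0
        by (intro mult_right_mono mult_left_mono) (auto simp: w_def q_def major_fraction_def)
      finally show "norm (\<Sum>j\<in>F p. T' j) \<le> 13000000000 * (2 powr (-1/6)) ^ w p * Z" .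
    qed
    also have "\<dots> = 13000000000 * (\<Sum>p\<in>h ` S1. (2 powr (-1/6)) ^ w p) * Z" by (simp only: sum_distrib_left sum_distrib_right)
    also have "\<dots> \<le> 13000000000 * (1 / (1 - 2 powr (-1/6))) * Z"
    proof (intro mult_right_mono mult_left_mono sum_geometric_inj_le finite_imageI finS Z0)
      show "inj_on w (h ` S1)"
      proof (rule inj_onI)
        fix p p' assume "p \<in> h ` S1" "p' \<in> h ` S1" "w p = w p'"
        then obtain i j where "i \<in> S1" "j \<in> S1" "p = h i" "p' = h j" by blast
        then show "p = p'" using \<open>w p = w p'\<close> same[of i j] by (simp add: S1_def w_def hj)
      qed
    qed (use powr_neg_less_1[of 2 "1/6"] in auto)
    finally show ?thesis .
  qed

  have "norm (\<Sum>j<J. T j) \<le> 1998 * (1 / (1 - 2 powr (-1/16))) * Z + (transitional_const * Z + (error_const * Z + 13000000000 * (1 / (1 - 2 powr (-1/6))) * Z))"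
    unfolding split by (intro norm_triangle_mono minor transitional error main)
  also have "\<dots> = all_scales_const * Z" by (simp add: all_scales_const_def distrib_right)
  finally show ?thesis unfolding T_def .
qed

section \<open>The sparse bound\<close>

lemma all_scales_const_pos: "all_scales_const > 0"
proof -
  have "1 / (1 - (b::real) powr (-c)) > 0" if "b > 1" "c > 0" for b c
    using powr_neg_less_1[OF that] by simp
  from this[of 2 "1/16"] this[of 2 "1/4"] this[of 4 "1/8"] this[of 2 "1/8"] this[of 4 "1/4"] this[of 2 "1/6"]
  show ?thesis unfolding all_scales_const_def transitional_const_def error_const_def
    by (intro add_pos_pos mult_pos_pos) auto
qed

lemma exp_quadratic_phase: "exp (2 * of_real pi * \<i> * of_real \<alpha> * of_int m ^ 2) = ee (\<alpha> * (of_int m)\<^sup>2)"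
  by (simp add: ee_def cis_conv_exp mult_ac)

lemma quad_hilbert_eq_sum:
  assumes A: "finite A" "\<And>n. n \<notin> A \<Longrightarrow> f n = 0"
  shows "quad_hilbert \<alpha> f n = (\<Sum>n'\<in>A. quadratic_kernel \<alpha> (n - n') * f n')"
proof -
  define B where "B = (\<lambda>n'. n - n') ` A - {0}"
  have fB: "finite B" using A by (simp add: B_def)
  have "quad_hilbert \<alpha> f n = (\<Sum>\<^sub>\<infinity>m\<in>{m::int. m \<noteq> 0}. quadratic_kernel \<alpha> m * f (n - m))"
    unfolding quad_hilbert_def exp_quadratic_phase quadratic_kernel_def by simp
  also have "\<dots> = (\<Sum>\<^sub>\<infinity>m\<in>B. quadratic_kernel \<alpha> m * f (n - m))"
  proof (rule infsum_cong_neutral)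
    fix m assume m: "m \<in> {m. m \<noteq> 0} - B"
    have "n - m \<notin> A"
    proof
      assume "n - m \<in> A"
      then have "n - (n - m) \<in> (\<lambda>n'. n - n') ` A" by (rule imageI)
      then show False using m by (simp add: B_def)
    qed
    then show "quadratic_kernel \<alpha> m * f (n - m) = 0" using A(2) by simp
  qed (auto simp: B_def)
  also have "\<dots> = (\<Sum>m\<in>B. quadratic_kernel \<alpha> m * f (n - m))" using fB by simp
  also have "\<dots> = (\<Sum>m\<in>(\<lambda>n'. n - n') ` A. quadratic_kernel \<alpha> m * f (n - m))"
    using A(1) by (intro sum.mono_neutral_left) (auto simp: B_def quadratic_kernel_def)
  also have "\<dots> = (\<Sum>n'\<in>A. quadratic_kernel \<alpha> (n - n') * f n')" by (subst sum.reindex) (auto simp: inj_on_def)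
  finally show ?thesis .
qed

lemma quadratic_kernel_eq_sum_shells:
  assumes "\<bar>m\<bar> < 2 ^ J"
  shows "quadratic_kernel \<alpha> m = (\<Sum>j<J. shell \<alpha> (2 ^ j) m)"
  using assms
proof (induction J)
  case 0
  then show ?case by (simp add: quadratic_kernel_def)
next
  case (Suc J)
  show ?case
  proof (cases "\<bar>m\<bar> < 2 ^ J")
    case True
    then show ?thesis using Suc.IH by (simp add: shell_def)
  next
    case False
    have "shell \<alpha> (2 ^ j) m = 0" if "j < J" for j
    proof -
      have "(2::int) * 2 ^ j \<le> 2 ^ J" using power_increasing[of "Suc j" J "2::int"] that by simp
      then show ?thesis using False by (simp add: shell_def)
    qed
    then show ?thesis using False Suc.prems by (simp add: shell_def)
  qed
qed

lemma pairing_quad_hilbert_eq: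
  assumes A: "finite A" "\<And>n. n \<notin> A \<Longrightarrow> f n = 0 \<and> g n = 0"
    and J: "\<And>n n'. n \<in> A \<Longrightarrow> n' \<in> A \<Longrightarrow> \<bar>n - n'\<bar> < 2 ^ J"
  shows "pairing (quad_hilbert \<alpha> f) g = (\<Sum>j<J. bform A (\<lambda>n' n. shell \<alpha> (2 ^ j) (n - n')) f g)"
proof -
  have "pairing (quad_hilbert \<alpha> f) g = (\<Sum>\<^sub>\<infinity>n\<in>A. quad_hilbert \<alpha> f n * cnj (g n))"
    unfolding pairing_def using A(2) by (intro infsum_cong_neutral) auto
  also have "\<dots> = (\<Sum>n\<in>A. quad_hilbert \<alpha> f n * cnj (g n))" using A(1) by simp
  also have "\<dots> = (\<Sum>n\<in>A. \<Sum>n'\<in>A. quadratic_kernel \<alpha> (n - n') * f n' * cnj (g n))"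
    using A by (simp add: quad_hilbert_eq_sum sum_distrib_right)
  also have "\<dots> = bform A (\<lambda>n' n. quadratic_kernel \<alpha> (n - n')) f g"
    unfolding bform_def by (rule sum.swap)
  also have "\<dots> = bform A (\<lambda>n' n. \<Sum>j<J. shell \<alpha> (2 ^ j) (n - n')) f g"
    by (rule bform_cong) (simp_all add: quadratic_kernel_eq_sum_shells[OF J])
  also have "\<dots> = (\<Sum>j<J. bform A (\<lambda>n' n. shell \<alpha> (2 ^ j) (n - n')) f g)" by (rule bform_sum_kernel)
  finally show ?thesis .
qed

text \<open>Only finitely many shells act between points of a finite set that contains both supports.\<close>

lemma pairing_le_maxprod:
  fixes f g :: "int \<Rightarrow> complex"
  assumes fs: "finitely_supported f" "finitely_supported g"
    and Z: "\<And>X. finite X \<Longrightarrow> (\<Sum>x\<in>X. maxprod f g x) \<le> Z"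
  shows "norm (pairing (quad_hilbert \<alpha> f) g) \<le> all_scales_const * Z"
proof -
  have "finite ({n. f n \<noteq> 0} \<union> {n. g n \<noteq> 0})" using fs by (simp add: finitely_supported_def)
  then obtain R where R: "{n. f n \<noteq> 0} \<union> {n. g n \<noteq> 0} \<subseteq> {-int R..int R}" by (rule int_finite_symmetric_cover)
  define A where "A = {-int R..int R}"
  define J where "J = 2 * R + 1"
  have A: "finite A" "f n = 0 \<and> g n = 0" if "n \<notin> A" for n
    using R that by (auto simp: A_def)
  have finA: "finite A" by (simp add: A_def)
  have "\<bar>n - n'\<bar> < 2 ^ J" if "n \<in> A" "n' \<in> A" for n n'
  proof -
    have "J < 2 ^ J" by (rule less_exp)
    then have "int J < int (2 ^ J)" by (simp only: of_nat_less_iff)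
    moreover have "\<bar>n - n'\<bar> < int J"
    proof -
      have "-int R \<le> n" "n \<le> int R" "-int R \<le> n'" "n' \<le> int R" using that by (simp_all add: A_def)
      moreover have "int J = 2 * int R + 1" by (simp add: J_def)
      ultimately show ?thesis by linarith
    qed
    ultimately show ?thesis by (simp only: of_nat_power of_nat_numeral)
  qed
  from pairing_quad_hilbert_eq[OF finA A(2) this] sum_shells_bound[OF fs finA A(2) Z]
  show ?thesis by simp
qed

theorem theorem1p2:
  fixes \<rho> :: real
  assumes "0 < \<rho>" and "\<rho> < 1"
  shows "\<exists>r::real. 1 < r \<and> r < 2 \<and>
           (SUP \<alpha>::real. sparse_norm \<rho> r (quad_hilbert \<alpha>)) < \<infinity>"
proof -
  obtain C where C: "C > 0" "\<And>f g X. finitely_supported f \<Longrightarrow> finitely_supported g \<Longrightarrow> finite X \<Longrightarrow>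
    ennreal (\<Sum>x\<in>X. maxprod f g x) \<le> ennreal C * (SUP \<S>\<in>{\<S>. sparse \<rho> \<S>}. sparse_form \<S> (3/2) f g)"
    using sum_maxprod_le_sparse[OF assms] by blast
  have "sparse_bound \<rho> (3/2) (quad_hilbert \<alpha>) (all_scales_const * C)" for \<alpha>
    unfolding sparse_bound_def
  proof (intro allI impI)
    fix f g assume fs: "finitely_supported f" "finitely_supported g"
    define W where "W = (SUP \<S>\<in>{\<S>. sparse \<rho> \<S>}. sparse_form \<S> (3/2) f g)"
    have "ennreal (norm (pairing (quad_hilbert \<alpha> f) g)) \<le> ennreal (all_scales_const * C) * W"
    proof (cases "W = \<infinity>")
      case True
      have "all_scales_const * C > 0" using all_scales_const_pos C(1) by simp
      then have "ennreal (all_scales_const * C) \<noteq> 0" by (simp only: ennreal_eq_0_iff not_le)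
      then show ?thesis unfolding True by (simp add: ennreal_mult_top infinity_ennreal_def del: ennreal_eq_0_iff)
    next
      case False
      define w where "w = enn2real W"
      have w: "W = ennreal w" "w \<ge> 0" using False by (simp_all add: w_def less_top)
      have "(\<Sum>x\<in>X. maxprod f g x) \<le> C * w" if "finite X" for X
      proof -
        have "ennreal (\<Sum>x\<in>X. maxprod f g x) \<le> ennreal C * ennreal w" using C(2)[OF fs that] unfolding W_def[symmetric] w(1) .
        also have "\<dots> = ennreal (C * w)" using C(1) w(2) by (simp add: ennreal_mult)
        finally show ?thesis using C(1) w(2) by (simp add: ennreal_le_iff)
      qed
      from pairing_le_maxprod[OF fs this, of \<alpha>]
      have "ennreal (norm (pairing (quad_hilbert \<alpha> f) g)) \<le> ennreal (all_scales_const * C * w)"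
        by (intro ennreal_leI) (simp add: mult.assoc)
      also have "\<dots> = ennreal (all_scales_const * C) * W"
        unfolding w(1) using all_scales_const_pos C(1) w(2) by (intro ennreal_mult) auto
      finally show ?thesis .
    qed
    then show "ennreal (norm (pairing (quad_hilbert \<alpha> f) g)) \<le>
        ennreal (all_scales_const * C) * (SUP \<S>\<in>{\<S>. sparse \<rho> \<S>}. sparse_form \<S> (3/2) f g)" unfolding W_def .
  qed
  then have "\<exists>C>0. \<forall>\<alpha>. sparse_bound \<rho> (3/2) (quad_hilbert \<alpha>) C"
    using all_scales_const_pos C(1) by (intro exI[of _ "all_scales_const * C"]) simp
  then have "(SUP \<alpha>::real. sparse_norm \<rho> (3/2) (quad_hilbert \<alpha>)) < \<infinity>"
    unfolding SUP_sparse_norm_finite_iff .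
  then show ?thesis by (intro exI[of _ "3/2"]) simp
qed

end
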